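(* Let $d\ge 4$, $g=(d-1)(d-2)/2$, let $\delta\in M_g^{Pl}$ be a non-singular plane curve of degree $d$, and let $\sigma\in Aut(\delta)$ be "very large", i.e. of order exactly one of $d^2-3d+3$, $(d-1)^2$, $d(d-2)$, $d(d-1)$. Then: (1) If $\sigma$ has order $d(d-1)$ and $d\ge 5$, then $Aut(\delta)=\langle\sigma\rangle$ and $\delta$ is $K$-isomorphic to $X^d+Y^d+XZ^{d-1}=0$. In particular, for $d\geq 5$, $M_g^{Pl}(\mathbb{Z}/d(d-1))$ is an irreducible locus with one element, and $$\widetilde{M_g^{Pl}(\mathbb{Z}/d(d-1))}=M_g^{Pl}(\mathbb{Z}/d(d-1))=\rho(M_g^{Pl}(\mathbb{Z}/d(d-1))),$$ where $\rho(\mathbb{Z}/d(d-1))=\langle diag(1,\xi_{d(d-1)}^{d-1},\xi_{d(d-1)}^{d})\rangle$. (2) If $\sigma$ has order $(d-1)^2$, then $Aut(\delta)=\langle\sigma\rangle$ and $\delta$ is $K$-isomorphic to $X^d+Y^{d-1}Z+XZ^{d-1}=0$. Also, $M_g^{Pl}(\mathbb{Z}/(d-1)^2)$ is an irreducible locus with one element, and $$\widetilde{M_g^{Pl}(\mathbb{Z}/(d-1)^2)}=M_g^{Pl}(\mathbb{Z}/(d-1)^2)=\rho(M_g^{Pl}(\mathbb{Z}/(d-1)^2)),$$ where $\rho(\mathbb{Z}/(d-1)^2)=\langle diag(1,\xi_{(d-1)^2},\xi_{(d-1)^2}^{(d-1)(d-2)})\rangle$. (3) If $\sigma$ has order $d(d-2)$,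 then $\delta$ is $K$-isomorphic to $X^d+Y^{d-1}Z+YZ^{d-1}=0$, and for $d\ne 4,6$ $$Aut(\delta)\cong H_d:=\langle\sigma,\tau\mid \tau^2=\sigma^{d(d-2)}=1,\ \tau\sigma\tau=\sigma^{-(d-1)}\rangle .$$ The locus $M_g^{Pl}(\mathbb{Z}/d(d-2))$ is irreducible with one element, and (for $d\neq 4,6$) $$\widetilde{M_g^{Pl}(H_d)}=M_g^{Pl}(\mathbb{Z}/d(d-2))=\rho(M_g^{Pl}(\mathbb{Z}/d(d-2))),$$ where $\rho(\mathbb{Z}/d(d-2))=\langle diag(1,\xi_{d(d-2)},\xi_{d(d-2)}^{-(d-1)})\rangle$. For $d=6$, $Aut(\delta)$ is a central extension of $S_4$ by $\mathbb{Z}/6$ (so of order $144$); for $d=4$, $\delta$ is isomorphic to the Fermat quartic and $Aut(\delta)\cong(\mathbb{Z}/4)^2\rtimes S_3$. (4) If $\sigma$ has order $d^2-3d+3$, then $\delta$ is $K$-isomorphic to the Klein curve $K_d: X^{d-1}Y+Y^{d-1}Z+Z^{d-1}X=0$, and for $d\ge 5$ $$Aut(\delta)\cong H_{K_d}:=\langle\sigma,\tau\mid \sigma^{d^2-3d+3}=\tau^3=1,\ \sigma\tau=\tau\sigma^{-(d-1)}\rangle .$$ The locus $M_g^{Pl}(\mathbb{Z}/(d^2-3d+3))$ is irreducible with one element, and (for $d\ge 5$) $$\widetilde{M_g^{Pl}(H_{K_d})}=M_g^{Pl}(\mathbb{Z}/(d^2-3d+3))=\rho(M_g^{Pl}(\mathbb{Z}/(d^2-3d+3))),$$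 where $\rho(\mathbb{Z}/(d^2-3d+3))=\langle diag(1,\xi_{d^2-3d+3},\xi_{d^2-3d+3}^{-(d-2)})\rangle$.
   Context: $K$ is an algebraically closed field of characteristic $0$; $\xi_m$ denotes a primitive $m$-th root of unity in $K$. For $d\ge4$ put $g=(d-1)(d-2)/2$. $M_g$ is the moduli space of smooth genus $g$ curves over $K$ and $M_g^{Pl}\subset M_g$ is the subset of (isomorphism classes of) curves admitting a non-singular plane model of degree $d$ in $\mathbb{P}^2(K)$. Any two such models of $\delta$ differ by an element of $PGL_3(K)$ ("$K$-isomorphic"), and for a model $C$, $Aut(\delta)\cong Aut(C)$ is a finite subgroup of $PGL_3(K)$. For a finite non-trivial group $G$: $M_g^{Pl}(G)$ is the set of $\delta\in M_g^{Pl}$ such that $G$ is isomorphic to a subgroup of $Aut(\delta)$, and $\widetilde{M_g^{Pl}(G)}$ is the set of $\delta\in M_g^{Pl}$ with $Aut(\delta)\cong G$. For an injective homomorphism $\rho:G\hookrightarrow PGL_3(K)$, $\rho(M_g^{Pl}(G))$ is the set of $\delta\in M_g^{Pl}(G)$ such that $G$ acts on a plane model of $\delta$ as $P^{-1}\rho(G)P$ for some $P\in PGL_3(K)$. $diag(1,\lambda,\mu)$ denotes the class in $PGL_3(K)$ of the diagonal matrix. *)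

theory Defs
  imports
    "HOL-Analysis.Determinants"
    "HOL-Analysis.Abstract_Topology"
    "HOL-Library.Poly_Mapping"
    "HOL-Computational_Algebra.Polynomial"
    "HOL-Algebra.Coset"
    "HOL-Algebra.Generated_Groups"
    "HOL-Algebra.Elementary_Groups"
    "HOL-Algebra.Multiplicative_Group"
    "HOL-Algebra.Sym_Groups"
begin

section \<open>Ternary forms\<close>

text \<open>The polynomial ring \<open>k[X, Y, Z]\<close> as the monoid algebra of the exponent vectors
  \<open>3 \<Rightarrow>\<^sub>0 nat\<close>; its multiplication is convolution.  The type \<open>3\<close> has the
  elements \<open>1\<close>, \<open>2\<close> and \<open>3 = 0\<close>, which index \<open>X\<close>, \<open>Y\<close> and \<open>Z\<close>.\<close>

type_synonym 'k poly3 = "(3 \<Rightarrow>\<^sub>0 nat) \<Rightarrow>\<^sub>0 'k"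

definition const3 :: "'k::comm_ring_1 \<Rightarrow> 'k poly3"
  where "const3 c = Poly_Mapping.single 0 c"

definition var3 :: "3 \<Rightarrow> 'k::comm_ring_1 poly3"
  where "var3 i = Poly_Mapping.single (Poly_Mapping.single i 1) 1"

abbreviation "varX \<equiv> var3 1"
abbreviation "varY \<equiv> var3 2"
abbreviation "varZ \<equiv> var3 3"

definition homogeneous3 :: "nat \<Rightarrow> 'k::comm_ring_1 poly3 \<Rightarrow> bool"
  where "homogeneous3 d F \<longleftrightarrow>
    (\<forall>m \<in> Poly_Mapping.keys F. (\<Sum>i\<in>UNIV. Poly_Mapping.lookup m i) = d)"

definition eval3 :: "'k::comm_ring_1 poly3 \<Rightarrow> 'k^3 \<Rightarrow> 'k"
  where "eval3 F x = (\<Sum>m\<in>Poly_Mapping.keys F.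
    Poly_Mapping.lookup F m * (\<Prod>i\<in>UNIV. (x $ i) ^ Poly_Mapping.lookup m i))"

definition partial3 :: "3 \<Rightarrow> 'k::comm_ring_1 poly3 \<Rightarrow> 'k poly3"
  where "partial3 i F = (\<Sum>m\<in>Poly_Mapping.keys F.
    Poly_Mapping.single (m - Poly_Mapping.single i 1)
      (of_nat (Poly_Mapping.lookup m i) * Poly_Mapping.lookup F m))"

text \<open>The polynomial \<open>F(A \<cdot> (X, Y, Z)\<^sup>T)\<close>.\<close>

definition subst3 :: "'k::comm_ring_1 poly3 \<Rightarrow> 'k^3^3 \<Rightarrow> 'k poly3"
  where "subst3 F A = (\<Sum>m\<in>Poly_Mapping.keys F. const3 (Poly_Mapping.lookup F m) *
    (\<Prod>i\<in>UNIV. (\<Sum>j\<in>UNIV. const3 (A $ i $ j) * var3 j) ^ Poly_Mapping.lookup m i))"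


section \<open>The group \<open>PGL\<^sub>3\<close>\<close>

definition GL3 :: "('k::field^3^3) monoid"
  where "GL3 = \<lparr>carrier = {A. invertible A}, monoid.mult = (**), one = mat 1\<rparr>"

definition scalars3 :: "('k::field^3^3) set"
  where "scalars3 = {mat c |c. c \<noteq> 0}"

definition PGL3 :: "('k::field^3^3) set monoid"
  where "PGL3 = GL3 Mod scalars3"

definition pgl :: "'k::field^3^3 \<Rightarrow> ('k^3^3) set"
  where "pgl A = scalars3 #>\<^bsub>GL3\<^esub> A"

definition diag3 :: "'k::field \<Rightarrow> 'k \<Rightarrow> 'k \<Rightarrow> 'k^3^3"
  where "diag3 a b c = (\<chi> i j. if i = j then vector [a, b, c] $ i else 0)"


section \<open>Smooth plane curves, their automorphisms and their isomorphism classes\<close>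

text \<open>A plane curve is given by a form \<open>F\<close>, taken up to a nonzero scalar.  For smooth forms of a
  fixed degree the zero locus in the projective plane determines \<open>F\<close> up to such a scalar, hence
  \<open>[A]\<close> preserves the curve iff \<open>F(A x) = c F(x)\<close> for some \<open>c \<noteq> 0\<close>.\<close>

definition smooth_form :: "nat \<Rightarrow> 'k::field poly3 \<Rightarrow> bool"
  where "smooth_form d F \<longleftrightarrow> F \<noteq> 0 \<and> homogeneous3 d F \<and>
    \<not> (\<exists>x. x \<noteq> 0 \<and> eval3 F x = 0 \<and> (\<forall>i. eval3 (partial3 i F) x = 0))"

definition K_isomorphic :: "'k::field poly3 \<Rightarrow> 'k poly3 \<Rightarrow> bool"
  where "K_isomorphic F G \<longleftrightarrow> (\<exists>A c. invertible A \<and> c \<noteq> 0 \<and> subst3 F A = const3 c * G)"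

definition Aut :: "'k::field poly3 \<Rightarrow> ('k^3^3) set monoid"
  where "Aut F = PGL3\<lparr>carrier :=
    {pgl A |A. invertible A \<and> (\<exists>c. c \<noteq> 0 \<and> subst3 F A = const3 c * F)}\<rparr>"

text \<open>The locus \<open>M\<^sub>g\<^sup>P\<^sup>l\<close> for \<open>g = (d - 1) (d - 2) / 2\<close>.  Two non-singular plane models of degree
  \<open>d \<ge> 4\<close> of the same curve differ by an element of \<open>PGL\<^sub>3\<close>, so an isomorphism class \<open>\<delta>\<close> is
  the set of all its plane models, which is one class of \<^const>\<open>K_isomorphic\<close>.\<close>

definition M_Pl :: "nat \<Rightarrow> 'k::field poly3 set set"
  where "M_Pl d = {F. smooth_form d F} //
    {(F, G). smooth_form d F \<and> smooth_form d G \<and> K_isomorphic F G}"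

text \<open>In the following three definitions the group \<open>G\<close> is only meant up to isomorphism, and
  replacing the plane model \<open>F\<close> of \<open>\<delta>\<close> by another one conjugates \<open>Aut F\<close> inside \<open>PGL\<^sub>3\<close>; so it
  makes no difference which model is used.\<close>

definition M_Pl_grp :: "nat \<Rightarrow> 'g monoid \<Rightarrow> 'k::field poly3 set set"
  where "M_Pl_grp d G = {\<delta> \<in> M_Pl d. \<exists>F\<in>\<delta>. \<exists>H. subgroup H (Aut F) \<and> G \<cong> (Aut F)\<lparr>carrier := H\<rparr>}"

definition M_Pl_full :: "nat \<Rightarrow> 'g monoid \<Rightarrow> 'k::field poly3 set set"
  where "M_Pl_full d G = {\<delta> \<in> M_Pl d. \<exists>F\<in>\<delta>. Aut F \<cong> G}"

definition M_Pl_rho ::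
    "nat \<Rightarrow> 'g monoid \<Rightarrow> ('g \<Rightarrow> ('k::field^3^3) set) \<Rightarrow> 'k poly3 set set"
  where "M_Pl_rho d G \<rho> = {\<delta> \<in> M_Pl_grp d G. \<exists>F\<in>\<delta>. \<exists>P\<in>carrier PGL3. \<forall>x\<in>carrier G.
    inv\<^bsub>PGL3\<^esub> P \<otimes>\<^bsub>PGL3\<^esub> \<rho> x \<otimes>\<^bsub>PGL3\<^esub> P \<in> carrier (Aut F)}"

text \<open>The injective homomorphisms \<open>\<rho> : \<int>/n \<rightarrow> PGL\<^sub>3\<close> whose image is generated by \<open>D\<close>.\<close>

definition cyclic_embeddings :: "nat \<Rightarrow> ('k::field^3^3) set \<Rightarrow> (int \<Rightarrow> ('k^3^3) set) set"
  where "cyclic_embeddings n D = {\<rho> \<in> mon (integer_mod_group n) PGL3.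
    \<rho> ` carrier (integer_mod_group n) = generate PGL3 {D}}"

definition primitive_root :: "nat \<Rightarrow> 'k::field \<Rightarrow> bool"
  where "primitive_root n \<xi> \<longleftrightarrow> n > 0 \<and> \<xi> ^ n = 1 \<and> (\<forall>k. 0 < k \<and> k < n \<longrightarrow> \<xi> ^ k \<noteq> 1)"

definition irreducible_in :: "'a topology \<Rightarrow> 'a set \<Rightarrow> bool"
  where "irreducible_in T S \<longleftrightarrow> S \<subseteq> topspace T \<and> S \<noteq> {} \<and>
    (\<forall>A B. closedin T A \<and> closedin T B \<and> S \<subseteq> A \<union> B \<longrightarrow> S \<subseteq> A \<or> S \<subseteq> B)"

text \<open>A locus with a single element is irreducible whatever the topology is; so irreducibility is
  required for every topology on \<open>M\<^sub>g\<^sup>P\<^sup>l\<close>, in particular for the one induced from the moduli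
  space of smooth curves of genus \<open>g\<close>.\<close>

definition irreducible_point_locus :: "nat \<Rightarrow> 'k::field poly3 set set \<Rightarrow> bool"
  where "irreducible_point_locus d S \<longleftrightarrow>
    (\<forall>T. topspace T = M_Pl d \<longrightarrow> irreducible_in T S) \<and> is_singleton S"


section \<open>Groups given by generators and relations\<close>

text \<open>A letter \<open>(x, True)\<close> stands for the generator \<open>x\<close> and \<open>(x, False)\<close> for its inverse.
  A relation \<open>u = v\<close> is the pair of words \<open>(u, v)\<close>.\<close>

inductive word_eq :: "(('x \<times> bool) list \<times> ('x \<times> bool) list) set \<Rightarrow>
    ('x \<times> bool) list \<Rightarrow> ('x \<times> bool) list \<Rightarrow> bool" for R
  where
    relation: "(u, v) \<in> R \<Longrightarrow> word_eq R u v"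
  | cancel: "word_eq R [(x, b), (x, \<not> b)] []"
  | refl: "word_eq R u u"
  | sym: "word_eq R u v \<Longrightarrow> word_eq R v u"
  | trans: "word_eq R u v \<Longrightarrow> word_eq R v w \<Longrightarrow> word_eq R u w"
  | append: "word_eq R u v \<Longrightarrow> word_eq R u' v' \<Longrightarrow> word_eq R (u @ u') (v @ v')"

definition presented_group :: "(('x \<times> bool) list \<times> ('x \<times> bool) list) set \<Rightarrow>
    ('x \<times> bool) list set monoid"
  where "presented_group R =
    \<lparr>carrier = UNIV // {(u, v). word_eq R u v},
     monoid.mult = (\<lambda>A B. {(u, v). word_eq R u v} `` {u @ v |u v. u \<in> A \<and> v \<in> B}),
     one = {(u, v). word_eq R u v} `` {[]}\<rparr>"

datatype gen = Sig | Tau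

abbreviation "sig \<equiv> (Sig, True)"
abbreviation "sig_inv \<equiv> (Sig, False)"
abbreviation "tau \<equiv> (Tau, True)"

definition H_group :: "nat \<Rightarrow> (gen \<times> bool) list set monoid"
  where "H_group d = presented_group
    {([tau, tau], []),
     (replicate (d * (d - 2)) sig, []),
     ([tau, sig, tau], replicate (d - 1) sig_inv)}"

definition H_Klein :: "nat \<Rightarrow> (gen \<times> bool) list set monoid"
  where "H_Klein d = presented_group
    {(replicate (d\<^sup>2 - 3 * d + 3) sig, []),
     ([tau, tau, tau], []),
     ([sig, tau], tau # replicate (d - 1) sig_inv)}"


section \<open>Group extensions\<close>

definition central_extension :: "'e monoid \<Rightarrow> 'q monoid \<Rightarrow> 'a monoid \<Rightarrow> bool"
  where "central_extension E Q A \<longleftrightarrow>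
    (\<exists>N. N \<lhd> E \<and> (\<forall>x\<in>N. \<forall>y\<in>carrier E. x \<otimes>\<^bsub>E\<^esub> y = y \<otimes>\<^bsub>E\<^esub> x) \<and>
         E\<lparr>carrier := N\<rparr> \<cong> A \<and> E Mod N \<cong> Q)"

definition semidirect :: "'n monoid \<Rightarrow> 'h monoid \<Rightarrow> ('h \<Rightarrow> 'n \<Rightarrow> 'n) \<Rightarrow> ('n \<times> 'h) monoid"
  where "semidirect N H \<phi> =
    \<lparr>carrier = carrier N \<times> carrier H,
     monoid.mult = (\<lambda>(n, h) (n', h'). (n \<otimes>\<^bsub>N\<^esub> \<phi> h n', h \<otimes>\<^bsub>H\<^esub> h')),
     one = (\<one>\<^bsub>N\<^esub>, \<one>\<^bsub>H\<^esub>)\<rparr>"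

text \<open>The action of \<open>S\<^sub>3\<close> on \<open>(\<int>/4)\<^sup>2\<close> by which the permutations of the coordinates act on the
  diagonal automorphisms \<open>diag(1, i\<^sup>a, i\<^sup>b)\<close> of the Fermat quartic: permute the exponents
  \<open>(0, a, b)\<close> and normalise the first one to \<open>0\<close> again.\<close>

definition coord_perm_action :: "(nat \<Rightarrow> nat) \<Rightarrow> int \<times> int \<Rightarrow> int \<times> int"
  where "coord_perm_action s v =
    (let e = (\<lambda>j::nat. if j = 1 then 0 else if j = 2 then fst v else snd v);
         e' = (\<lambda>j. e (inv_into UNIV s j))
     in ((e' 2 - e' 1) mod 4, (e' 3 - e' 1) mod 4))"

definition Fermat_quartic_group :: "((int \<times> int) \<times> (nat \<Rightarrow> nat)) monoid"
  where "Fermat_quartic_group =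
    semidirect (integer_mod_group 4 \<times>\<times> integer_mod_group 4) (sym_group 3) coord_perm_action"

end

theory Submission
  imports Defs "HOL-Combinatorics.Permutations"
begin

text \<open>An automorphism of order \<open>N\<close> has an eigenbasis, in which it is diagonal and all monomials of the form
  have the same weight.  Smoothness at the three coordinate points yields a monomial
  \<open>X\<^sub>i\<^bsup>d-1\<^esup> X\<^bsub>f i\<^esub>\<close> for each \<open>i\<close>.  Up to a permutation of the coordinates there are seven maps \<open>f\<close>, and they
  force \<open>N\<close> to divide \<open>d\<close>, \<open>d - 1\<close>, \<open>(d - 1)(d - 2)\<close>, \<open>d(d - 1)\<close>, \<open>(d - 1)\<^sup>2\<close>, \<open>d(d - 2)\<close> or \<open>d\<^sup>2 - 3d + 3\<close>.  So each very
  large order determines \<open>f\<close>; then only the three monomials of the normal form have the right weight, and their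
  coefficients can be scaled to \<open>1\<close>.

  The automorphisms of a normal form \<open>F\<close> respect the pairs \<open>(u, v)\<close> with \<open>D\<^sub>u D\<^sub>v F = 0\<close>, where \<open>D\<^sub>u\<close> is the
  directional derivative; comparing these pairs (and, where needed, derivatives of other orders) shows that the
  automorphisms are diagonal up to the obvious permutations of the coordinates.  The exceptions are
  \<open>X\<^sup>6 + Y Z (Y\<^sup>4 + Z\<^sup>4)\<close>, where \<open>S\<^sub>4\<close> acts on the octahedron of the zeros of the binary sextic, and
  \<open>X\<^sup>4 + Y Z (Y\<^sup>2 + Z\<^sup>2)\<close>, which is equivalent to the Fermat quartic.\<close>

subsection \<open>Ternary forms\<close>

text \<open>Forms are handled through their values, which determine them in characteristic 0;
  automorphisms, homogeneity and derivatives become statements about matrices acting on vectors. The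
  chain rule makes the vanishing of a higher derivative along chosen directions a relation that
  every automorphism respects. The special degrees show up there: such a relation splits into one
  equation per monomial only while the monomials of the derivative are distinct. At d = 4 two of
  them coincide in the relations used for the first, third and fourth normal form; at d = 6 this
  happens for the fourth derivatives of the third one, where only the sum of two conditions survives
  and extra automorphisms appear. In degree 5 the third form is treated by another relation between
  third derivatives. The four very large orders lie between n = (d-1)(d-2)+1 and 2n - 1, so none of
  them divides another. All claims on loci follow formally from three facts: the normal form is
  smooth, it has an automorphism of order N, and every smooth curve with such an automorphism is
  isomorphic to it.\<close>

lemma sum3: "(\<Sum>i\<in>(UNIV::3 set). f i) = f 1 + f 2 + f 3"
  by (simp add: sum_3)

lemma prod3: "(\<Prod>i\<in>(UNIV::3 set). f i) = f 1 * f 2 * f (3::3)"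
proof -
  have "(\<Prod>i\<in>(UNIV::3 set). f i) = prod f (insert 1 (insert 2 {3}))" by (simp only: UNIV_3)
  also have "\<dots> = f 1 * (f 2 * f 3)" by (subst prod.insert, simp, simp)+ simp
  finally show ?thesis by (simp only: mult.assoc)
qed

definition mon_eval :: "(3 \<Rightarrow>\<^sub>0 nat) \<Rightarrow> 'k::comm_ring_1^3 \<Rightarrow> 'k"
  where "mon_eval m x = (\<Prod>i\<in>UNIV. (x $ i) ^ Poly_Mapping.lookup m i)"

lemma mon_eval_add: "mon_eval (m + n) x = mon_eval m x * mon_eval n x"
  by (simp add: mon_eval_def lookup_add power_add prod.distrib)

lemma mon_eval_0 [simp]: "mon_eval 0 x = 1"
  by (simp add: mon_eval_def)

lemma eval3_superset:
  assumes "finite S" "Poly_Mapping.keys F \<subseteq> S"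
  shows "eval3 F x = (\<Sum>m\<in>S. Poly_Mapping.lookup F m * mon_eval m x)"
  unfolding eval3_def mon_eval_def
  by (rule sum.mono_neutral_left) (use assms in \<open>auto simp: in_keys_iff\<close>)

lemma eval3_single [simp]: "eval3 (Poly_Mapping.single m a) x = a * mon_eval m x"
  by (subst eval3_superset[of "{m}"]) auto

lemma eval3_0 [simp]: "eval3 0 x = 0"
  by (simp add: eval3_def)

lemma eval3_add [simp]: "eval3 (F + G) x = eval3 F x + eval3 G x"
proof -
  let ?S = "Poly_Mapping.keys F \<union> Poly_Mapping.keys G"
  have "eval3 (F + G) x = (\<Sum>m\<in>?S. Poly_Mapping.lookup (F + G) m * mon_eval m x)"
    by (rule eval3_superset) (auto dest: subsetD[OF keys_add])
  also have "\<dots> = eval3 F x + eval3 G x"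
    by (subst (1 2) eval3_superset[of ?S])
      (auto simp: lookup_add algebra_simps sum.distrib)
  finally show ?thesis .
qed

lemma eval3_sum [simp]: "eval3 (sum f S) x = (\<Sum>i\<in>S. eval3 (f i) x)"
  by (induction S rule: infinite_finite_induct) auto

lemma poly3_expand: "(\<Sum>m\<in>Poly_Mapping.keys F. Poly_Mapping.single m (Poly_Mapping.lookup F m)) = F"
proof (rule poly_mapping_eqI)
  fix k
  have "(\<Sum>m\<in>Poly_Mapping.keys F. Poly_Mapping.lookup (Poly_Mapping.single m (Poly_Mapping.lookup F m)) k)
      = (\<Sum>m\<in>Poly_Mapping.keys F. if m = k then Poly_Mapping.lookup F k else 0)"
    by (rule sum.cong) (auto simp: lookup_single when_def)
  thus "Poly_Mapping.lookup (\<Sum>m\<in>Poly_Mapping.keys F. Poly_Mapping.single m (Poly_Mapping.lookup F m)) k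
      = Poly_Mapping.lookup F k"
    by (simp add: lookup_sum in_keys_iff)
qed

lemma poly3_mult_expand:
  fixes F G :: "'k::comm_ring_1 poly3"
  shows "F * G = (\<Sum>m\<in>Poly_Mapping.keys F. \<Sum>n\<in>Poly_Mapping.keys G.
    Poly_Mapping.single (m + n) (Poly_Mapping.lookup F m * Poly_Mapping.lookup G n))"
proof -
  have "F * G = (\<Sum>m\<in>Poly_Mapping.keys F. Poly_Mapping.single m (Poly_Mapping.lookup F m)) *
     (\<Sum>m\<in>Poly_Mapping.keys G. Poly_Mapping.single m (Poly_Mapping.lookup G m))"
    by (simp only: poly3_expand)
  thus ?thesis by (simp add: sum_product mult_single)
qed

lemma eval3_mult [simp]: "eval3 (F * G) x = eval3 F x * eval3 G x"
proof -
  have "eval3 (F * G) x = (\<Sum>m\<in>Poly_Mapping.keys F. \<Sum>n\<in>Poly_Mapping.keys G.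
    Poly_Mapping.lookup F m * Poly_Mapping.lookup G n * (mon_eval m x * mon_eval n x))"
    by (subst poly3_mult_expand) (simp add: mon_eval_add)
  thus ?thesis
    unfolding eval3_superset[OF finite_keys order.refl] sum_product
    by (simp add: algebra_simps)
qed

lemma eval3_const3 [simp]: "eval3 (const3 c) x = c"
  by (simp add: const3_def)

lemma eval3_1 [simp]: "eval3 1 x = 1"
  using eval3_const3[of 1 x] by (simp add: const3_def)

lemma eval3_var3 [simp]: "eval3 (var3 i) x = x $ i"
proof -
  have "(\<Prod>j\<in>UNIV. x $ j ^ Poly_Mapping.lookup (Poly_Mapping.single i 1) j) = (\<Prod>j\<in>UNIV. if j = i then x $ i else 1)"
    by (rule prod.cong) (auto simp: lookup_single when_def)
  thus ?thesis by (simp add: var3_def mon_eval_def)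
qed

lemma eval3_power [simp]: "eval3 (F ^ n) x = eval3 F x ^ n"
  by (induction n) auto

lemma eval3_prod [simp]: "eval3 (prod f S) x = (\<Prod>i\<in>S. eval3 (f i) x)"
  by (induction S rule: infinite_finite_induct) auto

lemma eval3_subst3 [simp]: "eval3 (subst3 F A) x = eval3 F (A *v x)"
  unfolding subst3_def eval3_sum by (simp add: matrix_vector_mult_def eval3_def[of F])

text \<open>Kronecker substitution \<open>x = (t, t\<^sup>B, t\<^sup>(\<^sup>B\<^sup>2\<^sup>))\<close>: for large \<open>B\<close> distinct monomials of \<open>F\<close>
  become distinct powers of \<open>t\<close>.\<close>

lemma eval3_eq_0_imp:
  fixes F :: "'k::field_char_0 poly3"
  assumes "\<And>x. eval3 F x = 0"
  shows "F = 0"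
proof (rule ccontr)
  assume "F \<noteq> 0"
  then obtain m0 where m0: "m0 \<in> Poly_Mapping.keys F"
    by (metis all_not_in_conv poly3_expand sum.empty)
  define B where "B = Suc (\<Sum>m\<in>Poly_Mapping.keys F. \<Sum>i\<in>UNIV. Poly_Mapping.lookup m i)"
  define e where "e m = Poly_Mapping.lookup m 1 + B * (Poly_Mapping.lookup m 2 + B * Poly_Mapping.lookup m (3::3))" for m
  have lt: "Poly_Mapping.lookup m i < B" if "m \<in> Poly_Mapping.keys F" for m i
  proof -
    have "Poly_Mapping.lookup m i \<le> (\<Sum>i\<in>UNIV. Poly_Mapping.lookup m i)"
      by (rule member_le_sum) auto
    also have "\<dots> \<le> (\<Sum>m\<in>Poly_Mapping.keys F. \<Sum>i\<in>UNIV. Poly_Mapping.lookup m i)"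
      by (rule member_le_sum[OF that]) auto
    finally show ?thesis by (simp add: B_def)
  qed
  have inj: "inj_on e (Poly_Mapping.keys F)"
  proof (rule inj_onI)
    fix m n assume mn: "m \<in> Poly_Mapping.keys F" "n \<in> Poly_Mapping.keys F" and eq: "e m = e n"
    have *: "a = b \<and> c = d'" if "a + B * c = b + B * d'" "a < B" "b < B" for a b c d' :: nat
    proof -
      have "a = (a + B * c) mod B" "b = (b + B * d') mod B" using that(2,3) by simp_all
      hence "a = b" using that(1) by metis
      thus ?thesis using that by simp
    qed
    have 1: "Poly_Mapping.lookup m 1 = Poly_Mapping.lookup n 1 \<and>
       Poly_Mapping.lookup m 2 + B * Poly_Mapping.lookup m 3 = Poly_Mapping.lookup n 2 + B * Poly_Mapping.lookup n 3"
      using eq lt[OF mn(1)] lt[OF mn(2)] unfolding e_def by (intro *) auto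
    have 2: "Poly_Mapping.lookup m 2 = Poly_Mapping.lookup n 2 \<and> Poly_Mapping.lookup m 3 = Poly_Mapping.lookup n 3"
      using 1 lt[OF mn(1)] lt[OF mn(2)] by (intro *) auto
    show "m = n"
    proof (rule poly_mapping_eqI)
      fix i :: 3 show "Poly_Mapping.lookup m i = Poly_Mapping.lookup n i"
        using 1 2 exhaust_3[of i] by auto
    qed
  qed
  define p where "p = (\<Sum>m\<in>Poly_Mapping.keys F. Polynomial.monom (Poly_Mapping.lookup F m) (e m))"
  have "poly p t = 0" for t
  proof -
    have "poly p t = eval3 F (vector [t, t ^ B, t ^ (B * B)])"
      by (simp add: p_def poly_sum poly_monom eval3_superset[OF finite_keys order.refl] mon_eval_def
          prod3 e_def power_add distrib_left mult.assoc flip: power_mult)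
    thus ?thesis using assms by simp
  qed
  hence "p = 0" using poly_all_0_iff_0 by blast
  have "Polynomial.coeff p (e m0) = (\<Sum>m\<in>Poly_Mapping.keys F. if m = m0 then Poly_Mapping.lookup F m else 0)"
    unfolding p_def coeff_sum using inj m0 by (intro sum.cong) (auto dest: inj_onD)
  also have "\<dots> = Poly_Mapping.lookup F m0" using m0 by simp
  finally show False using \<open>p = 0\<close> m0 by (simp add: in_keys_iff)
qed

lemma eval3_diff [simp]: "eval3 (F - G) x = eval3 F x - eval3 G x"
  using eval3_add[of "F - G" G x] by (simp del: eval3_add)

text \<open>Most polynomial identities below are proved through this reduction to points instead of
  by comparing exponent vectors.\<close>

lemma eval3_inject:
  fixes F G :: "'k::field_char_0 poly3"
  assumes "\<And>x. eval3 F x = eval3 G x"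
  shows "F = G"
  using eval3_eq_0_imp[of "F - G"] assms by simp

lemma subst3_mult_mat:
  fixes F :: "'k::field_char_0 poly3"
  shows "subst3 (subst3 F A) B = subst3 F (A ** B)"
  by (rule eval3_inject) (simp add: matrix_vector_mul_assoc)

lemma subst3_mat_1 [simp]: "subst3 F (mat 1) = (F :: 'k::field_char_0 poly3)"
  by (rule eval3_inject) simp

lemma const3_mult: "const3 (a * b) = const3 a * const3 b"
  by (simp add: const3_def mult_single)

lemma const3_1 [simp]: "const3 1 = 1"
  by (simp add: const3_def)

lemma const3_0 [simp]: "const3 0 = 0"
  by (simp add: const3_def)

section \<open>Partial and directional derivatives\<close>

lemma partial3_superset:
  assumes "finite S" "Poly_Mapping.keys F \<subseteq> S"
  shows "partial3 i F = (\<Sum>m\<in>S. Poly_Mapping.single (m - Poly_Mapping.single i 1)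
      (of_nat (Poly_Mapping.lookup m i) * Poly_Mapping.lookup F m))"
  unfolding partial3_def
  by (rule sum.mono_neutral_left) (use assms in \<open>auto simp: in_keys_iff\<close>)

lemma partial3_0 [simp]: "partial3 i 0 = 0"
  by (simp add: partial3_def)

lemma partial3_single:
  "partial3 i (Poly_Mapping.single m a) =
    Poly_Mapping.single (m - Poly_Mapping.single i 1) (of_nat (Poly_Mapping.lookup m i) * a)"
  by (subst partial3_superset[of "{m}"]) auto

lemma partial3_add [simp]: "partial3 i (F + G) = partial3 i F + partial3 i G"
proof -
  let ?S = "Poly_Mapping.keys F \<union> Poly_Mapping.keys G"
  have "partial3 i (F + G) = (\<Sum>m\<in>?S. Poly_Mapping.single (m - Poly_Mapping.single i 1)
      (of_nat (Poly_Mapping.lookup m i) * Poly_Mapping.lookup (F + G) m))"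
    by (rule partial3_superset) (auto dest: subsetD[OF keys_add])
  also have "\<dots> = partial3 i F + partial3 i G"
    by (subst (1 2) partial3_superset[of ?S])
      (auto simp: lookup_add algebra_simps sum.distrib single_add)
  finally show ?thesis .
qed

lemma partial3_sum [simp]: "partial3 i (sum f S) = (\<Sum>j\<in>S. partial3 i (f j))"
  by (induction S rule: infinite_finite_induct) auto

text \<open>Both sides are bilinear, so the product rule is checked on a pair of monomials and then
  summed over the supports.\<close>

lemma partial3_mult [simp]:
  "partial3 i (F * G) = partial3 i F * G + F * partial3 i (G :: 'k::comm_ring_1 poly3)"
proof -
  define s where "s = Poly_Mapping.single i (1::nat)"
  have *: "Poly_Mapping.single (m + n - s) (of_nat (Poly_Mapping.lookup (m + n) i) * (a * b)) =
     Poly_Mapping.single (m - s) (of_nat (Poly_Mapping.lookup m i) * a) * Poly_Mapping.single n b +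
     Poly_Mapping.single m a * Poly_Mapping.single (n - s) (of_nat (Poly_Mapping.lookup n i) * b)"
    for m n :: "3 \<Rightarrow>\<^sub>0 nat" and a b :: 'k
  proof -
    \<comment> \<open>Exponents are subtracted with truncation at 0. The shift is faithful when the
      exponent of variable \<open>i\<close> is positive; otherwise the coefficient
      \<open>of_nat 0\<close> removes the term.\<close>
    have sh: "m + n - s = (m - s) + n" if "Poly_Mapping.lookup m i \<noteq> 0" for m n
      using that by (intro poly_mapping_eqI) (auto simp: lookup_add lookup_minus s_def lookup_single when_def)
    show ?thesis
    proof (cases "Poly_Mapping.lookup m i = 0")
      case True
      show ?thesis
      proof (cases "Poly_Mapping.lookup n i = 0")
        case False
        have "m + n - s = m + (n - s)" using sh[OF False, of m] by (simp add: add.commute)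
        thus ?thesis using True by (simp add: mult_single lookup_add mult.left_commute)
      qed (use True in \<open>simp add: mult_single lookup_add\<close>)
    next
      case False
      note F = False
      show ?thesis
      proof (cases "Poly_Mapping.lookup n i = 0")
        case True
        thus ?thesis using F by (auto simp: mult_single lookup_add algebra_simps sh[of m n])
      next
        case False
        have "m - s + n = m + (n - s)" using sh[OF F, of n] sh[OF False, of m] by (simp add: add.commute)
        thus ?thesis using F False
          by (auto simp: mult_single lookup_add algebra_simps sh[of m n] simp flip: single_add)
      qed
    qed
  qed
  have "partial3 i (F * G) = (\<Sum>m\<in>Poly_Mapping.keys F. \<Sum>n\<in>Poly_Mapping.keys G.
    Poly_Mapping.single (m + n - s) (of_nat (Poly_Mapping.lookup (m + n) i) *
      (Poly_Mapping.lookup F m * Poly_Mapping.lookup G n)))"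
    by (subst poly3_mult_expand) (simp add: partial3_single s_def)
  also have "\<dots> = (\<Sum>m\<in>Poly_Mapping.keys F. Poly_Mapping.single (m - s) (of_nat (Poly_Mapping.lookup m i) * Poly_Mapping.lookup F m))
      * (\<Sum>n\<in>Poly_Mapping.keys G. Poly_Mapping.single n (Poly_Mapping.lookup G n)) +
      (\<Sum>m\<in>Poly_Mapping.keys F. Poly_Mapping.single m (Poly_Mapping.lookup F m)) *
      (\<Sum>n\<in>Poly_Mapping.keys G. Poly_Mapping.single (n - s) (of_nat (Poly_Mapping.lookup n i) * Poly_Mapping.lookup G n))"
    by (simp add: * sum.distrib sum_product)
  also have "\<dots> = partial3 i F * G + F * partial3 i G"
    by (simp only: poly3_expand) (simp only: partial3_def s_def)
  finally show ?thesis .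
qed

lemma partial3_const3 [simp]: "partial3 i (const3 c) = 0"
  by (simp add: const3_def partial3_single)

lemma partial3_1 [simp]: "partial3 i 1 = 0"
  using partial3_const3[of i 1] by simp

lemma partial3_var3 [simp]: "partial3 i (var3 j) = (if i = j then 1 else 0)"
  by (auto simp: var3_def partial3_single lookup_single)

lemma partial3_power [simp]:
  "partial3 i (F ^ n) = of_nat n * F ^ (n - 1) * partial3 i (F :: 'k::comm_ring_1 poly3)"
proof (induction n)
  case (Suc n)
  have "of_nat n * F ^ (n - 1) * F = of_nat n * F ^ n"
    by (cases n) (auto simp: algebra_simps)
  moreover have "partial3 i (F ^ Suc n) = partial3 i F * F ^ n + (of_nat n * F ^ (n - 1) * F) * partial3 i F"
    by (simp add: Suc algebra_simps)
  ultimately show ?case by (simp add: algebra_simps)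
qed auto

lemma eval3_of_nat [simp]: "eval3 (of_nat n) x = of_nat n"
  by (induction n) auto

lemma single_eq_const3_mult:
  "Poly_Mapping.single m (a::'k::field_char_0) = const3 a * (\<Prod>i\<in>UNIV. var3 i ^ Poly_Mapping.lookup m i)"
  by (rule eval3_inject) (simp add: mon_eval_def)

text \<open>Constants and variables generate the polynomial ring; this serves the chain rule, both
  sides of which obey the same sum and product rules.\<close>

lemma poly3_induct [case_names const var add mult]:
  fixes F :: "'k::field_char_0 poly3"
  assumes "\<And>c. P (const3 c)" "\<And>i. P (var3 i)"
    and add: "\<And>F G. P F \<Longrightarrow> P G \<Longrightarrow> P (F + G)" and mult: "\<And>F G. P F \<Longrightarrow> P G \<Longrightarrow> P (F * G)"
  shows "P F"
proof -
  have pow: "P (F ^ n)" if "P F" for F n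
    using that assms(1)[of 1] by (induction n) (auto intro: mult)
  have "P (Poly_Mapping.single m a)" for m a
    unfolding single_eq_const3_mult prod3 by (intro mult pow assms)
  hence "P (\<Sum>m\<in>S. Poly_Mapping.single m (Poly_Mapping.lookup F m))" for S
    using assms(1)[of 0] by (induction S rule: infinite_finite_induct) (auto intro: add)
  thus ?thesis using poly3_expand[of F] by metis
qed

definition dd :: "'k::comm_ring_1^3 \<Rightarrow> 'k poly3 \<Rightarrow> 'k poly3"
  where "dd v F = (\<Sum>i\<in>UNIV. const3 (v $ i) * partial3 i F)"

lemma dd_add [simp]: "dd v (F + G) = dd v F + dd v G"
  by (simp add: dd_def distrib_left sum.distrib)

lemma dd_mult [simp]: "dd v (F * G) = dd v F * G + F * dd v G"
  by (simp add: dd_def sum3 algebra_simps)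

lemma dd_const3 [simp]: "dd v (const3 c) = 0"
  by (simp add: dd_def)

lemma dd_0 [simp]: "dd v 0 = 0"
  by (simp add: dd_def)

lemma dd_var3 [simp]: "dd v (var3 i) = const3 (v $ i)"
proof -
  have "dd v (var3 i) = (\<Sum>j\<in>UNIV. if j = i then const3 (v $ i) else 0)"
    unfolding dd_def by (rule sum.cong) auto
  thus ?thesis by simp
qed

lemma dd_sum [simp]: "dd v (sum f S) = (\<Sum>i\<in>S. dd v (f i))"
  by (induction S rule: infinite_finite_induct) auto

lemma dd_power [simp]: "dd v (F ^ n) = of_nat n * F ^ (n - 1) * dd v F"
  by (simp add: dd_def sum_distrib_left algebra_simps)

lemma dd_of_nat [simp]: "dd v (of_nat n) = 0"
  by (induction n) (simp_all add: dd_def)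

lemma dd_axis: "dd (axis i 1) F = partial3 i F"
proof -
  have "dd (axis i 1) F = (\<Sum>j\<in>UNIV. if j = i then partial3 i F else 0)"
    unfolding dd_def by (rule sum.cong) (auto simp: axis_def)
  thus ?thesis by simp
qed

lemma eval3_dd: "eval3 (dd v F) x = (\<Sum>i\<in>UNIV. v $ i * eval3 (partial3 i F) x)"
  by (simp add: dd_def)

lemma eval3_dd_plus: "eval3 (dd (u + v) F) x = eval3 (dd u F) x + eval3 (dd v F) x"
  by (simp add: eval3_dd sum3 algebra_simps)

lemma eval3_dd_scale: "eval3 (dd (c *s v) F) x = c * eval3 (dd v F) x"
  by (simp add: eval3_dd sum3 algebra_simps)

lemma subst3_add [simp]: "subst3 (F + G :: 'k::field_char_0 poly3) A = subst3 F A + subst3 G A"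
  by (rule eval3_inject) simp

lemma subst3_mult [simp]: "subst3 (F * G :: 'k::field_char_0 poly3) A = subst3 F A * subst3 G A"
  by (rule eval3_inject) simp

lemma subst3_const3 [simp]: "subst3 (const3 c :: 'k::field_char_0 poly3) A = const3 c"
  by (rule eval3_inject) simp

lemma subst3_var3: "subst3 (var3 i :: 'k::field_char_0 poly3) A = (\<Sum>j\<in>UNIV. const3 (A $ i $ j) * var3 j)"
  by (rule eval3_inject) (simp add: matrix_vector_mult_def)

lemma subst3_0 [simp]: "subst3 (0 :: 'k::field_char_0 poly3) A = 0"
  by (rule eval3_inject) simp

text \<open>The chain rule for a linear substitution, with the direction moved by the matrix.
  Constants, sums and products are immediate, which leaves the variables.\<close>

lemma dd_subst3:
  fixes F :: "'k::field_char_0 poly3"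
  shows "dd v (subst3 F A) = subst3 (dd (A *v v) F) A"
proof (induction F rule: poly3_induct)
  case (var i)
  show ?case by (rule eval3_inject) (simp add: subst3_var3 matrix_vector_mult_def)
qed auto

lemma subst3_eq_iff_eval3:
  fixes F G :: "'k::field_char_0 poly3"
  shows "subst3 F A = const3 c * G \<longleftrightarrow> (\<forall>x. eval3 F (A *v x) = c * eval3 G x)"
proof
  assume "subst3 F A = const3 c * G"
  thus "\<forall>x. eval3 F (A *v x) = c * eval3 G x" by (metis eval3_subst3 eval3_mult eval3_const3)
qed (rule eval3_inject, simp)

text \<open>Turns invariance under a diagonal matrix into one equation per monomial, the equation
  for its weight.\<close>

lemma lookup_subst3_diag3:
  fixes F :: "'k::field_char_0 poly3"
  shows "Poly_Mapping.lookup (subst3 F (diag3 a b c)) m = Poly_Mapping.lookup F m *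
    (a ^ Poly_Mapping.lookup m 1 * b ^ Poly_Mapping.lookup m 2 * c ^ Poly_Mapping.lookup m 3)"
proof -
  define w where "w m = a ^ Poly_Mapping.lookup m 1 * b ^ Poly_Mapping.lookup m 2 * c ^ Poly_Mapping.lookup m (3::3)" for m
  define G where "G = (\<Sum>m\<in>Poly_Mapping.keys F. Poly_Mapping.single m (Poly_Mapping.lookup F m * w m))"
  have D: "diag3 a b c *v x = vector [a * x $ 1, b * x $ 2, c * x $ 3]" for x
    by (simp add: vec_eq_iff forall_3 matrix_vector_mult_def diag3_def sum3)
  have "subst3 F (diag3 a b c) = G"
  proof (rule eval3_inject)
    fix x
    show "eval3 (subst3 F (diag3 a b c)) x = eval3 G x"
      unfolding eval3_subst3 D G_def eval3_sum eval3_single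
      unfolding eval3_superset[OF finite_keys order.refl]
      by (simp add: mon_eval_def prod3 w_def power_mult_distrib algebra_simps)
  qed
  moreover have "Poly_Mapping.lookup G m = Poly_Mapping.lookup F m * w m"
  proof -
    have "Poly_Mapping.lookup G m = (\<Sum>k\<in>Poly_Mapping.keys F. if k = m then Poly_Mapping.lookup F m * w m else 0)"
      unfolding G_def lookup_sum by (rule sum.cong) (auto simp: lookup_single when_def)
    thus ?thesis by (simp add: in_keys_iff)
  qed
  ultimately show ?thesis by (simp add: w_def)
qed

lemma diag3_mult_vec: "diag3 a b c *v x = vector [a * x $ 1, b * x $ 2, c * x $ 3]"
  by (simp add: vec_eq_iff forall_3 matrix_vector_mult_def diag3_def sum3)

lemma lookup_const3_mult: "Poly_Mapping.lookup (const3 c * F) m = c * Poly_Mapping.lookup F m"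
  unfolding const3_def by (auto simp: mult_map_scale_conv_mult[symmetric] map.rep_eq when_def)

text \<open>For the converse the scalar 2 suffices: it multiplies a monomial of total degree n by
  2^n, and in characteristic 0 these powers are distinct.\<close>

lemma homogeneous3_iff_eval3:
  fixes F :: "'k::field_char_0 poly3"
  shows "homogeneous3 d F \<longleftrightarrow> (\<forall>c x. eval3 F (c *s x) = c ^ d * eval3 F x)"
proof
  assume "homogeneous3 d F"
  thus "\<forall>c x. eval3 F (c *s x) = c ^ d * eval3 F x"
    unfolding eval3_superset[OF finite_keys order.refl] mon_eval_def prod3 sum_distrib_left
    by (intro allI sum.cong)
      (auto simp: homogeneous3_def sum3 power_mult_distrib algebra_simps simp flip: power_add)
next
  assume *: "\<forall>c x. eval3 F (c *s x) = c ^ d * eval3 F x"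
  have "eval3 (subst3 F (diag3 2 2 2)) x = eval3 (const3 (2 ^ d) * F) x" for x
  proof -
    have "diag3 2 2 2 *v x = 2 *s x" by (simp add: diag3_mult_vec vec_eq_iff forall_3)
    thus ?thesis using * by simp
  qed
  hence eq: "subst3 F (diag3 2 2 2) = const3 (2 ^ d) * F" by (rule eval3_inject)
  show "homogeneous3 d F"
    unfolding homogeneous3_def
  proof
    fix m assume m: "m \<in> Poly_Mapping.keys F"
    have "2 ^ (\<Sum>i\<in>UNIV. Poly_Mapping.lookup m i) = (2 ^ d :: 'k)"
      using m arg_cong[OF eq, of "\<lambda>G. Poly_Mapping.lookup G m"]
      by (simp add: lookup_subst3_diag3 lookup_const3_mult sum3 power_add in_keys_iff mult.assoc)
    hence "of_nat (2 ^ (\<Sum>i\<in>UNIV. Poly_Mapping.lookup m i)) = (of_nat (2 ^ d) :: 'k)" by simp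
    thus "(\<Sum>i\<in>UNIV. Poly_Mapping.lookup m i) = d"
      by (subst (asm) of_nat_eq_iff) simp
  qed
qed

lemma matrix_vector_scale: "A *v (c *s x) = c *s (A *v x)"
  for A :: "'k::field^'n^'m"
  by (simp add: vec_eq_iff matrix_vector_mult_def sum_distrib_left algebra_simps)

lemma homogeneous3_subst3:
  "homogeneous3 d F \<Longrightarrow> homogeneous3 d (subst3 (F :: 'k::field_char_0 poly3) A)"
  by (simp add: homogeneous3_iff_eval3 matrix_vector_scale)

lemma mat_vec: "mat c *v x = c *s (x :: 'k::field^'n)"
  by (simp add: vec_eq_iff matrix_vector_mult_def mat_def if_distrib[of "\<lambda>u. u * _"] cong: if_cong)

text \<open>Differentiating F(l x) = l^d F(x) produces a factor l on the left by the chain rule,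
  which is then cancelled. Positivity of d keeps the exponent d - 1 from being truncated.\<close>

lemma eval3_dd_homogeneous:
  fixes F :: "'k::field_char_0 poly3"
  assumes "homogeneous3 d F" "l \<noteq> 0" "d > 0"
  shows "eval3 (dd v F) (l *s x) = l ^ (d - 1) * eval3 (dd v F) x"
proof -
  have "subst3 F (mat l) = const3 (l ^ d) * F"
    using assms by (simp add: subst3_eq_iff_eval3 mat_vec homogeneous3_iff_eval3)
  hence "eval3 (dd v (subst3 F (mat l))) x = l ^ d * eval3 (dd v F) x" by simp
  hence "l * eval3 (dd v F) (l *s x) = l * (l ^ (d - 1) * eval3 (dd v F) x)"
    using \<open>d > 0\<close> unfolding dd_subst3 mat_vec by (cases d) (simp_all add: mat_vec eval3_dd_scale)
  thus ?thesis using \<open>l \<noteq> 0\<close> by simp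
qed

text \<open>Euler's identity, verified on each monomial.\<close>

lemma Euler_dd:
  fixes F :: "'k::field_char_0 poly3"
  assumes "homogeneous3 d F"
  shows "eval3 (dd u F) u = of_nat d * eval3 F u"
proof -
  \<comment> \<open>Multiplying by \<open>a\<close> first makes the truncated exponent harmless at n
    = 0.\<close>
  have p: "a * (of_nat n * a ^ (n - 1)) = of_nat n * a ^ n" for a :: 'k and n by (cases n) auto
  have 1: "eval3 (dd u (Poly_Mapping.single m a)) u =
      of_nat (\<Sum>i\<in>UNIV. Poly_Mapping.lookup m i) * eval3 (Poly_Mapping.single m a) u" for m and a :: 'k
  proof -
    have "eval3 (dd u (Poly_Mapping.single m a)) u = a * (
      (u$1 * (of_nat (Poly_Mapping.lookup m 1) * u$1 ^ (Poly_Mapping.lookup m 1 - 1))) * u$2 ^ Poly_Mapping.lookup m 2 * u$3 ^ Poly_Mapping.lookup m 3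
     + u$1 ^ Poly_Mapping.lookup m 1 * (u$2 * (of_nat (Poly_Mapping.lookup m 2) * u$2 ^ (Poly_Mapping.lookup m 2 - 1))) * u$3 ^ Poly_Mapping.lookup m 3
     + u$1 ^ Poly_Mapping.lookup m 1 * u$2 ^ Poly_Mapping.lookup m 2 * (u$3 * (of_nat (Poly_Mapping.lookup m 3) * u$3 ^ (Poly_Mapping.lookup m 3 - 1))))"
      unfolding single_eq_const3_mult prod3 by (simp add: algebra_simps)
    thus ?thesis unfolding p by (simp add: mon_eval_def prod3 sum3 algebra_simps)
  qed
  have "eval3 (dd u F) u = (\<Sum>m\<in>Poly_Mapping.keys F. eval3 (dd u (Poly_Mapping.single m (Poly_Mapping.lookup F m))) u)"
    by (subst poly3_expand[of F, symmetric]) (simp del: eval3_single)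
  also have "\<dots> = (\<Sum>m\<in>Poly_Mapping.keys F. of_nat d * eval3 (Poly_Mapping.single m (Poly_Mapping.lookup F m)) u)"
    using assms by (intro sum.cong) (auto simp: 1 homogeneous3_def simp del: eval3_single)
  also have "\<dots> = of_nat d * eval3 F u"
    by (subst (3) poly3_expand[of F, symmetric]) (simp add: sum_distrib_left del: eval3_single)
  finally show ?thesis .
qed

text \<open>By Euler's identity a point where all derivatives vanish lies on the curve, because d is
  invertible in the field. Arbitrary directions replace the coordinate ones, so that any basis can
  be used.\<close>

lemma smooth_form_iff:
  fixes F :: "'k::field_char_0 poly3"
  assumes "d > 0"
  shows "smooth_form d F \<longleftrightarrow> F \<noteq> 0 \<and> homogeneous3 d F \<and>
    (\<forall>x. x \<noteq> 0 \<longrightarrow> (\<exists>v. eval3 (dd v F) x \<noteq> 0))"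
proof (cases "homogeneous3 d F")
  case True
  have "(eval3 F x = 0 \<and> (\<forall>i. eval3 (partial3 i F) x = 0)) \<longleftrightarrow> (\<forall>v. eval3 (dd v F) x = 0)" for x
  proof
    assume *: "\<forall>v. eval3 (dd v F) x = 0"
    have "eval3 F x = 0" using Euler_dd[OF True, of x] * assms by simp
    moreover have "eval3 (partial3 i F) x = 0" for i using * dd_axis[of i F] by metis
    ultimately show "eval3 F x = 0 \<and> (\<forall>i. eval3 (partial3 i F) x = 0)" by blast
  qed (simp add: eval3_dd)
  thus ?thesis unfolding smooth_form_def by blast
qed (simp add: smooth_form_def)

subsection \<open>The projective linear group\<close>

lemma mat_mult_scale: "mat c ** A = (\<chi> i j. c * (A $ i $ j))" "A ** mat c = (\<chi> i j. c * (A $ i $ j))"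
  for A :: "'k::field^'n^'n"
  by (simp_all add: vec_eq_iff matrix_matrix_mult_def mat_def if_distrib[of "\<lambda>u. u * _"] if_distrib[of "\<lambda>u. _ * u"] mult.commute cong: if_cong)

lemma mat_commute: "mat c ** A = A ** mat c" for A :: "'k::field^'n^'n"
  by (simp add: mat_mult_scale)

lemma mat_mult_mat: "mat a ** mat b = (mat (a * b) :: 'k::field^'n^'n)"
  unfolding mat_mult_scale by (auto simp: vec_eq_iff mat_def)

lemma invertible_mat: "c \<noteq> 0 \<Longrightarrow> invertible (mat c :: 'k::field^'n^'n)"
  unfolding invertible_def by (rule exI[of _ "mat (inverse c)"]) (simp add: mat_mult_mat)

lemma group_GL3: "group (GL3 :: ('k::field^3^3) monoid)"
proof (rule groupI)
  fix A :: "'k^3^3" assume "A \<in> carrier GL3"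
  hence "invertible A" by (simp add: GL3_def)
  then obtain B where "A ** B = mat 1" "B ** A = mat 1" unfolding invertible_def by blast
  thus "\<exists>B\<in>carrier GL3. B \<otimes>\<^bsub>GL3\<^esub> A = \<one>\<^bsub>GL3\<^esub>"
    by (auto simp: GL3_def invertible_def)
qed (auto simp: GL3_def invertible_mult matrix_mul_assoc invertible_mat)

lemma scalars3_normal: "(scalars3 :: ('k::field^3^3) set) \<lhd> GL3"
proof -
  interpret group "GL3 :: ('k^3^3) monoid" by (rule group_GL3)
  have sub: "subgroup (scalars3 :: ('k^3^3) set) GL3"
  proof (rule subgroupI)
    fix A :: "'k^3^3" assume "A \<in> scalars3"
    then obtain c where c: "A = mat c" "c \<noteq> 0" by (auto simp: scalars3_def)
    have "inv\<^bsub>GL3\<^esub> A = mat (inverse c)"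
      by (rule inv_equality) (use c in \<open>auto simp: GL3_def mat_mult_mat invertible_mat\<close>)
    thus "inv\<^bsub>GL3\<^esub> A \<in> scalars3" using c by (auto simp: scalars3_def)
  next
    have "(mat 1 :: 'k^3^3) \<in> scalars3" unfolding scalars3_def using one_neq_zero[where 'a = 'k] by blast
    thus "(scalars3 :: ('k^3^3) set) \<noteq> {}" by blast
  qed (auto simp: scalars3_def GL3_def mat_mult_mat invertible_mat)
  show ?thesis
    unfolding normal_inv_iff
  proof (intro conjI sub ballI)
    fix A B :: "'k^3^3" assume A: "A \<in> carrier GL3" and B: "B \<in> scalars3"
    have "A \<otimes>\<^bsub>GL3\<^esub> B \<otimes>\<^bsub>GL3\<^esub> inv\<^bsub>GL3\<^esub> A = B \<otimes>\<^bsub>GL3\<^esub> (A \<otimes>\<^bsub>GL3\<^esub> inv\<^bsub>GL3\<^esub> A)"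
      using A B by (auto simp: GL3_def scalars3_def mat_commute[of _ A] matrix_mul_assoc)
    thus "A \<otimes>\<^bsub>GL3\<^esub> B \<otimes>\<^bsub>GL3\<^esub> inv\<^bsub>GL3\<^esub> A \<in> scalars3"
      using A B subgroup.mem_carrier[OF sub B] by simp
  qed
qed

lemma group_PGL3: "group (PGL3 :: ('k::field^3^3) set monoid)"
  unfolding PGL3_def by (rule normal.factorgroup_is_group[OF scalars3_normal])

lemma carrier_PGL3: "carrier PGL3 = {pgl A |A. invertible (A :: 'k::field^3^3)}"
  by (auto simp: PGL3_def FactGroup_def RCOSETS_def pgl_def GL3_def)

lemma pgl_in_PGL3 [simp]: "invertible A \<Longrightarrow> pgl A \<in> carrier PGL3"
  by (auto simp: carrier_PGL3)

lemma pgl_mult: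
  assumes "invertible (A :: 'k::field^3^3)" "invertible B"
  shows "pgl A \<otimes>\<^bsub>PGL3\<^esub> pgl B = pgl (A ** B)"
proof -
  interpret normal scalars3 "GL3 :: ('k^3^3) monoid" by (rule scalars3_normal)
  have "pgl A \<otimes>\<^bsub>PGL3\<^esub> pgl B = pgl (A \<otimes>\<^bsub>GL3\<^esub> B)"
    using rcos_sum[of A B] assms by (simp add: PGL3_def pgl_def FactGroup_def) (simp add: GL3_def)
  thus ?thesis by (simp add: GL3_def)
qed

lemma pgl_eq_set: "pgl A = {mat c ** A |c. c \<noteq> 0}"
  by (auto simp: pgl_def r_coset_def scalars3_def GL3_def)

lemma pgl_eq_iff: "pgl A = pgl B \<longleftrightarrow> (\<exists>c. c \<noteq> 0 \<and> A = mat c ** B)" for A :: "'k::field^3^3"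
proof
  assume "pgl A = pgl B"
  moreover have "A \<in> pgl A" unfolding pgl_eq_set by (auto intro!: exI[of _ 1])
  ultimately show "\<exists>c. c \<noteq> 0 \<and> A = mat c ** B" unfolding pgl_eq_set by auto
next
  assume "\<exists>c. c \<noteq> 0 \<and> A = mat c ** B"
  then obtain c where c: "c \<noteq> 0" "A = mat c ** B" by blast
  have "mat a ** B = mat (a / c) ** A" "mat a ** A = mat (a * c) ** B" for a
    using c by (simp_all add: matrix_mul_assoc mat_mult_mat)
  moreover have "a / c \<noteq> 0" "a * c \<noteq> 0" if "a \<noteq> 0" for a using c that by auto
  ultimately show "pgl A = pgl B" unfolding pgl_eq_set by blast
qed

lemma one_PGL3: "\<one>\<^bsub>PGL3\<^esub> = pgl (mat 1 :: 'k::field^3^3)"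
  by (auto simp: PGL3_def FactGroup_def pgl_eq_set scalars3_def)

fun mpow :: "'k::field^'n^'n \<Rightarrow> nat \<Rightarrow> 'k^'n^'n" where
  "mpow A 0 = mat 1"
| "mpow A (Suc n) = mpow A n ** A"

lemma invertible_mpow [simp]: "invertible A \<Longrightarrow> invertible (mpow A n)"
  by (induction n) (auto intro: invertible_mult invertible_mat)

lemma pgl_pow:
  assumes "invertible (A :: 'k::field^3^3)"
  shows "pgl A [^]\<^bsub>PGL3\<^esub> (n::nat) = pgl (mpow A n)"
proof -
  interpret group "PGL3 :: ('k^3^3) set monoid" by (rule group_PGL3)
  show ?thesis using assms by (induction n) (auto simp: one_PGL3 pgl_mult)
qed

lemma diag3_mult: "diag3 a b c ** diag3 a' b' c' = diag3 (a * a') (b * b') (c * c')"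
  by (simp add: vec_eq_iff forall_3 matrix_matrix_mult_def diag3_def sum3)

lemma mat_eq_diag3: "mat c = diag3 c c c"
  by (simp add: vec_eq_iff forall_3 mat_def diag3_def)

lemma invertible_diag3: "invertible (diag3 a b c) \<longleftrightarrow> a \<noteq> 0 \<and> b \<noteq> 0 \<and> c \<noteq> 0"
  by (simp add: invertible_det_nz det_3 diag3_def)

lemma mpow_diag3: "mpow (diag3 a b c) n = diag3 (a ^ n) (b ^ n) (c ^ n)"
  by (induction n) (auto simp: mat_eq_diag3 diag3_mult mult.commute)

lemma diag3_eq_iff: "diag3 a b c = diag3 a' b' c' \<longleftrightarrow> a = a' \<and> b = b' \<and> c = c'"
  by (simp add: vec_eq_iff forall_3 diag3_def)

lemma pgl_diag3_eq_iff: "pgl (diag3 1 b c) = pgl (diag3 1 b' c') \<longleftrightarrow> b = b' \<and> c = c'"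
  unfolding pgl_eq_iff mat_eq_diag3 diag3_mult diag3_eq_iff by auto

section \<open>Automorphisms as matrices, and isomorphisms of curves\<close>

definition preserves :: "'k::field poly3 \<Rightarrow> 'k^3^3 \<Rightarrow> bool"
  where "preserves F A \<longleftrightarrow> invertible A \<and> (\<exists>c. c \<noteq> 0 \<and> subst3 F A = const3 c * F)"

lemma preserves_iff:
  "preserves F A \<longleftrightarrow> invertible A \<and> (\<exists>c. c \<noteq> 0 \<and> (\<forall>x. eval3 F (A *v x) = c * eval3 (F :: 'k::field_char_0 poly3) x))"
  by (simp add: preserves_def subst3_eq_iff_eval3)

lemma carrier_Aut: "carrier (Aut F) = {pgl A |A. preserves F A}"
  by (simp add: Aut_def preserves_def)

lemma mult_Aut [simp]: "x \<otimes>\<^bsub>Aut F\<^esub> y = x \<otimes>\<^bsub>PGL3\<^esub> y" and one_Aut [simp]: "\<one>\<^bsub>Aut F\<^esub> = \<one>\<^bsub>PGL3\<^esub>"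
  by (simp_all add: Aut_def)

lemma pow_Aut [simp]: "x [^]\<^bsub>Aut F\<^esub> (n::nat) = x [^]\<^bsub>PGL3\<^esub> n"
  by (simp add: nat_pow_def)

lemma preserves_invertible: "preserves F A \<Longrightarrow> invertible A"
  by (simp add: preserves_def)

lemma preserves_mult:
  assumes "preserves F A" "preserves (F :: 'k::field_char_0 poly3) B"
  shows "preserves F (A ** B)"
proof -
  obtain a b where "a \<noteq> 0" "b \<noteq> 0" "\<forall>x. eval3 F (A *v x) = a * eval3 F x" "\<forall>x. eval3 F (B *v x) = b * eval3 F x"
    using assms unfolding preserves_iff by blast
  hence "a * b \<noteq> 0 \<and> (\<forall>x. eval3 F (A ** B *v x) = (a * b) * eval3 F x)"
    by (simp flip: matrix_vector_mul_assoc)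
  thus ?thesis using assms unfolding preserves_iff by (blast intro: invertible_mult)
qed

lemma preserves_inverse:
  assumes "preserves (F :: 'k::field_char_0 poly3) A" "A ** B = mat 1"
  shows "preserves F B"
proof -
  obtain a where a: "a \<noteq> 0" "\<forall>x. eval3 F (A *v x) = a * eval3 F x"
    using assms unfolding preserves_iff by blast
  have "eval3 F (B *v x) = inverse a * eval3 F x" for x
    using a(2)[rule_format, of "B *v x"] a(1) assms(2) by (simp add: matrix_vector_mul_assoc)
  moreover have "invertible B" using assms(2) matrix_left_right_inverse invertible_def by metis
  ultimately show ?thesis using a(1) unfolding preserves_iff by (metis inverse_nonzero_iff_nonzero)
qed

lemma preserves_mat_1: "preserves (F :: 'k::field_char_0 poly3) (mat 1)"
  unfolding preserves_iff by (auto intro!: exI[of _ 1] simp: invertible_mat)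

lemma inv_pgl:
  assumes "invertible (A :: 'k::field^3^3)" "A ** B = mat 1"
  shows "inv\<^bsub>PGL3\<^esub> pgl A = pgl B"
proof -
  interpret group "PGL3 :: ('k^3^3) set monoid" by (rule group_PGL3)
  have BA: "B ** A = mat 1" using assms(2) matrix_left_right_inverse by blast
  hence "invertible B" using assms(2) invertible_def by blast
  thus ?thesis using assms BA by (intro inv_equality) (auto simp: pgl_mult one_PGL3)
qed

lemma subgroup_Aut: "subgroup (carrier (Aut F)) PGL3" for F :: "'k::field_char_0 poly3"
proof -
  interpret group "PGL3 :: ('k^3^3) set monoid" by (rule group_PGL3)
  show ?thesis
  proof (rule subgroupI)
    show "carrier (Aut F) \<subseteq> carrier PGL3" by (auto simp: carrier_Aut carrier_PGL3 preserves_def)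
    show "carrier (Aut F) \<noteq> {}" using preserves_mat_1 by (auto simp: carrier_Aut)
  next
    fix x assume "x \<in> carrier (Aut F)"
    then obtain A where A: "x = pgl A" "preserves F A" by (auto simp: carrier_Aut)
    then obtain B where B: "A ** B = mat 1" unfolding preserves_def invertible_def by blast
    show "inv\<^bsub>PGL3\<^esub> x \<in> carrier (Aut F)"
      using A B inv_pgl preserves_inverse preserves_invertible unfolding carrier_Aut by blast
  next
    fix x y assume "x \<in> carrier (Aut F)" "y \<in> carrier (Aut F)"
    then obtain A B where "x = pgl A" "y = pgl B" "preserves F A" "preserves F B" by (auto simp: carrier_Aut)
    thus "x \<otimes>\<^bsub>PGL3\<^esub> y \<in> carrier (Aut F)"
      unfolding carrier_Aut by (auto simp: pgl_mult preserves_invertible intro: preserves_mult)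
  qed
qed

lemma group_Aut: "group (Aut (F :: 'k::field_char_0 poly3))"
  using subgroup.subgroup_is_group[OF subgroup_Aut[of F] group_PGL3] by (simp add: Aut_def)

lemma pgl_eq_one_iff: "pgl A = \<one>\<^bsub>PGL3\<^esub> \<longleftrightarrow> (\<exists>c. c \<noteq> 0 \<and> A = mat c)" for A :: "'k::field^3^3"
  by (simp add: one_PGL3 pgl_eq_iff)

lemma preserves_scale:
  assumes "preserves F A" "c \<noteq> 0" "homogeneous3 d (F :: 'k::field_char_0 poly3)"
  shows "preserves F (mat c ** A)"
proof -
  have "preserves F (mat c)"
    using assms(2,3) unfolding preserves_iff homogeneous3_iff_eval3
    by (intro conjI invertible_mat exI[of _ "c ^ d"]) (auto simp: mat_vec)
  thus ?thesis using assms(1) by (rule preserves_mult)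
qed

lemma K_isomorphic_iff:
  fixes F G :: "'k::field_char_0 poly3"
  shows "K_isomorphic F G \<longleftrightarrow> (\<exists>A c. invertible A \<and> c \<noteq> 0 \<and> (\<forall>x. eval3 F (A *v x) = c * eval3 G x))"
  by (simp add: K_isomorphic_def subst3_eq_iff_eval3)

lemma K_isomorphic_refl: "K_isomorphic F (F :: 'k::field_char_0 poly3)"
  unfolding K_isomorphic_iff by (intro exI[of _ "mat 1"] exI[of _ 1]) (auto simp: invertible_mat)

lemma K_isomorphic_sym:
  assumes "K_isomorphic F (G :: 'k::field_char_0 poly3)"
  shows "K_isomorphic G F"
proof -
  obtain A c where A: "invertible A" "c \<noteq> 0" "\<forall>x. eval3 F (A *v x) = c * eval3 G x"
    using assms unfolding K_isomorphic_iff by blast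
  then obtain B where B: "A ** B = mat 1" "B ** A = mat 1" unfolding invertible_def by blast
  have "eval3 G (B *v x) = inverse c * eval3 F x" for x
    using A(3)[rule_format, of "B *v x"] A(2) B(1) by (simp add: matrix_vector_mul_assoc)
  moreover have "invertible B" using B unfolding invertible_def by blast
  ultimately show ?thesis using A(2) unfolding K_isomorphic_iff by (metis inverse_nonzero_iff_nonzero)
qed

lemma K_isomorphic_trans:
  assumes "K_isomorphic F G" "K_isomorphic G (H :: 'k::field_char_0 poly3)"
  shows "K_isomorphic F H"
proof -
  obtain A a B b where "invertible A" "a \<noteq> 0" "\<forall>x. eval3 F (A *v x) = a * eval3 G x"
     "invertible B" "b \<noteq> 0" "\<forall>x. eval3 G (B *v x) = b * eval3 H x"
    using assms unfolding K_isomorphic_iff by metis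
  thus ?thesis unfolding K_isomorphic_iff
    by (intro exI[of _ "A ** B"] exI[of _ "a * b"]) (auto intro: invertible_mult simp flip: matrix_vector_mul_assoc)
qed

text \<open>The isomorphism is conjugation by the matrix \<open>P\<close> of the equivalence. It
  carries what is known about the normal forms to every model.\<close>

lemma K_isomorphic_Aut:
  assumes "K_isomorphic F (G :: 'k::field_char_0 poly3)"
  shows "Aut F \<cong> Aut G"
proof -
  interpret PG: group "PGL3 :: ('k^3^3) set monoid" by (rule group_PGL3)
  \<comment> \<open>Stated for arbitrary forms because it is applied in both directions, with the
    roles of \<open>P\<close> and \<open>Q\<close> exchanged.\<close>
  have conj: "preserves F' (P ** A ** Q)"
    if as: "invertible P" "P ** Q = mat 1" "a \<noteq> 0" "\<forall>x. eval3 F' (P *v x) = a * eval3 G' x" "preserves G' A"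
    for P Q A a and F' G' :: "'k poly3"
  proof -
    have Q: "Q ** P = mat 1" using as(2) matrix_left_right_inverse by blast
    obtain c where c: "c \<noteq> 0" "\<forall>x. eval3 G' (A *v x) = c * eval3 G' x" "invertible A"
      using as(5) unfolding preserves_iff by blast
    have "a * eval3 G' (Q *v x) = eval3 F' x" for x
      using as(4)[rule_format, of "Q *v x"] as(2) by (simp add: matrix_vector_mul_assoc)
    hence "eval3 F' (P ** A ** Q *v x) = c * eval3 F' x" for x
      using c as(4) by (simp add: mult.left_commute flip: matrix_vector_mul_assoc)
    moreover have "invertible Q" using Q as(2) invertible_def by blast
    ultimately show ?thesis using as(1) c unfolding preserves_iff by (blast intro: invertible_mult)
  qed
  obtain P a where P: "invertible P" "a \<noteq> 0" "\<forall>x. eval3 F (P *v x) = a * eval3 G x"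
    using assms unfolding K_isomorphic_iff by blast
  then obtain Q where Q: "P ** Q = mat 1" "Q ** P = mat 1" unfolding invertible_def by blast
  hence iQ: "invertible Q" unfolding invertible_def by blast
  have G: "\<forall>x. eval3 G (Q *v x) = inverse a * eval3 F x"
  proof
    fix x show "eval3 G (Q *v x) = inverse a * eval3 F x"
      using P(3)[rule_format, of "Q *v x"] P(2) Q(1) by (simp add: matrix_vector_mul_assoc)
  qed
  define h where "h x = pgl Q \<otimes>\<^bsub>PGL3\<^esub> x \<otimes>\<^bsub>PGL3\<^esub> pgl P" for x
  define k where "k x = pgl P \<otimes>\<^bsub>PGL3\<^esub> x \<otimes>\<^bsub>PGL3\<^esub> pgl Q" for x
  have h: "h (pgl A) = pgl (Q ** A ** P)" and k: "k (pgl A) = pgl (P ** A ** Q)" if "invertible A" for A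
    using that P iQ by (simp_all add: h_def k_def pgl_mult invertible_mult)
  have PQP: "P ** (Q ** A) = A" "Q ** (P ** A) = A" for A :: "'k^3^3" using Q by (simp_all add: matrix_mul_assoc)
  have inv: "invertible A \<Longrightarrow> invertible (Q ** (A ** P))" "invertible A \<Longrightarrow> invertible (P ** (A ** Q))" for A
    using P iQ by (auto intro: invertible_mult)
  have "bij_betw h (carrier (Aut F)) (carrier (Aut G))"
  proof (rule bij_betw_byWitness[of _ k])
    show "\<forall>x\<in>carrier (Aut F). k (h x) = x"
      using Q PQP inv by (auto simp: carrier_Aut preserves_invertible h k simp flip: matrix_mul_assoc)
    show "\<forall>x\<in>carrier (Aut G). h (k x) = x"
      using Q PQP inv by (auto simp: carrier_Aut preserves_invertible h k simp flip: matrix_mul_assoc)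
    show "h ` carrier (Aut F) \<subseteq> carrier (Aut G)"
      using conj[OF iQ Q(2) _ G] P(2) by (fastforce simp: carrier_Aut preserves_invertible h)
    show "k ` carrier (Aut G) \<subseteq> carrier (Aut F)"
      using conj[OF P(1) Q(1) P(2,3)] by (fastforce simp: carrier_Aut preserves_invertible k)
  qed
  moreover have "h \<in> hom (Aut F) (Aut G)"
  proof (rule homI)
    fix x assume "x \<in> carrier (Aut F)"
    thus "h x \<in> carrier (Aut G)" using calculation bij_betwE by blast
  next
    fix x y assume "x \<in> carrier (Aut F)" "y \<in> carrier (Aut F)"
    then obtain A B where "x = pgl A" "y = pgl B" "invertible A" "invertible B"
      by (auto simp: carrier_Aut preserves_invertible)
    moreover from this have "(Q ** A ** P) ** (Q ** B ** P) = Q ** (A ** B) ** P"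
      using PQP by (simp flip: matrix_mul_assoc)
    ultimately show "h (x \<otimes>\<^bsub>Aut F\<^esub> y) = h x \<otimes>\<^bsub>Aut G\<^esub> h y"
      using P iQ by (simp add: h pgl_mult invertible_mult)
  qed
  ultimately show ?thesis unfolding is_iso_def iso_def by blast
qed

subsection \<open>Roots of unity\<close>

lemma power_swap: "(x ^ a) ^ b = (x ^ b) ^ a" for x :: "'a::monoid_mult"
  by (simp only: power_mult[symmetric] mult.commute[of a b])

lemma primitive_root_iff: "primitive_root n x \<longleftrightarrow> n > 0 \<and> (\<forall>k. x ^ k = 1 \<longleftrightarrow> n dvd k)" for x :: "'k::field"
proof
  assume x: "primitive_root n x"
  have "n dvd k" if "x ^ k = 1" for k
  proof -
    have "x ^ k = (x ^ n) ^ (k div n) * x ^ (k mod n)"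
      by (simp flip: power_mult power_add)
    hence "x ^ (k mod n) = 1" using x that by (simp add: primitive_root_def)
    moreover have "k mod n < n" using x by (simp add: primitive_root_def)
    ultimately have "k mod n = 0" using x unfolding primitive_root_def by (metis gr0I)
    thus ?thesis by auto
  qed
  moreover have "x ^ k = 1" if "n dvd k" for k
    using that x by (auto simp: primitive_root_def power_mult)
  ultimately show "n > 0 \<and> (\<forall>k. x ^ k = 1 \<longleftrightarrow> n dvd k)" using x by (auto simp: primitive_root_def)
next
  assume "n > 0 \<and> (\<forall>k. x ^ k = 1 \<longleftrightarrow> n dvd k)"
  thus "primitive_root n x" unfolding primitive_root_def by (auto dest: dvd_imp_le)
qed

text \<open>A zero x of 1 + X + ... + X^(p-1) works: it satisfies x^p = 1, and x = 1 would make p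
  vanish in the field.\<close>

lemma ex_prime_root_of_unity:
  assumes "prime (p::nat)"
  shows "\<exists>x::'k::{alg_closed_field,field_char_0}. primitive_root p x"
proof -
  have p: "p \<ge> 2" using assms by (rule prime_ge_2_nat)
  obtain x :: 'k where x: "(\<Sum>k\<le>p - 1. x ^ k) = 0"
    using alg_closed[of "p - 1" "\<lambda>_. 1 :: 'k"] p by auto
  have "{..p - 1} = {..<p}" using p by auto
  hence "x ^ p = 1" using x power_diff_1_eq[of x p] by simp
  have "x \<noteq> 1" using x p by auto
  have "p dvd k" if "x ^ k = 1" for k
  proof (rule ccontr)
    assume "\<not> p dvd k"
    hence "coprime p k" using assms by (simp add: prime_imp_coprime)
    hence "gcd p k = 1" by simp
    \<comment> \<open>If x^k = 1 with k prime to p, a Bezout relation a p = b k + 1 gives x =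
      1.\<close>
    moreover obtain a b where "a * p = b * k + gcd p k" using bezout_nat[of p k] p by (auto simp: mult.commute)
    ultimately have ab: "a * p = b * k + 1" by simp
    have "x ^ (a * p) = 1" "x ^ (b * k) = 1"
      using \<open>x ^ p = 1\<close> \<open>x ^ k = 1\<close> by (simp_all add: power_mult power_swap[of x a] power_swap[of x b])
    hence "x = 1" using ab by auto
    thus False using \<open>x \<noteq> 1\<close> by blast
  qed
  hence "primitive_root p x" using \<open>x ^ p = 1\<close> p unfolding primitive_root_iff by (auto simp: power_mult)
  thus ?thesis ..
qed

text \<open>If p divides n, any p-th root of x will do. Otherwise x is multiplied by a primitive
  p-th root of unity, and the orders n and p are coprime.\<close>

lemma ex_primitive_root_step:
  fixes x :: "'k::{alg_closed_field,field_char_0}"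
  assumes x: "primitive_root n x" and p: "prime (p::nat)"
  shows "\<exists>y::'k. primitive_root (p * n) y"
proof (cases "p dvd n")
  case True
  obtain y where y: "y ^ p = x" using nth_root_exists p by (metis prime_gt_0_nat)
  have "p * n dvd k" if "y ^ k = 1" for k
  proof -
    have "x ^ k = (y ^ k) ^ p" by (simp only: y[symmetric] power_swap[of y k p])
    hence "n dvd k" using that x by (simp add: primitive_root_iff)
    hence "p dvd k" using True by (rule dvd_trans[rotated])
    then obtain k' where k': "k = p * k'" ..
    hence "x ^ k' = 1" using that by (simp add: y[symmetric] flip: power_mult)
    thus ?thesis using x k' by (simp add: primitive_root_iff)
  qed
  moreover have "y ^ (p * n) = 1" using x by (simp add: power_mult y primitive_root_def)
  ultimately have "primitive_root (p * n) y"
    using x p unfolding primitive_root_iff by (auto simp: power_mult dest: prime_gt_0_nat)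
  thus ?thesis ..
next
  case False
  obtain z :: 'k where z: "primitive_root p z" using ex_prime_root_of_unity[OF p] by blast
  have cop: "coprime p n" using False p by (simp add: prime_imp_coprime)
  have "p * n dvd k" if "(z * x) ^ k = 1" for k
  proof -
    have "x ^ (k * p) = ((z * x) ^ k) ^ p"
      using z by (simp add: power_mult_distrib primitive_root_def power_swap[of z k] power_mult[of x])
    hence "n dvd k" using that x cop by (simp add: primitive_root_iff coprime_dvd_mult_left_iff coprime_commute)
    hence "x ^ k = 1" using x by (simp add: primitive_root_iff)
    hence "z ^ k = 1" using that by (simp add: power_mult_distrib)
    hence "p dvd k" using z by (simp add: primitive_root_iff)
    thus ?thesis using \<open>n dvd k\<close> cop by (simp add: divides_mult)
  qed
  moreover have "(z * x) ^ (p * n) = 1"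
    using x z by (simp add: power_mult_distrib power_mult power_swap[of x p] primitive_root_def)
  ultimately have "primitive_root (p * n) (z * x)"
    using x p unfolding primitive_root_iff by (auto simp: power_mult dest: prime_gt_0_nat)
  thus ?thesis ..
qed

lemma ex_primitive_root:
  assumes "n > 0"
  shows "\<exists>x::'k::{alg_closed_field,field_char_0}. primitive_root n x"
  using assms
proof (induction n rule: prime_divisors_induct)
  case (unit n)
  thus ?case by (intro exI[of _ 1]) (auto simp: primitive_root_def)
next
  case (factor p n)
  thus ?case using ex_primitive_root_step by (cases "n = 0") auto
qed auto

lemma primitive_root_power_inj:
  assumes "primitive_root n (x::'k::field)" "i < n" "j < n" "x ^ i = x ^ j"
  shows "i = j"
proof -
  have x0: "x \<noteq> 0" using assms by (auto simp: primitive_root_def power_0_left split: if_splits)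
  have *: False if "i < j" "j < n" "x ^ i = x ^ j" for i j
  proof -
    have "x ^ j = x ^ (i + (j - i))" using that by simp
    hence "x ^ j = x ^ i * x ^ (j - i)" by (simp only: power_add)
    hence "x ^ (j - i) = 1" using that x0 by simp
    thus False using assms(1) that by (auto simp: primitive_root_def)
  qed
  show ?thesis using *[of i j] *[of j i] assms by (metis linorder_less_linear)
qed

lemma roots_of_unity_finite:
  assumes "n > 0"
  shows "finite {y::'k::field. y ^ n = 1}" "card {y::'k. y ^ n = 1} \<le> n"
proof -
  define p :: "'k poly" where "p = Polynomial.monom 1 n - 1"
  have "Polynomial.coeff p n = 1" using assms by (simp add: p_def)
  hence p: "p \<noteq> 0" by auto
  have "{y::'k. y ^ n = 1} = {y. poly p y = 0}" by (simp add: p_def poly_monom)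
  moreover have "Polynomial.degree p \<le> n"
    unfolding p_def by (rule degree_diff_le) (auto simp: degree_monom_le)
  ultimately show "finite {y::'k. y ^ n = 1}" "card {y::'k. y ^ n = 1} \<le> n"
    using poly_roots_finite[OF p] card_poly_roots_bound[OF p] by auto
qed

text \<open>A count: the n powers are distinct, and X^n - 1 has at most n zeros.\<close>

lemma primitive_root_powers:
  assumes "primitive_root n (x::'k::field)" "y ^ n = 1"
  shows "\<exists>k<n. y = x ^ k"
proof -
  have n: "n > 0" using assms by (simp add: primitive_root_def)
  have sub: "(\<lambda>k. x ^ k) ` {..<n} \<subseteq> {y. y ^ n = 1}"
    using assms by (auto simp: primitive_root_def power_swap[of x _ n])
  have "card ((\<lambda>k. x ^ k) ` {..<n}) = n"
    by (subst card_image) (auto intro!: inj_onI primitive_root_power_inj[OF assms(1)])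
  hence "(\<lambda>k. x ^ k) ` {..<n} = {y. y ^ n = 1}"
    using sub roots_of_unity_finite[OF n, where 'k = 'k] by (intro card_seteq) auto
  thus ?thesis using assms by auto
qed

subsection \<open>Eigenbases of automorphisms\<close>

definition colmat :: "(3 \<Rightarrow> 'k^3) \<Rightarrow> 'k^3^3"
  where "colmat p = (\<chi> i j. p j $ i)"

lemma colmat_mult_vec: "colmat p *v x = (\<Sum>j\<in>UNIV. x $ j *s p j)" for x :: "'k::field^3"
  by (simp add: vec_eq_iff colmat_def matrix_vector_mult_def mult.commute)

lemma invertible_colmat: "invertible (colmat p) \<longleftrightarrow> vec.span (range p) = UNIV" for p :: "3 \<Rightarrow> 'k::field^3"
proof -
  have "columns (colmat p) = range p"
    by (auto simp: columns_def column_def colmat_def vec_eq_iff image_iff)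
  moreover have "invertible (colmat p) \<longleftrightarrow> (\<exists>B. colmat p ** B = mat 1)"
    using invertible_right_inverse by blast
  ultimately show ?thesis by (simp add: matrix_right_invertible_span_columns)
qed

lemma mpow_commute: "mpow A n ** A = A ** mpow A n"
  by (induction n) (simp_all, metis matrix_mul_assoc)

lemma matrix_vector_mult_sum: "A *v sum f S = (\<Sum>i\<in>S. A *v f i)" for A :: "'k::field^'n^'m"
  by (induction S rule: infinite_finite_induct) (auto simp: matrix_vector_right_distrib)

text \<open>A finite Fourier transform: averaging the powers of \<open>A\<close> against the n-th
  roots of c writes every vector as a sum of eigenvectors.\<close>

lemma eigenvectors_span:
  fixes A :: "'k::{alg_closed_field,field_char_0}^3^3"
  assumes n: "n > 0" and c: "c \<noteq> 0" and A: "mpow A n = mat c"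
  shows "vec.span {v. \<exists>l. A *v v = l *s v} = UNIV"
proof -
  obtain z :: 'k where z: "primitive_root n z" using ex_primitive_root[OF n] by blast
  obtain g where g: "g ^ n = c" using nth_root_exists[OF n] by blast
  have g0: "g \<noteq> 0" using g c n by auto
  have z0: "z \<noteq> 0" using z by (auto simp: primitive_root_def power_0_left)
  \<comment> \<open>The numbers g z^k are the n-th roots of c, hence the candidates for eigenvalues;
    \<open>l k\<close> are their inverses.\<close>
  define l where "l k = inverse (g * z ^ k)" for k
  have l: "l k \<noteq> 0" "l k ^ n * c = 1" for k
  proof -
    show "l k \<noteq> 0" using g0 z0 by (simp add: l_def)
    have "(z ^ k) ^ n = 1" using z by (simp add: primitive_root_def power_swap[of z k])
    thus "l k ^ n * c = 1" using g c by (simp add: l_def power_mult_distrib power_inverse)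
  qed
  \<comment> \<open>Up to the factor n this is the component of v for the eigenvalue
    \<open>inverse (l k)\<close>: applying \<open>l k\<close> times \<open>A\<close> shifts the sum
    by one, and the last term equals the first since (l k)^n c = 1.\<close>
  define e where "e v k = (\<Sum>j<n. l k ^ j *s (mpow A j *v v))" for v k
  have eig: "A *v e v k = inverse (l k) *s e v k" for v k
  proof -
    have "l k *s (A *v e v k) = (\<Sum>j<n. l k ^ Suc j *s (mpow A (Suc j) *v v))"
      unfolding e_def by (simp add: matrix_vector_mult_sum vec.scale_sum_right mpow_commute matrix_vector_scale
        flip: matrix_vector_mul_assoc)
    also have "\<dots> = (\<Sum>j<Suc n. l k ^ j *s (mpow A j *v v)) - v"
      by (subst sum.lessThan_Suc_shift) simp
    also have "\<dots> = e v k" using l(2)[of k] by (simp add: e_def A mat_vec)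
    finally have "inverse (l k) *s (l k *s (A *v e v k)) = inverse (l k) *s e v k" by simp
    thus ?thesis using l(1)[of k] by simp
  qed
  have "v \<in> vec.span {v. \<exists>l. A *v v = l *s v}" for v
  proof -
    \<comment> \<open>Orthogonality of the roots of unity: in the sum of all components only the
      term j = 0 remains, which is n v.\<close>
    have s0: "(\<Sum>k<n. inverse (z ^ k) ^ j) = (if j = 0 then of_nat n else 0)" if "j < n" for j
    proof (cases "j = 0")
      case False
      hence "z ^ j \<noteq> 1" using z that by (simp add: primitive_root_def)
      hence 1: "inverse (z ^ j) \<noteq> 1" by (metis inverse_1 inverse_inverse_eq)
      have "(\<Sum>k<n. inverse (z ^ k) ^ j) = (\<Sum>k<n. inverse (z ^ j) ^ k)"
        by (simp add: power_inverse power_swap[of z _ j])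
      also have "\<dots> = 0"
      proof -
        have "inverse (z ^ j) ^ n = inverse ((z ^ n) ^ j)" by (simp add: power_inverse power_swap[of z j n])
        hence "inverse (z ^ j) ^ n = 1" using z by (simp add: primitive_root_def)
        thus ?thesis using power_diff_1_eq[of "inverse (z ^ j)" n] 1 by simp
      qed
      finally show ?thesis using False by simp
    qed simp
    have "(\<Sum>k<n. e v k) = (\<Sum>j<n. (\<Sum>k<n. l k ^ j) *s (mpow A j *v v))"
      unfolding e_def by (subst sum.swap) (simp add: vec.scale_sum_left)
    also have "\<dots> = (\<Sum>j<n. if j = 0 then of_nat n *s v else 0)"
    proof (rule sum.cong)
      fix j assume "j \<in> {..<n}"
      hence "(\<Sum>k<n. l k ^ j) = (if j = 0 then of_nat n else 0)"
        using s0[of j] by (simp add: l_def power_mult_distrib sum_distrib_left[symmetric])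
      thus "(\<Sum>k<n. l k ^ j) *s (mpow A j *v v) = (if j = 0 then of_nat n *s v else 0)" by simp
    qed simp
    also have "\<dots> = of_nat n *s v" using n by simp
    finally have "v = inverse (of_nat n) *s (\<Sum>k<n. e v k)" using n by simp
    moreover have "inverse (of_nat n) *s (\<Sum>k<n. e v k) \<in> vec.span {v. \<exists>l. A *v v = l *s v}"
      using eig by (intro vec.span_scale vec.span_sum vec.span_base) blast
    ultimately show ?thesis by simp
  qed
  thus ?thesis by blast
qed

lemma eigenbasis:
  fixes A :: "'k::{alg_closed_field,field_char_0}^3^3"
  assumes "n > 0" "c \<noteq> 0" "mpow A n = mat c"
  obtains p l where "invertible (colmat p)" "\<And>i. A *v p i = l i *s p i"
proof -
  let ?S = "{v. \<exists>l. A *v v = l *s v}"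
  obtain B where B: "B \<subseteq> ?S" "vec.independent B" "?S \<subseteq> vec.span B" "card B = vec.dim ?S"
    using vec.basis_exists[of ?S] by blast
  have span: "vec.span B = UNIV"
    using vec.span_minimal[OF B(3) vec.subspace_span] eigenvectors_span[OF assms] by auto
  have "card B = 3"
  proof -
    have "card B = vec.dim (UNIV :: ('k^3) set)" using vec.basis_card_eq_dim[of B UNIV] B(2) span by auto
    also have "\<dots> = 3" unfolding vec_dim_card by simp
    finally show ?thesis .
  qed
  moreover have "finite B" using B(2) by (rule vec.finiteI_independent)
  ultimately obtain p where p: "bij_betw p (UNIV :: 3 set) B"
    using finite_same_card_bij[of "UNIV :: 3 set" B] by auto
  have "\<exists>l. A *v p i = l *s p i" for i using bij_betwE[OF p] B(1) by blast
  then obtain l where "\<And>i. A *v p i = l i *s p i" by metis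
  moreover have "invertible (colmat p)" unfolding invertible_colmat using p span by (simp add: bij_betw_def)
  ultimately show thesis using that by blast
qed

lemma colmat_axis: "colmat p *v axis i 1 = (p i :: 'k::field^3)"
  by (simp add: vec_eq_iff colmat_def matrix_vector_mult_def axis_def if_distrib[of "\<lambda>u. _ * u"] cong: if_cong)

lemma invertible_mult_vec_eq_0:
  assumes "invertible (A :: 'k::field^'n^'n)" "A *v x = 0"
  shows "x = 0"
  using assms by (metis invertible_def matrix_vector_mul_assoc matrix_vector_mul_lid matrix_vector_mult_0_right)

lemma mpow_eigenvector:
  "A *v v = l *s v \<Longrightarrow> mpow A n *v v = l ^ n *s (v :: 'k::field^'n)"
  by (induction n) (simp_all add: matrix_vector_scale mult.commute flip: matrix_vector_mul_assoc)

text \<open>\<open>eval3 (dd (p j) F) (p i)\<close> is the coefficient of \<open>X\<^sub>i\<^bsup>d-1\<^esup> X\<^sub>j\<close> of \<open>F\<close> in the coordinates given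
  by \<open>p\<close>, multiplied by \<open>d\<close> if \<open>i = j\<close>; smoothness at \<open>p i\<close> makes it nonzero for some \<open>j\<close>.\<close>

definition eig_sys :: "nat \<Rightarrow> 'k::field poly3 \<Rightarrow> nat \<Rightarrow> 'k^3^3 \<Rightarrow> (3 \<Rightarrow> 'k^3) \<Rightarrow> (3 \<Rightarrow> 'k) \<Rightarrow> 'k \<Rightarrow> bool"
  where "eig_sys d F N A p l c \<longleftrightarrow> invertible (colmat p) \<and> (\<forall>i. l i \<noteq> 0) \<and> c \<noteq> 0 \<and>
    (\<forall>x. eval3 F (A *v x) = c * eval3 F x) \<and> (\<forall>i. A *v p i = l i *s p i) \<and>
    (\<forall>k. (\<forall>i j. l i ^ k = l j ^ k) \<longleftrightarrow> N dvd k) \<and>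
    (\<forall>i. \<exists>j. eval3 (dd (p j) F) (p i) \<noteq> 0) \<and>
    (\<forall>i j. eval3 (dd (p j) F) (p i) \<noteq> 0 \<longrightarrow> l i ^ (d - 1) * l j = c)"

lemma eig_sys_exists:
  fixes F :: "'k::{alg_closed_field,field_char_0} poly3"
  assumes F: "smooth_form d F" and d: "d \<ge> 2" and \<sigma>: "\<sigma> \<in> carrier (Aut F)"
    and ord: "group.ord (Aut F) \<sigma> = N" and N: "N > 0"
  obtains A p l c where "eig_sys d F N A p l c"
proof -
  interpret G: group "Aut F" by (rule group_Aut)
  have hom: "homogeneous3 d F" using F by (simp add: smooth_form_def)
  obtain A where A: "\<sigma> = pgl A" "preserves F A" using \<sigma> by (auto simp: carrier_Aut)
  have invA: "invertible A" using A(2) by (rule preserves_invertible)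
  obtain c where c: "c \<noteq> 0" "\<forall>x. eval3 F (A *v x) = c * eval3 F x"
    using A(2) unfolding preserves_iff by blast
  \<comment> \<open>The order is taken in \<open>PGL3\<close>, where a power is trivial exactly when
    the matrix power is scalar.\<close>
  have scal: "(\<exists>s. s \<noteq> 0 \<and> mpow A k = mat s) \<longleftrightarrow> N dvd k" for k
  proof -
    have "pgl A [^]\<^bsub>Aut F\<^esub> k = \<one>\<^bsub>Aut F\<^esub> \<longleftrightarrow> N dvd k"
      using G.pow_eq_id[of \<sigma> k] \<sigma> ord A(1) by simp
    thus ?thesis using invA by (simp add: pgl_pow pgl_eq_one_iff)
  qed
  obtain s where s: "s \<noteq> 0" "mpow A N = mat s" using scal[of N] by auto
  obtain p l where p: "invertible (colmat p)" "\<And>i. A *v p i = l i *s p i"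
    using eigenbasis[OF N s] by blast
  have p0: "p i \<noteq> 0" for i
  proof
    assume "p i = 0"
    hence "colmat p *v axis i 1 = 0" by (simp add: colmat_axis)
    hence "axis i (1::'k) = 0" by (rule invertible_mult_vec_eq_0[OF p(1)])
    thus False by simp
  qed
  have l0: "l i \<noteq> 0" for i
    using invertible_mult_vec_eq_0[OF invA, of "p i"] p(2)[of i] p0[of i] by auto
  have ev: "mpow A k *v p i = l i ^ k *s p i" for k i using p(2) by (rule mpow_eigenvector)
  \<comment> \<open>A power of \<open>A\<close> is diagonal in the eigenbasis, so it is scalar
    exactly when the powers of the three eigenvalues agree.\<close>
  have order: "(\<forall>i j. l i ^ k = l j ^ k) \<longleftrightarrow> N dvd k" for k
  proof
    assume "N dvd k"
    then obtain s where "mpow A k = mat s" using scal by blast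
    hence "s *s p i = l i ^ k *s p i" for i using ev[of k i] by (simp add: mat_vec)
    hence "l i ^ k = s" for i using p0 by (metis vec.scale_cancel_right)
    thus "\<forall>i j. l i ^ k = l j ^ k" by simp
  next
    assume eq: "\<forall>i j. l i ^ k = l j ^ k"
    have "mpow A k *v (colmat p *v x) = l 1 ^ k *s (colmat p *v x)" for x
    proof -
      have "mpow A k *v (x $ j *s p j) = l 1 ^ k *s (x $ j *s p j)" for j
        using eq by (simp add: matrix_vector_scale ev mult.commute)
      thus ?thesis unfolding colmat_mult_vec
        by (simp add: matrix_vector_mult_sum vec.scale_sum_right del: vec.scale_scale)
    qed
    moreover obtain Q where "colmat p ** Q = mat 1" using p(1) unfolding invertible_def by blast
    ultimately have "mpow A k *v x = mat (l 1 ^ k) *v x" for x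
      by (metis matrix_vector_mul_assoc matrix_vector_mul_lid mat_vec)
    hence "mpow A k = mat (l 1 ^ k)" by (simp add: matrix_eq)
    moreover have "l 1 ^ k \<noteq> 0" using l0 by simp
    ultimately show "N dvd k" using scal[of k] by blast
  qed
  \<comment> \<open>Derivatives are linear in the direction; if those along a basis vanished at
    \<open>p i\<close>, all would, and the point would be singular.\<close>
  have ex: "\<exists>j. eval3 (dd (p j) F) (p i) \<noteq> 0" for i
  proof (rule ccontr)
    assume "\<not> ?thesis"
    hence 0: "eval3 (dd (p j) F) (p i) = 0" for j by simp
    obtain v where v: "eval3 (dd v F) (p i) \<noteq> 0"
      using F d p0[of i] by (auto simp: smooth_form_iff)
    obtain Q where Q: "colmat p ** Q = mat 1" using p(1) unfolding invertible_def by blast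
    have "v = colmat p *v (Q *v v)" by (simp add: matrix_vector_mul_assoc Q)
    then obtain w :: "'k^3" where "v = w $ 1 *s p 1 + w $ 2 *s p 2 + w $ 3 *s p 3"
      unfolding colmat_mult_vec sum3 by blast
    thus False using v by (simp add: eval3_dd_plus eval3_dd_scale 0)
  qed
  \<comment> \<open>Both sides of F(A x) = c F(x) are differentiated along \<open>p j\<close> at
    \<open>p i\<close>; homogeneity of the derivative supplies the factor (l i)^(d-1).\<close>
  have wt: "l i ^ (d - 1) * l j = c" if "eval3 (dd (p j) F) (p i) \<noteq> 0" for i j
  proof -
    have "subst3 F A = const3 c * F" using c by (simp add: subst3_eq_iff_eval3)
    hence "eval3 (dd (p j) (subst3 F A)) (p i) = c * eval3 (dd (p j) F) (p i)" by simp
    moreover have "eval3 (dd (p j) (subst3 F A)) (p i) = l j * (l i ^ (d - 1) * eval3 (dd (p j) F) (p i))"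
      unfolding dd_subst3 eval3_subst3 p(2) eval3_dd_scale
      using eval3_dd_homogeneous[OF hom l0] d by simp
    ultimately show ?thesis using that by (simp add: mult.commute)
  qed
  show thesis
    by (rule that[of A p l c]) (unfold eig_sys_def, use p l0 c order ex wt in blast)
qed

lemma eig_sys_permute:
  assumes "eig_sys d F N A p l c" "bij \<pi>"
  shows "eig_sys d F N A (p \<circ> \<pi>) (l \<circ> \<pi>) (c :: 'k::field)"
proof -
  have all: "(\<forall>i. Q (\<pi> i)) \<longleftrightarrow> (\<forall>i. Q i)" for Q using assms(2) by (metis bij_pointE)
  have ex: "(\<exists>i. Q (\<pi> i)) \<longleftrightarrow> (\<exists>i. Q i)" for Q using assms(2) by (metis bij_pointE)
  have "range (p \<circ> \<pi>) = range p" using assms(2) by (metis bij_def image_comp)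
  hence "invertible (colmat (p \<circ> \<pi>)) = invertible (colmat p)" by (simp add: invertible_colmat)
  moreover have "\<forall>i. \<exists>j. eval3 (dd (p (\<pi> j)) F) (p (\<pi> i)) \<noteq> 0"
    using assms(1) ex[of "\<lambda>j. eval3 (dd (p j) F) (p _) \<noteq> 0"] unfolding eig_sys_def by simp
  ultimately show ?thesis using assms(1) unfolding eig_sys_def o_def
    by (simp add: all[of "\<lambda>i. \<forall>j. l i ^ _ = l j ^ _"] all[of "\<lambda>j. l _ ^ _ = l j ^ _"] all[of "\<lambda>i. l i \<noteq> 0"]
       all[of "\<lambda>i. A *v p i = l i *s p i"])
qed

section \<open>Patterns of monomials at the three eigenpoints\<close>

lemma exists_3: "(\<exists>i::3. P i) \<longleftrightarrow> P 1 \<or> P 2 \<or> P 3"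
  using forall_3[of "\<lambda>i. \<not> P i"] by blast

text \<open>The list represents all conjugacy classes of self-maps of a set of three elements; the
  27 maps are inspected one by one.\<close>

lemma function_on_3_pattern:
  fixes f :: "3 \<Rightarrow> 3"
  obtains i j k where "i \<noteq> j" "j \<noteq> k" "i \<noteq> k"
    "(f i = i \<and> f j = j \<and> f k = k) \<or> (f i = i \<and> f j = j \<and> f k = i) \<or> (f i = i \<and> f j = i \<and> f k = i) \<or>
     (f i = i \<and> f j = k \<and> f k = i) \<or> (f i = i \<and> f j = k \<and> f k = j) \<or>
     (f i = j \<and> f j = k \<and> f k = i) \<or> (f i = j \<and> f j = i \<and> f k = i)"
proof -
  have "\<exists>i j k. i \<noteq> j \<and> j \<noteq> k \<and> i \<noteq> k \<and>
    ((f i = i \<and> f j = j \<and> f k = k) \<or> (f i = i \<and> f j = j \<and> f k = i) \<or> (f i = i \<and> f j = i \<and> f k = i) \<or>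
     (f i = i \<and> f j = k \<and> f k = i) \<or> (f i = i \<and> f j = k \<and> f k = j) \<or>
     (f i = j \<and> f j = k \<and> f k = i) \<or> (f i = j \<and> f j = i \<and> f k = i))"
    using exhaust_3[of "f 1"] exhaust_3[of "f 2"] exhaust_3[of "f 3"]
    unfolding exists_3 by (elim disjE) simp_all
  thus thesis using that by blast
qed

lemma eig_sys_pattern:
  fixes F :: "'k::field poly3"
  assumes "eig_sys d F N A p l c"
  obtains q m f where "eig_sys d F N A q m c" "\<And>i. eval3 (dd (q (f i)) F) (q i) \<noteq> 0"
    "(f 1, f 2, f 3) \<in> {(1::3, 2::3, 3::3), (1, 2, 1), (1, 1, 1), (1, 3, 1), (1, 3, 2), (2, 3, 1), (2, 1, 1)}"
proof -
  have "\<forall>i. \<exists>j. eval3 (dd (p j) F) (p i) \<noteq> 0" using assms unfolding eig_sys_def by blast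
  then obtain f where f: "\<And>i. eval3 (dd (p (f i)) F) (p i) \<noteq> 0" by metis
  obtain i j k where ijk: "i \<noteq> j" "j \<noteq> k" "i \<noteq> k" and pat:
    "(f i = i \<and> f j = j \<and> f k = k) \<or> (f i = i \<and> f j = j \<and> f k = i) \<or> (f i = i \<and> f j = i \<and> f k = i) \<or>
     (f i = i \<and> f j = k \<and> f k = i) \<or> (f i = i \<and> f j = k \<and> f k = j) \<or>
     (f i = j \<and> f j = k \<and> f k = i) \<or> (f i = j \<and> f j = i \<and> f k = i)"
    by (rule function_on_3_pattern)
  define \<pi> :: "3 \<Rightarrow> 3" where "\<pi> n = (if n = 1 then i else if n = 2 then j else k)" for n
  have \<pi>: "\<pi> 1 = i" "\<pi> 2 = j" "\<pi> 3 = k" by (simp_all add: \<pi>_def)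
  have "inj \<pi>" unfolding inj_def forall_3 \<pi> using ijk by auto
  hence bij: "bij \<pi>" by (simp add: bij_def finite_UNIV_inj_surj)
  \<comment> \<open>The map f in the new labels, that is, conjugated by
    \<open>\<pi>\<close>.\<close>
  define f' where "f' = inv_into UNIV \<pi> \<circ> f \<circ> \<pi>"
  have "eval3 (dd ((p \<circ> \<pi>) (f' n)) F) ((p \<circ> \<pi>) n) \<noteq> 0" for n
    using f[of "\<pi> n"] bij by (simp add: f'_def bij_is_surj surj_f_inv_f)
  moreover have "inv_into UNIV \<pi> i = 1" "inv_into UNIV \<pi> j = 2" "inv_into UNIV \<pi> k = 3"
    using \<pi> bij by (metis bij_is_inj inv_f_f)+
  hence "(f' 1, f' 2, f' 3) \<in> {(1::3, 2::3, 3::3), (1, 2, 1), (1, 1, 1), (1, 3, 1), (1, 3, 2), (2, 3, 1), (2, 1, 1)}"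
    using pat unfolding f'_def o_def \<pi> by (elim disjE) simp_all
  ultimately show thesis using that[OF eig_sys_permute[OF assms bij]] by blast
qed

definition coords3 :: "'a \<Rightarrow> 'a \<Rightarrow> 'a \<Rightarrow> 3 \<Rightarrow> 'a"
  where "coords3 a b c i = (if i = 1 then a else if i = 2 then b else c)"

lemma coords3_simps [simp]: "coords3 a b c 1 = a" "coords3 a b c 2 = b" "coords3 a b c 3 = c"
  by (simp_all add: coords3_def)

text \<open>Dividing by the first eigenvalue leaves diag(1, x, y), and the common weight becomes C.
  From here on only x, y and the support of \<open>G\<close> matter.\<close>

lemma aut_diagonal_form:
  fixes F :: "'k::{alg_closed_field,field_char_0} poly3"
  assumes F: "smooth_form d F" and d: "d \<ge> 2" and \<sigma>: "\<sigma> \<in> carrier (Aut F)"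
    and ord: "group.ord (Aut F) \<sigma> = N" and N: "N > 0"
  obtains P :: "'k^3^3" and G :: "'k poly3" and x y C :: 'k and f :: "3 \<Rightarrow> 3" where "invertible P" "G = subst3 F P" "homogeneous3 d G" "x \<noteq> 0" "y \<noteq> 0"
    "\<And>k. x ^ k = 1 \<and> y ^ k = 1 \<longleftrightarrow> N dvd k"
    "\<And>m. m \<in> Poly_Mapping.keys G \<Longrightarrow> x ^ Poly_Mapping.lookup m 2 * y ^ Poly_Mapping.lookup m 3 = C"
    "\<And>i. eval3 (partial3 (f i) G) (axis i 1) \<noteq> 0"
    "coords3 1 x y (f 1) = C" "x ^ (d - 1) * coords3 1 x y (f 2) = C" "y ^ (d - 1) * coords3 1 x y (f 3) = C"
    "(f 1, f 2, f 3) \<in> {(1::3, 2::3, 3::3), (1, 2, 1), (1, 1, 1), (1, 3, 1), (1, 3, 2), (2, 3, 1), (2, 1, 1)}"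
proof -
  have homF: "homogeneous3 d F" using F by (simp add: smooth_form_def)
  obtain A p l c where sys: "eig_sys d F N A p l c" by (rule eig_sys_exists[OF assms])
  then obtain q m f where q: "eig_sys d F N A q m c" and f: "\<And>i. eval3 (dd (q (f i)) F) (q i) \<noteq> 0"
    and pat: "(f 1, f 2, f 3) \<in> {(1::3, 2::3, 3::3), (1, 2, 1), (1, 1, 1), (1, 3, 1), (1, 3, 2), (2, 3, 1), (2, 1, 1)}"
    using eig_sys_pattern[OF sys] by metis
  have m0: "m i \<noteq> 0" for i using q by (simp add: eig_sys_def)
  have wt: "m i ^ (d - 1) * m (f i) = c" for i using q f[of i] by (simp add: eig_sys_def)
  define P where "P = colmat q"
  define G where "G = subst3 F P"
  define x where "x = m 2 / m 1"
  define y where "y = m 3 / m 1"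
  define C where "C = c / m 1 ^ d"
  have G: "homogeneous3 d G" unfolding G_def using homF by (rule homogeneous3_subst3)
  have v: "coords3 1 x y i = m i / m 1" for i using exhaust_3[of i] m0 by (auto simp: x_def y_def)
  have wt': "(m i / m 1) ^ (d - 1) * coords3 1 x y (f i) = C" for i
    using wt[of i] d by (cases d) (auto simp: v C_def power_divide mult.commute)
  have ordxy: "x ^ k = 1 \<and> y ^ k = 1 \<longleftrightarrow> N dvd k" for k
  proof -
    have "x ^ k = 1 \<and> y ^ k = 1 \<longleftrightarrow> (\<forall>i j. m i ^ k = m j ^ k)"
      using m0 by (auto simp: x_def y_def power_divide forall_3)
    thus ?thesis using q by (simp add: eig_sys_def)
  qed
  have AP: "A *v (P *v v) = P *v (diag3 (m 1) (m 2) (m 3) *v v)" for v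
  proof -
    have "A *v q i = m i *s q i" for i using q by (simp add: eig_sys_def)
    thus ?thesis
      by (simp add: P_def colmat_mult_vec sum3 matrix_vector_right_distrib matrix_vector_scale diag3_mult_vec mult.commute)
  qed
  have "subst3 G (diag3 (m 1) (m 2) (m 3)) = const3 c * G"
    using q by (simp add: subst3_eq_iff_eval3 G_def eig_sys_def flip: AP)
  hence lk: "Poly_Mapping.lookup G n * (m 1 ^ Poly_Mapping.lookup n 1 * m 2 ^ Poly_Mapping.lookup n 2 * m 3 ^ Poly_Mapping.lookup n 3)
      = c * Poly_Mapping.lookup G n" for n
    by (metis lookup_subst3_diag3 lookup_const3_mult)
  have keys: "x ^ Poly_Mapping.lookup n 2 * y ^ Poly_Mapping.lookup n 3 = C" if n: "n \<in> Poly_Mapping.keys G" for n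
  proof -
    have "m 1 ^ Poly_Mapping.lookup n 1 * m 2 ^ Poly_Mapping.lookup n 2 * m 3 ^ Poly_Mapping.lookup n 3 = c"
      using lk[of n] n by (simp add: in_keys_iff mult.commute)
    moreover have "d = Poly_Mapping.lookup n 1 + Poly_Mapping.lookup n 2 + Poly_Mapping.lookup n 3"
      using G n by (simp add: homogeneous3_def sum3)
    ultimately show ?thesis using m0 by (simp add: x_def y_def C_def power_divide power_add field_simps)
  qed
  have part: "eval3 (partial3 (f i) G) (axis i 1) \<noteq> 0" for i
    using f[of i] unfolding dd_axis[symmetric] G_def dd_subst3 by (simp add: P_def colmat_axis)
  show thesis
  proof (rule that[of P G x y C f])
    show "invertible P" using q by (simp add: P_def eig_sys_def)
    show "G = subst3 F P" by (simp add: G_def)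
    show "x \<noteq> 0" "y \<noteq> 0" using m0 by (simp_all add: x_def y_def)
    show "coords3 1 x y (f 1) = C" using wt'[of 1] m0 by simp
    show "x ^ (d - 1) * coords3 1 x y (f 2) = C" using wt'[of 2] by (simp add: x_def)
    show "y ^ (d - 1) * coords3 1 x y (f 3) = C" using wt'[of 3] by (simp add: y_def)
  qed (use G ordxy keys part pat in blast)+
qed

section \<open>Which orders the patterns allow\<close>

text \<open>In each pattern C is eliminated from the three weight equations until a common exponent
  annihilates x and y; the order divides it.\<close>

lemma pattern_exponents:
  fixes x y :: "'k::field"
  assumes d: "d \<ge> 4" and x: "x \<noteq> 0" and y: "y \<noteq> 0" and N: "\<And>k. x ^ k = 1 \<and> y ^ k = 1 \<Longrightarrow> N dvd k"
    and eqs: "coords3 1 x y (f 1) = C" "x ^ (d - 1) * coords3 1 x y (f 2) = C" "y ^ (d - 1) * coords3 1 x y (f 3) = C"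
  shows "(f 1, f 2, f 3) = (1::3, 2::3, 3::3) \<Longrightarrow> N dvd d"
    and "(f 1, f 2, f 3) = (1, 2, 1) \<Longrightarrow> N dvd d * (d - 1)"
    and "(f 1, f 2, f 3) = (1, 1, 1) \<Longrightarrow> N dvd d - 1"
    and "(f 1, f 2, f 3) = (1, 3, 1) \<Longrightarrow> N dvd (d - 1)\<^sup>2"
    and "(f 1, f 2, f 3) = (1, 3, 2) \<Longrightarrow> N dvd d * (d - 2)"
    and "(f 1, f 2, f 3) = (2, 3, 1) \<Longrightarrow> N dvd (d - 1) * (d - 2) + 1"
    and "(f 1, f 2, f 3) = (2, 1, 1) \<Longrightarrow> N dvd (d - 1) * (d - 2)"
proof -
  have dd: "d = Suc (d - 1)" using d by simp
  have pd: "u ^ d = u ^ (d - 1) * u" for u :: 'k by (subst dd) simp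
  show "N dvd d" if "(f 1, f 2, f 3) = (1::3, 2::3, 3::3)"
    using eqs that by (intro N) (auto simp: pd)
  show "N dvd d * (d - 1)" if "(f 1, f 2, f 3) = (1, 2, 1)"
    using eqs that by (intro N) (auto simp: power_mult power_swap[of y d] pd[of x])
  show "N dvd d - 1" if "(f 1, f 2, f 3) = (1, 1, 1)"
    using eqs that by (intro N) auto
  show "N dvd (d - 1)\<^sup>2" if "(f 1, f 2, f 3) = (1, 3, 1)"
  proof (rule N, intro conjI)
    have e: "x ^ (d - 1) * y = 1" "y ^ (d - 1) = 1" using eqs that by auto
    show "y ^ (d - 1)\<^sup>2 = 1" using e by (simp add: power2_eq_square power_mult)
    have "(x ^ (d - 1) * y) ^ (d - 1) = 1" using e by simp
    thus "x ^ (d - 1)\<^sup>2 = 1" using e by (simp add: power2_eq_square power_mult power_mult_distrib)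
  qed
  have sq: "d * (d - 2) + 1 = (d - 1)\<^sup>2"
  proof -
    obtain e where "d = e + 2" using d by (metis add.commute le_Suc_ex add_leD1 numeral_Bit0)
    thus ?thesis by (simp add: power2_eq_square)
  qed
  show "N dvd d * (d - 2)" if "(f 1, f 2, f 3) = (1, 3, 2)"
  proof (rule N, intro conjI)
    have e: "x ^ (d - 1) * y = 1" "y ^ (d - 1) * x = 1" using eqs that by auto
    \<comment> \<open>Raising the first equation to the power d - 1 and inserting the second
      eliminates v and gives u^((d-1)^2) = u, where (d-1)^2 - 1 = d (d-2).\<close>
    have *: "u ^ (d * (d - 2)) = 1" if "u ^ (d - 1) * v = 1" "v ^ (d - 1) * u = 1" "u \<noteq> 0" for u v :: 'k
    proof -
      have "(u ^ (d - 1) * v) ^ (d - 1) = 1" using that by simp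
      hence "u ^ (d - 1)\<^sup>2 * v ^ (d - 1) = 1"
        by (simp add: power2_eq_square power_mult power_mult_distrib)
      hence "u ^ (d - 1)\<^sup>2 * (v ^ (d - 1) * u) = u" by (simp only: mult.assoc[symmetric]) simp
      hence "u ^ (d - 1)\<^sup>2 = u" by (simp only: that mult_1_right)
      hence "u ^ (d * (d - 2)) * u = u" by (simp only: sq[symmetric] power_add power_one_right)
      thus ?thesis using that by simp
    qed
    show "x ^ (d * (d - 2)) = 1" "y ^ (d * (d - 2)) = 1" using *[OF e x] *[OF e(2,1) y] by auto
  qed
  have pd1: "u ^ (d - 1) = u ^ (d - 2) * u" for u :: 'k
  proof -
    have "d - 1 = Suc (d - 2)" using d by simp
    thus ?thesis by (simp only: power_Suc2)
  qed
  show "N dvd (d - 1) * (d - 2) + 1" if "(f 1, f 2, f 3) = (2, 3, 1)"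
  proof (rule N, intro conjI)
    have e: "x ^ (d - 1) * y = x" "y ^ (d - 1) = x" using eqs that by auto
    hence "x * (x ^ (d - 2) * y) = x * 1" by (simp only: pd1[of x] ac_simps) simp
    hence e': "x ^ (d - 2) * y = 1" using x by simp
    have "y ^ ((d - 1) * (d - 2) + 1) = 1" by (simp only: power_add power_mult e power_one_right e')
    thus "y ^ ((d - 1) * (d - 2) + 1) = 1" .
    hence "(y ^ ((d - 1) * (d - 2) + 1)) ^ (d - 1) = 1" by simp
    thus "x ^ ((d - 1) * (d - 2) + 1) = 1" by (simp only: power_swap[of y _ "d - 1"] e)
  qed
  show "N dvd (d - 1) * (d - 2)" if "(f 1, f 2, f 3) = (2, 1, 1)"
  proof (rule N, intro conjI)
    have e: "x ^ (d - 1) = x" "y ^ (d - 1) = x" using eqs that by auto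
    have "x ^ (d - 2) * x = 1 * x" using e(1) pd1[of x] by simp
    hence x2: "x ^ (d - 2) = 1" using x by simp
    show "x ^ ((d - 1) * (d - 2)) = 1" by (simp only: power_mult e(1) x2)
    show "y ^ ((d - 1) * (d - 2)) = 1" by (simp only: power_mult e x2)
  qed
qed

text \<open>The three exponents to be excluded are positive and smaller than every very large order.
  The very large orders all lie below twice the smallest one, so a proper divisibility between them
  is impossible.\<close>

lemma large_orders_not_dvd:
  fixes d N :: nat
  assumes "d \<ge> 4"
  shows "N \<in> {d * (d - 1), (d - 1)\<^sup>2, d * (d - 2), (d - 1) * (d - 2) + 1} \<Longrightarrow> \<not> N dvd d \<and> \<not> N dvd d - 1 \<and> \<not> N dvd (d - 1) * (d - 2)"
    "N \<in> {d * (d - 1), (d - 1)\<^sup>2, d * (d - 2), (d - 1) * (d - 2) + 1} \<Longrightarrow> M \<in> {d * (d - 1), (d - 1)\<^sup>2, d * (d - 2), (d - 1) * (d - 2) + 1} \<Longrightarrow> N dvd M \<Longrightarrow> N = M"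
proof -
  obtain e where e: "d = e + 4" using assms by (metis add.commute le_Suc_ex)
  have d1: "d - 1 = e + 3" "d - 2 = e + 2" by (simp_all add: e)
  have small: "\<not> n dvd m" if "0 < m" "m < n" for m n :: nat using that by (auto dest: dvd_imp_le)
  have nz: "\<not> n dvd n + r" if "0 < r" "r < n" for n r :: nat
    using small[OF that] by simp
  show "\<not> N dvd d \<and> \<not> N dvd d - 1 \<and> \<not> N dvd (d - 1) * (d - 2)"
    if "N \<in> {d * (d - 1), (d - 1)\<^sup>2, d * (d - 2), (d - 1) * (d - 2) + 1}"
    using that unfolding d1 e
    by (intro conjI small) (auto simp: algebra_simps power2_eq_square)
  \<comment> \<open>The smallest of the four orders; the others exceed it by less than its own
    size.\<close>
  define N4 where "N4 = (e + 3) * (e + 2) + 1"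
  have N4: "N4 = e * e + 5 * e + 7" by (simp add: N4_def algebra_simps)
  have eq: "d * (d - 1) = N4 + (2 * e + 5)" "(d - 1)\<^sup>2 = N4 + (e + 2)" "d * (d - 2) = N4 + (e + 1)" "(d - 1) * (d - 2) + 1 = N4"
    unfolding d1 e N4 by (simp_all add: algebra_simps power2_eq_square)
  show "N = M" if "N \<in> {d * (d - 1), (d - 1)\<^sup>2, d * (d - 2), (d - 1) * (d - 2) + 1}"
    "M \<in> {d * (d - 1), (d - 1)\<^sup>2, d * (d - 2), (d - 1) * (d - 2) + 1}" "N dvd M"
  proof (rule ccontr)
    assume ne: "N \<noteq> M"
    have "M > 0" using that(2) unfolding eq N4 by auto
    hence "N \<le> M" using that(3) by (rule dvd_imp_le[rotated])
    hence "0 < M - N" "M - N < N" using ne that(1,2) unfolding eq N4 by auto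
    hence "\<not> N dvd N + (M - N)" by (rule nz)
    thus False using \<open>N \<le> M\<close> that(3) by simp
  qed
qed

lemma klein_order: "d \<ge> 4 \<Longrightarrow> d\<^sup>2 - 3 * d + 3 = (d - 1) * (d - 2) + (1::nat)"
proof -
  assume "d \<ge> 4"
  then obtain e where e: "d = e + 4" by (metis add.commute le_Suc_ex)
  show ?thesis by (simp add: e power2_eq_square algebra_simps)
qed

text \<open>The difference of exponents is taken in the integers, so that neither has to be the
  larger one.\<close>

lemma primitive_power_eq_iff:
  assumes "\<And>k. x ^ k = 1 \<longleftrightarrow> N dvd k" "(x::'k::field) \<noteq> 0"
  shows "x ^ a = x ^ b \<longleftrightarrow> int N dvd int a - int b"
proof -
  have *: "x ^ a = x ^ b \<longleftrightarrow> int N dvd int a - int b" if "b \<le> a" for a b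
  proof -
    have "x ^ a = x ^ (a - b) * x ^ b" using that by (simp flip: power_add)
    hence "x ^ a = x ^ b \<longleftrightarrow> x ^ (a - b) = 1" using assms(2) by simp
    also have "\<dots> \<longleftrightarrow> int N dvd int a - int b" using that assms(1) by (simp flip: of_nat_diff)
    finally show ?thesis .
  qed
  show ?thesis using *[of b a] *[of a b] by (metis nat_le_linear dvd_diff_commute)
qed

subsection \<open>Normal forms\<close>

definition mon3 :: "nat \<Rightarrow> nat \<Rightarrow> nat \<Rightarrow> 3 \<Rightarrow>\<^sub>0 nat"
  where "mon3 a b c = Poly_Mapping.single 1 a + Poly_Mapping.single 2 b + Poly_Mapping.single 3 c"

lemma lookup_mon3 [simp]: "Poly_Mapping.lookup (mon3 a b c) 1 = a"
  "Poly_Mapping.lookup (mon3 a b c) 2 = b" "Poly_Mapping.lookup (mon3 a b c) 3 = c"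
  by (simp_all add: mon3_def lookup_add lookup_single)

lemma mon3_eqI:
  assumes "Poly_Mapping.lookup m 1 = a" "Poly_Mapping.lookup m 2 = b" "Poly_Mapping.lookup m 3 = c"
  shows "m = mon3 a b c"
proof (rule poly_mapping_eqI)
  fix i :: 3 show "Poly_Mapping.lookup m i = Poly_Mapping.lookup (mon3 a b c) i"
    using exhaust_3[of i] assms by auto
qed

lemma mon_eval_mon3 [simp]: "mon_eval (mon3 a b c) x = x $ 1 ^ a * x $ 2 ^ b * x $ 3 ^ c"
  by (simp add: mon_eval_def prod3)

lemma mon3_inject [simp]: "mon3 a b c = mon3 a' b' c' \<longleftrightarrow> a = a' \<and> b = b' \<and> c = c'"
  by (metis lookup_mon3)

text \<open>The coefficients may still vanish here; that they do not is drawn from smoothness at the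
  coordinate points in each application.\<close>

lemma three_terms:
  fixes G :: "'k::field_char_0 poly3"
  assumes "\<And>m. m \<in> Poly_Mapping.keys G \<Longrightarrow> m \<in> {mon3 a1 b1 c1, mon3 a2 b2 c2, mon3 a3 b3 c3}"
    and "distinct [mon3 a1 b1 c1, mon3 a2 b2 c2, mon3 a3 b3 c3]"
  obtains a b c where "G = const3 a * (varX ^ a1 * varY ^ b1 * varZ ^ c1) +
    const3 b * (varX ^ a2 * varY ^ b2 * varZ ^ c2) + const3 c * (varX ^ a3 * varY ^ b3 * varZ ^ c3)"
proof (rule that)
  show "G = const3 (Poly_Mapping.lookup G (mon3 a1 b1 c1)) * (varX ^ a1 * varY ^ b1 * varZ ^ c1) +
    const3 (Poly_Mapping.lookup G (mon3 a2 b2 c2)) * (varX ^ a2 * varY ^ b2 * varZ ^ c2) +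
    const3 (Poly_Mapping.lookup G (mon3 a3 b3 c3)) * (varX ^ a3 * varY ^ b3 * varZ ^ c3)"
  proof (rule eval3_inject)
    fix x
    have "eval3 G x = (\<Sum>m\<in>{mon3 a1 b1 c1, mon3 a2 b2 c2, mon3 a3 b3 c3}. Poly_Mapping.lookup G m * mon_eval m x)"
      by (rule eval3_superset) (use assms(1) in auto)
    also have "\<dots> = Poly_Mapping.lookup G (mon3 a1 b1 c1) * (x $ 1 ^ a1 * x $ 2 ^ b1 * x $ 3 ^ c1) +
      Poly_Mapping.lookup G (mon3 a2 b2 c2) * (x $ 1 ^ a2 * x $ 2 ^ b2 * x $ 3 ^ c2) +
      Poly_Mapping.lookup G (mon3 a3 b3 c3) * (x $ 1 ^ a3 * x $ 2 ^ b3 * x $ 3 ^ c3)"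
      using assms(2) by (simp del: mon3_inject add: add.assoc)
    finally show "eval3 G x = eval3 (const3 (Poly_Mapping.lookup G (mon3 a1 b1 c1)) * (varX ^ a1 * varY ^ b1 * varZ ^ c1) +
    const3 (Poly_Mapping.lookup G (mon3 a2 b2 c2)) * (varX ^ a2 * varY ^ b2 * varZ ^ c2) +
    const3 (Poly_Mapping.lookup G (mon3 a3 b3 c3)) * (varX ^ a3 * varY ^ b3 * varZ ^ c3)) x" by simp
  qed
qed

text \<open>Combines the change to the eigenbasis with a rescaling of its vectors. The factor t
  leaves room for the Klein form, whose three coefficients are made equal to a common value other
  than 1.\<close>

lemma K_isomorphic_rescale:
  fixes F :: "'k::field_char_0 poly3"
  assumes "invertible P" "G = subst3 F P" "s1 \<noteq> 0" "s2 \<noteq> 0" "s3 \<noteq> 0" "t \<noteq> 0"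
    and "\<And>x. eval3 G (vector [s1 * x $ 1, s2 * x $ 2, s3 * x $ 3]) = t * eval3 S x"
  shows "K_isomorphic F S"
  unfolding K_isomorphic_iff
proof (intro exI conjI allI)
  show "invertible (P ** diag3 s1 s2 s3)" using assms by (simp add: invertible_mult invertible_diag3)
  fix x show "eval3 F (P ** diag3 s1 s2 s3 *v x) = t * eval3 S x"
    using assms(7)[of x] by (simp add: assms(2) diag3_mult_vec flip: matrix_vector_mul_assoc)
qed (rule assms)

definition nf1 :: "nat \<Rightarrow> 'k::comm_ring_1 poly3"
  where "nf1 d = varX ^ d + varY ^ d + varX * varZ ^ (d - 1)"
definition nf2 :: "nat \<Rightarrow> 'k::comm_ring_1 poly3"
  where "nf2 d = varX ^ d + varY ^ (d - 1) * varZ + varX * varZ ^ (d - 1)"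
definition nf3 :: "nat \<Rightarrow> 'k::comm_ring_1 poly3"
  where "nf3 d = varX ^ d + varY ^ (d - 1) * varZ + varY * varZ ^ (d - 1)"
definition nf4 :: "nat \<Rightarrow> 'k::comm_ring_1 poly3"
  where "nf4 d = varX ^ (d - 1) * varY + varY ^ (d - 1) * varZ + varZ ^ (d - 1) * varX"

section \<open>Monomials of the right weight\<close>

lemma dvd_le_cases: "D dvd k \<Longrightarrow> k < 2 * D \<Longrightarrow> k = 0 \<or> k = (D::nat)"
proof -
  assume "D dvd k" "k < 2 * D"
  then obtain q where q: "k = D * q" "D * q < D * 2" by (auto simp: mult.commute)
  hence "q < 2" by simp
  thus "k = 0 \<or> k = D" using q by (auto simp: less_2_cases_iff)
qed

text \<open>Raising the weight equation to the power d - 1 removes y and leaves d | j; with j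
  settled, the power d removes x and leaves d - 1 | k.\<close>

lemma exponents_nf1:
  fixes x y :: "'k::field"
  assumes d: "d \<ge> 4" and N: "\<And>k. x ^ k = 1 \<and> y ^ k = 1 \<Longrightarrow> d * (d - 1) dvd k"
    and x: "x ^ d = 1" and y: "y ^ (d - 1) = 1" and e: "i + j + k = d" "x ^ j * y ^ k = 1"
  shows "(i, j, k) \<in> {(d, 0, 0), (0, d, 0), (1, 0, d - 1)}"
proof -
  have "(x ^ j * y ^ k) ^ (d - 1) = 1" using e by simp
  hence "x ^ (j * (d - 1)) = 1" using y by (simp add: power_mult_distrib power_swap[of y k] power_mult)
  moreover have "y ^ (j * (d - 1)) = 1" using y by (simp add: power_mult power_swap[of y j])
  ultimately have "d * (d - 1) dvd j * (d - 1)" using N by blast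
  hence "d dvd j" using d by simp
  hence j: "j = 0 \<or> j = d" using e d by (intro dvd_le_cases) auto
  hence "x ^ j = 1" using x by auto
  hence "y ^ k = 1" using e by simp
  hence "y ^ (k * d) = 1" "x ^ (k * d) = 1" using x by (simp_all add: power_mult power_swap[of x k])
  hence "d * (d - 1) dvd k * d" using N by blast
  hence "d - 1 dvd k" using d by (simp add: mult.commute[of d])
  hence "k = 0 \<or> k = d - 1" using e d by (intro dvd_le_cases) auto
  thus ?thesis using j e d by auto
qed

text \<open>As y is the inverse of x^(d-1), the order is detected by x alone and the weight equation
  becomes the congruence j = (d-1) k modulo (d-1)^2.\<close>

lemma exponents_nf2:
  fixes x y :: "'k::field"
  assumes d: "d \<ge> 4" and x: "x \<noteq> 0" and N: "\<And>k. x ^ k = 1 \<and> y ^ k = 1 \<longleftrightarrow> (d - 1)\<^sup>2 dvd k"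
    and xy: "x ^ (d - 1) * y = 1" and e: "i + j + k = d" "x ^ j * y ^ k = 1"
  shows "(i, j, k) \<in> {(d, 0, 0), (0, d - 1, 1), (1, 0, d - 1)}"
proof -
  have eq: "x ^ ((d - 1) * k) * y ^ k = 1" for k
    using arg_cong[OF xy, of "\<lambda>u. u ^ k"] by (simp add: power_mult_distrib power_mult)
  have prim: "x ^ k = 1 \<longleftrightarrow> (d - 1)\<^sup>2 dvd k" for k
    using N[of k] eq[of k] by (auto simp: power_mult power_swap[of x _ k])
  have "y \<noteq> 0" using xy by auto
  hence "y ^ k \<noteq> 0" by simp
  hence "x ^ j = x ^ ((d - 1) * k)" using eq[of k] e(2) by (metis mult_cancel_right)
  hence "int ((d - 1)\<^sup>2) dvd int j - int ((d - 1) * k)"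
    using primitive_power_eq_iff[OF prim x] by blast
  then obtain q where q: "int j - int ((d - 1) * k) = int ((d - 1)\<^sup>2) * q" ..
  obtain D where D: "d = Suc D" "D \<ge> 3" using d by (cases d) auto
  \<comment> \<open>With D = d - 1, the exponent j is a multiple of D between 0 and D + 1.\<close>
  have j: "int j = int D * (int k + int D * q)"
    using q D by (simp add: algebra_simps power2_eq_square)
  have bj: "int j \<le> int D + 1" "int k \<le> int D + 1" "int j + int k \<le> int D + 1" using e D by auto
  have "0 \<le> int D * (int k + int D * q)" using j by (metis of_nat_0_le_iff)
  hence "int k + int D * q \<ge> 0" using D by (simp add: zero_le_mult_iff)
  moreover have "int k + int D * q < 2"
  proof (rule ccontr)
    assume "\<not> ?thesis"
    hence "int D * 2 \<le> int D * (int k + int D * q)" by (intro mult_left_mono) auto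
    hence "int D * 2 \<le> int j" by (simp only: j)
    thus False using bj D(2) by linarith
  qed
  ultimately consider "int k + int D * q = 0" | "int k + int D * q = 1" by linarith
  thus ?thesis
  proof cases
    case 1
    hence "j = 0" using j by simp
    have "int D dvd int k" using 1 by (metis dvd_add_times_triv_right_iff dvd_0_right mult.commute)
    hence "k = 0 \<or> k = D" using bj D by (intro dvd_le_cases) auto
    thus ?thesis using e D \<open>j = 0\<close> by auto
  next
    case 2
    hence "j = D" using j by simp
    hence "k \<le> 1" using bj by simp
    moreover have "k \<noteq> 0"
    proof
      assume "k = 0"
      hence "int D dvd 1" using 2 by (metis add_0 dvd_triv_left of_nat_0)
      thus False using D by simp
    qed
    ultimately show ?thesis using e D \<open>j = D\<close> by auto
  qed
qed

text \<open>Again y is a power of x, and the weight equation becomes j = (d-1) k modulo d (d-2). The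
  bounds on j and k leave only two quotients.\<close>

lemma exponents_nf3:
  fixes x y :: "'k::field"
  assumes d: "d \<ge> 4" and x: "x \<noteq> 0" and N: "\<And>k. x ^ k = 1 \<and> y ^ k = 1 \<longleftrightarrow> d * (d - 2) dvd k"
    and xy: "x ^ (d - 1) * y = 1" and e: "i + j + k = d" "x ^ j * y ^ k = 1"
  shows "(i, j, k) \<in> {(d, 0, 0), (0, d - 1, 1), (0, 1, d - 1)}"
proof -
  have eq: "x ^ ((d - 1) * k) * y ^ k = 1" for k
    using arg_cong[OF xy, of "\<lambda>u. u ^ k"] by (simp add: power_mult_distrib power_mult)
  have prim: "x ^ k = 1 \<longleftrightarrow> d * (d - 2) dvd k" for k
    using N[of k] eq[of k] by (auto simp: power_mult power_swap[of x _ k])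
  have "y \<noteq> 0" using xy by auto
  hence "y ^ k \<noteq> 0" by simp
  hence "x ^ j = x ^ ((d - 1) * k)" using eq[of k] e(2) by (metis mult_cancel_right)
  hence "int (d * (d - 2)) dvd int j - int ((d - 1) * k)"
    using primitive_power_eq_iff[OF prim x] by blast
  then obtain q where q: "int j - int ((d - 1) * k) = int (d * (d - 2)) * q" ..
  obtain D where D: "d = D + 4" using d by (metis add.commute le_Suc_ex)
  define N where "N = (int D + 4) * (int D + 2)"
  have j: "int j = (int D + 3) * int k + N * q"
    using q D by (simp add: algebra_simps N_def)
  have bj: "int i + int j + int k = int D + 4" "0 \<le> int i" "0 \<le> int j" "0 \<le> int k" "0 \<le> int D"
    using e D by simp_all
  have k0: "(int D + 3) * int k \<ge> 0" by simp
  have k1: "(int D + 3) * int k \<le> (int D + 3) * (int D + 4)" using bj by (intro mult_left_mono) auto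
  have Np: "N > int D + 4" "2 * N > (int D + 3) * (int D + 4)" by (simp_all add: N_def algebra_simps add_pos_nonneg)
  have "q < 1"
  proof (rule ccontr)
    assume "\<not> q < 1"
    hence "N * 1 \<le> N * q" using Np by (intro mult_left_mono) auto
    thus False using j bj k0 Np by linarith
  qed
  moreover have "q > -2"
  proof (rule ccontr)
    assume "\<not> q > -2"
    hence "N * q \<le> N * (-2)" using Np by (intro mult_left_mono) auto
    thus False using j k1 Np bj by linarith
  qed
  ultimately have q01: "q = 0 \<or> q = -1" by linarith
  obtain M where M: "M = int D + 3" by blast
  from q01 consider "q = 0" | "q = -1" by blast
  thus ?thesis
  proof cases
    case 1
    hence j': "int j = M * int k" using j by (simp add: M)
    have "k < 2"
    proof (rule ccontr)
      assume "\<not> k < 2"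
      hence "M * 2 \<le> M * int k" using M by (intro mult_left_mono) auto
      thus False using j' bj M by linarith
    qed
    hence "k = 0 \<or> k = 1" by auto
    thus ?thesis using j' bj M D by auto
  next
    case 2
    \<comment> \<open>For q = -1 the exponent k is compared with d - 1 = D + 3. In the deviation l
      the equation reads j = (d-1) l + 1, and the degree forces l = 0.\<close>
    define l where "l = int k - (int D + 3)"
    have k: "int k = int D + 3 + l" by (simp add: l_def)
    have j': "int j = M * l + 1" using j 2 unfolding k N_def M by (simp add: algebra_simps)
    have "l < 1"
    proof (rule ccontr)
      assume "\<not> l < 1"
      hence "M * 1 \<le> M * l" using M by (intro mult_left_mono) auto
      thus False using j' bj M k \<open>\<not> l < 1\<close> by linarith
    qed
    moreover have "l > -1"
    proof (rule ccontr)
      assume "\<not> l > -1"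
      hence "M * l \<le> M * (-1)" using M by (intro mult_left_mono) auto
      thus False using j' bj M by linarith
    qed
    ultimately have "l = 0" by linarith
    thus ?thesis using j' k bj D M by auto
  qed
qed

text \<open>Here y is the inverse of x^(d-2) and the weight is x itself, so the congruence is j =
  (d-2) k + 1 modulo (d-1)(d-2) + 1, again with two possible quotients.\<close>

lemma exponents_nf4:
  fixes x y :: "'k::field"
  assumes d: "d \<ge> 4" and x: "x \<noteq> 0" and N: "\<And>k. x ^ k = 1 \<and> y ^ k = 1 \<longleftrightarrow> (d - 1) * (d - 2) + 1 dvd k"
    and xy: "x ^ (d - 2) * y = 1" and e: "i + j + k = d" "x ^ j * y ^ k = x"
  shows "(i, j, k) \<in> {(d - 1, 1, 0), (0, d - 1, 1), (1, 0, d - 1)}"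
proof -
  have eq: "x ^ ((d - 2) * k) * y ^ k = 1" for k
    using arg_cong[OF xy, of "\<lambda>u. u ^ k"] by (simp add: power_mult_distrib power_mult)
  have prim: "x ^ k = 1 \<longleftrightarrow> (d - 1) * (d - 2) + 1 dvd k" for k
    using N[of k] eq[of k] by (auto simp: power_mult power_swap[of x _ k])
  have "y \<noteq> 0" using xy by auto
  hence y: "y ^ k \<noteq> 0" by simp
  have "x ^ ((d - 2) * k + 1) * y ^ k = x * (x ^ ((d - 2) * k) * y ^ k)" by (simp add: mult.assoc)
  also have "\<dots> = x ^ j * y ^ k" using eq[of k] e(2) by simp
  finally have "x ^ j = x ^ ((d - 2) * k + 1)" using y by (metis mult_cancel_right)
  hence "int ((d - 1) * (d - 2) + 1) dvd int j - int ((d - 2) * k + 1)"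
    using primitive_power_eq_iff[OF prim x] by blast
  then obtain q where q: "int j - int ((d - 2) * k + 1) = int ((d - 1) * (d - 2) + 1) * q" ..
  obtain D where D: "d = D + 4" using d by (metis add.commute le_Suc_ex)
  define N where "N = (int D + 3) * (int D + 2) + 1"
  have j: "int j = (int D + 2) * int k + 1 + N * q"
    using q D by (simp add: algebra_simps N_def)
  have bj: "int i + int j + int k = int D + 4" "0 \<le> int i" "0 \<le> int j" "0 \<le> int k" "0 \<le> int D"
    using e D by simp_all
  have k0: "(int D + 2) * int k \<ge> 0" by simp
  have k1: "(int D + 2) * int k \<le> (int D + 2) * (int D + 4)" using bj by (intro mult_left_mono) auto
  have Np: "N > int D + 4" "2 * N > (int D + 2) * (int D + 4) + 1" by (simp_all add: N_def algebra_simps add_pos_nonneg)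
  have "q < 1"
  proof (rule ccontr)
    assume "\<not> q < 1"
    hence "N * 1 \<le> N * q" using Np by (intro mult_left_mono) auto
    thus False using j bj k0 Np by linarith
  qed
  moreover have "q > -2"
  proof (rule ccontr)
    assume "\<not> q > -2"
    hence "N * q \<le> N * (-2)" using Np by (intro mult_left_mono) auto
    thus False using j k1 Np bj by linarith
  qed
  ultimately have q01: "q = 0 \<or> q = -1" by linarith
  obtain M where M: "M = int D + 2" by blast
  from q01 consider "q = 0" | "q = -1" by blast
  thus ?thesis
  proof cases
    case 1
    hence j': "int j = M * int k + 1" using j by (simp add: M)
    have "k < 2"
    proof (rule ccontr)
      assume "\<not> k < 2"
      hence "M * 2 \<le> M * int k" using M by (intro mult_left_mono) auto
      thus False using j' bj M \<open>\<not> k < 2\<close> by linarith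
    qed
    hence "k = 0 \<or> k = 1" by auto
    thus ?thesis using j' bj M D by auto
  next
    case 2
    \<comment> \<open>The deviation of k from d - 1; now j = (d-2) l, and again l = 0.\<close>
    define l where "l = int k - (int D + 3)"
    have k: "int k = int D + 3 + l" by (simp add: l_def)
    have j': "int j = M * l" using j 2 unfolding k N_def M by (simp add: algebra_simps)
    have "l < 1"
    proof (rule ccontr)
      assume "\<not> l < 1"
      hence "M * 1 \<le> M * l" using M by (intro mult_left_mono) auto
      thus False using j' bj M k \<open>\<not> l < 1\<close> by linarith
    qed
    moreover have "l > -1"
    proof (rule ccontr)
      assume "\<not> l > -1"
      hence "M * l \<le> M * (-1)" using M by (intro mult_left_mono) auto
      thus False using j' bj M by linarith
    qed
    ultimately have "l = 0" by linarith
    thus ?thesis using j' k bj D M by auto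
  qed
qed

section \<open>Reduction of a curve to its normal form\<close>

definition diag_form :: "nat \<Rightarrow> 'k::field_char_0 poly3 \<Rightarrow> nat \<Rightarrow> 'k^3^3 \<Rightarrow> 'k poly3 \<Rightarrow> 'k \<Rightarrow> 'k \<Rightarrow> 'k \<Rightarrow> (3 \<Rightarrow> 3) \<Rightarrow> bool"
  where "diag_form d F N P G x y C f \<longleftrightarrow> invertible P \<and> G = subst3 F P \<and> homogeneous3 d G \<and> x \<noteq> 0 \<and> y \<noteq> 0 \<and>
    (\<forall>k. x ^ k = 1 \<and> y ^ k = 1 \<longleftrightarrow> N dvd k) \<and>
    (\<forall>m\<in>Poly_Mapping.keys G. x ^ Poly_Mapping.lookup m 2 * y ^ Poly_Mapping.lookup m 3 = C) \<and>
    (\<forall>i. eval3 (partial3 (f i) G) (axis i 1) \<noteq> 0) \<and>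
    coords3 1 x y (f 1) = C \<and> x ^ (d - 1) * coords3 1 x y (f 2) = C \<and> y ^ (d - 1) * coords3 1 x y (f 3) = C \<and>
    (f 1, f 2, f 3) \<in> {(1::3, 2::3, 3::3), (1, 2, 1), (1, 1, 1), (1, 3, 1), (1, 3, 2), (2, 3, 1), (2, 1, 1)}"

lemma diag_form_exists:
  fixes F :: "'k::{alg_closed_field,field_char_0} poly3"
  assumes "smooth_form d F" "d \<ge> 2" "\<sigma> \<in> carrier (Aut F)" "group.ord (Aut F) \<sigma> = N" "N > 0"
  shows "\<exists>P G x y C f. diag_form d F N P G x y C f"
  by (rule aut_diagonal_form[OF assms]) (unfold diag_form_def, blast)

lemma partial_three_terms:
  fixes a b c :: "'k::field_char_0"
  assumes "G = const3 a * (varX ^ a1 * varY ^ b1 * varZ ^ c1) +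
    const3 b * (varX ^ a2 * varY ^ b2 * varZ ^ c2) + const3 c * (varX ^ a3 * varY ^ b3 * varZ ^ c3)"
  shows "eval3 (partial3 1 G) v =
      a * (of_nat a1 * v$1 ^ (a1 - 1) * v$2 ^ b1 * v$3 ^ c1) + b * (of_nat a2 * v$1 ^ (a2 - 1) * v$2 ^ b2 * v$3 ^ c2)
      + c * (of_nat a3 * v$1 ^ (a3 - 1) * v$2 ^ b3 * v$3 ^ c3)"
    and "eval3 (partial3 2 G) v =
      a * (of_nat b1 * v$1 ^ a1 * v$2 ^ (b1 - 1) * v$3 ^ c1) + b * (of_nat b2 * v$1 ^ a2 * v$2 ^ (b2 - 1) * v$3 ^ c2)
      + c * (of_nat b3 * v$1 ^ a3 * v$2 ^ (b3 - 1) * v$3 ^ c3)"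
    and "eval3 (partial3 3 G) v =
      a * (of_nat c1 * v$1 ^ a1 * v$2 ^ b1 * v$3 ^ (c1 - 1)) + b * (of_nat c2 * v$1 ^ a2 * v$2 ^ b2 * v$3 ^ (c2 - 1))
      + c * (of_nat c3 * v$1 ^ a3 * v$2 ^ b3 * v$3 ^ (c3 - 1))"
  unfolding assms by (simp_all add: algebra_simps)

lemma K_isomorphic_nf1:
  fixes F :: "'k::{alg_closed_field,field_char_0} poly3"
  assumes F: "smooth_form d F" and d: "d \<ge> 4" and \<sigma>: "\<sigma> \<in> carrier (Aut F)"
    and ord: "group.ord (Aut F) \<sigma> = d * (d - 1)"
  shows "K_isomorphic F (nf1 d)"
proof -
  have d2: "d \<ge> 2" and Np: "d * (d - 1) > 0" using d by auto
  obtain P G x y C f where D: "diag_form d F (d * (d - 1)) P G x y C f"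
    using diag_form_exists[OF F d2 \<sigma> ord Np] by blast
  have P: "invertible P" "G = subst3 F P" and G: "homogeneous3 d G" and xy0: "x \<noteq> 0" "y \<noteq> 0"
    and N: "\<And>k. x ^ k = 1 \<and> y ^ k = 1 \<longleftrightarrow> d * (d - 1) dvd k"
    and keys: "\<And>m. m \<in> Poly_Mapping.keys G \<Longrightarrow> x ^ Poly_Mapping.lookup m 2 * y ^ Poly_Mapping.lookup m 3 = C"
    and part: "\<And>i. eval3 (partial3 (f i) G) (axis i 1) \<noteq> 0"
    and eqs: "coords3 1 x y (f 1) = C" "x ^ (d - 1) * coords3 1 x y (f 2) = C" "y ^ (d - 1) * coords3 1 x y (f 3) = C"
    and pat: "(f 1, f 2, f 3) \<in> {(1::3, 2::3, 3::3), (1, 2, 1), (1, 1, 1), (1, 3, 1), (1, 3, 2), (2, 3, 1), (2, 1, 1)}"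
    using D unfolding diag_form_def by auto
  note pe = pattern_exponents[OF d xy0 iffD1[OF N] eqs]
  note lo = large_orders_not_dvd[OF d, where N = "d * (d - 1)"]
  have ne: "d * (d - 1) \<noteq> (d - 1)\<^sup>2" "d * (d - 1) \<noteq> d * (d - 2)" "d * (d - 1) \<noteq> (d - 1) * (d - 2) + 1"
  proof -
    obtain e where e: "d = e + 4" using d by (metis add.commute le_Suc_ex)
    show "d * (d - 1) \<noteq> (d - 1)\<^sup>2" "d * (d - 1) \<noteq> d * (d - 2)" "d * (d - 1) \<noteq> (d - 1) * (d - 2) + 1"
      by (simp_all add: e power2_eq_square algebra_simps)
  qed
  have "\<not> d * (d - 1) dvd d" "\<not> d * (d - 1) dvd d - 1" "\<not> d * (d - 1) dvd (d - 1) * (d - 2)"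
    using lo(1) by blast+
  moreover have "\<not> d * (d - 1) dvd (d - 1)\<^sup>2" "\<not> d * (d - 1) dvd d * (d - 2)" "\<not> d * (d - 1) dvd (d - 1) * (d - 2) + 1"
    using lo(2) ne by blast+
  ultimately have "(f 1, f 2, f 3) = (1, 2, 1)"
    using pat pe unfolding insert_iff empty_iff by blast
  hence f: "f 1 = 1" "f 2 = 2" "f 3 = 1" by auto
  have C: "C = 1" and x: "x ^ d = 1" and y: "y ^ (d - 1) = 1"
    using eqs f d by (cases d; auto simp: mult.commute)+
  have "m \<in> {mon3 d 0 0, mon3 0 d 0, mon3 1 0 (d - 1)}" if "m \<in> Poly_Mapping.keys G" for m
    using exponents_nf1[OF d iffD1[OF N] x y, of "Poly_Mapping.lookup m 1" "Poly_Mapping.lookup m 2" "Poly_Mapping.lookup m 3"]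
      keys[OF that] C G that by (auto simp: homogeneous3_def sum3 intro: mon3_eqI)
  then obtain a b c where abc: "G = const3 a * (varX ^ d * varY ^ 0 * varZ ^ 0) +
    const3 b * (varX ^ 0 * varY ^ d * varZ ^ 0) + const3 c * (varX ^ 1 * varY ^ 0 * varZ ^ (d - 1))"
    by (rule three_terms) (use d in auto)
  \<comment> \<open>At each coordinate point the derivative provided by smoothness sees exactly one
    of the three monomials.\<close>
  have "a \<noteq> 0" "b \<noteq> 0" "c \<noteq> 0"
    using part[of 1] part[of 2] part[of 3] d unfolding f partial_three_terms[OF abc]
    by (auto simp: axis_def power_0_left)
  \<comment> \<open>The scaling equations are triangular: s1 and s2 are independent, and s3 is found
    from s1.\<close>
  obtain s1 where s1: "s1 ^ d = inverse a" using nth_root_exists[of d] d by auto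
  obtain s2 where s2: "s2 ^ d = inverse b" using nth_root_exists[of d] d by auto
  have s0: "s1 \<noteq> 0" "s2 \<noteq> 0" using s1 s2 \<open>a \<noteq> 0\<close> \<open>b \<noteq> 0\<close> d by (auto simp: power_0_left)
  obtain s3 where s3: "s3 ^ (d - 1) = inverse (c * s1)" using nth_root_exists[of "d - 1"] d by auto
  have "s3 \<noteq> 0" using s3 s0 \<open>c \<noteq> 0\<close> d by (auto simp: power_0_left)
  show ?thesis
  proof (rule K_isomorphic_rescale[OF P s0(1,2) \<open>s3 \<noteq> 0\<close> one_neq_zero])
    fix v :: "'k^3"
    have t: "a * s1 ^ d = 1" "b * s2 ^ d = 1" "c * (s1 * s3 ^ (d - 1)) = 1"
      unfolding s1 s2 s3 using \<open>a \<noteq> 0\<close> \<open>b \<noteq> 0\<close> \<open>c \<noteq> 0\<close> s0 by (simp_all add: field_simps)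
    have "eval3 G (vector [s1 * v $ 1, s2 * v $ 2, s3 * v $ 3]) = (a * s1 ^ d) * v $ 1 ^ d +
       (b * s2 ^ d) * v $ 2 ^ d + (c * (s1 * s3 ^ (d - 1))) * (v $ 1 * v $ 3 ^ (d - 1))"
      by (simp add: abc power_mult_distrib algebra_simps)
    thus "eval3 G (vector [s1 * v $ 1, s2 * v $ 2, s3 * v $ 3]) = 1 * eval3 (nf1 d) v"
      unfolding t by (simp add: nf1_def)
  qed
qed

lemma K_isomorphic_nf2:
  fixes F :: "'k::{alg_closed_field,field_char_0} poly3"
  assumes F: "smooth_form d F" and d: "d \<ge> 4" and \<sigma>: "\<sigma> \<in> carrier (Aut F)"
    and ord: "group.ord (Aut F) \<sigma> = (d - 1)\<^sup>2"
  shows "K_isomorphic F (nf2 d)"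
proof -
  have d2: "d \<ge> 2" and Np: "(d - 1)\<^sup>2 > 0" using d by auto
  obtain P G x y C f where D: "diag_form d F ((d - 1)\<^sup>2) P G x y C f"
    using diag_form_exists[OF F d2 \<sigma> ord Np] by blast
  have P: "invertible P" "G = subst3 F P" and G: "homogeneous3 d G" and xy0: "x \<noteq> 0" "y \<noteq> 0"
    and N: "\<And>k. x ^ k = 1 \<and> y ^ k = 1 \<longleftrightarrow> (d - 1)\<^sup>2 dvd k"
    and keys: "\<And>m. m \<in> Poly_Mapping.keys G \<Longrightarrow> x ^ Poly_Mapping.lookup m 2 * y ^ Poly_Mapping.lookup m 3 = C"
    and part: "\<And>i. eval3 (partial3 (f i) G) (axis i 1) \<noteq> 0"
    and eqs: "coords3 1 x y (f 1) = C" "x ^ (d - 1) * coords3 1 x y (f 2) = C" "y ^ (d - 1) * coords3 1 x y (f 3) = C"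
    and pat: "(f 1, f 2, f 3) \<in> {(1::3, 2::3, 3::3), (1, 2, 1), (1, 1, 1), (1, 3, 1), (1, 3, 2), (2, 3, 1), (2, 1, 1)}"
    using D unfolding diag_form_def by auto
  note pe = pattern_exponents[OF d xy0 iffD1[OF N] eqs]
  note lo = large_orders_not_dvd[OF d, where N = "(d - 1)\<^sup>2"]
  have ne: "(d - 1)\<^sup>2 \<noteq> d * (d - 1)" "(d - 1)\<^sup>2 \<noteq> d * (d - 2)" "(d - 1)\<^sup>2 \<noteq> (d - 1) * (d - 2) + 1"
  proof -
    obtain e where e: "d = e + 4" using d by (metis add.commute le_Suc_ex)
    show "(d - 1)\<^sup>2 \<noteq> d * (d - 1)" "(d - 1)\<^sup>2 \<noteq> d * (d - 2)" "(d - 1)\<^sup>2 \<noteq> (d - 1) * (d - 2) + 1"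
      by (simp_all add: e power2_eq_square algebra_simps)
  qed
  have "\<not> (d - 1)\<^sup>2 dvd d" "\<not> (d - 1)\<^sup>2 dvd d - 1" "\<not> (d - 1)\<^sup>2 dvd (d - 1) * (d - 2)"
    using lo(1) by blast+
  moreover have "\<not> (d - 1)\<^sup>2 dvd d * (d - 1)" "\<not> (d - 1)\<^sup>2 dvd d * (d - 2)" "\<not> (d - 1)\<^sup>2 dvd (d - 1) * (d - 2) + 1"
    using lo(2) ne by blast+
  ultimately have "(f 1, f 2, f 3) = (1, 3, 1)"
    using pat pe unfolding insert_iff empty_iff by blast
  hence f: "f 1 = 1" "f 2 = 3" "f 3 = 1" by auto
  have C: "C = 1" and xy: "x ^ (d - 1) * y = 1"
    using eqs f by auto
  have "m \<in> {mon3 d 0 0, mon3 0 (d - 1) 1, mon3 1 0 (d - 1)}" if "m \<in> Poly_Mapping.keys G" for m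
    using exponents_nf2[OF d xy0(1) N xy, of "Poly_Mapping.lookup m 1" "Poly_Mapping.lookup m 2" "Poly_Mapping.lookup m 3"]
      keys[OF that] C G that by (auto simp: homogeneous3_def sum3 intro: mon3_eqI)
  then obtain a b c where abc: "G = const3 a * (varX ^ d * varY ^ 0 * varZ ^ 0) +
    const3 b * (varX ^ 0 * varY ^ (d - 1) * varZ ^ 1) + const3 c * (varX ^ 1 * varY ^ 0 * varZ ^ (d - 1))"
    by (rule three_terms) (use d in auto)
  have "a \<noteq> 0" "b \<noteq> 0" "c \<noteq> 0"
    using part[of 1] part[of 2] part[of 3] d unfolding f partial_three_terms[OF abc]
    by (auto simp: axis_def power_0_left)
  \<comment> \<open>Triangular in the order s1, s3, s2, following the chain of variables in the
    form.\<close>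
  obtain s1 where s1: "s1 ^ d = inverse a" using nth_root_exists[of d] d by auto
  have s10: "s1 \<noteq> 0" using s1 \<open>a \<noteq> 0\<close> d by (auto simp: power_0_left)
  obtain s3 where s3: "s3 ^ (d - 1) = inverse (c * s1)" using nth_root_exists[of "d - 1"] d by auto
  have s30: "s3 \<noteq> 0" using s3 s10 \<open>c \<noteq> 0\<close> d by (auto simp: power_0_left)
  obtain s2 where s2: "s2 ^ (d - 1) = inverse (b * s3)" using nth_root_exists[of "d - 1"] d by auto
  have s20: "s2 \<noteq> 0" using s2 s30 \<open>b \<noteq> 0\<close> d by (auto simp: power_0_left)
  show ?thesis
  proof (rule K_isomorphic_rescale[OF P s10 s20 s30 one_neq_zero])
    fix v :: "'k^3"
    have t: "a * s1 ^ d = 1" "b * (s2 ^ (d - 1) * s3) = 1" "c * (s1 * s3 ^ (d - 1)) = 1"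
      unfolding s1 s2 s3 using \<open>a \<noteq> 0\<close> \<open>b \<noteq> 0\<close> \<open>c \<noteq> 0\<close> s10 s30 by (simp_all add: field_simps)
    have "eval3 G (vector [s1 * v $ 1, s2 * v $ 2, s3 * v $ 3]) = (a * s1 ^ d) * v $ 1 ^ d +
       (b * (s2 ^ (d - 1) * s3)) * (v $ 2 ^ (d - 1) * v $ 3) + (c * (s1 * s3 ^ (d - 1))) * (v $ 1 * v $ 3 ^ (d - 1))"
      by (simp add: abc power_mult_distrib algebra_simps)
    thus "eval3 G (vector [s1 * v $ 1, s2 * v $ 2, s3 * v $ 3]) = 1 * eval3 (nf2 d) v"
      unfolding t by (simp add: nf2_def)
  qed
qed

lemma K_isomorphic_nf3:
  fixes F :: "'k::{alg_closed_field,field_char_0} poly3"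
  assumes F: "smooth_form d F" and d: "d \<ge> 4" and \<sigma>: "\<sigma> \<in> carrier (Aut F)"
    and ord: "group.ord (Aut F) \<sigma> = d * (d - 2)"
  shows "K_isomorphic F (nf3 d)"
proof -
  have d2: "d \<ge> 2" and Np: "d * (d - 2) > 0" using d by auto
  obtain P G x y C f where D: "diag_form d F (d * (d - 2)) P G x y C f"
    using diag_form_exists[OF F d2 \<sigma> ord Np] by blast
  have P: "invertible P" "G = subst3 F P" and G: "homogeneous3 d G" and xy0: "x \<noteq> 0" "y \<noteq> 0"
    and N: "\<And>k. x ^ k = 1 \<and> y ^ k = 1 \<longleftrightarrow> d * (d - 2) dvd k"
    and keys: "\<And>m. m \<in> Poly_Mapping.keys G \<Longrightarrow> x ^ Poly_Mapping.lookup m 2 * y ^ Poly_Mapping.lookup m 3 = C"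
    and part: "\<And>i. eval3 (partial3 (f i) G) (axis i 1) \<noteq> 0"
    and eqs: "coords3 1 x y (f 1) = C" "x ^ (d - 1) * coords3 1 x y (f 2) = C" "y ^ (d - 1) * coords3 1 x y (f 3) = C"
    and pat: "(f 1, f 2, f 3) \<in> {(1::3, 2::3, 3::3), (1, 2, 1), (1, 1, 1), (1, 3, 1), (1, 3, 2), (2, 3, 1), (2, 1, 1)}"
    using D unfolding diag_form_def by auto
  note pe = pattern_exponents[OF d xy0 iffD1[OF N] eqs]
  note lo = large_orders_not_dvd[OF d, where N = "d * (d - 2)"]
  obtain e where e: "d = e + 4" using d by (metis add.commute le_Suc_ex)
  have ne: "d * (d - 2) \<noteq> d * (d - 1)" "d * (d - 2) \<noteq> (d - 1)\<^sup>2" "d * (d - 2) \<noteq> (d - 1) * (d - 2) + 1"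
    by (simp_all add: e power2_eq_square algebra_simps)
  have "\<not> d * (d - 2) dvd d" "\<not> d * (d - 2) dvd d - 1" "\<not> d * (d - 2) dvd (d - 1) * (d - 2)"
    using lo(1) by blast+
  moreover have "\<not> d * (d - 2) dvd d * (d - 1)" "\<not> d * (d - 2) dvd (d - 1)\<^sup>2" "\<not> d * (d - 2) dvd (d - 1) * (d - 2) + 1"
    using lo(2) ne by blast+
  ultimately have "(f 1, f 2, f 3) = (1, 3, 2)"
    using pat pe unfolding insert_iff empty_iff by blast
  hence f: "f 1 = 1" "f 2 = 3" "f 3 = 2" by auto
  have C: "C = 1" and xy: "x ^ (d - 1) * y = 1"
    using eqs f by auto
  have "m \<in> {mon3 d 0 0, mon3 0 (d - 1) 1, mon3 0 1 (d - 1)}" if "m \<in> Poly_Mapping.keys G" for m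
    using exponents_nf3[OF d xy0(1) N xy, of "Poly_Mapping.lookup m 1" "Poly_Mapping.lookup m 2" "Poly_Mapping.lookup m 3"]
      keys[OF that] C G that by (auto simp: homogeneous3_def sum3 intro: mon3_eqI)
  then obtain a b c where abc: "G = const3 a * (varX ^ d * varY ^ 0 * varZ ^ 0) +
    const3 b * (varX ^ 0 * varY ^ (d - 1) * varZ ^ 1) + const3 c * (varX ^ 0 * varY ^ 1 * varZ ^ (d - 1))"
    by (rule three_terms) (use d in auto)
  have nz: "a \<noteq> 0" "b \<noteq> 0" "c \<noteq> 0"
    using part[of 1] part[of 2] part[of 3] d unfolding f partial_three_terms[OF abc]
    by (auto simp: axis_def power_0_left)
  obtain s1 where s1: "s1 ^ d = inverse a" using nth_root_exists[of d] d by auto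
  have s10: "s1 \<noteq> 0" using s1 nz d by (auto simp: power_0_left)
  \<comment> \<open>The equations for s2 and s3 are coupled. Solving b s2^(d-1) s3 = 1 for s3 and
    inserting it into c s2 s3^(d-1) = 1 yields this power of s2.\<close>
  obtain s2 where s2: "s2 ^ (d * (d - 2)) = c / b ^ (d - 1)" using nth_root_exists[OF Np] by blast
  have s20: "s2 \<noteq> 0" using s2 nz d by (auto simp: power_0_left)
  define s3 where "s3 = inverse (b * s2 ^ (d - 1))"
  have s30: "s3 \<noteq> 0" using s20 nz by (simp add: s3_def)
  have t2: "b * (s2 ^ (d - 1) * s3) = 1" using nz s20 by (simp add: s3_def field_simps)
  have sq: "(d - 1) * (d - 1) = d * (d - 2) + 1" by (simp add: e algebra_simps)
  have "s2 ^ ((d - 1) * (d - 1)) = c / b ^ (d - 1) * s2" by (simp only: sq power_add s2 power_one_right)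
  hence "c * s2 = b ^ (d - 1) * (s2 ^ (d - 1)) ^ (d - 1)" using nz by (simp add: power_mult)
  hence t3: "c * (s2 * s3 ^ (d - 1)) = 1" using nz s20
    by (simp add: s3_def power_mult_distrib power_inverse mult.assoc[symmetric] field_simps)
  show ?thesis
  proof (rule K_isomorphic_rescale[OF P s10 s20 s30 one_neq_zero])
    fix v :: "'k^3"
    have "eval3 G (vector [s1 * v $ 1, s2 * v $ 2, s3 * v $ 3]) = (a * s1 ^ d) * v $ 1 ^ d +
       (b * (s2 ^ (d - 1) * s3)) * (v $ 2 ^ (d - 1) * v $ 3) + (c * (s2 * s3 ^ (d - 1))) * (v $ 2 * v $ 3 ^ (d - 1))"
      by (simp add: abc power_mult_distrib algebra_simps)
    thus "eval3 G (vector [s1 * v $ 1, s2 * v $ 2, s3 * v $ 3]) = 1 * eval3 (nf3 d) v"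
      unfolding t2 t3 s1 using nz by (simp add: nf3_def)
  qed
qed

lemma K_isomorphic_nf4:
  fixes F :: "'k::{alg_closed_field,field_char_0} poly3"
  assumes F: "smooth_form d F" and d: "d \<ge> 4" and \<sigma>: "\<sigma> \<in> carrier (Aut F)"
    and ord: "group.ord (Aut F) \<sigma> = (d - 1) * (d - 2) + 1"
  shows "K_isomorphic F (nf4 d)"
proof -
  have d2: "d \<ge> 2" and Np: "(d - 1) * (d - 2) + 1 > 0" using d by auto
  obtain P G x y C f where D: "diag_form d F ((d - 1) * (d - 2) + 1) P G x y C f"
    using diag_form_exists[OF F d2 \<sigma> ord Np] by blast
  have P: "invertible P" "G = subst3 F P" and G: "homogeneous3 d G" and xy0: "x \<noteq> 0" "y \<noteq> 0"
    and N: "\<And>k. x ^ k = 1 \<and> y ^ k = 1 \<longleftrightarrow> (d - 1) * (d - 2) + 1 dvd k"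
    and keys: "\<And>m. m \<in> Poly_Mapping.keys G \<Longrightarrow> x ^ Poly_Mapping.lookup m 2 * y ^ Poly_Mapping.lookup m 3 = C"
    and part: "\<And>i. eval3 (partial3 (f i) G) (axis i 1) \<noteq> 0"
    and eqs: "coords3 1 x y (f 1) = C" "x ^ (d - 1) * coords3 1 x y (f 2) = C" "y ^ (d - 1) * coords3 1 x y (f 3) = C"
    and pat: "(f 1, f 2, f 3) \<in> {(1::3, 2::3, 3::3), (1, 2, 1), (1, 1, 1), (1, 3, 1), (1, 3, 2), (2, 3, 1), (2, 1, 1)}"
    using D unfolding diag_form_def by auto
  note pe = pattern_exponents[OF d xy0 iffD1[OF N] eqs]
  note lo = large_orders_not_dvd[OF d, where N = "(d - 1) * (d - 2) + 1"]
  obtain e where e: "d = e + 4" using d by (metis add.commute le_Suc_ex)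
  have ne: "(d - 1) * (d - 2) + 1 \<noteq> d * (d - 1)" "(d - 1) * (d - 2) + 1 \<noteq> (d - 1)\<^sup>2" "(d - 1) * (d - 2) + 1 \<noteq> d * (d - 2)"
    by (simp_all add: e power2_eq_square algebra_simps)
  have "\<not> ((d - 1) * (d - 2) + 1) dvd d" "\<not> ((d - 1) * (d - 2) + 1) dvd d - 1" "\<not> ((d - 1) * (d - 2) + 1) dvd (d - 1) * (d - 2)"
    using lo(1) by blast+
  moreover have "\<not> (d - 1) * (d - 2) + 1 dvd d * (d - 1)" "\<not> (d - 1) * (d - 2) + 1 dvd (d - 1)\<^sup>2" "\<not> (d - 1) * (d - 2) + 1 dvd d * (d - 2)"
    using lo(2) ne by blast+
  ultimately have "(f 1, f 2, f 3) = (2, 3, 1)"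
    using pat pe unfolding insert_iff empty_iff by blast
  hence f: "f 1 = 2" "f 2 = 3" "f 3 = 1" by auto
  have C: "C = x" and xy': "x ^ (d - 1) * y = x"
    using eqs f by auto
  have pd1: "x ^ (d - 1) = x ^ (d - 2) * x"
  proof -
    have "d - 1 = Suc (d - 2)" using d by simp
    thus ?thesis by (simp only: power_Suc2)
  qed
  have "x * (x ^ (d - 2) * y) = x * 1" using xy' unfolding pd1 by (simp only: ac_simps) simp
  hence xy: "x ^ (d - 2) * y = 1" using xy0 by simp
  have "m \<in> {mon3 (d - 1) 1 0, mon3 0 (d - 1) 1, mon3 1 0 (d - 1)}" if "m \<in> Poly_Mapping.keys G" for m
    using exponents_nf4[OF d xy0(1) N xy, of "Poly_Mapping.lookup m 1" "Poly_Mapping.lookup m 2" "Poly_Mapping.lookup m 3"]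
      keys[OF that] C G that by (auto simp: homogeneous3_def sum3 intro: mon3_eqI)
  then obtain a b c where abc: "G = const3 a * (varX ^ (d - 1) * varY ^ 1 * varZ ^ 0) +
    const3 b * (varX ^ 0 * varY ^ (d - 1) * varZ ^ 1) + const3 c * (varX ^ 1 * varY ^ 0 * varZ ^ (d - 1))"
    by (rule three_terms) (use d in auto)
  have nz: "a \<noteq> 0" "b \<noteq> 0" "c \<noteq> 0"
    using part[of 1] part[of 2] part[of 3] d unfolding f partial_three_terms[OF abc]
    by (auto simp: axis_def power_0_left)
  \<comment> \<open>With the first scale fixed as 1, all three coefficients shall become the same u.
    Expressing s2 and then s3 through u in the first two equations turns the third into this
    one.\<close>
  obtain u where u: "u ^ ((d - 1) * (d - 2) + 1) = c * a ^ ((d - 1) * (d - 1)) / b ^ (d - 1)"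
    using nth_root_exists[OF Np] by blast
  have u0: "u \<noteq> 0" using u nz by (auto simp: power_0_left)
  define s2 where "s2 = u / a"
  define s3 where "s3 = u / (b * s2 ^ (d - 1))"
  have s20: "s2 \<noteq> 0" and s30: "s3 \<noteq> 0" using u0 nz by (simp_all add: s2_def s3_def)
  have t2: "b * (s2 ^ (d - 1) * s3) = u" using nz s20 by (simp add: s3_def field_simps)
  have sq: "(d - 1) * (d - 1) = (d - 1) * (d - 2) + (d - 1)" by (simp add: e algebra_simps)
  have "u * u ^ ((d - 1) * (d - 1)) = u ^ ((d - 1) * (d - 2) + 1) * u ^ (d - 1)"
    unfolding sq by (simp add: power_add)
  hence "b ^ (d - 1) * (u * u ^ ((d - 1) * (d - 1))) = c * a ^ ((d - 1) * (d - 1)) * u ^ (d - 1)"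
    using nz unfolding u by simp
  hence "u * (b ^ (d - 1) * (s2 ^ (d - 1)) ^ (d - 1)) = c * u ^ (d - 1)"
    using nz by (simp add: s2_def power_divide power_mult field_simps)
  hence t3: "c * s3 ^ (d - 1) = u" using nz s20
    by (simp add: s3_def power_mult_distrib power_divide field_simps)
  have t1: "a * s2 = u" using nz by (simp add: s2_def)
  show ?thesis
  proof (rule K_isomorphic_rescale[OF P one_neq_zero s20 s30 u0])
    fix v :: "'k^3"
    have "eval3 G (vector [1 * v $ 1, s2 * v $ 2, s3 * v $ 3]) = (a * s2) * (v $ 1 ^ (d - 1) * v $ 2) +
       (b * (s2 ^ (d - 1) * s3)) * (v $ 2 ^ (d - 1) * v $ 3) + (c * s3 ^ (d - 1)) * (v $ 1 * v $ 3 ^ (d - 1))"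
      by (simp add: abc power_mult_distrib algebra_simps)
    thus "eval3 G (vector [1 * v $ 1, s2 * v $ 2, s3 * v $ 3]) = u * eval3 (nf4 d) v"
      unfolding t1 t2 t3 by (simp add: nf4_def algebra_simps)
  qed
qed

section \<open>Smoothness of the normal forms\<close>

lemma eval3_numeral [simp]: "eval3 (numeral n) x = numeral n"
  by (metis eval3_of_nat of_nat_numeral)

lemma smooth_nf1: "d \<ge> 4 \<Longrightarrow> smooth_form d (nf1 d :: 'k::field_char_0 poly3)"
  unfolding smooth_form_def
proof (intro conjI)
  assume d: "d \<ge> 4"
  have "eval3 (nf1 d :: 'k poly3) (axis 1 1) = 1" using d by (simp add: nf1_def axis_def power_0_left)
  thus "(nf1 d :: 'k poly3) \<noteq> 0" by (metis eval3_0 zero_neq_one)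
  obtain e where e: "d = Suc e" using d by (cases d) auto
  show "homogeneous3 d (nf1 d :: 'k poly3)"
    by (simp add: homogeneous3_iff_eval3 nf1_def e power_mult_distrib algebra_simps)
  show "\<not> (\<exists>x. x \<noteq> 0 \<and> eval3 (nf1 d :: 'k poly3) x = 0 \<and> (\<forall>i. eval3 (partial3 i (nf1 d)) x = 0))"
    using d by (auto simp: nf1_def forall_3 vec_eq_iff power_0_left)
qed

lemma smooth_nf2: "d \<ge> 4 \<Longrightarrow> smooth_form d (nf2 d :: 'k::field_char_0 poly3)"
  unfolding smooth_form_def
proof (intro conjI)
  assume d: "d \<ge> 4"
  have "eval3 (nf2 d :: 'k poly3) (axis 1 1) = 1" using d by (simp add: nf2_def axis_def power_0_left)
  thus "(nf2 d :: 'k poly3) \<noteq> 0" by (metis eval3_0 zero_neq_one)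
  obtain e where e: "d = Suc e" using d by (cases d) auto
  show "homogeneous3 d (nf2 d :: 'k poly3)"
    by (simp add: homogeneous3_iff_eval3 nf2_def e power_mult_distrib algebra_simps)
  show "\<not> (\<exists>x. x \<noteq> 0 \<and> eval3 (nf2 d :: 'k poly3) x = 0 \<and> (\<forall>i. eval3 (partial3 i (nf2 d)) x = 0))"
    using d by (auto simp: nf2_def forall_3 vec_eq_iff power_0_left)
qed

text \<open>At a singular point X = 0, while Y and Z are nonzero. Eliminating Z^(d-2) from the two
  remaining equations gives (d-1)^2 = 1 in the field, impossible in characteristic 0.\<close>

lemma smooth_nf3: "d \<ge> 4 \<Longrightarrow> smooth_form d (nf3 d :: 'k::field_char_0 poly3)"
  unfolding smooth_form_def
proof (intro conjI)
  assume d: "d \<ge> 4"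
  have "eval3 (nf3 d :: 'k poly3) (axis 1 1) = 1" using d by (simp add: nf3_def axis_def power_0_left)
  thus "(nf3 d :: 'k poly3) \<noteq> 0" by (metis eval3_0 zero_neq_one)
  obtain e where e: "d = Suc e" using d by (cases d) auto
  show "homogeneous3 d (nf3 d :: 'k poly3)"
    by (simp add: homogeneous3_iff_eval3 nf3_def e power_mult_distrib algebra_simps)
  show "\<not> (\<exists>x. x \<noteq> 0 \<and> eval3 (nf3 d :: 'k poly3) x = 0 \<and> (\<forall>i. eval3 (partial3 i (nf3 d)) x = 0))"
  proof safe
    fix v :: "'k^3" assume v: "v \<noteq> 0" and p: "\<forall>i. eval3 (partial3 i (nf3 d)) v = 0"
    obtain e where e: "d = e + 4" using d by (metis add.commute le_Suc_ex)
    define y z where "y = v $ 2" and "z = v $ 3"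
    have x: "v $ 1 = 0" using p d by (auto simp: nf3_def forall_3)
    have 2: "of_nat (e + 3) * y ^ (e + 2) * z + z ^ (e + 3) = 0"
      and 3: "y ^ (e + 3) + y * (of_nat (e + 3) * z ^ (e + 2)) = 0"
      using p e by (auto simp: nf3_def forall_3 y_def z_def algebra_simps)
    have "z * (of_nat (e + 3) * y ^ (e + 2) + z ^ (e + 2)) = 0" using 2 by (simp add: algebra_simps power_add eval_nat_numeral)
    moreover have "y * (y ^ (e + 2) + of_nat (e + 3) * z ^ (e + 2)) = 0" using 3 by (simp add: algebra_simps power_add eval_nat_numeral)
    moreover have "z = 0 \<longleftrightarrow> y = 0" using 2 3 by auto
    moreover have "\<not> (y = 0 \<and> z = 0)" using v x by (auto simp: vec_eq_iff forall_3 y_def z_def)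
    ultimately have 4: "of_nat (e + 3) * y ^ (e + 2) + z ^ (e + 2) = 0" and 5: "y ^ (e + 2) + of_nat (e + 3) * z ^ (e + 2) = 0"
      and y: "y \<noteq> 0" by auto
    have z: "z ^ (e + 2) = - (of_nat (e + 3) * y ^ (e + 2))" using 4 by (simp add: eq_neg_iff_add_eq_0 add.commute)
    have "y ^ (e + 2) = - (of_nat (e + 3) * z ^ (e + 2))" using 5 by (simp only: eq_neg_iff_add_eq_0)
    also have "\<dots> = of_nat (e + 3) * of_nat (e + 3) * y ^ (e + 2)"
      unfolding z by (simp only: mult_minus_right minus_minus mult.assoc)
    finally have "y ^ (e + 2) = of_nat (e + 3) * of_nat (e + 3) * y ^ (e + 2)" .
    hence "of_nat 1 = (of_nat ((e + 3) * (e + 3)) :: 'k)" using y by simp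
    hence "1 = (e + 3) * (e + 3)" by (subst (asm) of_nat_eq_iff)
    thus False by simp
  qed
qed

text \<open>A singular point has no zero coordinate, and the cyclic gradient equations then force 1
  + (d-1)^3 = 0, impossible in characteristic 0.\<close>

lemma smooth_nf4: "d \<ge> 4 \<Longrightarrow> smooth_form d (nf4 d :: 'k::field_char_0 poly3)"
  unfolding smooth_form_def
proof (intro conjI)
  assume d: "d \<ge> 4"
  have "eval3 (nf4 d :: 'k poly3) (vector [1, 1, 1]) = of_nat 3" by (simp add: nf4_def)
  thus "(nf4 d :: 'k poly3) \<noteq> 0" by auto
  obtain e where e: "d = Suc e" using d by (cases d) auto
  show "homogeneous3 d (nf4 d :: 'k poly3)"
    by (simp add: homogeneous3_iff_eval3 nf4_def e power_mult_distrib algebra_simps)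
  show "\<not> (\<exists>x. x \<noteq> 0 \<and> eval3 (nf4 d :: 'k poly3) x = 0 \<and> (\<forall>i. eval3 (partial3 i (nf4 d)) x = 0))"
  proof safe
    fix v :: "'k^3" assume v: "v \<noteq> 0" and p: "\<forall>i. eval3 (partial3 i (nf4 d)) v = 0"
    obtain e where e: "d = e + 4" using d by (metis add.commute le_Suc_ex)
    define x y z where "x = v $ 1" and "y = v $ 2" and "z = v $ 3"
    define m :: 'k where "m = of_nat (e + 3)"
    have 1: "m * x ^ (e + 2) * y + z ^ (e + 3) = 0" and 2: "x ^ (e + 3) + m * y ^ (e + 2) * z = 0"
      and 3: "y ^ (e + 3) + m * z ^ (e + 2) * x = 0"
      using p e by (auto simp: nf4_def forall_3 x_def y_def z_def m_def algebra_simps)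
    have "x \<noteq> 0" "y \<noteq> 0" "z \<noteq> 0" using 1 2 3 v by (auto simp: vec_eq_iff forall_3 x_def y_def z_def)
    \<comment> \<open>The values of the three monomials of the form: multiplying each gradient
      equation by its variable gives a linear system in them.\<close>
    define a b c where "a = x ^ (e + 3) * y" and "b = y ^ (e + 3) * z" and "c = z ^ (e + 3) * x"
    have "x * (m * x ^ (e + 2) * y + z ^ (e + 3)) = 0" "y * (x ^ (e + 3) + m * y ^ (e + 2) * z) = 0"
      "z * (y ^ (e + 3) + m * z ^ (e + 2) * x) = 0" unfolding 1 2 3 by simp_all
    hence "m * a + c = 0" "a + m * b = 0" "b + m * c = 0"
      by (simp_all add: a_def b_def c_def algebra_simps eval_nat_numeral)
    hence "c = - (m * a)" "a = - (m * b)" "b = - (m * c)" by (simp_all add: eq_neg_iff_add_eq_0 add.commute)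
    hence "a = - (m * - (m * - (m * a)))" by simp
    hence "a = - (m * (m * (m * a)))" by (simp only: mult_minus_right minus_minus)
    hence "a + m * (m * (m * a)) = 0" by (simp only: eq_neg_iff_add_eq_0)
    hence "(1 + m * m * m) * a = 0" by (simp only: distrib_right mult_1_left mult.assoc)
    moreover have "1 + m * m * m = of_nat (1 + (e + 3) * (e + 3) * (e + 3))" by (simp add: m_def)
    hence "1 + m * m * m \<noteq> 0" by (simp only: of_nat_eq_0_iff)
    ultimately show False using \<open>x \<noteq> 0\<close> \<open>y \<noteq> 0\<close> by (simp add: a_def)
  qed
qed

subsection \<open>Loci with a single element\<close>

definition iso_class :: "nat \<Rightarrow> 'k::field poly3 \<Rightarrow> 'k poly3 set"
  where "iso_class d F = {G. smooth_form d G \<and> K_isomorphic F G}"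

lemma M_Pl_iff: "\<delta> \<in> M_Pl d \<longleftrightarrow> (\<exists>F. smooth_form d F \<and> \<delta> = iso_class d F)"
  unfolding M_Pl_def quotient_def iso_class_def Image_def by auto

lemma iso_class_eq:
  assumes "K_isomorphic F (G :: 'k::field_char_0 poly3)"
  shows "iso_class d F = iso_class d G"
  using assms unfolding iso_class_def by (blast intro: K_isomorphic_trans K_isomorphic_sym)

lemma iso_class_self: "smooth_form d F \<Longrightarrow> F \<in> iso_class d (F :: 'k::field_char_0 poly3)"
  by (simp add: iso_class_def K_isomorphic_refl)

lemma M_Pl_mem:
  assumes "\<delta> \<in> M_Pl d" "(F :: 'k::field_char_0 poly3) \<in> \<delta>"
  shows "smooth_form d F" "\<delta> = iso_class d F"
  using assms iso_class_eq by (auto simp: M_Pl_iff iso_class_def)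

lemma ord_Aut:
  fixes F :: "'k::field_char_0 poly3"
  shows "group.ord (Aut F) x = group.ord PGL3 x"
  unfolding group.ord_def[OF group_Aut] group.ord_def[OF group_PGL3] by simp

lemma ord_eqI:
  assumes "group G" "x \<in> carrier G" "\<And>k::nat. x [^]\<^bsub>G\<^esub> k = \<one>\<^bsub>G\<^esub> \<longleftrightarrow> N dvd k"
  shows "group.ord G x = N"
  using assms group.pow_eq_id[OF assms(1,2)] by (metis dvd_antisym dvd_refl)

lemma iso_ord:
  assumes "group G" "group H" "h \<in> iso G H" "x \<in> carrier G"
  shows "group.ord H (h x) = group.ord G x"
proof (rule ord_eqI[OF assms(2)])
  have h: "h \<in> hom G H" "bij_betw h (carrier G) (carrier H)" using assms(3) by (auto simp: iso_def)
  show "h x \<in> carrier H" using h assms(4) by (auto simp: hom_def)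
  fix k :: nat
  interpret G: group G by fact
  interpret H: group H by fact
  interpret group_hom G H h by (unfold_locales) (rule h)
  have "h x [^]\<^bsub>H\<^esub> k = \<one>\<^bsub>H\<^esub> \<longleftrightarrow> h (x [^]\<^bsub>G\<^esub> k) = h \<one>\<^bsub>G\<^esub>"
    using assms(4) by (simp add: hom_nat_pow)
  also have "\<dots> \<longleftrightarrow> x [^]\<^bsub>G\<^esub> k = \<one>\<^bsub>G\<^esub>"
    using h(2) assms(4) by (intro inj_on_eq_iff[of h "carrier G"]) (auto simp: bij_betw_def)
  also have "\<dots> \<longleftrightarrow> G.ord x dvd k" using assms(4) by (simp add: G.pow_eq_id)
  finally show "h x [^]\<^bsub>H\<^esub> k = \<one>\<^bsub>H\<^esub> \<longleftrightarrow> G.ord x dvd k" .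
qed

text \<open>The generator is written \<open>1 mod int N\<close>, which lies in the carrier even for
  N = 1.\<close>

lemma ord_integer_mod_group:
  assumes "N > 0"
  shows "group.ord (integer_mod_group N) (1 mod int N) = N"
  by (rule ord_eqI) (use assms in \<open>auto simp: carrier_integer_mod_group mod_mult_right_eq simp flip: int_dvd_int_iff simp: dvd_eq_mod_eq_0\<close>)

lemma cyclic_embedding:
  assumes "group G" "x \<in> carrier G" "group.ord G x = N" "N > 0"
  defines "h \<equiv> (\<lambda>k::int. x [^]\<^bsub>G\<^esub> k)"
  shows "h \<in> mon (integer_mod_group N) G" "h ` carrier (integer_mod_group N) = generate G {x}"
proof -
  interpret group G by fact
  have c: "carrier (integer_mod_group N) = {0..<int N}" using assms(4) by (simp add: carrier_integer_mod_group)
  have eq: "h a = h b \<longleftrightarrow> int N dvd a - b" for a b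
    unfolding h_def using int_pow_eq[OF assms(2), of a b] assms(3) by (simp add: dvd_diff_commute)
  have hmod: "h (a mod int N) = h a" for a by (simp add: eq mod_eq_dvd_iff[symmetric])
  have "h \<in> hom (integer_mod_group N) G"
    by (rule homI) (use assms(2) in \<open>auto simp: hmod\<close>, auto simp: h_def int_pow_mult)
  moreover have "inj_on h (carrier (integer_mod_group N))"
  proof (rule inj_onI)
    fix a b assume ab: "a \<in> carrier (integer_mod_group N)" "b \<in> carrier (integer_mod_group N)" "h a = h b"
    hence "a mod int N = b mod int N" by (simp add: eq mod_eq_dvd_iff)
    thus "a = b" using ab c by simp
  qed
  ultimately show "h \<in> mon (integer_mod_group N) G" by (simp add: mon_def)
  have "generate G {x} = range h" using generate_pow[OF assms(2)] by (auto simp: h_def)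
  moreover have "h k \<in> h ` carrier (integer_mod_group N)" for k
    using hmod[of k] assms(4) c by (metis atLeastLessThan_iff imageI pos_mod_bound pos_mod_sign of_nat_0_less_iff)
  ultimately show "h ` carrier (integer_mod_group N) = generate G {x}" by auto
qed

text \<open>Replaces the abstract subgroup in the definition of the loci by a single automorphism of
  order N.\<close>

lemma subgroup_iso_integer_mod_iff:
  assumes "group G" "N > 0"
  shows "(\<exists>H. subgroup H G \<and> integer_mod_group N \<cong> G\<lparr>carrier := H\<rparr>) \<longleftrightarrow> (\<exists>x\<in>carrier G. group.ord G x = N)"
proof
  assume "\<exists>H. subgroup H G \<and> integer_mod_group N \<cong> G\<lparr>carrier := H\<rparr>"
  then obtain H h where H: "subgroup H G" and h: "h \<in> iso (integer_mod_group N) (G\<lparr>carrier := H\<rparr>)"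
    by (auto simp: is_iso_def)
  let ?o = "1 mod int N"
  have gH: "group (G\<lparr>carrier := H\<rparr>)" using H assms(1) by (rule subgroup.subgroup_is_group)
  have o: "?o \<in> carrier (integer_mod_group N)" using assms(2) by (auto simp: carrier_integer_mod_group)
  have "group.ord (G\<lparr>carrier := H\<rparr>) (h ?o) = N"
    using iso_ord[OF group_integer_mod_group gH h o] ord_integer_mod_group[OF assms(2)] by simp
  moreover have "group.ord (G\<lparr>carrier := H\<rparr>) (h ?o) = group.ord G (h ?o)"
    unfolding group.ord_def[OF gH] group.ord_def[OF assms(1)] by (simp add: nat_pow_def)
  moreover have "h ?o \<in> carrier G" using h o subgroup.mem_carrier[OF H] by (auto simp: iso_def hom_def)
  ultimately show "\<exists>x\<in>carrier G. group.ord G x = N" by auto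
next
  assume "\<exists>x\<in>carrier G. group.ord G x = N"
  then obtain x where x: "x \<in> carrier G" "group.ord G x = N" by blast
  interpret group G by fact
  let ?h = "\<lambda>k::int. x [^]\<^bsub>G\<^esub> k"
  note h = cyclic_embedding[OF assms(1) x assms(2)]
  have "subgroup (generate G {x}) G" using x by (intro generate_is_subgroup) auto
  moreover have "?h \<in> iso (integer_mod_group N) (G\<lparr>carrier := generate G {x}\<rparr>)"
    using h by (auto simp: mon_def iso_def hom_def bij_betw_def)
  ultimately show "\<exists>H. subgroup H G \<and> integer_mod_group N \<cong> G\<lparr>carrier := H\<rparr>"
    unfolding is_iso_def by blast
qed

lemma ex_ord_iso:
  assumes "G \<cong> H" "group G" "group H" "\<exists>x\<in>carrier G. group.ord G x = N"
  shows "\<exists>x\<in>carrier H. group.ord H x = N"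
proof -
  obtain h x where h: "h \<in> iso G H" "x \<in> carrier G" "group.ord G x = N"
    using assms(1,4) unfolding is_iso_def by blast
  hence "h x \<in> carrier H" by (auto simp: iso_def hom_def)
  thus ?thesis using iso_ord[OF assms(2,3) h(1,2)] h(3) by blast
qed

text \<open>The formal part common to the four orders: \<open>T\<close> gives existence and
  \<open>uniq\<close> shows that the class of \<open>S\<close> is the only one.\<close>

lemma single_locus:
  fixes S :: "'k::{alg_closed_field,field_char_0} poly3"
  assumes S: "smooth_form d S" and N: "N > 0" and T: "T \<in> carrier (Aut S)" "group.ord (Aut S) T = N"
    and uniq: "\<And>F \<sigma>. smooth_form d F \<Longrightarrow> \<sigma> \<in> carrier (Aut F) \<Longrightarrow> group.ord (Aut F) \<sigma> = N \<Longrightarrow> K_isomorphic F S"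
  shows single_locus_grp: "M_Pl_grp d (integer_mod_group N) = {iso_class d S}"
    and single_locus_irreducible: "irreducible_point_locus d (M_Pl_grp d (integer_mod_group N) :: 'k poly3 set set)"
    and single_locus_full: "Aut S \<cong> H \<Longrightarrow> M_Pl_full d H = (M_Pl_grp d (integer_mod_group N) :: 'k poly3 set set)"
proof -
  have S_in: "iso_class d S \<in> M_Pl d" using S M_Pl_iff by blast
  show grp: "M_Pl_grp d (integer_mod_group N) = {iso_class d S}"
  proof (rule Set.set_eqI)
    fix \<delta> :: "'k poly3 set"
    have "\<delta> \<in> M_Pl_grp d (integer_mod_group N) \<longleftrightarrow> \<delta> \<in> M_Pl d \<and> (\<exists>F\<in>\<delta>. \<exists>x\<in>carrier (Aut F). group.ord (Aut F) x = N)"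
      unfolding M_Pl_grp_def by (simp add: subgroup_iso_integer_mod_iff[OF group_Aut N])
    also have "\<dots> \<longleftrightarrow> \<delta> = iso_class d S"
    proof
      assume "\<delta> \<in> M_Pl d \<and> (\<exists>F\<in>\<delta>. \<exists>x\<in>carrier (Aut F). group.ord (Aut F) x = N)"
      then obtain F x where F: "\<delta> \<in> M_Pl d" "F \<in> \<delta>" "x \<in> carrier (Aut F)" "group.ord (Aut F) x = N" by blast
      hence "K_isomorphic F S" using uniq M_Pl_mem(1) by blast
      thus "\<delta> = iso_class d S" using M_Pl_mem(2)[OF F(1,2)] iso_class_eq by blast
    next
      assume "\<delta> = iso_class d S"
      thus "\<delta> \<in> M_Pl d \<and> (\<exists>F\<in>\<delta>. \<exists>x\<in>carrier (Aut F). group.ord (Aut F) x = N)"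
        using S_in iso_class_self[OF S] T by blast
    qed
    finally show "\<delta> \<in> M_Pl_grp d (integer_mod_group N) \<longleftrightarrow> \<delta> \<in> {iso_class d S}" by simp
  qed
  show "irreducible_point_locus d (M_Pl_grp d (integer_mod_group N) :: 'k poly3 set set)"
    unfolding irreducible_point_locus_def irreducible_in_def grp using S_in by auto
  show "M_Pl_full d H = (M_Pl_grp d (integer_mod_group N) :: 'k poly3 set set)" if iso: "Aut S \<cong> H"
  proof (rule Set.set_eqI)
    fix \<delta> :: "'k poly3 set"
    have "\<delta> \<in> M_Pl_full d H \<longleftrightarrow> \<delta> = iso_class d S"
    proof
      assume "\<delta> \<in> M_Pl_full d H"
      then obtain F where F: "\<delta> \<in> M_Pl d" "F \<in> \<delta>" "Aut F \<cong> H" unfolding M_Pl_full_def by blast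
      note g = group_Aut[of F] group_Aut[of S]
      \<comment> \<open>Along this isomorphism \<open>T\<close> becomes an element of order N in
        \<open>Aut F\<close>, to which uniqueness applies.\<close>
      have "Aut S \<cong> Aut F"
      proof -
        obtain f h where f: "f \<in> iso (Aut F) H" and h: "h \<in> iso (Aut S) H"
          using F(3) iso unfolding is_iso_def by blast
        have "inv_into (carrier (Aut F)) f \<in> iso H (Aut F)" using group.iso_set_sym[OF g(1) f] .
        thus ?thesis using iso_set_trans[OF h] unfolding is_iso_def by blast
      qed
      hence "\<exists>x\<in>carrier (Aut F). group.ord (Aut F) x = N" using ex_ord_iso[OF _ g(2,1)] T by blast
      hence "K_isomorphic F S" using uniq M_Pl_mem(1)[OF F(1,2)] by blast
      thus "\<delta> = iso_class d S" using M_Pl_mem(2)[OF F(1,2)] iso_class_eq by blast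
    next
      assume "\<delta> = iso_class d S"
      thus "\<delta> \<in> M_Pl_full d H" unfolding M_Pl_full_def using S_in iso_class_self[OF S] iso by blast
    qed
    thus "\<delta> \<in> M_Pl_full d H \<longleftrightarrow> \<delta> \<in> M_Pl_grp d (integer_mod_group N)" unfolding grp by simp
  qed
qed

text \<open>Every admissible embedding has the subgroup generated by \<open>T\<close> as its image,
  and this lies in \<open>Aut S\<close>. The locus on the right is thus a nonempty part of a single
  class.\<close>

lemma single_locus_rho:
  fixes S :: "'k::{alg_closed_field,field_char_0} poly3"
  assumes S: "smooth_form d S" and N: "N > 0" and T: "T \<in> carrier (Aut S)" "group.ord (Aut S) T = N"
    and uniq: "\<And>F \<sigma>. smooth_form d F \<Longrightarrow> \<sigma> \<in> carrier (Aut F) \<Longrightarrow> group.ord (Aut F) \<sigma> = N \<Longrightarrow> K_isomorphic F S"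
  shows "let E = cyclic_embeddings N T in E \<noteq> {} \<and>
    (\<forall>\<rho>\<in>E. (M_Pl_grp d (integer_mod_group N) :: 'k poly3 set set) = M_Pl_rho d (integer_mod_group N) \<rho>)"
  unfolding Let_def
proof (intro conjI ballI)
  interpret group "PGL3 :: ('k^3^3) set monoid" by (rule group_PGL3)
  have T': "T \<in> carrier PGL3" using T(1) subgroup.mem_carrier[OF subgroup_Aut] by blast
  show "cyclic_embeddings N T \<noteq> {}"
  proof -
    have oT: "group.ord PGL3 T = N" using T(2) by (simp only: ord_Aut)
    have "(\<lambda>k::int. T [^]\<^bsub>PGL3\<^esub> k) \<in> cyclic_embeddings N T"
      using cyclic_embedding[OF group_PGL3 T' oT N] unfolding cyclic_embeddings_def mem_Collect_eq by (rule conjI)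
    thus ?thesis by blast
  qed
  fix \<rho> assume \<rho>: "\<rho> \<in> cyclic_embeddings N T"
  have grp: "M_Pl_grp d (integer_mod_group N) = {iso_class d S}" by (rule single_locus_grp[OF S N T uniq])
  have S_in: "iso_class d S \<in> M_Pl d" using S M_Pl_iff by blast
  have "\<rho> x \<in> carrier (Aut S)" if "x \<in> carrier (integer_mod_group N)" for x
  proof -
    have "\<rho> x \<in> generate PGL3 {T}" using \<rho> that unfolding cyclic_embeddings_def by blast
    thus ?thesis using generate_subgroup_incl[of "{T}" "carrier (Aut S)"] T(1) subgroup_Aut by blast
  qed
  hence "\<forall>x\<in>carrier (integer_mod_group N). inv\<^bsub>PGL3\<^esub> \<one>\<^bsub>PGL3\<^esub> \<otimes>\<^bsub>PGL3\<^esub> \<rho> x \<otimes>\<^bsub>PGL3\<^esub> \<one>\<^bsub>PGL3\<^esub> \<in> carrier (Aut S)"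
    by (auto simp: subgroup.mem_carrier[OF subgroup_Aut[of S]])
  hence "iso_class d S \<in> M_Pl_rho d (integer_mod_group N) \<rho>"
    unfolding M_Pl_rho_def using grp iso_class_self[OF S] one_closed by blast
  thus "M_Pl_grp d (integer_mod_group N) = M_Pl_rho d (integer_mod_group N) \<rho>"
    using grp unfolding M_Pl_rho_def by blast
qed

lemma generate_ord_card:
  fixes C :: "'k::field_char_0 poly3"
  assumes "\<sigma> \<in> carrier (Aut C)" "group.ord (Aut C) \<sigma> = N" "N > 0" "card (carrier (Aut C)) = N"
  shows "carrier (Aut C) = generate PGL3 {\<sigma>}"
proof -
  interpret group "PGL3 :: ('k^3^3) set monoid" by (rule group_PGL3)
  have s: "\<sigma> \<in> carrier PGL3" using assms(1) subgroup.mem_carrier[OF subgroup_Aut] by blast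
  have "generate PGL3 {\<sigma>} \<subseteq> carrier (Aut C)"
    using generate_subgroup_incl[of "{\<sigma>}" "carrier (Aut C)"] assms(1) subgroup_Aut by blast
  moreover have "card (generate PGL3 {\<sigma>}) = N"
    using generate_pow_card[OF s] assms(2) by (simp only: ord_Aut)
  moreover have "finite (carrier (Aut C))" using assms(3,4) card_gt_0_iff by metis
  ultimately show ?thesis using card_subset_eq assms(4) by metis
qed

subsection \<open>Automorphism groups of the normal forms\<close>

lemma dd_const3_mult: "dd v (const3 c * F) = const3 c * dd v F"
  by simp

lemma const3_mult_eq_0: "c \<noteq> 0 \<Longrightarrow> const3 c * F = 0 \<longleftrightarrow> F = (0 :: 'k::field_char_0 poly3)"
proof
  assume "c \<noteq> 0" "const3 c * F = 0"
  hence "c * eval3 F x = 0" for x by (metis eval3_0 eval3_const3 eval3_mult)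
  thus "F = 0" using \<open>c \<noteq> 0\<close> by (intro eval3_eq_0_imp) auto
qed simp

lemma subst3_eq_0_iff:
  fixes F :: "'k::field_char_0 poly3"
  assumes "invertible A"
  shows "subst3 F A = 0 \<longleftrightarrow> F = 0"
proof
  assume 0: "subst3 F A = 0"
  obtain B where "A ** B = mat 1" using assms unfolding invertible_def by blast
  hence "F = subst3 (subst3 F A) B" by (simp add: subst3_mult_mat)
  thus "F = 0" using 0 by simp
qed simp

text \<open>The chain rule applied twice; neither the substitution nor the scalar factor affects
  vanishing.\<close>

lemma preserves_dd2:
  fixes F :: "'k::field_char_0 poly3"
  assumes "preserves F A"
  shows "dd (A *v u) (dd (A *v v) F) = 0 \<longleftrightarrow> dd u (dd v F) = 0"
proof -
  obtain c where A: "invertible A" "c \<noteq> 0" "subst3 F A = const3 c * F" using assms by (auto simp: preserves_def)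
  have "dd u (dd v (subst3 F A)) = subst3 (dd (A *v u) (dd (A *v v) F)) A" by (simp only: dd_subst3)
  thus ?thesis unfolding A(3) dd_const3_mult
    by (metis subst3_eq_0_iff[OF A(1)] const3_mult_eq_0[OF A(2)])
qed

lemma preserves_dd3:
  fixes F :: "'k::field_char_0 poly3"
  assumes "preserves F A"
  shows "dd (A *v u) (dd (A *v v) (dd (A *v w) F)) = 0 \<longleftrightarrow> dd u (dd v (dd w F)) = 0"
proof -
  obtain c where A: "invertible A" "c \<noteq> 0" "subst3 F A = const3 c * F" using assms by (auto simp: preserves_def)
  have "dd u (dd v (dd w (subst3 F A))) = subst3 (dd (A *v u) (dd (A *v v) (dd (A *v w) F))) A" by (simp only: dd_subst3)
  thus ?thesis unfolding A(3) dd_const3_mult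
    by (metis subst3_eq_0_iff[OF A(1)] const3_mult_eq_0[OF A(2)])
qed

lemma mult_axis_nth: "(A *v axis i 1) $ j = (A $ j $ i :: 'k::field)"
  by (simp add: matrix_vector_mult_def axis_def if_distrib[of "\<lambda>u. _ * u"] cong: if_cong)

lemma invertible_det3:
  "invertible A \<longleftrightarrow> A$1$1 * A$2$2 * A$3$3 + A$1$2 * A$2$3 * A$3$1 + A$1$3 * A$2$1 * A$3$2
     - A$1$1 * A$2$3 * A$3$2 - A$1$2 * A$2$1 * A$3$3 - A$1$3 * A$2$2 * A$3$1 \<noteq> 0" for A :: "'k::field^3^3"
  by (simp add: invertible_det_nz det_3)

section \<open>Automorphisms of X^d + Y^d + X Z^(d-1)\<close>

lemma dd2_nf1:
  "dd u (dd v (nf1 d)) = const3 (of_nat d * of_nat (d - 1) * (u$1 * v$1)) * varX ^ (d - 2) +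
    const3 (of_nat d * of_nat (d - 1) * (u$2 * v$2)) * varY ^ (d - 2) +
    const3 (of_nat (d - 1) * (u$1 * v$3 + u$3 * v$1)) * varZ ^ (d - 2) +
    const3 (of_nat (d - 1) * of_nat (d - 2) * (u$3 * (v$3 :: 'k::field_char_0))) * (varX * varZ ^ (d - 3))"
  by (rule eval3_inject) (simp add: nf1_def algebra_simps numeral_2_eq_2 numeral_3_eq_3)

lemma dd3_nf1:
  assumes "u $ 2 = 0" "v $ 2 = 0"
  shows "dd u (dd u (dd v (nf1 d))) = const3 (of_nat d * of_nat (d - 1) * of_nat (d - 2) * (u$1 * u$1 * v$1)) * varX ^ (d - 3) +
    const3 (of_nat (d - 1) * of_nat (d - 2) * (2 * u$1 * u$3 * v$3 + u$3 * u$3 * v$1)) * varZ ^ (d - 3) +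
    const3 (of_nat (d - 1) * of_nat (d - 2) * of_nat (d - 3) * (u$3 * u$3 * (v$3 :: 'k::field_char_0))) * (varX * varZ ^ (d - 4))"
  unfolding dd2_nf1
  by (rule eval3_inject) (simp add: assms algebra_simps numeral_2_eq_2 numeral_3_eq_3 eval_nat_numeral)

text \<open>For d at least 4 the monomials of the second derivative are distinct, and four points
  suffice to separate their coefficients.\<close>

lemma dd2_nf1_eq_0_iff:
  assumes d: "d \<ge> 4"
  shows "dd u (dd v (nf1 d)) = 0 \<longleftrightarrow> u$1 * v$1 = 0 \<and> u$2 * v$2 = 0 \<and> u$3 * v$3 = (0::'k::field_char_0) \<and> u$1 * v$3 + u$3 * v$1 = 0"
proof
  assume "dd u (dd v (nf1 d)) = 0"
  hence *: "eval3 (dd u (dd v (nf1 d))) x = 0" for x by simp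
  show "u$1 * v$1 = 0 \<and> u$2 * v$2 = 0 \<and> u$3 * v$3 = (0::'k::field_char_0) \<and> u$1 * v$3 + u$3 * v$1 = 0"
    using *[of "vector [1, 0, 0]"] *[of "vector [0, 1, 0]"] *[of "vector [0, 0, 1]"] *[of "vector [1, 0, 1]"] d
    unfolding dd2_nf1 by (auto simp: power_0_left simp del: of_nat_diff)
qed (auto simp: dd2_nf1)

text \<open>Here d = 4 has to be excluded: X^(d-3) and X Z^(d-4) would be the same monomial.\<close>

lemma dd3_nf1_eq_0:
  assumes d: "d \<ge> 5" and uv: "u $ 2 = 0" "v $ 2 = 0"
    and 0: "dd u (dd u (dd v (nf1 d))) = 0"
  shows "u$1 * u$1 * v$1 = 0 \<and> 2 * u$1 * u$3 * v$3 + u$3 * u$3 * v$1 = 0 \<and> u$3 * u$3 * v$3 = (0::'k::field_char_0)"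
proof -
  have *: "eval3 (dd u (dd u (dd v (nf1 d)))) x = 0" for x using 0 by simp
  show ?thesis
    using *[of "vector [1, 0, 0]"] *[of "vector [0, 0, 1]"] *[of "vector [1, 0, 1]"] d
    unfolding dd3_nf1[OF uv] by (auto simp: power_0_left simp del: of_nat_diff)
qed

text \<open>Second derivatives separate Y from the other variables, since D_Y D_X F = D_Y D_Z F = 0.
  They do not distinguish X from Z; a third derivative does.\<close>

lemma preserves_nf1_diagonal:
  fixes A :: "'k::field_char_0^3^3"
  assumes d: "d \<ge> 5" and A: "preserves (nf1 d) A"
  shows "A = diag3 (A$1$1) (A$2$2) (A$3$3)"
proof -
  have d4: "d \<ge> 4" using d by simp
  have det: "A$1$1 * A$2$2 * A$3$3 + A$1$2 * A$2$3 * A$3$1 + A$1$3 * A$2$1 * A$3$2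
     - A$1$1 * A$2$3 * A$3$2 - A$1$2 * A$2$1 * A$3$3 - A$1$3 * A$2$2 * A$3$1 \<noteq> 0"
    using A preserves_invertible invertible_det3 by blast
  have p: "A$1$2 * A$1$j = 0 \<and> A$2$2 * A$2$j = 0 \<and> A$3$2 * A$3$j = 0 \<and> A$1$2 * A$3$j + A$3$2 * A$1$j = 0"
    if "j \<noteq> 2" for j
  proof -
    have "dd (axis 2 1) (dd (axis j 1) (nf1 d)) = (0 :: 'k poly3)"
      using that by (simp add: dd2_nf1_eq_0_iff[OF d4]) (simp add: axis_def)
    hence "dd (A *v axis 2 1) (dd (A *v axis j 1) (nf1 d)) = 0" using preserves_dd2[OF A] by blast
    thus ?thesis by (simp add: dd2_nf1_eq_0_iff[OF d4] mult_axis_nth)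
  qed
  note p1 = p[of 1, simplified] and p3 = p[of 3, simplified]
  have "A$1$2 = 0"
  proof (rule ccontr)
    assume "A$1$2 \<noteq> 0"
    hence "A$1$1 = 0" "A$3$1 = 0" "A$1$3 = 0" "A$3$3 = 0" using p1 p3 by auto
    thus False using det by simp
  qed
  moreover have "A$3$2 = 0"
  proof (rule ccontr)
    assume "A$3$2 \<noteq> 0"
    hence "A$3$1 = 0" "A$1$1 = 0" "A$3$3 = 0" "A$1$3 = 0" using p1 p3 calculation by auto
    thus False using det by simp
  qed
  ultimately have 2: "A$1$2 = 0" "A$3$2 = 0" by auto
  hence "A$2$2 \<noteq> 0" using det by auto
  hence 22: "A$2$1 = 0" "A$2$3 = 0" using p1 p3 by auto
  have det': "A$1$1 * A$3$3 - A$1$3 * A$3$1 \<noteq> 0" using det 2 22 by (auto simp: algebra_simps)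
  \<comment> \<open>D_X D_X D_Z kills X Z^(d-1) as well as X^d, while D_Z D_Z D_X does not, which
    breaks the symmetry between X and Z.\<close>
  have "dd (axis 1 1) (dd (axis 1 1) (dd (axis 3 1) (nf1 d))) = (0 :: 'k poly3)"
    by (subst dd3_nf1) (simp_all add: axis_def)
  hence "dd (A *v axis 1 1) (dd (A *v axis 1 1) (dd (A *v axis 3 1) (nf1 d))) = 0" using preserves_dd3[OF A] by blast
  from dd3_nf1_eq_0[OF d _ _ this]
  have q: "A$1$1 * A$1$1 * A$1$3 = 0" "2 * A$1$1 * A$3$1 * A$3$3 + A$3$1 * A$3$1 * A$1$3 = 0" "A$3$1 * A$3$1 * A$3$3 = 0"
    using 22 by (auto simp: mult_axis_nth)
  have "A$3$1 = 0"
  proof (rule ccontr)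
    assume "A$3$1 \<noteq> 0"
    thus False using q det' by auto
  qed
  moreover from this have "A$1$3 = 0" using q det' by auto
  ultimately show ?thesis using 2 22 by (simp add: vec_eq_iff forall_3 diag3_def)
qed

lemma pgl_diag3_normalise: "pgl (diag3 a b c) = pgl (diag3 1 (b / a) (c / a))" if "a \<noteq> 0" for a :: "'k::field"
  unfolding pgl_eq_iff using that by (intro exI[of _ a]) (simp add: mat_eq_diag3 diag3_mult)

lemma Aut_nf1:
  assumes d: "d \<ge> 5"
  shows "carrier (Aut (nf1 d :: 'k::field_char_0 poly3)) = {pgl (diag3 1 y z) |y z. y ^ d = 1 \<and> z ^ (d - 1) = 1}"
proof (intro equalityI subsetI)
  fix g assume "g \<in> carrier (Aut (nf1 d :: 'k poly3))"
  then obtain A :: "'k^3^3" where A: "g = pgl A" "preserves (nf1 d) A" by (auto simp: carrier_Aut)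
  obtain a b c where abc: "A = diag3 a b c" using preserves_nf1_diagonal[OF d A(2)] by blast
  hence nz: "a \<noteq> 0" "b \<noteq> 0" "c \<noteq> 0" using preserves_invertible[OF A(2)] by (simp_all add: invertible_diag3)
  obtain l where l: "\<forall>x. eval3 (nf1 d) (A *v x) = l * eval3 (nf1 d) x" using A(2) unfolding preserves_iff by blast
  have "a ^ d = l" "b ^ d = l" "a ^ d + a * c ^ (d - 1) = 2 * l"
    using l[rule_format, of "vector [1, 0, 0]"] l[rule_format, of "vector [0, 1, 0]"] l[rule_format, of "vector [1, 0, 1]"] d
    by (simp_all add: abc diag3_mult_vec nf1_def power_0_left algebra_simps)
  hence e: "b ^ d = a ^ d" "a * c ^ (d - 1) = a ^ d" by auto
  have "(b / a) ^ d = 1" using e nz by (simp add: power_divide)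
  moreover have "a * c ^ (d - 1) = a * a ^ (d - 1)" using e d by (cases d) auto
  hence "(c / a) ^ (d - 1) = 1" using nz by (simp add: power_divide)
  ultimately show "g \<in> {pgl (diag3 1 y z) |y z. y ^ d = 1 \<and> z ^ (d - 1) = 1}"
    using A(1) abc pgl_diag3_normalise[OF nz(1)] by blast
next
  fix g assume "g \<in> {pgl (diag3 1 y z) |y z :: 'k. y ^ d = 1 \<and> z ^ (d - 1) = 1}"
  then obtain y z :: 'k where yz: "g = pgl (diag3 1 y z)" "y ^ d = 1" "z ^ (d - 1) = 1" by blast
  hence nz: "y \<noteq> 0" "z \<noteq> 0" using d by (auto simp: power_0_left)
  have "preserves (nf1 d) (diag3 1 y z)"
    unfolding preserves_iff using nz yz(2,3)
    by (intro conjI exI[of _ 1]) (simp_all add: invertible_diag3 diag3_mult_vec nf1_def power_mult_distrib)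
  thus "g \<in> carrier (Aut (nf1 d))" using yz(1) by (auto simp: carrier_Aut)
qed

lemma ord_pgl_diag3:
  fixes F :: "'k::field_char_0 poly3"
  assumes "pgl (diag3 1 y z) \<in> carrier (Aut F)" "y \<noteq> 0" "z \<noteq> 0" "\<And>k. y ^ k = 1 \<and> z ^ k = 1 \<longleftrightarrow> N dvd k"
  shows "group.ord (Aut F) (pgl (diag3 1 y z)) = N"
  using assms
  by (intro ord_eqI group_Aut)
    (auto simp: pgl_pow mpow_diag3 invertible_diag3 one_PGL3 mat_eq_diag3 pgl_diag3_eq_iff)

lemma Aut_nf1_generator:
  fixes \<xi> :: "'k::field_char_0"
  assumes d: "d \<ge> 5" and \<xi>: "primitive_root (d * (d - 1)) \<xi>"
  shows "pgl (diag3 1 (\<xi> ^ (d - 1)) (\<xi> ^ d)) \<in> carrier (Aut (nf1 d))"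
    "group.ord (Aut (nf1 d)) (pgl (diag3 1 (\<xi> ^ (d - 1)) (\<xi> ^ d))) = d * (d - 1)"
proof -
  have p: "\<xi> ^ k = 1 \<longleftrightarrow> d * (d - 1) dvd k" for k using \<xi> by (simp add: primitive_root_iff)
  have nz: "\<xi> \<noteq> 0" using \<xi> by (auto simp: primitive_root_def power_0_left split: if_splits)
  show in': "pgl (diag3 1 (\<xi> ^ (d - 1)) (\<xi> ^ d)) \<in> carrier (Aut (nf1 d))"
  proof -
    have "(\<xi> ^ (d - 1)) ^ d = 1" "(\<xi> ^ d) ^ (d - 1) = 1"
      unfolding power_mult[symmetric] p by (simp_all add: mult.commute)
    thus ?thesis unfolding Aut_nf1[OF d] by blast
  qed
  \<comment> \<open>The two entries have the coprime orders d and d - 1.\<close>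
  have "(\<xi> ^ (d - 1)) ^ k = 1 \<and> (\<xi> ^ d) ^ k = 1 \<longleftrightarrow> d * (d - 1) dvd k" for k
  proof -
    have "(\<xi> ^ (d - 1)) ^ k = 1 \<longleftrightarrow> d dvd k" unfolding power_mult[symmetric] p using d by (simp add: mult.commute[of d])
    moreover have "(\<xi> ^ d) ^ k = 1 \<longleftrightarrow> d - 1 dvd k" unfolding power_mult[symmetric] p using d by simp
    moreover have "coprime d (d - 1)" using d coprime_diff_one_right_nat[of d] by simp
    ultimately show ?thesis by (metis divides_mult dvd_mult_left dvd_mult_right)
  qed
  thus "group.ord (Aut (nf1 d)) (pgl (diag3 1 (\<xi> ^ (d - 1)) (\<xi> ^ d))) = d * (d - 1)"
    using nz by (intro ord_pgl_diag3[OF in']) auto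
qed

lemma card_eq_if_ord:
  assumes "group G" "x \<in> carrier G" "group.ord G x = N" "finite (carrier G)" "card (carrier G) \<le> N"
  shows "card (carrier G) = N"
  using group.ord_le_group_order[OF assms(1,4,2)] assms by (simp add: order_def)

text \<open>At most d choices of y and d - 1 of z bound the order from above; the generator bounds
  it from below.\<close>

lemma card_Aut_nf1:
  assumes d: "d \<ge> 5"
  shows "card (carrier (Aut (nf1 d :: 'k::{alg_closed_field,field_char_0} poly3))) = d * (d - 1)"
proof -
  let ?Y = "{y::'k. y ^ d = 1}" and ?Z = "{z::'k. z ^ (d - 1) = 1}"
  have f: "finite ?Y" "card ?Y \<le> d" "finite ?Z" "card ?Z \<le> d - 1"
    using roots_of_unity_finite[of d, where 'k = 'k] roots_of_unity_finite[of "d - 1", where 'k = 'k] d by auto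
  have eq: "carrier (Aut (nf1 d :: 'k poly3)) = (\<lambda>(y, z). pgl (diag3 1 y z)) ` (?Y \<times> ?Z)"
    unfolding Aut_nf1[OF d] by (auto simp: image_iff)
  have "card (carrier (Aut (nf1 d :: 'k poly3))) \<le> card (?Y \<times> ?Z)"
    unfolding eq using f by (intro card_image_le) auto
  also have "\<dots> \<le> d * (d - 1)" using f by (simp add: card_cartesian_product mult_le_mono)
  finally have le: "card (carrier (Aut (nf1 d :: 'k poly3))) \<le> d * (d - 1)" .
  obtain \<xi> :: 'k where \<xi>: "primitive_root (d * (d - 1)) \<xi>" using ex_primitive_root[of "d * (d - 1)"] d by auto
  show ?thesis
    by (rule card_eq_if_ord[OF group_Aut Aut_nf1_generator[OF d \<xi>] _ le]) (use f eq in auto)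
qed

section \<open>Automorphisms of X^d + Y^(d-1) Z + X Z^(d-1)\<close>

lemma dd2_nf2:
  "dd u (dd v (nf2 d)) = const3 (of_nat d * of_nat (d - 1) * (u$1 * v$1)) * varX ^ (d - 2) +
    const3 (of_nat (d - 1) * of_nat (d - 2) * (u$2 * v$2)) * (varY ^ (d - 3) * varZ) +
    const3 (of_nat (d - 1) * (u$2 * v$3 + u$3 * v$2)) * varY ^ (d - 2) +
    const3 (of_nat (d - 1) * (u$1 * v$3 + u$3 * v$1)) * varZ ^ (d - 2) +
    const3 (of_nat (d - 1) * of_nat (d - 2) * (u$3 * (v$3 :: 'k::field_char_0))) * (varX * varZ ^ (d - 3))"
  by (rule eval3_inject) (simp add: nf2_def algebra_simps numeral_2_eq_2 numeral_3_eq_3)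

lemma dd2_nf2_eq_0:
  assumes d: "d \<ge> 4" and 0: "dd u (dd v (nf2 d)) = 0"
  shows "u$1 * v$1 = 0 \<and> u$2 * v$2 = 0 \<and> u$3 * v$3 = (0::'k::field_char_0) \<and> u$2 * v$3 + u$3 * v$2 = 0"
proof -
  have *: "eval3 (dd u (dd v (nf2 d))) x = 0" for x using 0 by simp
  show ?thesis
    using *[of "vector [1, 0, 0]"] *[of "vector [0, 1, 0]"] *[of "vector [0, 0, 1]"] *[of "vector [1, 0, 1]"]
      *[of "vector [0, 1, 1]"] d
    unfolding dd2_nf2 by (auto simp: power_0_left simp del: of_nat_diff)
qed

text \<open>For this normal form the vanishing of D_X D_Y F only concerns the first two columns of a
  matrix; zeros of the form and its derivatives at single points supply the rest.\<close>

lemma preserves_eval_dd2: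
  fixes F :: "'k::field_char_0 poly3"
  assumes "preserves F A"
  shows "eval3 (dd (A *v u) (dd (A *v v) F)) (A *v x) = 0 \<longleftrightarrow> eval3 (dd u (dd v F)) x = 0"
    and "eval3 (dd (A *v v) F) (A *v x) = 0 \<longleftrightarrow> eval3 (dd v F) x = 0"
    and "eval3 F (A *v x) = 0 \<longleftrightarrow> eval3 F x = 0"
proof -
  obtain c where A: "c \<noteq> 0" "subst3 F A = const3 c * F" using assms by (auto simp: preserves_def)
  have "eval3 (dd u (dd v (subst3 F A))) x = eval3 (dd (A *v u) (dd (A *v v) F)) (A *v x)"
    by (simp only: dd_subst3 eval3_subst3)
  thus "eval3 (dd (A *v u) (dd (A *v v) F)) (A *v x) = 0 \<longleftrightarrow> eval3 (dd u (dd v F)) x = 0"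
    unfolding A(2) dd_const3_mult eval3_mult eval3_const3 using A(1) by (metis mult_eq_0_iff)
  have "eval3 (dd v (subst3 F A)) x = eval3 (dd (A *v v) F) (A *v x)"
    by (simp only: dd_subst3 eval3_subst3)
  thus "eval3 (dd (A *v v) F) (A *v x) = 0 \<longleftrightarrow> eval3 (dd v F) x = 0"
    unfolding A(2) dd_const3_mult eval3_mult eval3_const3 using A(1) by (metis mult_eq_0_iff)
  have "eval3 F (A *v x) = eval3 (subst3 F A) x" by simp
  thus "eval3 F (A *v x) = 0 \<longleftrightarrow> eval3 F x = 0" using A(1) unfolding A(2) by simp
qed

text \<open>D_X D_Y F = 0 restricts the first two columns. The remaining entries are removed by
  incidences: (1,0,0) is off the curve, the other coordinate points are on it, and certain
  derivatives vanish at them.\<close>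

lemma preserves_nf2_diagonal:
  fixes A :: "'k::field_char_0^3^3"
  assumes d: "d \<ge> 4" and A: "preserves (nf2 d) A"
  shows "A = diag3 (A$1$1) (A$2$2) (A$3$3)"
proof -
  have det: "A$1$1 * A$2$2 * A$3$3 + A$1$2 * A$2$3 * A$3$1 + A$1$3 * A$2$1 * A$3$2
     - A$1$1 * A$2$3 * A$3$2 - A$1$2 * A$2$1 * A$3$3 - A$1$3 * A$2$2 * A$3$1 \<noteq> 0"
    using A preserves_invertible invertible_det3 by blast
  have "dd (axis 1 1) (dd (axis 2 1) (nf2 d)) = (0 :: 'k poly3)"
    by (simp add: dd2_nf2) (simp add: axis_def)
  hence "dd (A *v axis 1 1) (dd (A *v axis 2 1) (nf2 d)) = 0" using preserves_dd2[OF A] by blast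
  from dd2_nf2_eq_0[OF d this]
  have p: "A$1$1 * A$1$2 = 0" "A$2$1 * A$2$2 = 0" "A$3$1 * A$3$2 = 0" "A$2$1 * A$3$2 + A$3$1 * A$2$2 = 0"
    by (auto simp: mult_axis_nth)
  have 3: "A$3$1 = 0"
  proof (rule ccontr)
    assume n: "A$3$1 \<noteq> 0"
    hence z: "A$3$2 = 0" "A$2$2 = 0" using p by auto
    show False
    proof (cases "A$1$2 = 0")
      case False
      have "eval3 (nf2 d) (A *v axis 2 1) = (0 :: 'k)"
        using preserves_eval_dd2(3)[OF A, of "axis 2 1"] d by (simp add: nf2_def axis_def power_0_left)
      hence "A$1$2 ^ d = 0" using z d by (simp add: nf2_def mult_axis_nth power_0_left)
      thus False using False by simp
    qed (use det z in simp)
  qed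
  \<comment> \<open>(1,0,0) is not on the curve, so neither is its image, the first column.\<close>
  have "eval3 (nf2 d) (A *v axis 1 1) \<noteq> (0 :: 'k)"
    using preserves_eval_dd2(3)[OF A, of "axis 1 1"] d by (simp add: nf2_def axis_def power_0_left)
  hence 11: "A$1$1 \<noteq> 0" using 3 d by (auto simp: nf2_def mult_axis_nth power_0_left)
  hence 12: "A$1$2 = 0" using p by auto
  have 32: "A$3$2 = 0"
  proof (rule ccontr)
    assume n: "A$3$2 \<noteq> 0"
    hence z: "A$2$1 = 0" using p 3 by auto
    have "eval3 (dd (A *v axis 3 1) (nf2 d)) (A *v axis 1 1) = (0 :: 'k)"
      using preserves_eval_dd2(2)[OF A, of "axis 3 1" "axis 1 1"] d by (simp add: nf2_def axis_def power_0_left)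
    hence e13: "A$1$3 = 0" using 3 z d 11 by (simp add: nf2_def mult_axis_nth power_0_left)
    have "eval3 (nf2 d) (A *v axis 2 1) = (0 :: 'k)" "eval3 (nf2 d) (A *v axis 3 1) = (0 :: 'k)"
      using preserves_eval_dd2(3)[OF A, of "axis 2 1"] preserves_eval_dd2(3)[OF A, of "axis 3 1"] d by (simp_all add: nf2_def axis_def power_0_left)
    hence "A$2$2 = 0" "A$2$3 = 0 \<or> A$3$3 = 0" using 12 e13 n d by (auto simp: nf2_def mult_axis_nth power_0_left)
    hence e33: "A$3$3 = 0" "A$2$2 = 0" using det z 3 e13 12 by auto
    have "eval3 (dd (A *v axis 1 1) (nf2 d)) (A *v axis 2 1) = (0 :: 'k)"
      using preserves_eval_dd2(2)[OF A, of "axis 1 1" "axis 2 1"] d by (simp add: nf2_def axis_def power_0_left)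
    thus False using 12 z 3 11 n e33 d by (simp add: nf2_def mult_axis_nth power_0_left)
  qed
  hence 22: "A$2$2 \<noteq> 0" using det 12 by auto
  hence 21: "A$2$1 = 0" using p by auto
  have "eval3 (dd (A *v axis 3 1) (nf2 d)) (A *v axis 1 1) = (0 :: 'k)"
    using preserves_eval_dd2(2)[OF A, of "axis 3 1" "axis 1 1"] d by (simp add: nf2_def axis_def power_0_left)
  hence 13: "A$1$3 = 0" using 3 21 d 11 by (simp add: nf2_def mult_axis_nth power_0_left)
  \<comment> \<open>The last entry takes a second derivative: D_Z D_Z F vanishes at (0,1,0), and for
    the images its value is a nonzero multiple of \<open>A$2$3 * A$3$3\<close>.\<close>
  have "eval3 (dd (axis 3 1) (dd (axis 3 1) (nf2 d))) (axis 2 1) = (0 :: 'k)"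
    using d by (simp add: dd2_nf2) (simp add: axis_def power_0_left)
  hence "eval3 (dd (A *v axis 3 1) (dd (A *v axis 3 1) (nf2 d))) (A *v axis 2 1) = (0 :: 'k)"
    using preserves_eval_dd2(1)[OF A] by blast
  hence "A$2$3 * A$3$3 = 0" using 12 32 22 13 d by (simp add: dd2_nf2 mult_axis_nth power_0_left del: of_nat_diff)
  moreover have "A$3$3 \<noteq> 0" using det 12 32 21 3 13 by auto
  ultimately have "A$2$3 = 0" by simp
  thus ?thesis using 3 12 13 32 21 by (simp add: vec_eq_iff forall_3 diag3_def)
qed

lemma Aut_nf2:
  assumes d: "d \<ge> 4"
  shows "carrier (Aut (nf2 d :: 'k::field_char_0 poly3)) = {pgl (diag3 1 y z) |y z. y ^ (d - 1) * z = 1 \<and> z ^ (d - 1) = 1}"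
proof (intro equalityI subsetI)
  fix g assume "g \<in> carrier (Aut (nf2 d :: 'k poly3))"
  then obtain A :: "'k^3^3" where A: "g = pgl A" "preserves (nf2 d) A" by (auto simp: carrier_Aut)
  obtain a b c where abc: "A = diag3 a b c" using preserves_nf2_diagonal[OF d A(2)] by blast
  hence nz: "a \<noteq> 0" "b \<noteq> 0" "c \<noteq> 0" using preserves_invertible[OF A(2)] by (simp_all add: invertible_diag3)
  obtain l where l: "\<forall>x. eval3 (nf2 d) (A *v x) = l * eval3 (nf2 d) x" using A(2) unfolding preserves_iff by blast
  have "a ^ d = l" "b ^ (d - 1) * c = l" "a ^ d + a * c ^ (d - 1) = 2 * l"
    using l[rule_format, of "vector [1, 0, 0]"] l[rule_format, of "vector [0, 1, 1]"] l[rule_format, of "vector [1, 0, 1]"] d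
    by (simp_all add: abc diag3_mult_vec nf2_def power_0_left algebra_simps)
  hence e: "b ^ (d - 1) * c = a ^ d" "a * c ^ (d - 1) = a ^ d" by auto
  have ad: "a ^ d = a * a ^ (d - 1)" using d by (cases d) auto
  have "(b / a) ^ (d - 1) * (c / a) = 1" using e(1) nz unfolding ad by (simp add: power_divide mult.commute)
  moreover have "(c / a) ^ (d - 1) = 1" using nz e(2) unfolding ad by (simp add: power_divide)
  ultimately show "g \<in> {pgl (diag3 1 y z) |y z. y ^ (d - 1) * z = 1 \<and> z ^ (d - 1) = 1}"
    using A(1) abc pgl_diag3_normalise[OF nz(1)] by blast
next
  fix g assume "g \<in> {pgl (diag3 1 y z) |y z :: 'k. y ^ (d - 1) * z = 1 \<and> z ^ (d - 1) = 1}"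
  then obtain y z :: 'k where yz: "g = pgl (diag3 1 y z)" "y ^ (d - 1) * z = 1" "z ^ (d - 1) = 1" by blast
  hence nz: "y \<noteq> 0" "z \<noteq> 0" using d by (auto simp: power_0_left)
  have "y ^ (d - 1) * p * (z * q) = (y ^ (d - 1) * z) * (p * q)" for p q by (simp add: algebra_simps)
  hence "preserves (nf2 d) (diag3 1 y z)"
    unfolding preserves_iff using nz yz(2,3)
    by (intro conjI exI[of _ 1]) (simp_all add: invertible_diag3 diag3_mult_vec nf2_def power_mult_distrib)
  thus "g \<in> carrier (Aut (nf2 d))" using yz(1) by (auto simp: carrier_Aut)
qed

lemma Aut_nf2_generator:
  fixes \<xi> :: "'k::field_char_0"
  assumes d: "d \<ge> 4" and \<xi>: "primitive_root ((d - 1)\<^sup>2) \<xi>"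
  shows "pgl (diag3 1 \<xi> (\<xi> ^ ((d - 1) * (d - 2)))) \<in> carrier (Aut (nf2 d))"
    "group.ord (Aut (nf2 d)) (pgl (diag3 1 \<xi> (\<xi> ^ ((d - 1) * (d - 2))))) = (d - 1)\<^sup>2"
proof -
  have p: "\<xi> ^ k = 1 \<longleftrightarrow> (d - 1)\<^sup>2 dvd k" for k using \<xi> by (simp add: primitive_root_iff)
  have nz: "\<xi> \<noteq> 0" using \<xi> by (auto simp: primitive_root_def power_0_left split: if_splits)
  obtain e where e: "d = e + 4" using d by (metis add.commute le_Suc_ex)
  \<comment> \<open>This is the exponent of the root of unity picked up by Y^(d-1) Z.\<close>
  have "(d - 1) + (d - 1) * (d - 2) = (d - 1)\<^sup>2" by (simp add: e power2_eq_square algebra_simps)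
  hence "\<xi> ^ (d - 1) * \<xi> ^ ((d - 1) * (d - 2)) = 1" using p[of "(d - 1)\<^sup>2"] by (simp only: power_add[symmetric]) simp
  moreover have "(\<xi> ^ ((d - 1) * (d - 2))) ^ (d - 1) = 1"
    unfolding power_mult[symmetric] p by (simp add: power2_eq_square)
  ultimately show in': "pgl (diag3 1 \<xi> (\<xi> ^ ((d - 1) * (d - 2)))) \<in> carrier (Aut (nf2 d))"
    unfolding Aut_nf2[OF d] by blast
  have "\<xi> ^ k = 1 \<and> (\<xi> ^ ((d - 1) * (d - 2))) ^ k = 1 \<longleftrightarrow> (d - 1)\<^sup>2 dvd k" for k
    using p[of k] by (auto simp: power_swap[of \<xi> _ k])
  thus "group.ord (Aut (nf2 d)) (pgl (diag3 1 \<xi> (\<xi> ^ ((d - 1) * (d - 2))))) = (d - 1)\<^sup>2"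
    using nz by (intro ord_pgl_diag3[OF in']) auto
qed

text \<open>y determines z, and eliminating z shows that y is a root of unity of exponent (d-1)^2;
  the generator shows that the bound is attained.\<close>

lemma card_Aut_nf2:
  assumes d: "d \<ge> 4"
  shows "card (carrier (Aut (nf2 d :: 'k::{alg_closed_field,field_char_0} poly3))) = (d - 1)\<^sup>2"
proof -
  let ?Y = "{y::'k. y ^ (d - 1)\<^sup>2 = 1}"
  have N: "(d - 1)\<^sup>2 > 0" using d by simp
  note f = roots_of_unity_finite[OF N, where 'k = 'k]
  have sub: "carrier (Aut (nf2 d :: 'k poly3)) \<subseteq> (\<lambda>y. pgl (diag3 1 y (inverse (y ^ (d - 1))))) ` ?Y"
  proof
    fix g assume "g \<in> carrier (Aut (nf2 d :: 'k poly3))"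
    then obtain y z :: 'k where yz: "g = pgl (diag3 1 y z)" "y ^ (d - 1) * z = 1" "z ^ (d - 1) = 1"
      unfolding Aut_nf2[OF d] by blast
    have "(y ^ (d - 1) * z) ^ (d - 1) = 1" using yz by simp
    hence "y ^ (d - 1)\<^sup>2 = 1" using yz(3) by (simp add: power_mult_distrib power2_eq_square power_mult)
    moreover have "z = inverse (y ^ (d - 1))" using yz(2) by (metis inverse_unique)
    ultimately show "g \<in> (\<lambda>y. pgl (diag3 1 y (inverse (y ^ (d - 1))))) ` ?Y" using yz(1) by blast
  qed
  have "card (carrier (Aut (nf2 d :: 'k poly3))) \<le> card ?Y"
    using surj_card_le[OF f(1) sub] .
  hence le: "card (carrier (Aut (nf2 d :: 'k poly3))) \<le> (d - 1)\<^sup>2" using f(2) by linarith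
  obtain \<xi> :: 'k where \<xi>: "primitive_root ((d - 1)\<^sup>2) \<xi>" using ex_primitive_root[OF N] by auto
  show ?thesis
    by (rule card_eq_if_ord[OF group_Aut Aut_nf2_generator[OF d \<xi>] _ le]) (use f sub finite_subset in blast)
qed

subsection \<open>Groups given by generators and relations\<close>

lemma word_eq_equiv: "equiv UNIV {(u, v). word_eq R u v}"
  by (rule equivI) (auto simp: refl_on_def sym_def trans_def intro: word_eq.refl word_eq.sym word_eq.trans)

definition word_val :: "('a, 'b) monoid_scheme \<Rightarrow> ('x \<Rightarrow> 'a) \<Rightarrow> ('x \<times> bool) list \<Rightarrow> 'a"
  where "word_val G h w = foldr (\<lambda>(x, b) y. (if b then h x else inv\<^bsub>G\<^esub> (h x)) \<otimes>\<^bsub>G\<^esub> y) w \<one>\<^bsub>G\<^esub>"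

context group
begin

lemma word_val_Nil [simp]: "word_val G h [] = \<one>"
  by (simp add: word_val_def)

lemma word_val_Cons [simp]: "word_val G h ((x, b) # w) = (if b then h x else inv (h x)) \<otimes> word_val G h w"
  by (simp add: word_val_def)

lemma word_val_closed [simp]: "range h \<subseteq> carrier G \<Longrightarrow> word_val G h w \<in> carrier G"
  by (induction w) (auto simp: image_subset_iff)

lemma word_val_append: "range h \<subseteq> carrier G \<Longrightarrow> word_val G h (u @ v) = word_val G h u \<otimes> word_val G h v"
  by (induction u) (auto simp: image_subset_iff m_assoc)

lemma word_val_replicate: "range h \<subseteq> carrier G \<Longrightarrow> word_val G h (replicate n (x, True)) = h x [^] n"
proof (induction n)
  case (Suc n)
  hence "h x \<in> carrier G" by auto
  thus ?case using Suc by (simp add: nat_pow_Suc2[symmetric] del: nat_pow_Suc)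
qed simp

lemma word_val_replicate_inv: "range h \<subseteq> carrier G \<Longrightarrow> word_val G h (replicate n (x, False)) = inv (h x) [^] n"
proof (induction n)
  case (Suc n)
  hence "h x \<in> carrier G" by auto
  thus ?case using Suc by (simp add: nat_pow_Suc2[symmetric] del: nat_pow_Suc)
qed simp

lemma word_eq_word_val:
  assumes "word_eq R u v" "range h \<subseteq> carrier G" "\<And>u v. (u, v) \<in> R \<Longrightarrow> word_val G h u = word_val G h v"
  shows "word_val G h u = word_val G h v"
  using assms(1)
proof (induction rule: word_eq.induct)
  case (cancel x b)
  have "h x \<in> carrier G" using assms(2) by auto
  thus ?case by (cases b) auto
qed (use assms in \<open>auto simp: word_val_append\<close>)

end

lemma word_eq_append_left: "word_eq R u v \<Longrightarrow> word_eq R (w @ u) (w @ v)"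
  by (rule word_eq.append[OF word_eq.refl])

lemma word_eq_append_right: "word_eq R u v \<Longrightarrow> word_eq R (u @ w) (v @ w)"
  by (rule word_eq.append[OF _ word_eq.refl])

text \<open>Asks only for closure of \<open>A\<close>, so it applies to a presented group or a
  semidirect product before either is known to be a group.\<close>

lemma bij_hom_inverse:
  assumes "f \<in> hom A B" "bij_betw f (carrier A) (carrier B)"
    "\<And>x y. x \<in> carrier A \<Longrightarrow> y \<in> carrier A \<Longrightarrow> x \<otimes>\<^bsub>A\<^esub> y \<in> carrier A"
  shows "B \<cong> A"
proof -
  let ?g = "inv_into (carrier A) f"
  have g: "bij_betw ?g (carrier B) (carrier A)" using assms(2) by (rule bij_betw_inv_into)
  have "?g \<in> hom B A"
  proof (rule homI)
    fix x assume "x \<in> carrier B" thus "?g x \<in> carrier A" using g by (auto simp: bij_betw_def)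
  next
    fix x y assume xy: "x \<in> carrier B" "y \<in> carrier B"
    hence c: "?g x \<in> carrier A" "?g y \<in> carrier A" using g by (auto simp: bij_betw_def)
    have "f (?g x \<otimes>\<^bsub>A\<^esub> ?g y) = x \<otimes>\<^bsub>B\<^esub> y"
      using assms(1,2) c xy by (simp add: hom_def bij_betw_def f_inv_into_f)
    thus "?g (x \<otimes>\<^bsub>B\<^esub> y) = ?g x \<otimes>\<^bsub>A\<^esub> ?g y"
      using assms(2) assms(3)[OF c] by (metis bij_betw_def inv_into_f_f)
  qed
  thus ?thesis using g unfolding is_iso_def iso_def by blast
qed

text \<open>Evaluation of words is well defined by the relations. It is injective because every word
  is equivalent to one in \<open>V\<close>, where the values are distinct, so the order of the
  presented group need not be known beforehand.\<close>

lemma presented_group_iso: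
  fixes R :: "(('x \<times> bool) list \<times> ('x \<times> bool) list) set"
  assumes "group G" and h: "range h \<subseteq> carrier G"
    and R: "\<And>u v. (u, v) \<in> R \<Longrightarrow> word_val G h u = word_val G h v"
    and nf: "\<And>w. \<exists>v\<in>V. word_eq R w v" and surj: "carrier G \<subseteq> word_val G h ` V" and inj: "inj_on (word_val G h) V"
  shows "G \<cong> presented_group R"
proof -
  interpret group G by fact
  let ?r = "{(u, v). word_eq R u v}"
  let ?P = "presented_group R"
  define c where "c w = ?r `` {w}" for w
  have c_eq: "c u = c v \<longleftrightarrow> word_eq R u v" for u v
    unfolding c_def using eq_equiv_class_iff[OF word_eq_equiv, of u v R] by simp
  have carr: "carrier ?P = range c" by (auto simp: presented_group_def quotient_def c_def)
  have mult: "c u \<otimes>\<^bsub>?P\<^esub> c v = c (u @ v)" for u v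
  proof -
    have "?r `` {u' @ v' |u' v'. word_eq R u u' \<and> word_eq R v v'} = ?r `` {u @ v}"
      by (auto intro: word_eq.refl word_eq.trans word_eq.append)
    thus ?thesis by (simp add: presented_group_def c_def)
  qed
  have val: "word_eq R u v \<Longrightarrow> word_val G h u = word_val G h v" for u v
    using word_eq_word_val[OF _ h R] .
  define f where "f A = word_val G h (SOME w. c w = A)" for A
  have fc: "f (c w) = word_val G h w" for w
  proof -
    have "c (SOME u. c u = c w) = c w" by (rule someI[of "\<lambda>u. c u = c w"]) simp
    thus ?thesis unfolding f_def using c_eq val by blast
  qed
  have "f \<in> hom ?P G"
    by (rule homI) (auto simp: carr fc mult word_val_append[OF h] word_val_closed[OF h])
  moreover have "inj_on f (carrier ?P)"
  proof (rule inj_onI)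
    fix A B assume "A \<in> carrier ?P" "B \<in> carrier ?P" "f A = f B"
    then obtain u v where uv: "A = c u" "B = c v" "word_val G h u = word_val G h v" by (auto simp: carr fc)
    obtain u' v' where *: "u' \<in> V" "word_eq R u u'" "v' \<in> V" "word_eq R v v'" using nf by blast
    hence "word_val G h u' = word_val G h v'" using uv(3) val by metis
    hence "u' = v'" using inj * by (auto dest: inj_onD)
    hence "word_eq R u v" using * by (metis word_eq.sym word_eq.trans)
    thus "A = B" using uv c_eq by simp
  qed
  moreover have "f ` carrier ?P = carrier G"
  proof
    show "f ` carrier ?P \<subseteq> carrier G" by (auto simp: carr fc word_val_closed[OF h])
    show "carrier G \<subseteq> f ` carrier ?P"
    proof
      fix x assume "x \<in> carrier G"
      then obtain w where "x = word_val G h w" using surj by blast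
      hence "x = f (c w)" by (simp add: fc)
      thus "x \<in> f ` carrier ?P" by (simp add: carr)
    qed
  qed
  moreover have "x \<otimes>\<^bsub>?P\<^esub> y \<in> carrier ?P" if "x \<in> carrier ?P" "y \<in> carrier ?P" for x y
    using that by (auto simp: carr mult)
  ultimately show ?thesis by (intro bij_hom_inverse[of f]) (auto simp: bij_betw_def)
qed

section \<open>Metacyclic groups and their presentations\<close>

text \<open>Inverse letters are replaced by positive powers, every sigma is pushed to the right past
  the taus, and the two exponents are reduced by the orders.\<close>

lemma word_normal_form:
  assumes m: "m > 0" and N: "N > 0"
    and tm: "word_eq R (replicate m tau) []" and sN: "word_eq R (replicate N sig) []"
    and st: "word_eq R [sig, tau] (tau # replicate e sig_inv)"
  shows "\<exists>v\<in>{replicate j tau @ replicate i sig |i j. i < N \<and> j < m}. word_eq R w v"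
proof -
  note tr [trans] = word_eq.trans
  have mod: "word_eq R (replicate i x) (replicate (i mod k) x)" if "word_eq R (replicate k x) []" for i k and x :: "gen \<times> bool"
  proof -
    have "word_eq R (replicate (k * q) x) []" for q
    proof (induction q)
      case (Suc q)
      have "word_eq R (replicate k x @ replicate (k * q) x) ([] @ [])" using that Suc by (rule word_eq.append)
      thus ?case by (simp add: replicate_add[symmetric])
    qed (simp add: word_eq.refl)
    hence "word_eq R (replicate (k * (i div k)) x @ replicate (i mod k) x) ([] @ replicate (i mod k) x)"
      by (rule word_eq_append_right)
    thus ?thesis by (simp add: replicate_add[symmetric])
  qed
  have inv: "word_eq R [(x, False)] (replicate (k - 1) (x, True))" if "word_eq R (replicate k (x, True)) []" "k > 0" for k and x :: gen
  proof -
    have "replicate k (x, True) = (x, True) # replicate (k - 1) (x, True)" using that(2) by (cases k) auto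
    hence "word_eq R ([(x, False)] @ (x, True) # replicate (k - 1) (x, True)) ([(x, False)] @ [])"
      using word_eq_append_left[OF that(1)] by metis
    moreover have "word_eq R ([(x, False), (x, True)] @ replicate (k - 1) (x, True)) ([] @ replicate (k - 1) (x, True))"
      using word_eq.cancel[of R x False] by (intro word_eq_append_right) simp
    ultimately show ?thesis by (simp) (metis word_eq.sym word_eq.trans)
  qed
  have si: "word_eq R [sig_inv] (replicate (N - 1) sig)" using inv[OF sN N] .
  \<comment> \<open>sigma^(-1) is the (N-1)-th power of sigma, so sigma^(-e) becomes sigma^q and
    passing one tau multiplies a sigma exponent by q.\<close>
  define q where "q = (N - 1) * e"
  have siv: "word_eq R (replicate n sig_inv) (replicate ((N - 1) * n) sig)" for n
  proof (induction n)
    case (Suc n)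
    have "word_eq R ([sig_inv] @ replicate n sig_inv) (replicate (N - 1) sig @ replicate ((N - 1) * n) sig)"
      using si Suc by (rule word_eq.append)
    thus ?case by (simp add: replicate_add[symmetric])
  qed (simp add: word_eq.refl)
  have st': "word_eq R [sig, tau] (tau # replicate q sig)"
    using word_eq.trans[OF st word_eq_append_left[OF siv[of e], of "[tau]", simplified]] by (simp add: q_def)
  have spt: "word_eq R (replicate p sig @ [tau]) (tau # replicate (q * p) sig)" for p
  proof (induction p)
    case (Suc p)
    have "word_eq R ([sig] @ (replicate p sig @ [tau])) ([sig] @ (tau # replicate (q * p) sig))"
      using Suc by (rule word_eq_append_left)
    also have "word_eq R ([sig] @ (tau # replicate (q * p) sig)) ((tau # replicate q sig) @ replicate (q * p) sig)"
      using word_eq_append_right[OF st', of "replicate (q * p) sig"] by simp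
    finally show ?case by (simp add: replicate_add[symmetric])
  qed (simp add: word_eq.refl)
  have stj: "word_eq R (replicate p sig @ replicate j tau) (replicate j tau @ replicate (q ^ j * p) sig)" for p j
  proof (induction j arbitrary: p)
    case (Suc j)
    have "word_eq R ((replicate p sig @ [tau]) @ replicate j tau) ((tau # replicate (q * p) sig) @ replicate j tau)"
      using spt by (rule word_eq_append_right)
    also have "word_eq R ((tau # replicate (q * p) sig) @ replicate j tau) ([tau] @ (replicate j tau @ replicate (q ^ j * (q * p)) sig))"
      using word_eq_append_left[OF Suc[of "q * p"], of "[tau]"] by simp
    finally show ?case by (simp add: mult.assoc mult.left_commute)
  qed (simp add: word_eq.refl)
  have red: "word_eq R (replicate j tau @ replicate i sig) (replicate (j mod m) tau @ replicate (i mod N) sig)" for i j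
    by (intro word_eq.append mod tm sN)
  have "\<exists>i j. word_eq R w (replicate j tau @ replicate i sig)"
  proof (induction w)
    case Nil
    have "word_eq R [] (replicate 0 tau @ replicate 0 sig)" by (simp add: word_eq.refl)
    thus ?case by blast
  next
    case (Cons x w)
    then obtain i j where ij: "word_eq R w (replicate j tau @ replicate i sig)" by blast
    have t: "\<exists>i j. word_eq R (replicate k tau @ w) (replicate j tau @ replicate i sig)" for k
      using word_eq_append_left[OF ij, of "replicate k tau"] by (metis append.assoc replicate_add)
    have s: "\<exists>i j. word_eq R (replicate k sig @ w) (replicate j tau @ replicate i sig)" for k
    proof -
      have "word_eq R (replicate k sig @ w) ((replicate k sig @ replicate j tau) @ replicate i sig)"
        using word_eq_append_left[OF ij, of "replicate k sig"] by simp
      also have "word_eq R ((replicate k sig @ replicate j tau) @ replicate i sig) ((replicate j tau @ replicate (q ^ j * k) sig) @ replicate i sig)"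
        using stj by (rule word_eq_append_right)
      finally show ?thesis by (metis append.assoc replicate_add)
    qed
    have red1: "\<exists>i j. word_eq R (x # w) (replicate j tau @ replicate i sig)"
      if "word_eq R [x] u" "\<exists>i j. word_eq R (u @ w) (replicate j tau @ replicate i sig)" for u
      using word_eq_append_right[OF that(1), of w] that(2) by (metis append_Cons append_Nil word_eq.trans)
    obtain g b where x: "x = (g, b)" by (cases x)
    show ?case
    proof (cases g; cases b)
      assume "g = Sig" b thus ?thesis using s[of 1] x by simp
    next
      assume "g = Sig" "\<not> b" thus ?thesis using red1[OF _ s] si x by simp
    next
      assume "g = Tau" b thus ?thesis using t[of 1] x by simp
    next
      assume "g = Tau" "\<not> b" thus ?thesis using red1[OF _ t] inv[OF tm m] x by simp
    qed
  qed
  then obtain i j where "word_eq R w (replicate j tau @ replicate i sig)" by blast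
  hence "word_eq R w (replicate (j mod m) tau @ replicate (i mod N) sig)" using red word_eq.trans by blast
  moreover have "replicate (j mod m) tau @ replicate (i mod N) sig \<in> {replicate j tau @ replicate i sig |i j. i < N \<and> j < m}"
    using m N by (intro CollectI exI[of _ "i mod N"] exI[of _ "j mod m"]) simp
  ultimately show ?thesis by (rule bexI)
qed

definition gen_map :: "'a \<Rightarrow> 'a \<Rightarrow> gen \<Rightarrow> 'a"
  where "gen_map s t g = (case g of Sig \<Rightarrow> s | Tau \<Rightarrow> t)"

text \<open>The normal words t^j s^i exhaust the group by assumption. They have distinct values
  because no power of t strictly between the trivial ones is a power of s.\<close>

lemma metacyclic_presentation:
  fixes R :: "((gen \<times> bool) list \<times> (gen \<times> bool) list) set" and G :: "('a, 'b) monoid_scheme" (structure)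
  assumes "group G" and st: "s \<in> carrier G" "t \<in> carrier G" and m: "m > 0" and N: "N > 0"
    and R: "\<And>u v. (u, v) \<in> R \<Longrightarrow> word_val G (gen_map s t) u = word_val G (gen_map s t) v"
    and R': "word_eq R (replicate m tau) []" "word_eq R (replicate N sig) []" "word_eq R [sig, tau] (tau # replicate e sig_inv)"
    and ex: "\<And>g. g \<in> carrier G \<Longrightarrow> \<exists>i<N. \<exists>j<m. g = t [^]\<^bsub>G\<^esub> j \<otimes>\<^bsub>G\<^esub> s [^]\<^bsub>G\<^esub> i"
    and ord: "group.ord G s = N" and t_notin: "\<And>(i::nat) (j::nat). 0 < j \<Longrightarrow> j < m \<Longrightarrow> t [^]\<^bsub>G\<^esub> j \<noteq> s [^]\<^bsub>G\<^esub> i"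
  shows "G \<cong> presented_group R"
proof -
  interpret group G by fact
  have h: "range (gen_map s t) \<subseteq> carrier G" using st by (auto simp: gen_map_def split: gen.splits)
  let ?V = "{replicate j tau @ replicate i sig |i j. i < N \<and> j < m}"
  have val: "word_val G (gen_map s t) (replicate j tau @ replicate i sig) = t [^] j \<otimes> s [^] i" for i j
    by (simp add: word_val_append[OF h] word_val_replicate[OF h] gen_map_def)
  \<comment> \<open>Cancelling t^j and multiplying by s^(N-i') exhibits t^(j'-j) as a power of s,
    hence j = j'.\<close>
  have *: "j = j' \<and> i = i'" if "t [^] j \<otimes> s [^] i = t [^] j' \<otimes> s [^] i'" "i < N" "i' < N" "j \<le> j'" "j' < m" for i i' j j'
  proof -
    have "t [^] j \<otimes> s [^] i = t [^] j \<otimes> (t [^] (j' - j) \<otimes> s [^] i')"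
      using that st by (simp add: nat_pow_mult m_assoc[symmetric])
    hence eq: "s [^] i = t [^] (j' - j) \<otimes> s [^] i'" using st by simp
    have "s [^] i \<otimes> s [^] (N - i') = t [^] (j' - j) \<otimes> (s [^] i' \<otimes> s [^] (N - i'))"
      unfolding eq using st by (simp add: m_assoc)
    also have "s [^] i' \<otimes> s [^] (N - i') = \<one>" using that st ord by (simp add: nat_pow_mult pow_eq_id)
    finally have "t [^] (j' - j) = s [^] (i + (N - i'))" using st by (simp add: nat_pow_mult)
    moreover have "j' - j < m" using that(5) by simp
    ultimately have "\<not> 0 < j' - j" using t_notin[of "j' - j" "i + (N - i')"] by blast
    hence jj: "j = j'" using that(4) by simp
    hence "s [^] i = s [^] i'" using eq st by simp
    moreover have "i \<in> {0..ord s - 1}" "i' \<in> {0..ord s - 1}" using that ord by auto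
    ultimately have "i = i'" using ord_inj[OF st(1)] by (rule_tac inj_onD)
    thus ?thesis using jj by simp
  qed
  show ?thesis
  proof (rule presented_group_iso[OF assms(1) h R])
    show "\<exists>v\<in>?V. word_eq R w v" for w using word_normal_form[OF m N R'] .
    show "carrier G \<subseteq> word_val G (gen_map s t) ` ?V"
    proof
      fix g assume "g \<in> carrier G"
      then obtain i j where ij: "i < N" "j < m" "g = t [^] j \<otimes> s [^] i" using ex by blast
      hence "replicate j tau @ replicate i sig \<in> ?V" by blast
      moreover have "g = word_val G (gen_map s t) (replicate j tau @ replicate i sig)" unfolding val by (rule ij(3))
      ultimately show "g \<in> word_val G (gen_map s t) ` ?V" by (rule image_eqI[rotated])
    qed
    show "inj_on (word_val G (gen_map s t)) ?V"
    proof (rule inj_onI)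
      fix u v assume "u \<in> ?V" "v \<in> ?V" and eq: "word_val G (gen_map s t) u = word_val G (gen_map s t) v"
      then obtain i j i' j' where ij: "u = replicate j tau @ replicate i sig" "i < N" "j < m"
        "v = replicate j' tau @ replicate i' sig" "i' < N" "j' < m" by blast
      have "t [^] j \<otimes> s [^] i = t [^] j' \<otimes> s [^] i'" using eq unfolding ij(1,4) val .
      hence "j = j' \<and> i = i'"
      proof (cases "j \<le> j'")
        case False
        thus ?thesis using *[of j' i' j i] ij \<open>t [^] j \<otimes> s [^] i = t [^] j' \<otimes> s [^] i'\<close> by simp
      qed (use *[of j i j' i'] ij in simp)
      thus "u = v" using ij by simp
    qed
  qed
qed

section \<open>Automorphisms of X^d + Y^(d-1) Z + Y Z^(d-1)\<close>

lemma dd2_nf3: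
  "dd u (dd v (nf3 d)) = const3 (of_nat d * of_nat (d - 1) * (u$1 * v$1)) * varX ^ (d - 2) +
    const3 (of_nat (d - 1) * of_nat (d - 2) * (u$2 * v$2)) * (varY ^ (d - 3) * varZ) +
    const3 (of_nat (d - 1) * (u$2 * v$3 + u$3 * v$2)) * (varY ^ (d - 2) + varZ ^ (d - 2)) +
    const3 (of_nat (d - 1) * of_nat (d - 2) * (u$3 * (v$3 :: 'k::field_char_0))) * (varY * varZ ^ (d - 3))"
  by (rule eval3_inject) (simp add: nf3_def algebra_simps numeral_2_eq_2 numeral_3_eq_3)

lemma dd3_nf3:
  assumes "u $ 1 = 0"
  shows "dd u (dd v (dd v (nf3 d))) =
    const3 (of_nat (d - 1) * of_nat (d - 2) * of_nat (d - 3) * (u$2 * v$2 * v$2)) * (varY ^ (d - 4) * varZ) +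
    const3 (of_nat (d - 1) * of_nat (d - 2) * (u$3 * v$2 * v$2 + 2 * u$2 * v$2 * v$3)) * varY ^ (d - 3) +
    const3 (of_nat (d - 1) * of_nat (d - 2) * (u$2 * v$3 * v$3 + 2 * u$3 * v$2 * v$3)) * varZ ^ (d - 3) +
    const3 (of_nat (d - 1) * of_nat (d - 2) * of_nat (d - 3) * (u$3 * v$3 * (v$3 :: 'k::field_char_0))) * (varY * varZ ^ (d - 4))"
  unfolding dd2_nf3
  by (rule eval3_inject) (simp add: assms algebra_simps numeral_2_eq_2 numeral_3_eq_3 eval_nat_numeral)

lemma dd4_nf3:
  assumes "u $ 1 = 0"
  shows "dd u (dd u (dd v (dd v (nf3 d)))) =
    const3 (of_nat (d - 1) * of_nat (d - 2) * of_nat (d - 3) * of_nat (d - 4) * (u$2 * u$2 * v$2 * v$2)) * (varY ^ (d - 5) * varZ) +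
    const3 (of_nat (d - 1) * of_nat (d - 2) * of_nat (d - 3) * (2 * u$2 * u$3 * v$2 * v$2 + 2 * u$2 * u$2 * v$2 * v$3)) * varY ^ (d - 4) +
    const3 (of_nat (d - 1) * of_nat (d - 2) * of_nat (d - 3) * (2 * u$2 * u$3 * v$3 * v$3 + 2 * u$3 * u$3 * v$2 * v$3)) * varZ ^ (d - 4) +
    const3 (of_nat (d - 1) * of_nat (d - 2) * of_nat (d - 3) * of_nat (d - 4) * (u$3 * u$3 * v$3 * (v$3 :: 'k::field_char_0))) * (varY * varZ ^ (d - 5))"
  unfolding dd3_nf3[OF assms]
  by (rule eval3_inject) (simp add: algebra_simps numeral_2_eq_2 numeral_3_eq_3 eval_nat_numeral)

lemma two_power_neq_2: "m \<ge> 2 \<Longrightarrow> 2 ^ m \<noteq> (2 :: 'k::field_char_0)"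
proof
  assume m: "m \<ge> 2" and "2 ^ m = (2 :: 'k)"
  hence "of_nat (2 ^ m) = (of_nat 2 :: 'k)" by simp
  hence "(2::nat) ^ m = 2 ^ 1" by (simp only: of_nat_eq_iff) simp
  hence "m = 1" by (subst (asm) power_inject_exp) auto
  thus False using m by simp
qed

text \<open>Used with values at (0,1,1) and (0,2,1), where t is a power of 2: this separates the
  coefficients of Y^m Z and Y Z^m.\<close>

lemma eliminate_second:
  fixes X Y t :: "'k::field"
  assumes "X + Y = 0" "t * X + 2 * Y = 0" "t \<noteq> 2"
  shows "X = 0" "Y = 0"
proof -
  have "(t - 2) * X = (t * X + 2 * Y) - 2 * (X + Y)" by (simp add: algebra_simps)
  thus "X = 0" using assms by simp
  thus "Y = 0" using assms(1) by simp
qed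

text \<open>At d = 4 the monomials Y^(d-3) Z and Y Z^(d-3) would coincide and only the sum of their
  coefficients would have to vanish.\<close>

lemma dd2_nf3_eq_0_iff:
  assumes d: "d \<ge> 5"
  shows "dd u (dd v (nf3 d)) = 0 \<longleftrightarrow> u$1 * v$1 = 0 \<and> u$2 * v$2 = 0 \<and> u$3 * v$3 = (0::'k::field_char_0) \<and> u$2 * v$3 + u$3 * v$2 = 0"
proof
  assume 0: "dd u (dd v (nf3 d)) = 0"
  hence *: "eval3 (dd u (dd v (nf3 d))) x = 0" for x by simp
  have c: "of_nat d \<noteq> (0 :: 'k)" "of_nat (d - 1) \<noteq> (0 :: 'k)" "of_nat (d - 2) \<noteq> (0 :: 'k)"
    using d by (simp_all del: of_nat_diff)
  have d': "d - 3 \<noteq> 0" "d - 2 \<noteq> 0" using d by auto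
  have 1: "u$1 * v$1 = 0" using *[of "vector [1, 0, 0]"] c d' unfolding dd2_nf3 by (simp add: power_0_left del: of_nat_diff)
  have 2: "u$2 * v$3 + u$3 * v$2 = 0" using *[of "vector [0, 1, 0]"] c d' unfolding dd2_nf3 by (simp add: power_0_left del: of_nat_diff)
  have "of_nat (d - 1) * of_nat (d - 2) * (u$2 * v$2 + u$3 * v$3) = 0"
    using *[of "vector [0, 1, 1]"] d' unfolding dd2_nf3 2 by (simp add: power_0_left algebra_simps del: of_nat_diff)
  hence 3: "u$2 * v$2 + u$3 * v$3 = 0" using c by (simp del: of_nat_diff)
  have "of_nat (d - 1) * of_nat (d - 2) * (2 ^ (d - 3) * (u$2 * v$2) + 2 * (u$3 * v$3)) = 0"
    using *[of "vector [0, 2, 1]"] d' unfolding dd2_nf3 2 by (simp add: power_0_left algebra_simps del: of_nat_diff)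
  hence "2 ^ (d - 3) * (u$2 * v$2) + 2 * (u$3 * v$3) = 0" using c by (simp del: of_nat_diff)
  from eliminate_second[OF 3 this] two_power_neq_2[where 'k = 'k and m = "d - 3"] d
  have "u$2 * v$2 = 0" "u$3 * v$3 = 0" by auto
  thus "u$1 * v$1 = 0 \<and> u$2 * v$2 = 0 \<and> u$3 * v$3 = (0::'k::field_char_0) \<and> u$2 * v$3 + u$3 * v$2 = 0"
    using 1 2 by blast
qed (auto simp: dd2_nf3)

text \<open>The direction X pairs to zero with Y and with Z, and invertibility then splits the
  matrix. What remains is its action on the binary form Y Z (Y^(d-2) + Z^(d-2)).\<close>

lemma preserves_nf3_block:
  fixes A :: "'k::field_char_0^3^3"
  assumes d: "d \<ge> 5" and A: "preserves (nf3 d) A"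
  shows "A$2$1 = 0" "A$3$1 = 0" "A$1$1 \<noteq> 0" "A$1$2 = 0" "A$1$3 = 0" "A$2$2 * A$3$3 - A$2$3 * A$3$2 \<noteq> 0"
proof -
  have det: "A$1$1 * A$2$2 * A$3$3 + A$1$2 * A$2$3 * A$3$1 + A$1$3 * A$2$1 * A$3$2
     - A$1$1 * A$2$3 * A$3$2 - A$1$2 * A$2$1 * A$3$3 - A$1$3 * A$2$2 * A$3$1 \<noteq> 0"
    using A preserves_invertible invertible_det3 by blast
  have p: "A$1$1 * A$1$j = 0 \<and> A$2$1 * A$2$j = 0 \<and> A$3$1 * A$3$j = 0 \<and> A$2$1 * A$3$j + A$3$1 * A$2$j = 0"
    if "j \<noteq> 1" for j
  proof -
    have "dd (axis 1 1) (dd (axis j 1) (nf3 d)) = (0 :: 'k poly3)"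
      using that by (simp add: dd2_nf3_eq_0_iff[OF d]) (simp add: axis_def)
    hence "dd (A *v axis 1 1) (dd (A *v axis j 1) (nf3 d)) = 0" using preserves_dd2[OF A] by blast
    thus ?thesis by (simp add: dd2_nf3_eq_0_iff[OF d] mult_axis_nth)
  qed
  note p2 = p[of 2, simplified] and p3 = p[of 3, simplified]
  show 2: "A$2$1 = 0"
  proof (rule ccontr)
    assume "A$2$1 \<noteq> 0"
    hence "A$2$2 = 0" "A$2$3 = 0" "A$3$2 = 0" "A$3$3 = 0" using p2 p3 by auto
    thus False using det by simp
  qed
  show 3: "A$3$1 = 0"
  proof (rule ccontr)
    assume "A$3$1 \<noteq> 0"
    hence "A$3$2 = 0" "A$3$3 = 0" "A$2$2 = 0" "A$2$3 = 0" using p2 p3 2 by auto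
    thus False using det by simp
  qed
  show 11: "A$1$1 \<noteq> 0" using det 2 3 by auto
  thus "A$1$2 = 0" "A$1$3 = 0" using p2 p3 by auto
  thus "A$2$2 * A$3$3 - A$2$3 * A$3$2 \<noteq> 0" using det 2 3 by (auto simp: algebra_simps)
qed

definition swap3 :: "'k::field^3^3"
  where "swap3 = vector [vector [1, 0, 0], vector [0, 0, 1], vector [0, 1, 0]]"

lemma swap3_mult_vec: "swap3 *v x = vector [x $ 1, x $ 3, x $ 2]"
  by (simp add: vec_eq_iff forall_3 matrix_vector_mult_def swap3_def sum3)

lemma invertible_swap3: "invertible (swap3 :: 'k::field^3^3)"
  by (simp add: invertible_det3 swap3_def)

lemma preserves_swap3: "preserves (nf3 d :: 'k::field_char_0 poly3) swap3"
  unfolding preserves_iff by (intro conjI exI[of _ 1] invertible_swap3) (simp_all add: swap3_mult_vec nf3_def algebra_simps)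

lemma swap3_square: "swap3 ** swap3 = (mat 1 :: 'k::field^3^3)"
  by (simp add: vec_eq_iff forall_3 matrix_matrix_mult_def swap3_def sum3 mat_def)

text \<open>D_Y D_Y D_Z D_Z F = 0, so the images of the directions Y and Z satisfy the same
  relation. From d = 7 on the monomials Y^(d-5) Z and Y Z^(d-5) are distinct and each gives its own
  equation.\<close>

lemma preserves_nf3_products:
  fixes A :: "'k::field_char_0^3^3"
  assumes d: "d \<ge> 7" and A: "preserves (nf3 d) A"
  shows "A$2$2 * A$2$3 = 0" "A$3$2 * A$3$3 = 0"
proof -
  have d5: "d \<ge> 5" using d by simp
  note blk = preserves_nf3_block[OF d5 A]
  obtain c where c: "c \<noteq> 0" "subst3 (nf3 d) A = const3 c * nf3 d" using A by (auto simp: preserves_def)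
  let ?u = "A *v axis 2 1" and ?v = "A *v axis 3 1"
  have uv: "?u $ 1 = 0" "?u $ 2 = A$2$2" "?u $ 3 = A$3$2" "?v $ 2 = A$2$3" "?v $ 3 = A$3$3" using blk by (simp_all add: mult_axis_nth)
  have z: "dd (axis 2 1) (dd (axis 2 1) (dd (axis 3 1) (dd (axis 3 1) (nf3 d)))) = (0 :: 'k poly3)"
    by (subst dd4_nf3) (simp_all add: axis_def)
  have "dd (axis 2 1) (dd (axis 2 1) (dd (axis 3 1) (dd (axis 3 1) (subst3 (nf3 d) A)))) = 0"
    unfolding c(2) dd_const3_mult z by simp
  hence "dd ?u (dd ?u (dd ?v (dd ?v (nf3 d)))) = 0"
    using subst3_eq_0_iff[OF preserves_invertible[OF A]] unfolding dd_subst3 by blast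
  hence *: "eval3 (dd ?u (dd ?u (dd ?v (dd ?v (nf3 d))))) x = 0" for x by simp
  have k: "of_nat (d - 1) \<noteq> (0 :: 'k)" "of_nat (d - 2) \<noteq> (0 :: 'k)" "of_nat (d - 3) \<noteq> (0 :: 'k)" "of_nat (d - 4) \<noteq> (0 :: 'k)"
    using d by (simp_all del: of_nat_diff)
  have d': "d - 5 \<noteq> 0" "d - 4 \<noteq> 0" using d by auto
  define p q r w where "p = A$2$2" "q = A$3$2" "r = A$2$3" "w = A$3$3"
  note uv' = uv(2-5)[folded p_q_r_w_def]
  note e4 = dd4_nf3[OF uv(1), of ?v, unfolded uv']
  have 1: "2 * p * q * r * r + 2 * p * p * r * w = 0"
    using *[of "vector [0, 1, 0]"] k d' unfolding e4 by (simp add: power_0_left del: of_nat_diff)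
  have 2: "2 * p * q * w * w + 2 * q * q * r * w = 0"
    using *[of "vector [0, 0, 1]"] k d' unfolding e4 by (simp add: power_0_left del: of_nat_diff)
  define K :: 'k where "K = of_nat (d - 1) * of_nat (d - 2) * of_nat (d - 3) * of_nat (d - 4)"
  have K: "K \<noteq> 0" using k unfolding K_def by (simp del: of_nat_diff)
  have "K * (p * p * r * r + q * q * w * w) = 0"
    using *[of "vector [0, 1, 1]"] d' unfolding e4 1 2 K_def by (simp add: algebra_simps del: of_nat_diff)
  hence 3: "p * p * r * r + q * q * w * w = 0" using K by simp
  have "K * (2 ^ (d - 5) * (p * p * r * r) + 2 * (q * q * w * w)) = 0"
    using *[of "vector [0, 2, 1]"] d' unfolding e4 1 2 K_def by (simp add: algebra_simps del: of_nat_diff)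
  hence "2 ^ (d - 5) * (p * p * r * r) + 2 * (q * q * w * w) = 0" using K by simp
  from eliminate_second[OF 3 this] two_power_neq_2[where 'k = 'k and m = "d - 5"] d
  have "p * p * r * r = 0" "q * q * w * w = 0" by auto
  thus "A$2$2 * A$2$3 = 0" "A$3$2 * A$3$3 = 0" by (auto simp: p_q_r_w_def)
qed

text \<open>In degree 5 both D_Y D_Y D_Y F and D_Z D_Z D_Z F equal 24 Y Z, and an automorphism
  respects their equality.\<close>

lemma preserves_nf3_products_5:
  fixes A :: "'k::field_char_0^3^3"
  assumes d: "d = 5" and A: "preserves (nf3 d) A"
  shows "A$2$2 * A$3$2 = 0" "A$2$3 * A$3$3 = 0"
proof -
  have d5: "d \<ge> 5" using d by simp
  note blk = preserves_nf3_block[OF d5 A]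
  obtain c where c: "c \<noteq> 0" "subst3 (nf3 d) A = const3 c * nf3 d" using A by (auto simp: preserves_def)
  let ?u = "A *v axis 2 1" and ?v = "A *v axis 3 1"
  have uv: "?u $ 1 = 0" "?v $ 1 = 0" "?u $ 2 = A$2$2" "?u $ 3 = A$3$2" "?v $ 2 = A$2$3" "?v $ 3 = A$3$3" using blk by (simp_all add: mult_axis_nth)
  have z: "dd (axis 2 1) (dd (axis 2 1) (dd (axis 2 1) (nf3 d))) = dd (axis 3 1) (dd (axis 3 1) (dd (axis 3 1) (nf3 d :: 'k poly3)))"
    by (subst (1 2) dd3_nf3) (simp_all add: axis_def d)
  have "dd (axis 2 1) (dd (axis 2 1) (dd (axis 2 1) (subst3 (nf3 d) A))) = dd (axis 3 1) (dd (axis 3 1) (dd (axis 3 1) (subst3 (nf3 d) A)))"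
    unfolding c(2) dd_const3_mult z by simp
  hence "subst3 (dd ?u (dd ?u (dd ?u (nf3 d))) - dd ?v (dd ?v (dd ?v (nf3 d)))) A = 0"
    unfolding dd_subst3 by (intro eval3_eq_0_imp) (simp, metis eval3_subst3)
  hence "dd ?u (dd ?u (dd ?u (nf3 d))) - dd ?v (dd ?v (dd ?v (nf3 d))) = 0"
    using subst3_eq_0_iff[OF preserves_invertible[OF A]] by blast
  hence *: "eval3 (dd ?u (dd ?u (dd ?u (nf3 d)))) x = eval3 (dd ?v (dd ?v (dd ?v (nf3 d)))) x" for x by simp
  define p q r w where "p = A$2$2" "q = A$3$2" "r = A$2$3" "w = A$3$3"
  note uv' = uv(3-6)[folded p_q_r_w_def]
  note e3 = dd3_nf3[OF uv(1), of ?u, unfolded uv'] dd3_nf3[OF uv(2), of ?v, unfolded uv']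
  have "36 * (p * p * q) = 36 * (r * r * w)"
    using *[of "vector [0, 1, 0]"] unfolding e3 by (simp add: d algebra_simps)
  hence 1: "p * p * q = r * r * w" by simp
  have "36 * (p * q * q) = 36 * (r * w * w)"
    using *[of "vector [0, 0, 1]"] unfolding e3 by (simp add: d algebra_simps)
  hence 2: "p * q * q = r * w * w" by simp
  have pq: "p * q = 0"
  proof (rule ccontr)
    assume pq: "p * q \<noteq> 0"
    hence rw: "r * w \<noteq> 0" using 1 by auto
    \<comment> \<open>Cross-multiplying the two equations brings out the determinant p w - r q of
      the block.\<close>
    have "(p * p * q) * (r * w * w) = (r * r * w) * (p * q * q)" using 1 2 by simp
    hence "(p * q) * (r * w) * (p * w - r * q) = 0" by (simp add: algebra_simps)
    thus False using pq rw blk(6) by (simp add: p_q_r_w_def)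
  qed
  hence "r * r * w = 0" using 1 by auto
  thus "A$2$2 * A$3$2 = 0" "A$2$3 * A$3$3 = 0" using pq by (auto simp: p_q_r_w_def)
qed

lemma preserves_nf3_monomial:
  fixes A :: "'k::field_char_0^3^3"
  assumes d: "d \<ge> 5" "d \<noteq> 6" and A: "preserves (nf3 d) A"
  shows "\<exists>a b c. A = diag3 a b c \<or> A = swap3 ** diag3 a b c"
proof -
  note blk = preserves_nf3_block[OF d(1) A]
  have "(A$2$3 = 0 \<and> A$3$2 = 0) \<or> (A$2$2 = 0 \<and> A$3$3 = 0)"
  proof (cases "d = 5")
    case True
    from preserves_nf3_products_5[OF True A] show ?thesis using blk(6) by auto
  next
    case False
    hence "d \<ge> 7" using d by simp
    from preserves_nf3_products[OF this A] show ?thesis using blk(6) by auto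
  qed
  thus ?thesis
  proof
    assume "A$2$3 = 0 \<and> A$3$2 = 0"
    hence "A = diag3 (A$1$1) (A$2$2) (A$3$3)" using blk by (simp add: vec_eq_iff forall_3 diag3_def)
    thus ?thesis by blast
  next
    assume "A$2$2 = 0 \<and> A$3$3 = 0"
    hence "A = swap3 ** diag3 (A$1$1) (A$3$2) (A$2$3)"
      using blk by (simp add: vec_eq_iff forall_3 matrix_matrix_mult_def swap3_def sum3 diag3_def)
    thus ?thesis by blast
  qed
qed

lemma preserves_nf3_diag3:
  fixes a b c :: "'k::field_char_0"
  assumes d: "d \<ge> 4" and P: "preserves (nf3 d) (diag3 a b c)"
  obtains y where "pgl (diag3 a b c) = pgl (diag3 1 y (inverse (y ^ (d - 1))))" "y ^ (d * (d - 2)) = 1"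
proof -
  have nz: "a \<noteq> 0" "b \<noteq> 0" "c \<noteq> 0" using preserves_invertible[OF P] by (simp_all add: invertible_diag3)
  obtain l where l: "\<forall>x. eval3 (nf3 d) (diag3 a b c *v x) = l * eval3 (nf3 d) x" using P unfolding preserves_iff by blast
  \<comment> \<open>Values at (0,1,1) and (0,2,1) separate the two mixed monomials, because 2^(d-1)
    differs from 2.\<close>
  have 2: "a ^ d = l" "b ^ (d - 1) * c + b * c ^ (d - 1) = 2 * l"
    "2 ^ (d - 1) * (b ^ (d - 1) * c) + 2 * (b * c ^ (d - 1)) = (2 ^ (d - 1) + 2) * l"
    using l[rule_format, of "vector [0, 1, 1]"] l[rule_format, of "vector [1, 0, 0]"] l[rule_format, of "vector [0, 2, 1]"] d
    by (simp_all add: diag3_mult_vec nf3_def power_0_left power_mult_distrib algebra_simps)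
  have "(2 ^ (d - 1) - 2) * (b ^ (d - 1) * c - l) =
     (2 ^ (d - 1) * (b ^ (d - 1) * c) + 2 * (b * c ^ (d - 1)) - (2 ^ (d - 1) + 2) * l) - 2 * (b ^ (d - 1) * c + b * c ^ (d - 1) - 2 * l)"
    by (simp add: algebra_simps)
  also have "\<dots> = 0" unfolding 2 by simp
  finally have "(2 ^ (d - 1) - 2) * (b ^ (d - 1) * c - l) = 0" .
  moreover have "2 ^ (d - 1) - 2 \<noteq> (0 :: 'k)" using two_power_neq_2[where 'k = 'k and m = "d - 1"] d by auto
  ultimately have e: "b ^ (d - 1) * c = l" by simp
  hence e': "b * c ^ (d - 1) = l" using 2(2) by simp
  define y z where "y = b / a" and "z = c / a"
  have y0: "y \<noteq> 0" using nz by (simp add: y_def)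
  have ad: "a ^ d = a ^ (d - 1) * a" using d by (cases d) auto
  have "y ^ (d - 1) * z = l / a ^ d" using e nz by (simp add: y_def z_def ad power_divide)
  moreover have l0: "l \<noteq> 0" using 2(1) nz by auto
  ultimately have yz: "y ^ (d - 1) * z = 1" using 2(1) by simp
  have "z ^ (d - 1) * y = l / a ^ d" using e' nz by (simp add: y_def z_def ad power_divide mult.commute)
  hence yz': "z ^ (d - 1) * y = 1" using 2(1) l0 by simp
  have zz: "z = inverse (y ^ (d - 1))" using yz by (metis inverse_unique)
  have sq: "(d - 1) * (d - 1) = d * (d - 2) + 1"
  proof -
    obtain e where "d = e + 4" using d by (metis add.commute le_Suc_ex)
    thus ?thesis by (simp add: algebra_simps)
  qed
  have "y = y * (y ^ (d - 1) * z) ^ (d - 1)" using yz by simp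
  also have "\<dots> = y ^ ((d - 1) * (d - 1)) * (z ^ (d - 1) * y)"
    by (simp only: power_mult_distrib power_mult mult.commute mult.left_commute mult.assoc)
  also have "\<dots> = y ^ (d * (d - 2)) * y" unfolding yz' sq by simp
  finally have "y ^ (d * (d - 2)) = 1" using y0 by simp
  thus thesis using that[of y] pgl_diag3_normalise[OF nz(1)] zz unfolding y_def z_def by simp
qed

lemma Aut_nf3_generator:
  fixes \<xi> :: "'k::field_char_0"
  assumes d: "d \<ge> 4" and \<xi>: "primitive_root (d * (d - 2)) \<xi>"
  defines "S \<equiv> pgl (diag3 1 \<xi> (inverse (\<xi> ^ (d - 1))))"
  shows "S \<in> carrier (Aut (nf3 d))" "group.ord (Aut (nf3 d)) S = d * (d - 2)"
proof -
  have p: "\<xi> ^ k = 1 \<longleftrightarrow> d * (d - 2) dvd k" for k using \<xi> by (simp add: primitive_root_iff)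
  have nz: "\<xi> \<noteq> 0" using \<xi> d by (auto simp: primitive_root_def power_0_left split: if_splits)
  have 1: "\<xi> ^ (d - 1) * inverse (\<xi> ^ (d - 1)) = 1" using nz by simp
  have sq: "(d - 1) * (d - 1) = d * (d - 2) + 1"
  proof -
    obtain e where "d = e + 4" using d by (metis add.commute le_Suc_ex)
    thus ?thesis by (simp add: algebra_simps)
  qed
  have "\<xi> ^ ((d - 1) * (d - 1)) = \<xi>" unfolding sq using p[of "d * (d - 2)"] by simp
  hence 2: "\<xi> * inverse (\<xi> ^ (d - 1)) ^ (d - 1) = 1"
    using nz by (simp add: power_inverse power_mult)
  have "preserves (nf3 d) (diag3 1 \<xi> (inverse (\<xi> ^ (d - 1))))"
    unfolding preserves_iff
  proof (intro conjI exI[of _ 1] one_neq_zero allI)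
    show "invertible (diag3 1 \<xi> (inverse (\<xi> ^ (d - 1))))" using nz by (simp add: invertible_diag3)
    fix x
    have "eval3 (nf3 d) (diag3 1 \<xi> (inverse (\<xi> ^ (d - 1))) *v x) = x$1 ^ d +
      (\<xi> ^ (d - 1) * inverse (\<xi> ^ (d - 1))) * (x$2 ^ (d - 1) * x$3) + (\<xi> * inverse (\<xi> ^ (d - 1)) ^ (d - 1)) * (x$2 * x$3 ^ (d - 1))"
      by (simp add: diag3_mult_vec nf3_def power_mult_distrib algebra_simps)
    thus "eval3 (nf3 d) (diag3 1 \<xi> (inverse (\<xi> ^ (d - 1))) *v x) = 1 * eval3 (nf3 d) x"
      unfolding 1 2 by (simp add: nf3_def algebra_simps)
  qed
  thus S: "S \<in> carrier (Aut (nf3 d))" unfolding S_def carrier_Aut by blast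
  have "\<xi> ^ k = 1 \<and> inverse (\<xi> ^ (d - 1)) ^ k = 1 \<longleftrightarrow> d * (d - 2) dvd k" for k
    using p[of k] by (auto simp: power_inverse power_swap[of \<xi> _ k])
  thus "group.ord (Aut (nf3 d)) S = d * (d - 2)"
    unfolding S_def using nz by (intro ord_pgl_diag3[OF S[unfolded S_def]]) auto
qed


lemma inv_pgl_diag3:
  fixes a b c :: "'k::field"
  assumes "a \<noteq> 0" "b \<noteq> 0" "c \<noteq> 0"
  shows "inv\<^bsub>PGL3\<^esub> pgl (diag3 a b c) = pgl (diag3 (inverse a) (inverse b) (inverse c))"
  using assms by (intro inv_pgl) (simp_all add: invertible_diag3 diag3_mult mat_eq_diag3)

lemma inv_Aut: "x \<in> carrier (Aut F) \<Longrightarrow> inv\<^bsub>Aut F\<^esub> x = inv\<^bsub>PGL3\<^esub> x" for F :: "'k::field_char_0 poly3"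
  using group.m_inv_consistent[OF group_PGL3 subgroup_Aut[of F]] by (simp add: Aut_def)

lemma pgl_diag3_pow: "a \<noteq> 0 \<Longrightarrow> b \<noteq> 0 \<Longrightarrow> c \<noteq> 0 \<Longrightarrow> pgl (diag3 a b c) [^]\<^bsub>PGL3\<^esub> (n::nat) = pgl (diag3 (a ^ n) (b ^ n) (c ^ n))" for a :: "'k::field"
  by (simp add: pgl_pow invertible_diag3 mpow_diag3)

text \<open>Since tau is an involution, multiplying by it on the left turns the conjugation relation
  of \<open>H_group\<close> into the commutation rule used for normal words.\<close>

lemma sig_tau_if_conjugation:
  assumes "word_eq R [tau, tau] []" "word_eq R [tau, sig, tau] (replicate e sig_inv)"
  shows "word_eq R [sig, tau] (tau # replicate e sig_inv)"
proof -
  have "word_eq R [tau, tau, sig, tau] [sig, tau]"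
    using word_eq_append_right[OF assms(1), of "[sig, tau]"] by simp
  moreover have "word_eq R [tau, tau, sig, tau] (tau # replicate e sig_inv)"
    using word_eq_append_left[OF assms(2), of "[tau]"] by simp
  ultimately show ?thesis by (rule word_eq.trans[OF word_eq.sym])
qed

lemma H_group_iso:
  assumes d: "d \<ge> 5" "d \<noteq> 6"
  shows "Aut (nf3 d :: 'k::{alg_closed_field,field_char_0} poly3) \<cong> H_group d"
proof -
  have d4: "d \<ge> 4" using d by simp
  let ?N = "d * (d - 2)"
  have N: "?N > 0" using d by simp
  obtain \<xi> :: 'k where \<xi>: "primitive_root ?N \<xi>" using ex_primitive_root[OF N] by auto
  have nz: "\<xi> \<noteq> 0" using \<xi> N by (auto simp: primitive_root_def power_0_left split: if_splits)
  define D where "D = diag3 1 \<xi> (inverse (\<xi> ^ (d - 1)))"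
  define s where "s = pgl D"
  define t where "t = pgl (swap3 :: 'k^3^3)"
  let ?G = "Aut (nf3 d :: 'k poly3)"
  interpret G: group ?G by (rule group_Aut)
  have iD: "invertible D" using nz by (simp add: D_def invertible_diag3)
  have s: "s \<in> carrier ?G" "G.ord s = ?N" using Aut_nf3_generator[OF d4 \<xi>] unfolding s_def D_def by auto
  have t: "t \<in> carrier ?G" unfolding t_def carrier_Aut using preserves_swap3 by blast
  have sp: "s [^]\<^bsub>?G\<^esub> (i::nat) = pgl (diag3 1 (\<xi> ^ i) (inverse (\<xi> ^ (d - 1)) ^ i))" for i
    using nz by (simp add: s_def D_def pgl_diag3_pow)
  have tp: "t [^]\<^bsub>?G\<^esub> (1::nat) = pgl swap3"
    by (simp only: pow_Aut t_def pgl_pow[OF invertible_swap3] One_nat_def mpow.simps matrix_mul_lid)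
  have t2: "t \<otimes>\<^bsub>?G\<^esub> t = \<one>\<^bsub>?G\<^esub>"
    by (simp add: t_def pgl_mult invertible_swap3 swap3_square one_PGL3)
  have rel: "t \<otimes>\<^bsub>?G\<^esub> (s \<otimes>\<^bsub>?G\<^esub> t) = (inv\<^bsub>?G\<^esub> s) [^]\<^bsub>?G\<^esub> (d - 1)"
  proof -
    have sq: "(d - 1) * (d - 1) = d * (d - 2) + 1"
    proof -
      obtain e where "d = e + 4" using d4 by (metis add.commute le_Suc_ex)
      thus ?thesis by (simp add: algebra_simps)
    qed
    have x: "(\<xi> ^ (d - 1)) ^ (d - 1) = \<xi>"
      unfolding power_mult[symmetric] sq using \<xi> by (simp add: primitive_root_def)
    have "inv\<^bsub>?G\<^esub> s = pgl (diag3 1 (inverse \<xi>) (\<xi> ^ (d - 1)))"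
      using nz inv_Aut[OF s(1)] by (simp add: s_def D_def inv_pgl_diag3)
    hence "(inv\<^bsub>?G\<^esub> s) [^]\<^bsub>?G\<^esub> (d - 1) = pgl (diag3 1 (inverse (\<xi> ^ (d - 1))) \<xi>)"
      using nz x by (simp add: pgl_diag3_pow power_inverse)
    moreover have "swap3 ** (D ** swap3) = diag3 1 (inverse (\<xi> ^ (d - 1))) \<xi>"
      by (simp add: D_def vec_eq_iff forall_3 matrix_matrix_mult_def sum3 swap3_def diag3_def)
    ultimately show ?thesis
      using iD nz by (simp add: s_def t_def pgl_mult invertible_swap3 invertible_mult)
  qed
  have "?G \<cong> presented_group {([tau, tau], []), (replicate ?N sig, []), ([tau, sig, tau], replicate (d - 1) sig_inv)}"
  proof (rule metacyclic_presentation[where s = s and t = t and m = 2 and N = ?N and e = "d - 1"])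
    have h: "range (gen_map s t) \<subseteq> carrier ?G" using s t by (auto simp: gen_map_def split: gen.splits)
    fix u v assume "(u, v) \<in> {([tau, tau], []), (replicate ?N sig, []), ([tau, sig, tau], replicate (d - 1) sig_inv)}"
    then consider "u = replicate ?N sig" "v = []" | "u = [tau, tau]" "v = []" | "u = [tau, sig, tau]" "v = replicate (d - 1) sig_inv"
      by blast
    thus "word_val ?G (gen_map s t) u = word_val ?G (gen_map s t) v"
    proof cases
      case 1
      thus ?thesis using s G.pow_ord_eq_1[OF s(1)] by (simp only: G.word_val_replicate[OF h] gen_map_def gen.case G.word_val_Nil)
    next
      case 2
      thus ?thesis using t t2 by (simp add: gen_map_def del: mult_Aut one_Aut)
    next
      case 3
      thus ?thesis using s t rel by (simp add: gen_map_def G.word_val_replicate_inv[OF h] del: mult_Aut one_Aut pow_Aut)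
    qed
  next
    fix g assume "g \<in> carrier ?G"
    then obtain A :: "'k^3^3" where A: "g = pgl A" "preserves (nf3 d) A" by (auto simp: carrier_Aut)
    have diag: "\<exists>i<?N. pgl (diag3 a b c) = s [^]\<^bsub>?G\<^esub> i" if pd: "preserves (nf3 d) (diag3 a b c)" for a b c :: 'k
    proof -
      obtain y where y: "pgl (diag3 a b c) = pgl (diag3 1 y (inverse (y ^ (d - 1))))" "y ^ ?N = 1"
        using preserves_nf3_diag3[OF d4 pd] by blast
      obtain i where i: "i < ?N" "y = \<xi> ^ i" using primitive_root_powers[OF \<xi> y(2)] by blast
      have "inverse (y ^ (d - 1)) = inverse (\<xi> ^ (d - 1)) ^ i" by (simp add: i(2) power_inverse power_swap[of \<xi> i])
      thus ?thesis using i y(1) sp by metis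
    qed
    have c2: "swap3 ** (swap3 ** B) = B" for B :: "'k^3^3"
      by (simp add: matrix_mul_assoc swap3_square)
    obtain a b c where abc: "A = diag3 a b c \<or> A = swap3 ** diag3 a b c"
      using preserves_nf3_monomial[OF d A(2)] by blast
    \<comment> \<open>\<open>swap3\<close> is an involution, so in the second case this product is
      the diagonal factor itself.\<close>
    moreover have "preserves (nf3 d) (swap3 ** A)" using preserves_mult[OF preserves_swap3 A(2)] .
    ultimately have PD: "preserves (nf3 d) (diag3 a b c)" using A(2) c2 by auto
    hence iD': "invertible (diag3 a b c)" by (rule preserves_invertible)
    obtain i where i: "i < ?N" "pgl (diag3 a b c) = s [^]\<^bsub>?G\<^esub> i" using diag[OF PD] by blast
    have "\<exists>j::nat. j < 2 \<and> g = t [^]\<^bsub>?G\<^esub> j \<otimes>\<^bsub>?G\<^esub> pgl (diag3 a b c)"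
      using abc
    proof
      assume 1: "A = diag3 a b c"
      have "g = t [^]\<^bsub>?G\<^esub> (0::nat) \<otimes>\<^bsub>?G\<^esub> pgl (diag3 a b c)"
        using 1 A(1) iD' by (simp add: one_PGL3 pgl_mult invertible_mat)
      thus ?thesis by (intro exI[of _ 0]) simp
    next
      assume 2: "A = swap3 ** diag3 a b c"
      have "g = t [^]\<^bsub>?G\<^esub> (1::nat) \<otimes>\<^bsub>?G\<^esub> pgl (diag3 a b c)"
        unfolding tp using 2 A(1) iD' by (simp add: pgl_mult invertible_swap3)
      thus ?thesis by (intro exI[of _ 1]) simp
    qed
    thus "\<exists>i<?N. \<exists>j<(2::nat). g = t [^]\<^bsub>?G\<^esub> j \<otimes>\<^bsub>?G\<^esub> s [^]\<^bsub>?G\<^esub> i" using i by metis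
  next
    fix i j :: nat assume "0 < j" "j < 2"
    hence j: "j = 1" by auto
    have "pgl (swap3 :: 'k^3^3) \<noteq> pgl (diag3 a b c)" for a b c
      unfolding pgl_eq_iff mat_eq_diag3 diag3_mult
      by (auto simp: vec_eq_iff forall_3 swap3_def diag3_def)
    thus "t [^]\<^bsub>?G\<^esub> j \<noteq> s [^]\<^bsub>?G\<^esub> i" unfolding sp j tp by blast
  qed (use s t N in \<open>auto intro: word_eq.relation sig_tau_if_conjugation simp: numeral_2_eq_2\<close>)
  thus ?thesis by (simp add: H_group_def)
qed

section \<open>Automorphisms of the Klein curves\<close>

lemma dd2_nf4:
  "dd u (dd v (nf4 d)) =
    const3 (of_nat (d - 1) * of_nat (d - 2) * (u$1 * v$1)) * (varX ^ (d - 3) * varY) + const3 (of_nat (d - 1) * (u$1 * v$2 + u$2 * v$1)) * varX ^ (d - 2) +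
    const3 (of_nat (d - 1) * of_nat (d - 2) * (u$2 * v$2)) * (varY ^ (d - 3) * varZ) + const3 (of_nat (d - 1) * (u$2 * v$3 + u$3 * v$2)) * varY ^ (d - 2) +
    const3 (of_nat (d - 1) * of_nat (d - 2) * (u$3 * v$3)) * (varZ ^ (d - 3) * varX) + const3 (of_nat (d - 1) * (u$3 * v$1 + u$1 * (v$3 :: 'k::field_char_0))) * varZ ^ (d - 2)"
  by (rule eval3_inject) (simp add: nf4_def algebra_simps numeral_2_eq_2 numeral_3_eq_3)

lemma dd3_nf4:
  "dd u (dd u (dd v (nf4 d))) =
    const3 (of_nat (d - 1) * of_nat (d - 2) * of_nat (d - 3) * (u$1 * u$1 * v$1)) * (varX ^ (d - 4) * varY) + const3 (of_nat (d - 1) * of_nat (d - 2) * (u$1 * u$1 * v$2 + 2 * u$1 * u$2 * v$1)) * varX ^ (d - 3) +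
    const3 (of_nat (d - 1) * of_nat (d - 2) * of_nat (d - 3) * (u$2 * u$2 * v$2)) * (varY ^ (d - 4) * varZ) + const3 (of_nat (d - 1) * of_nat (d - 2) * (u$2 * u$2 * v$3 + 2 * u$2 * u$3 * v$2)) * varY ^ (d - 3) +
    const3 (of_nat (d - 1) * of_nat (d - 2) * of_nat (d - 3) * (u$3 * u$3 * v$3)) * (varZ ^ (d - 4) * varX) + const3 (of_nat (d - 1) * of_nat (d - 2) * (u$3 * u$3 * v$1 + 2 * u$3 * u$1 * (v$3 :: 'k::field_char_0))) * varZ ^ (d - 3)"
  unfolding dd2_nf4
  by (rule eval3_inject) (simp add: algebra_simps numeral_2_eq_2 numeral_3_eq_3 eval_nat_numeral)

text \<open>Up to scalars the solutions (u, v) are the directions (X, Z), (Y, X) and (Z, Y), so an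
  orientation of the coordinate triangle is remembered. At d = 4 monomials such as X^(d-4) Y and
  Y^(d-3) would coincide.\<close>

lemma dd3_nf4_eq_0:
  assumes d: "d \<ge> 5" and 0: "dd u (dd u (dd v (nf4 d))) = (0 :: 'k::field_char_0 poly3)" and nz: "u \<noteq> 0" "v \<noteq> 0"
  shows "(u$2 = 0 \<and> u$3 = 0 \<and> v$1 = 0 \<and> v$2 = 0) \<or> (u$3 = 0 \<and> u$1 = 0 \<and> v$2 = 0 \<and> v$3 = 0) \<or> (u$1 = 0 \<and> u$2 = 0 \<and> v$3 = 0 \<and> v$1 = 0)"
proof -
  have *: "eval3 (dd u (dd u (dd v (nf4 d)))) x = 0" for x using 0 by simp
  have c: "of_nat (d - 1) \<noteq> (0 :: 'k)" "of_nat (d - 2) \<noteq> (0 :: 'k)" "of_nat (d - 3) \<noteq> (0 :: 'k)"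
    using d by (simp_all del: of_nat_diff)
  have d': "d - 3 \<noteq> 0" "d - 4 \<noteq> 0" using d by auto
  have 1: "u$1 * u$1 * v$2 + 2 * u$1 * u$2 * v$1 = 0"
    using *[of "vector [1, 0, 0]"] c d' unfolding dd3_nf4 by (simp add: power_0_left del: of_nat_diff)
  have 2: "u$2 * u$2 * v$3 + 2 * u$2 * u$3 * v$2 = 0"
    using *[of "vector [0, 1, 0]"] c d' unfolding dd3_nf4 by (simp add: power_0_left del: of_nat_diff)
  have 3: "u$3 * u$3 * v$1 + 2 * u$3 * u$1 * v$3 = 0"
    using *[of "vector [0, 0, 1]"] c d' unfolding dd3_nf4 by (simp add: power_0_left del: of_nat_diff)
  have 4: "u$1 * u$1 * v$1 = 0" using *[of "vector [1, 1, 0]"] c d' unfolding dd3_nf4 1 2 3 by (simp add: power_0_left del: of_nat_diff)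
  have 5: "u$2 * u$2 * v$2 = 0" using *[of "vector [0, 1, 1]"] c d' unfolding dd3_nf4 1 2 3 by (simp add: power_0_left del: of_nat_diff)
  have 6: "u$3 * u$3 * v$3 = 0" using *[of "vector [1, 0, 1]"] c d' unfolding dd3_nf4 1 2 3 by (simp add: power_0_left del: of_nat_diff)
  have u: "u$1 \<noteq> 0 \<or> u$2 \<noteq> 0 \<or> u$3 \<noteq> 0" and v: "v$1 \<noteq> 0 \<or> v$2 \<noteq> 0 \<or> v$3 \<noteq> 0"
    using nz by (auto simp: vec_eq_iff forall_3)
  from u consider "u$1 \<noteq> 0" | "u$2 \<noteq> 0" | "u$3 \<noteq> 0" by blast
  thus ?thesis
  proof cases
    case 1
    hence "v$1 = 0" using 4 by simp
    moreover from this have "v$2 = 0" using \<open>u$1 * u$1 * v$2 + 2 * u$1 * u$2 * v$1 = 0\<close> 1 by simp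
    moreover from calculation v have "v$3 \<noteq> 0" by simp
    ultimately show ?thesis using 2 6 by auto
  next
    case 2
    hence "v$2 = 0" using 5 by simp
    moreover from this have "v$3 = 0" using \<open>u$2 * u$2 * v$3 + 2 * u$2 * u$3 * v$2 = 0\<close> 2 by simp
    moreover from calculation v have "v$1 \<noteq> 0" by simp
    ultimately show ?thesis using 3 4 by auto
  next
    case 3
    hence "v$3 = 0" using 6 by simp
    moreover from this have "v$1 = 0" using \<open>u$3 * u$3 * v$1 + 2 * u$3 * u$1 * v$3 = 0\<close> 3 by simp
    moreover from calculation v have "v$2 \<noteq> 0" by simp
    ultimately show ?thesis using 1 5 by auto
  qed
qed

definition cyc3 :: "'k::field^3^3"
  where "cyc3 = vector [vector [0, 0, 1], vector [1, 0, 0], vector [0, 1, 0]]"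

lemma cyc3_mult_vec: "cyc3 *v x = vector [x $ 3, x $ 1, x $ 2]"
  by (simp add: vec_eq_iff forall_3 matrix_vector_mult_def cyc3_def sum3)

lemma invertible_cyc3: "invertible (cyc3 :: 'k::field^3^3)"
  by (simp add: invertible_det3 cyc3_def)

lemma preserves_cyc3: "preserves (nf4 d :: 'k::field_char_0 poly3) cyc3"
  unfolding preserves_iff by (intro conjI exI[of _ 1] invertible_cyc3) (simp_all add: cyc3_mult_vec nf4_def algebra_simps)

lemma cyc3_cubed: "cyc3 ** cyc3 ** cyc3 = (mat 1 :: 'k::field^3^3)"
  by (simp add: vec_eq_iff forall_3 matrix_matrix_mult_def cyc3_def sum3 mat_def)

text \<open>A matrix that respects the three oriented pairs permutes the coordinate axes cyclically;
  transpositions would reverse the orientation.\<close>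

lemma preserves_nf4_monomial:
  fixes A :: "'k::field_char_0^3^3"
  assumes d: "d \<ge> 5" and A: "preserves (nf4 d) A"
  shows "\<exists>a b c. A = diag3 a b c \<or> A = cyc3 ** diag3 a b c \<or> A = cyc3 ** cyc3 ** diag3 a b c"
proof -
  have nz: "A *v axis i 1 \<noteq> 0" for i
    using invertible_mult_vec_eq_0[OF preserves_invertible[OF A], of "axis i 1"] by auto
  have z: "dd (axis 1 1) (dd (axis 1 1) (dd (axis 3 1) (nf4 d))) = (0 :: 'k poly3)"
    "dd (axis 2 1) (dd (axis 2 1) (dd (axis 1 1) (nf4 d))) = (0 :: 'k poly3)"
    "dd (axis 3 1) (dd (axis 3 1) (dd (axis 2 1) (nf4 d))) = (0 :: 'k poly3)"
    by (simp_all add: dd3_nf4, simp_all add: axis_def)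
  note t = dd3_nf4_eq_0[OF d iffD2[OF preserves_dd3[OF A]] nz nz, unfolded mult_axis_nth]
  have "(A$2$1 = 0 \<and> A$3$1 = 0 \<and> A$1$3 = 0 \<and> A$2$3 = 0 \<and> A$3$2 = 0 \<and> A$1$2 = 0) \<or>
     (A$3$1 = 0 \<and> A$1$1 = 0 \<and> A$2$3 = 0 \<and> A$3$3 = 0 \<and> A$1$2 = 0 \<and> A$2$2 = 0) \<or>
     (A$1$1 = 0 \<and> A$2$1 = 0 \<and> A$3$3 = 0 \<and> A$1$3 = 0 \<and> A$2$2 = 0 \<and> A$3$2 = 0)"
  proof -
    have n: "A$1$i \<noteq> 0 \<or> A$2$i \<noteq> 0 \<or> A$3$i \<noteq> 0" for i
      using nz[of i] by (auto simp: vec_eq_iff forall_3 mult_axis_nth)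
    show ?thesis using t[OF z(1)] t[OF z(2)] t[OF z(3)] n[of 1] n[of 2] n[of 3] by argo
  qed
  thus ?thesis
  proof (elim disjE)
    assume "A$2$1 = 0 \<and> A$3$1 = 0 \<and> A$1$3 = 0 \<and> A$2$3 = 0 \<and> A$3$2 = 0 \<and> A$1$2 = 0"
    hence "A = diag3 (A$1$1) (A$2$2) (A$3$3)" by (simp add: vec_eq_iff forall_3 diag3_def)
    thus ?thesis by blast
  next
    assume "A$3$1 = 0 \<and> A$1$1 = 0 \<and> A$2$3 = 0 \<and> A$3$3 = 0 \<and> A$1$2 = 0 \<and> A$2$2 = 0"
    hence "A = cyc3 ** diag3 (A$2$1) (A$3$2) (A$1$3)"
      by (simp add: vec_eq_iff forall_3 matrix_matrix_mult_def cyc3_def sum3 diag3_def)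
    thus ?thesis by blast
  next
    assume "A$1$1 = 0 \<and> A$2$1 = 0 \<and> A$3$3 = 0 \<and> A$1$3 = 0 \<and> A$2$2 = 0 \<and> A$3$2 = 0"
    hence "A = cyc3 ** cyc3 ** diag3 (A$3$1) (A$1$2) (A$2$3)"
      by (simp add: vec_eq_iff forall_3 matrix_matrix_mult_def cyc3_def sum3 diag3_def)
    thus ?thesis by blast
  qed
qed

lemma power_int_nat_minus: "m \<le> n \<Longrightarrow> x powi (- (int n - int m)) = inverse (x ^ (n - m))" for x :: "'k::field"
  by (simp add: power_int_minus of_nat_diff[symmetric] del: of_nat_diff)

lemma preserves_nf4_diag3:
  fixes a b c :: "'k::field_char_0"
  assumes d: "d \<ge> 4" and P: "preserves (nf4 d) (diag3 a b c)"
  obtains y where "pgl (diag3 a b c) = pgl (diag3 1 y (inverse (y ^ (d - 2))))" "y ^ ((d - 1) * (d - 2) + 1) = 1"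
proof -
  have nz: "a \<noteq> 0" "b \<noteq> 0" "c \<noteq> 0" using preserves_invertible[OF P] by (simp_all add: invertible_diag3)
  obtain l where l: "\<forall>x. eval3 (nf4 d) (diag3 a b c *v x) = l * eval3 (nf4 d) x" using P unfolding preserves_iff by blast
  have e: "a ^ (d - 1) * b = l" "b ^ (d - 1) * c = l" "c ^ (d - 1) * a = l"
    using l[rule_format, of "vector [1, 1, 0]"] l[rule_format, of "vector [0, 1, 1]"] l[rule_format, of "vector [1, 0, 1]"] d
    by (simp_all add: diag3_mult_vec nf4_def power_0_left)
  define y z where "y = b / a" and "z = c / a"
  have y0: "y \<noteq> 0" using nz by (simp add: y_def)
  have ad: "a ^ d = a ^ (d - 1) * a" using d by (cases d) auto
  have "y = l / a ^ d" using e(1) nz by (simp add: y_def ad field_simps)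
  moreover have "y ^ (d - 1) * z = l / a ^ d" using e(2) nz by (simp add: y_def z_def ad power_divide)
  moreover have "z ^ (d - 1) = l / a ^ d" using e(3) nz by (simp add: y_def z_def ad power_divide field_simps)
  ultimately have yz: "y ^ (d - 1) * z = y" "z ^ (d - 1) = y" by simp_all
  have "d - 1 = Suc (d - 2)" using d by simp
  hence "y * (y ^ (d - 2) * z) = y * 1" using yz(1) by (simp add: algebra_simps)
  hence yz1: "y ^ (d - 2) * z = 1" using y0 by simp
  hence zz: "z = inverse (y ^ (d - 2))" by (metis inverse_unique)
  have "(y ^ (d - 2) * z) ^ (d - 1) = 1" using yz1 by simp
  hence "y ^ ((d - 1) * (d - 2) + 1) = 1" using yz(2) by (simp add: power_mult_distrib power_mult power_swap[of y "d - Suc 0"] mult.commute)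
  thus thesis using that[of y] pgl_diag3_normalise[OF nz(1)] zz unfolding y_def z_def by simp
qed

lemma Aut_nf4_generator:
  fixes \<xi> :: "'k::field_char_0"
  assumes d: "d \<ge> 4" and \<xi>: "primitive_root ((d - 1) * (d - 2) + 1) \<xi>"
  defines "S \<equiv> pgl (diag3 1 \<xi> (inverse (\<xi> ^ (d - 2))))"
  shows "S \<in> carrier (Aut (nf4 d))" "group.ord (Aut (nf4 d)) S = (d - 1) * (d - 2) + 1"
proof -
  have p: "\<xi> ^ k = 1 \<longleftrightarrow> (d - 1) * (d - 2) + 1 dvd k" for k using \<xi> by (simp add: primitive_root_iff)
  have nz: "\<xi> \<noteq> 0" using \<xi> by (auto simp: primitive_root_def power_0_left split: if_splits)
  have "d - 1 = Suc (d - 2)" using d by simp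
  hence 1: "\<xi> ^ (d - 1) * inverse (\<xi> ^ (d - 2)) = \<xi>" using nz by simp
  have "\<xi> ^ ((d - 2) * (d - 1)) * \<xi> = 1" using p[of "(d - 1) * (d - 2) + 1"] by (simp add: mult.commute)
  hence 2: "inverse (\<xi> ^ (d - 2)) ^ (d - 1) = \<xi>"
    using nz by (simp add: power_inverse power_mult inverse_unique)
  have "preserves (nf4 d) (diag3 1 \<xi> (inverse (\<xi> ^ (d - 2))))"
    unfolding preserves_iff
  \<comment> \<open>The form is reproduced only up to the factor \<open>\<xi>\<close>: each of its
    monomials has that weight.\<close>
  proof (intro conjI exI[of _ \<xi>] nz allI)
    show "invertible (diag3 1 \<xi> (inverse (\<xi> ^ (d - 2))))" using nz by (simp add: invertible_diag3)
    fix x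
    have "eval3 (nf4 d) (diag3 1 \<xi> (inverse (\<xi> ^ (d - 2))) *v x) = \<xi> * (x$1 ^ (d - 1) * x$2) +
      (\<xi> ^ (d - 1) * inverse (\<xi> ^ (d - 2))) * (x$2 ^ (d - 1) * x$3) + inverse (\<xi> ^ (d - 2)) ^ (d - 1) * (x$3 ^ (d - 1) * x$1)"
      by (simp add: diag3_mult_vec nf4_def power_mult_distrib algebra_simps)
    thus "eval3 (nf4 d) (diag3 1 \<xi> (inverse (\<xi> ^ (d - 2))) *v x) = \<xi> * eval3 (nf4 d) x"
      unfolding 1 2 by (simp add: nf4_def algebra_simps)
  qed
  thus S: "S \<in> carrier (Aut (nf4 d))" unfolding S_def carrier_Aut by blast
  have "\<xi> ^ k = 1 \<and> inverse (\<xi> ^ (d - 2)) ^ k = 1 \<longleftrightarrow> (d - 1) * (d - 2) + 1 dvd k" for k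
    using p[of k] by (auto simp: power_inverse power_swap[of \<xi> _ k])
  thus "group.ord (Aut (nf4 d)) S = (d - 1) * (d - 2) + 1"
    unfolding S_def using nz by (intro ord_pgl_diag3[OF S[unfolded S_def]]) auto
qed


lemma pgl_cyc3_powers_not_diag3:
  "pgl (cyc3 :: 'k::field^3^3) \<noteq> pgl (diag3 a b c)" "pgl (cyc3 ** cyc3 :: 'k^3^3) \<noteq> pgl (diag3 a b c)"
  unfolding pgl_eq_iff mat_eq_diag3 diag3_mult
  by (auto simp: vec_eq_iff forall_3 cyc3_def diag3_def matrix_matrix_mult_def sum3)

lemma H_Klein_iso:
  assumes d: "d \<ge> 5"
  shows "Aut (nf4 d :: 'k::{alg_closed_field,field_char_0} poly3) \<cong> H_Klein d"
proof -
  have d4: "d \<ge> 4" using d by simp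
  let ?N = "(d - 1) * (d - 2) + 1"
  obtain \<xi> :: 'k where \<xi>: "primitive_root ?N \<xi>" using ex_primitive_root[of ?N] by auto
  have nz: "\<xi> \<noteq> 0" using \<xi> by (auto simp: primitive_root_def power_0_left split: if_splits)
  define D where "D = diag3 1 \<xi> (inverse (\<xi> ^ (d - 2)))"
  define s where "s = pgl D"
  define t where "t = pgl (cyc3 :: 'k^3^3)"
  let ?G = "Aut (nf4 d :: 'k poly3)"
  interpret G: group ?G by (rule group_Aut)
  have iD: "invertible D" using nz by (simp add: D_def invertible_diag3)
  have s: "s \<in> carrier ?G" "G.ord s = ?N" using Aut_nf4_generator[OF d4 \<xi>] unfolding s_def D_def by auto
  have t: "t \<in> carrier ?G" unfolding t_def carrier_Aut using preserves_cyc3 by blast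
  have sp: "s [^]\<^bsub>?G\<^esub> (i::nat) = pgl (diag3 1 (\<xi> ^ i) (inverse (\<xi> ^ (d - 2)) ^ i))" for i
    using nz by (simp add: s_def D_def pgl_diag3_pow)
  have tp: "t [^]\<^bsub>?G\<^esub> (1::nat) = pgl cyc3" "t [^]\<^bsub>?G\<^esub> (2::nat) = pgl (cyc3 ** cyc3)"
    by (simp_all only: pow_Aut t_def pgl_pow[OF invertible_cyc3] numeral_2_eq_2 One_nat_def mpow.simps matrix_mul_lid)
  have t3: "t \<otimes>\<^bsub>?G\<^esub> (t \<otimes>\<^bsub>?G\<^esub> t) = \<one>\<^bsub>?G\<^esub>"
    by (simp add: t_def pgl_mult invertible_mult invertible_cyc3 matrix_mul_assoc cyc3_cubed one_PGL3)
  have rel: "s \<otimes>\<^bsub>?G\<^esub> t = t \<otimes>\<^bsub>?G\<^esub> (inv\<^bsub>?G\<^esub> s) [^]\<^bsub>?G\<^esub> (d - 1)"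
  proof -
    have d1: "d - 1 = Suc (d - 2)" using d by simp
    have "\<xi> ^ ((d - 2) * (d - 1)) * \<xi> = 1" using \<xi> by (simp add: primitive_root_def mult.commute)
    hence x: "\<xi> * (\<xi> ^ (d - 2)) ^ (d - 1) = 1" by (simp add: power_mult[symmetric] mult.commute)
    have y: "\<xi> * inverse \<xi> ^ (d - 1) = inverse (\<xi> ^ (d - 2))" using nz unfolding d1 by (simp add: power_inverse)
    have "inv\<^bsub>?G\<^esub> s = pgl (diag3 1 (inverse \<xi>) (\<xi> ^ (d - 2)))"
      using nz inv_Aut[OF s(1)] by (simp add: s_def D_def inv_pgl_diag3)
    hence "(inv\<^bsub>?G\<^esub> s) [^]\<^bsub>?G\<^esub> (d - 1) = pgl (diag3 1 (inverse \<xi> ^ (d - 1)) ((\<xi> ^ (d - 2)) ^ (d - 1)))"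
      using nz by (simp add: pgl_diag3_pow)
    \<comment> \<open>The commutation rule holds for matrices only up to the scalar
      \<open>\<xi>\<close>, which disappears in \<open>PGL3\<close>.\<close>
    moreover have "D ** cyc3 = mat \<xi> ** (cyc3 ** diag3 1 (inverse \<xi> ^ (d - 1)) ((\<xi> ^ (d - 2)) ^ (d - 1)))"
      using x y unfolding mat_mult_scale by (simp add: D_def vec_eq_iff forall_3 matrix_matrix_mult_def sum3 cyc3_def diag3_def)
    ultimately show ?thesis
      using iD nz by (simp add: s_def t_def pgl_mult invertible_cyc3 invertible_diag3 pgl_eq_iff) blast
  qed
  have "?G \<cong> presented_group {(replicate ?N sig, []), ([tau, tau, tau], []), ([sig, tau], tau # replicate (d - 1) sig_inv)}"
  proof (rule metacyclic_presentation[where s = s and t = t and m = 3 and N = ?N and e = "d - 1"])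
    have h: "range (gen_map s t) \<subseteq> carrier ?G" using s t by (auto simp: gen_map_def split: gen.splits)
    fix u v assume "(u, v) \<in> {(replicate ?N sig, []), ([tau, tau, tau], []), ([sig, tau], tau # replicate (d - 1) sig_inv)}"
    then consider "u = replicate ?N sig" "v = []" | "u = [tau, tau, tau]" "v = []" | "u = [sig, tau]" "v = tau # replicate (d - 1) sig_inv"
      by blast
    thus "word_val ?G (gen_map s t) u = word_val ?G (gen_map s t) v"
    proof cases
      case 1
      thus ?thesis using s G.pow_ord_eq_1[OF s(1)] by (simp only: G.word_val_replicate[OF h] gen_map_def gen.case G.word_val_Nil)
    next
      case 2
      thus ?thesis using t t3 by (simp add: gen_map_def del: mult_Aut one_Aut)
    next
      case 3
      thus ?thesis using s t rel by (simp add: gen_map_def G.word_val_replicate_inv[OF h] del: mult_Aut one_Aut pow_Aut)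
    qed
  next
    fix g assume "g \<in> carrier ?G"
    then obtain A :: "'k^3^3" where A: "g = pgl A" "preserves (nf4 d) A" by (auto simp: carrier_Aut)
    have diag: "\<exists>i<?N. pgl (diag3 a b c) = s [^]\<^bsub>?G\<^esub> i" if pd: "preserves (nf4 d) (diag3 a b c)" for a b c :: 'k
    proof -
      obtain y where y: "pgl (diag3 a b c) = pgl (diag3 1 y (inverse (y ^ (d - 2))))" "y ^ ?N = 1"
        using preserves_nf4_diag3[OF d4 pd] by blast
      obtain i where i: "i < ?N" "y = \<xi> ^ i" using primitive_root_powers[OF \<xi> y(2)] by blast
      have "inverse (y ^ (d - 2)) = inverse (\<xi> ^ (d - 2)) ^ i" by (simp add: i(2) power_inverse power_swap[of \<xi> i])
      thus ?thesis using i y(1) sp by metis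
    qed
    have c3': "cyc3 ** (cyc3 ** (cyc3 ** B)) = B" for B :: "'k^3^3"
      by (simp add: matrix_mul_assoc cyc3_cubed)
    obtain a b c where "A = diag3 a b c \<or> A = cyc3 ** diag3 a b c \<or> A = cyc3 ** cyc3 ** diag3 a b c"
      using preserves_nf4_monomial[OF d A(2)] by blast
    moreover note P = preserves_mult[OF preserves_cyc3]
    moreover have "preserves (nf4 d) (cyc3 ** A)" "preserves (nf4 d) (cyc3 ** (cyc3 ** A))" using P A(2) by blast+
    ultimately have PD: "preserves (nf4 d) (diag3 a b c)" using A(2) c3' by (auto simp: matrix_mul_assoc[symmetric])
    hence iD': "invertible (diag3 a b c)" by (rule preserves_invertible)
    obtain i where i: "i < ?N" "pgl (diag3 a b c) = s [^]\<^bsub>?G\<^esub> i" using diag[OF PD] by blast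
    have "\<exists>j::nat. j < 3 \<and> g = t [^]\<^bsub>?G\<^esub> j \<otimes>\<^bsub>?G\<^esub> pgl (diag3 a b c)"
    proof -
      from \<open>A = diag3 a b c \<or> A = cyc3 ** diag3 a b c \<or> A = cyc3 ** cyc3 ** diag3 a b c\<close>
      consider "A = diag3 a b c" | "A = cyc3 ** diag3 a b c" | "A = cyc3 ** cyc3 ** diag3 a b c" by blast
      thus ?thesis
      proof cases
        case 1
        have "g = t [^]\<^bsub>?G\<^esub> (0::nat) \<otimes>\<^bsub>?G\<^esub> pgl (diag3 a b c)"
          using 1 A(1) iD' by (simp add: one_PGL3 pgl_mult invertible_mat)
        thus ?thesis by (intro exI[of _ 0]) simp
      next
        case 2
        have "g = t [^]\<^bsub>?G\<^esub> (1::nat) \<otimes>\<^bsub>?G\<^esub> pgl (diag3 a b c)"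
          unfolding tp using 2 A(1) iD' by (simp add: pgl_mult invertible_cyc3)
        thus ?thesis by (intro exI[of _ 1]) simp
      next
        case 3
        have "g = t [^]\<^bsub>?G\<^esub> (2::nat) \<otimes>\<^bsub>?G\<^esub> pgl (diag3 a b c)"
          unfolding tp using 3 A(1) iD' by (simp add: pgl_mult invertible_mult invertible_cyc3)
        thus ?thesis by (intro exI[of _ 2]) simp
      qed
    qed
    thus "\<exists>i<?N. \<exists>j<(3::nat). g = t [^]\<^bsub>?G\<^esub> j \<otimes>\<^bsub>?G\<^esub> s [^]\<^bsub>?G\<^esub> i" using i by metis
  next
    fix i j :: nat assume "0 < j" "j < 3"
    hence "j = 1 \<or> j = 2" by auto
    thus "t [^]\<^bsub>?G\<^esub> j \<noteq> s [^]\<^bsub>?G\<^esub> i"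
    proof
      assume j: "j = 1"
      show ?thesis unfolding sp j tp by (rule pgl_cyc3_powers_not_diag3)
    next
      assume j: "j = 2"
      show ?thesis unfolding sp j tp by (rule pgl_cyc3_powers_not_diag3)
    qed
  qed (use s t in \<open>auto intro: word_eq.relation simp: numeral_3_eq_3\<close>)
  thus ?thesis by (simp add: H_Klein_def klein_order[OF d4])
qed

subsection \<open>The Fermat quartic\<close>

definition fermat4 :: "'k::comm_ring_1 poly3"
  where "fermat4 = varX ^ 4 + varY ^ 4 + varZ ^ 4"

text \<open>With Y = (U+V)/2 and Z = (U-V)/2 the binary part Y^3 Z + Y Z^3 becomes (U^4 - V^4)/8.
  The constants a and b with a^4 = 8 and b^4 = -8 turn this into a sum of fourth powers.\<close>

lemma nf3_4_fermat: "K_isomorphic (nf3 4) (fermat4 :: 'k::{alg_closed_field,field_char_0} poly3)"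
proof -
  obtain a :: 'k where a: "a ^ 4 = 8" using nth_root_exists[of 4] by auto
  obtain b :: 'k where b: "b ^ 4 = -8" using nth_root_exists[of 4] by auto
  have nz: "a \<noteq> 0" "b \<noteq> 0" using a b by auto
  define A :: "'k^3^3" where "A = vector [vector [1, 0, 0], vector [0, a / 2, b / 2], vector [0, a / 2, - b / 2]]"
  have Av: "A *v v = vector [v$1, (a * v$2 + b * v$3) / 2, (a * v$2 - b * v$3) / 2]" for v
    by (simp add: A_def vec_eq_iff forall_3 matrix_vector_mult_def sum3 add_divide_distrib diff_divide_distrib)
  have *: "((U + V) / 2) ^ 3 * ((U - V) / 2) + (U + V) / 2 * ((U - V) / 2) ^ 3 = (U ^ 4 - V ^ 4) / 8" for U V :: 'k
    by (simp add: power_divide field_simps eval_nat_numeral)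
  have "eval3 (nf3 4) (A *v v) = 1 * eval3 fermat4 v" for v
  proof -
    let ?U = "a * v$2" and ?V = "b * v$3"
    have "eval3 (nf3 4) (A *v v) = (v$1) ^ 4 + (((?U + ?V) / 2) ^ 3 * ((?U - ?V) / 2) + (?U + ?V) / 2 * ((?U - ?V) / 2) ^ 3)"
      unfolding Av nf3_def by (simp del: times_divide_eq_left times_divide_eq_right)
    also have "\<dots> = (v$1) ^ 4 + (?U ^ 4 - ?V ^ 4) / 8" unfolding * ..
    also have "?U ^ 4 - ?V ^ 4 = 8 * ((v$2) ^ 4 + (v$3) ^ 4)" by (simp add: power_mult_distrib a b algebra_simps)
    finally show ?thesis by (simp add: fermat4_def)
  qed
  moreover have "invertible A" using nz by (simp add: invertible_det3 A_def)
  ultimately show ?thesis unfolding K_isomorphic_iff by (intro exI[of _ A] exI[of _ 1]) simp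
qed

lemma dd_numeral [simp]: "dd v (numeral n) = 0"
  using dd_of_nat[of v "numeral n"] by simp

lemma dd2_fermat4:
  "dd u (dd v fermat4) = const3 (12 * (u$1 * v$1)) * varX ^ 2 + const3 (12 * (u$2 * v$2)) * varY ^ 2 +
    const3 (12 * (u$3 * (v$3 :: 'k::field_char_0))) * varZ ^ 2"
  by (rule eval3_inject) (simp add: fermat4_def algebra_simps power2_eq_square)

lemma dd2_fermat4_eq_0_iff: "dd u (dd v fermat4) = 0 \<longleftrightarrow> (\<forall>i. u$i * v$i = (0 :: 'k::field_char_0))"
proof
  assume "dd u (dd v fermat4) = 0"
  hence *: "eval3 (dd u (dd v fermat4)) x = 0" for x by simp
  show "\<forall>i. u$i * v$i = 0"
    using *[of "vector [1, 0, 0]"] *[of "vector [0, 1, 0]"] *[of "vector [0, 0, 1]"]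
    unfolding dd2_fermat4 forall_3 by simp
next
  assume "\<forall>i. u$i * v$i = 0"
  hence "u$1 * v$1 = 0" "u$2 * v$2 = 0" "u$3 * v$3 = 0" by blast+
  thus "dd u (dd v fermat4) = 0" unfolding dd2_fermat4 by (simp only:) simp
qed

text \<open>D_u D_v F = 0 says that u and v have disjoint supports. The columns of A are therefore
  pairwise disjointly supported and nonzero, which makes A monomial.\<close>

lemma preserves_fermat4_monomial:
  fixes A :: "'k::field_char_0^3^3"
  assumes A: "preserves fermat4 A"
  shows "\<exists>\<pi>. bij \<pi> \<and> (\<forall>i j. A$i$j \<noteq> 0 \<longleftrightarrow> i = \<pi> j)"
proof -
  have "A *v axis j 1 \<noteq> 0" for j
    using invertible_mult_vec_eq_0[OF preserves_invertible[OF A], of "axis j 1"] by auto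
  hence "\<exists>i. A$i$j \<noteq> 0" for j by (auto simp: vec_eq_iff mult_axis_nth)
  then obtain \<pi> where \<pi>: "\<And>j. A$(\<pi> j)$j \<noteq> 0" by metis
  have disj: "A$i$j * A$i$j' = 0" if "j \<noteq> j'" for i j j'
  proof -
    have "axis j 1 $ i * axis j' 1 $ i = (0 :: 'k)" for i using that by (simp add: axis_def)
    hence "dd (axis j 1) (dd (axis j' 1) fermat4) = (0 :: 'k poly3)" unfolding dd2_fermat4_eq_0_iff by blast
    hence "dd (A *v axis j 1) (dd (A *v axis j' 1) fermat4) = 0" using preserves_dd2[OF A] by blast
    thus ?thesis unfolding dd2_fermat4_eq_0_iff mult_axis_nth by blast
  qed
  have "inj \<pi>"
  proof (rule injI)
    fix j j' assume "\<pi> j = \<pi> j'"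
    hence "A$(\<pi> j)$j * A$(\<pi> j)$j' \<noteq> 0" using \<pi>[of j] \<pi>[of j'] by simp
    thus "j = j'" using disj by blast
  qed
  hence bij: "bij \<pi>" by (simp add: bij_def finite_UNIV_inj_surj)
  moreover have "A$i$j \<noteq> 0 \<longleftrightarrow> i = \<pi> j" for i j
  proof
    assume n: "A$i$j \<noteq> 0"
    obtain j' where j': "i = \<pi> j'" using bij by (metis bij_pointE)
    have "A$i$j * A$i$j' \<noteq> 0" using n \<pi>[of j'] j' by simp
    hence "j = j'" using disj by blast
    thus "i = \<pi> j" using j' by simp
  qed (use \<pi> in simp)
  ultimately show ?thesis by blast
qed

text \<open>Translates the index type into the set 1, 2, 3 on which \<open>sym_group 3\<close>
  acts.\<close>

definition idx :: "3 \<Rightarrow> nat"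
  where "idx i = (if i = 1 then 1 else if i = 2 then 2 else 3)"

lemma idx_simps [simp]: "idx 1 = 1" "idx 2 = 2" "idx 3 = 3"
  by (simp_all add: idx_def)

lemma idx_inj: "idx i = idx j \<longleftrightarrow> i = j"
  using exhaust_3[of i] exhaust_3[of j] by auto

lemma idx_mem: "idx i \<in> {1..3}"
  using exhaust_3[of i] by auto

lemma idx_surj: "n \<in> {1..3} \<Longrightarrow> \<exists>i. n = idx i"
proof -
  assume "n \<in> {1..3}"
  hence "n = 1 \<or> n = 2 \<or> n = 3" by auto
  thus ?thesis using idx_simps by metis
qed

text \<open>The exponent vector (0, a, b) of a normalised diagonal matrix, the \<open>e\<close>
  inside \<open>coord_perm_action\<close>.\<close>

definition fexp :: "int \<times> int \<Rightarrow> nat \<Rightarrow> int"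
  where "fexp v j = (if j = 1 then 0 else if j = 2 then fst v else snd v)"

text \<open>The permutation \<open>s\<close> of the coordinates followed by \<open>diag(1, \<iota>\<^sup>a, \<iota>\<^sup>b)\<close>, for \<open>x = ((a, b), s)\<close>.\<close>

definition fmat :: "'k::field \<Rightarrow> (int \<times> int) \<times> (nat \<Rightarrow> nat) \<Rightarrow> 'k^3^3"
  where "fmat \<iota> x = (\<chi> i j. if idx i = snd x (idx j) then \<iota> powi (fexp (fst x) (idx i)) else 0)"

lemma fmat_nth: "fmat \<iota> x $ i $ j = (if idx i = snd x (idx j) then \<iota> powi (fexp (fst x) (idx i)) else 0)"
  by (simp add: fmat_def)

context
  fixes \<iota> :: "'k::field_char_0"
  assumes \<iota>: "primitive_root 4 \<iota>"
begin

lemma iota_nz: "\<iota> \<noteq> 0"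
  using \<iota> by (auto simp: primitive_root_def)

lemma iota_powi_4: "(\<iota> powi k) ^ 4 = 1" "\<iota> powi (4 * k) = 1"
proof -
  have i4: "\<iota> powi 4 = 1" using \<iota> by (simp add: primitive_root_def)
  show *: "\<iota> powi (4 * k) = 1" unfolding power_int_mult i4 by simp
  have "(\<iota> powi k) ^ 4 = (\<iota> powi k) powi 4" by simp
  also have "\<dots> = \<iota> powi (k * 4)" by (simp only: power_int_mult)
  finally show "(\<iota> powi k) ^ 4 = 1" using * by (simp add: mult.commute)
qed

lemma iota_mod: "\<iota> powi (k mod 4) = \<iota> powi k"
proof -
  have "\<iota> powi k = \<iota> powi (4 * (k div 4) + k mod 4)" by simp
  also have "\<dots> = \<iota> powi (4 * (k div 4)) * \<iota> powi (k mod 4)"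
    by (rule power_int_add) (simp add: iota_nz)
  finally show ?thesis unfolding iota_powi_4(2) by simp
qed

lemma iota_inj: "a \<in> {0..<4} \<Longrightarrow> b \<in> {0..<4} \<Longrightarrow> \<iota> powi a = \<iota> powi b \<Longrightarrow> a = b"
proof -
  assume "a \<in> {0..<4}" "b \<in> {0..<4}" "\<iota> powi a = \<iota> powi b"
  hence "nat a < 4" "nat b < 4" "\<iota> ^ nat a = \<iota> ^ nat b" "a \<ge> 0" "b \<ge> 0" by (auto simp: power_int_def)
  thus "a = b" using primitive_root_power_inj[OF \<iota>] by (metis eq_nat_nat_iff)
qed

lemma invertible_fmat:
  assumes "s permutes {1..3}"
  shows "preserves fermat4 (fmat \<iota> (v, s))"
proof -
  have s: "inj s" using assms permutes_inj by blast
  have ex: "\<exists>j. idx i = s (idx j)" for i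
  proof -
    have "idx i \<in> s ` {1..3}" using permutes_image[OF assms] idx_mem by simp
    thus ?thesis using idx_surj by blast
  qed
  then obtain g where g: "\<And>i. idx i = s (idx (g i))" by metis
  have g': "idx i = s (idx j) \<longleftrightarrow> j = g i" for i j using g s by (metis idx_inj injD)
  have "inj g" by (rule injI) (metis g idx_inj)
  hence bij: "bij g" by (simp add: bij_def finite_UNIV_inj_surj)
  have row: "(fmat \<iota> (v, s) *v x) $ i = \<iota> powi (fexp v (idx i)) * x $ g i" for x i
    by (simp add: matrix_vector_mult_def fmat_nth g' if_distrib[of "\<lambda>u. u * _"] cong: if_cong)
  have ev: "eval3 fermat4 x = (\<Sum>i\<in>UNIV. x $ i ^ 4)" for x :: "'k^3" by (simp add: fermat4_def sum3)
  have "eval3 fermat4 (fmat \<iota> (v, s) *v x) = eval3 fermat4 x" for x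
    unfolding ev row power_mult_distrib iota_powi_4(1) mult_1_left
    by (rule sum.reindex_bij_betw[OF bij, of "\<lambda>i. x $ i ^ 4"])
  moreover have "invertible (fmat \<iota> (v, s))"
  proof -
    have "x = 0" if "fmat \<iota> (v, s) *v x = 0" for x
    proof -
      have "\<iota> powi (fexp v (idx i)) * x $ g i = 0" for i using that row[of x i] by simp
      hence "x $ g i = 0" for i using iota_nz by simp
      hence "x $ j = 0" for j using bij by (metis bij_pointE)
      thus ?thesis by (simp add: vec_eq_iff)
    qed
    thus ?thesis using matrix_left_invertible_ker[of "fmat \<iota> (v, s)"] invertible_left_inverse by blast
  qed
  ultimately show ?thesis unfolding preserves_iff by (intro conjI exI[of _ 1]) auto
qed

text \<open>Permuting the exponents may put a nonzero one in first place. Subtracting it is the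
  normalisation in \<open>coord_perm_action\<close> and costs the constant last factor.\<close>

lemma fexp_action:
  assumes "s permutes {1..3}" "n \<in> {1..3}"
  shows "\<iota> powi (fexp (coord_perm_action s v) n) =
    \<iota> powi (fexp v (inv_into UNIV s n)) * \<iota> powi (- fexp v (inv_into UNIV s 1))"
proof -
  have act: "coord_perm_action s v = ((fexp v (inv_into UNIV s 2) - fexp v (inv_into UNIV s 1)) mod 4,
     (fexp v (inv_into UNIV s 3) - fexp v (inv_into UNIV s 1)) mod 4)"
    by (simp add: coord_perm_action_def fexp_def Let_def)
  have "n = 1 \<or> n = 2 \<or> n = 3" using assms(2) by auto
  thus ?thesis unfolding act
    by (elim disjE) (simp_all add: fexp_def[of "(_, _)"] iota_mod iota_nz flip: power_int_add)
qed

text \<open>The scalar in front is the first exponent that the normalisation removes, so the product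
  law of the semidirect product holds in \<open>PGL3\<close> and not for the matrices
  themselves.\<close>

lemma fmat_mult:
  assumes s: "s permutes {1..3}" and t: "t permutes {1..3}"
  shows "fmat \<iota> (v, s) ** fmat \<iota> (w, t) = mat (\<iota> powi (fexp w (inv_into UNIV s 1))) **
    fmat \<iota> (((fst v + fst (coord_perm_action s w)) mod 4, (snd v + snd (coord_perm_action s w)) mod 4), s \<circ> t)"
  unfolding mat_mult_scale vec_eq_iff
proof (intro allI)
  fix i k :: 3
  let ?u = "((fst v + fst (coord_perm_action s w)) mod 4, (snd v + snd (coord_perm_action s w)) mod 4)"
  have inv: "inv_into UNIV s (s m) = m" for m using s by (simp add: permutes_inverses)
  obtain j where j: "t (idx k) = idx j" using idx_surj permutes_in_image[OF t] idx_mem by metis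
  have "(fmat \<iota> (v, s) ** fmat \<iota> (w, t)) $ i $ k = (\<Sum>m\<in>UNIV. fmat \<iota> (v, s) $ i $ m * fmat \<iota> (w, t) $ m $ k)"
    by (simp add: matrix_matrix_mult_def)
  also have "\<dots> = (\<Sum>m\<in>UNIV. if m = j then fmat \<iota> (v, s) $ i $ j * \<iota> powi (fexp w (idx j)) else 0)"
    by (rule sum.cong) (auto simp: fmat_nth j idx_inj)
  also have "\<dots> = fmat \<iota> (v, s) $ i $ j * \<iota> powi (fexp w (idx j))" by simp
  also have "\<dots> = (if idx i = s (t (idx k)) then \<iota> powi (fexp v (idx i)) * \<iota> powi (fexp w (inv_into UNIV s (idx i))) else 0)"
    using inv by (auto simp: fmat_nth j)
  also have "\<dots> = \<iota> powi (fexp w (inv_into UNIV s 1)) * fmat \<iota> (?u, s \<circ> t) $ i $ k"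
  proof -
    have "\<iota> powi (fexp ?u (idx i)) = \<iota> powi (fexp v (idx i)) * \<iota> powi (fexp (coord_perm_action s w) (idx i))"
      using iota_nz by (auto simp: fexp_def iota_mod power_int_add)
    also have "\<dots> = \<iota> powi (fexp v (idx i)) * (\<iota> powi (fexp w (inv_into UNIV s (idx i))) * \<iota> powi (- fexp w (inv_into UNIV s 1)))"
      unfolding fexp_action[OF s idx_mem] ..
    finally have e: "\<iota> powi (fexp w (inv_into UNIV s 1)) * \<iota> powi (fexp ?u (idx i)) = \<iota> powi (fexp v (idx i)) * \<iota> powi (fexp w (inv_into UNIV s (idx i)))"
      using iota_nz by (simp add: power_int_minus)
    show ?thesis
    proof (cases "idx i = s (t (idx k))")
      case True
      show ?thesis unfolding fmat_nth fst_conv snd_conv o_apply if_P[OF True] e ..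
    qed (simp add: fmat_nth)
  qed
  finally show "(fmat \<iota> (v, s) ** fmat \<iota> (w, t)) $ i $ k = (\<chi> i j. \<iota> powi (fexp w (inv_into UNIV s 1)) * fmat \<iota> (?u, s \<circ> t) $ i $ j) $ i $ k"
    by simp
qed

lemma fmat_pgl_inj:
  assumes "s permutes {1..3}" "t permutes {1..3}" "pgl (fmat \<iota> (v, s)) = pgl (fmat \<iota> (w, t))"
    "fst v \<in> {0..<4}" "snd v \<in> {0..<4}" "fst w \<in> {0..<4}" "snd w \<in> {0..<4}"
  shows "v = w \<and> s = t"
proof -
  obtain c where c: "c \<noteq> 0" "fmat \<iota> (v, s) = mat c ** fmat \<iota> (w, t)" using assms(3) by (auto simp: pgl_eq_iff)
  hence eq: "fmat \<iota> (v, s) $ i $ j = c * fmat \<iota> (w, t) $ i $ j" for i j by (simp add: mat_mult_scale)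
  have p0: "\<iota> powi k \<noteq> 0" for k using iota_nz by simp
  have "idx i = s (idx j) \<longleftrightarrow> idx i = t (idx j)" for i j
    using eq[of i j] c(1) p0 by (auto simp: fmat_nth split: if_splits)
  hence "s (idx j) = t (idx j)" for j using idx_surj permutes_in_image[OF assms(1)] idx_mem by metis
  hence "s n = t n" for n using idx_surj permutes_not_in[OF assms(1)] permutes_not_in[OF assms(2)] by metis
  hence st: "s = t" by blast
  have e: "\<iota> powi (fexp v (idx i)) = c * \<iota> powi (fexp w (idx i))" for i
  proof -
    have "idx i \<in> s ` {1..3}" using permutes_image[OF assms(1)] idx_mem by simp
    then obtain j where "idx i = s (idx j)" using idx_surj by blast
    thus ?thesis using eq[of i j] st by (simp add: fmat_nth)
  qed
  \<comment> \<open>The first exponent is 0 on both sides, which fixes the scalar.\<close>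
  have "c = 1" using e[of 1] by (simp add: fexp_def)
  hence "\<iota> powi (fst v) = \<iota> powi (fst w)" "\<iota> powi (snd v) = \<iota> powi (snd w)" using e[of 2] e[of 3] by (simp_all add: fexp_def)
  hence "v = w" using iota_inj assms(4-7) by (auto simp: prod_eq_iff)
  thus ?thesis using st by simp
qed

lemma fmat_surj:
  assumes A: "preserves fermat4 A"
  shows "\<exists>v s. fst v \<in> {0..<4} \<and> snd v \<in> {0..<4} \<and> s permutes {1..3} \<and> pgl A = pgl (fmat \<iota> (v, s))"
proof -
  obtain \<pi> where \<pi>: "bij \<pi>" "\<And>i j. A$i$j \<noteq> 0 \<longleftrightarrow> i = \<pi> j" using preserves_fermat4_monomial[OF A] by blast
  define g where "g = inv_into UNIV \<pi>"
  have g: "\<pi> (g i) = i" "g (\<pi> j) = j" for i j using \<pi>(1) by (simp_all add: g_def bij_is_surj surj_f_inv_f bij_is_inj)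
  \<comment> \<open>The only nonzero entry of row i. All these entries have the same fourth power,
    so their ratios are powers of \<open>\<iota>\<close>.\<close>
  define w where "w i = A$i$(g i)" for i
  have w0: "w i \<noteq> 0" for i using \<pi>(2) g by (simp add: w_def)
  obtain l where l: "\<forall>x. eval3 fermat4 (A *v x) = l * eval3 fermat4 x" using A unfolding preserves_iff by blast
  have wl: "w i ^ 4 = l" for i
  proof -
    have "(A *v axis (g i) 1) $ m = (if m = i then w i else 0)" for m
      using \<pi>(2)[of m "g i"] g by (auto simp: mult_axis_nth w_def)
    hence "eval3 fermat4 (A *v axis (g i) 1) = w i ^ 4" using exhaust_3[of i] by (auto simp: fermat4_def)
    moreover have "eval3 fermat4 (axis (g i) 1 :: 'k^3) = 1" using exhaust_3[of "g i"] by (auto simp: fermat4_def axis_def)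
    ultimately show ?thesis using l by simp
  qed
  have ex: "\<exists>k\<in>{0..<4}. w i / w 1 = \<iota> powi k" for i
  proof -
    have "w 1 ^ 4 \<noteq> 0" using w0[of 1] by simp
    hence "(w i / w 1) ^ 4 = 1" using wl[of i] wl[of 1] by (simp add: power_divide)
    then obtain k where "k < 4" "w i / w 1 = \<iota> ^ k" using primitive_root_powers[OF \<iota>] by blast
    thus ?thesis by (intro bexI[of _ "int k"]) auto
  qed
  obtain a where a: "a \<in> {0..<4}" "w 2 / w 1 = \<iota> powi a" using ex by blast
  obtain b where b: "b \<in> {0..<4}" "w 3 / w 1 = \<iota> powi b" using ex by blast
  have wi: "w i = w 1 * \<iota> powi (fexp (a, b) (idx i))" for i
    using exhaust_3[of i] a b w0[of 1] by (auto simp: fexp_def field_simps)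
  \<comment> \<open>\<open>\<pi>\<close> transported along \<open>idx\<close> and extended by the
    identity outside 1, 2, 3.\<close>
  define s where "s n = (if n \<in> {1..3} then idx (\<pi> (SOME j. n = idx j)) else n)" for n
  have sidx: "s (idx j) = idx (\<pi> j)" for j
    using idx_mem[of j] by (simp add: s_def idx_inj del: atLeastAtMost_iff)
  have "s permutes {1..3}"
  proof (rule bij_imp_permutes)
    have im: "s ` {1..3} \<subseteq> {1..3}" using idx_surj sidx idx_mem by (metis image_subsetI)
    have "inj_on s {1..3}"
    proof (rule inj_onI)
      fix x y assume "x \<in> {1..3}" "y \<in> {1..3}" "s x = s y"
      then obtain i j where "x = idx i" "y = idx j" "idx (\<pi> i) = idx (\<pi> j)" using idx_surj sidx by metis
      thus "x = y" using g idx_inj by metis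
    qed
    thus "bij_betw s {1..3} {1..3}" using im by (simp add: bij_betw_def endo_inj_surj)
    show "s x = x" if "x \<notin> {1..3}" for x using that by (simp only: s_def if_False)
  qed
  moreover have "A = mat (w 1) ** fmat \<iota> ((a, b), s)"
    unfolding mat_mult_scale vec_eq_iff
  proof (intro allI)
    fix i j
    show "A $ i $ j = (\<chi> i j. w 1 * fmat \<iota> ((a, b), s) $ i $ j) $ i $ j"
    proof (cases "i = \<pi> j")
      case True
      hence "j = g i" using g by simp
      hence "A $ i $ j = w i" by (simp add: w_def)
      also have "\<dots> = w 1 * \<iota> powi (fexp (a, b) (idx i))" by (rule wi)
      finally show ?thesis using True by (simp add: fmat_nth sidx)
    next
      case False
      thus ?thesis using \<pi>(2)[of i j] by (simp add: fmat_nth sidx idx_inj)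
    qed
  qed
  hence "pgl A = pgl (fmat \<iota> ((a, b), s))" using w0[of 1] pgl_eq_iff by blast
  ultimately show ?thesis using a b by (intro exI[of _ "(a, b)"] exI[of _ s]) simp
qed

end

lemma Aut_fermat4:
  "Aut (fermat4 :: 'k::{alg_closed_field,field_char_0} poly3) \<cong> Fermat_quartic_group"
proof -
  obtain \<iota> :: 'k where \<iota>: "primitive_root 4 \<iota>" using ex_primitive_root[of 4] by auto
  let ?H = "Fermat_quartic_group" and ?G = "Aut (fermat4 :: 'k poly3)"
  define f where "f x = pgl (fmat \<iota> x)" for x
  have carr: "carrier ?H = ({0..<4} \<times> {0..<4}) \<times> {s. s permutes {1..3}}"
    by (simp add: Fermat_quartic_group_def semidirect_def carrier_integer_mod_group sym_group_def DirProd_def)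
  have mult: "(v, s) \<otimes>\<^bsub>?H\<^esub> (w, t) = (((fst v + fst (coord_perm_action s w)) mod 4, (snd v + snd (coord_perm_action s w)) mod 4), s \<circ> t)" for v s w t
    by (simp add: Fermat_quartic_group_def semidirect_def DirProd_def sym_group_def case_prod_unfold)
  have "f \<in> hom ?H ?G"
  proof (rule homI)
    fix x assume "x \<in> carrier ?H"
    thus "f x \<in> carrier ?G" using invertible_fmat[OF \<iota>] unfolding carr f_def carrier_Aut by auto
  next
    fix x y assume x: "x \<in> carrier ?H" and y: "y \<in> carrier ?H"
    obtain v s w t where xy: "x = (v, s)" "y = (w, t)" by (cases x; cases y) auto
    have s: "s permutes {1..3}" and t: "t permutes {1..3}" using x y unfolding carr xy by auto
    note i = preserves_invertible[OF invertible_fmat[OF \<iota>]]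
    have "f x \<otimes>\<^bsub>?G\<^esub> f y = pgl (fmat \<iota> (v, s) ** fmat \<iota> (w, t))"
      using s t i by (simp add: f_def xy pgl_mult)
    also have "\<dots> = f (x \<otimes>\<^bsub>?H\<^esub> y)"
      unfolding f_def xy mult pgl_eq_iff fmat_mult[OF \<iota> s t] using iota_nz[OF \<iota>]
      by (intro exI[of _ "\<iota> powi (fexp w (inv_into UNIV s 1))"]) simp
    finally show "f (x \<otimes>\<^bsub>?H\<^esub> y) = f x \<otimes>\<^bsub>?G\<^esub> f y" ..
  qed
  moreover have "bij_betw f (carrier ?H) (carrier ?G)"
    unfolding bij_betw_def
  proof
    show "inj_on f (carrier ?H)"
    proof (rule inj_onI)
      fix x y assume x: "x \<in> carrier ?H" and y: "y \<in> carrier ?H" and eq: "f x = f y"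
      obtain v s w t where xy: "x = (v, s)" "y = (w, t)" by (cases x; cases y) auto
      show "x = y" using fmat_pgl_inj[OF \<iota>, of s t v w] x y eq unfolding carr xy f_def by auto
    qed
    show "f ` carrier ?H = carrier ?G"
    proof
      show "f ` carrier ?H \<subseteq> carrier ?G" using calculation by (auto simp: hom_def)
      show "carrier ?G \<subseteq> f ` carrier ?H"
      proof
        fix g assume "g \<in> carrier ?G"
        then obtain A where A: "g = pgl A" "preserves fermat4 A" by (auto simp: carrier_Aut)
        obtain v s where "fst v \<in> {0..<4}" "snd v \<in> {0..<4}" "s permutes {1..3}" "pgl A = pgl (fmat \<iota> (v, s))"
          using fmat_surj[OF \<iota> A(2)] by blast
        moreover from this have "(v, s) \<in> carrier ?H" unfolding carr by (auto simp: mem_Times_iff)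
        ultimately show "g \<in> f ` carrier ?H" using A(1) by (auto simp: f_def)
      qed
    qed
  qed
  moreover have "x \<otimes>\<^bsub>?H\<^esub> y \<in> carrier ?H" if "x \<in> carrier ?H" "y \<in> carrier ?H" for x y
    using that unfolding carr by (cases x; cases y) (auto simp: mult permutes_compose)
  ultimately show ?thesis by (intro bij_hom_inverse[of f]) auto
qed

subsection \<open>The sextic\<close>

text \<open>With \<open>z\<^sup>4 = -1\<close>, the zeros of \<open>Y Z (Y\<^sup>4 + Z\<^sup>4)\<close> are the vertices of an octahedron, in pairs of opposite
  ones \<open>P\<^sub>1 = 2 z Y Z\<close>, \<open>P\<^sub>2 = Z\<^sup>2 - z\<^sup>2 Y\<^sup>2\<close> and \<open>P\<^sub>3 = z\<^sup>2 Z\<^sup>2 - Y\<^sup>2\<close>.  The four forms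
  \<open>P\<^sub>1 \<plusminus> P\<^sub>2 \<plusminus> P\<^sub>3\<close> are the diagonals of the dual cube, which \<open>S\<^sub>4\<close> permutes.\<close>

definition cube_diag :: "'k::field \<Rightarrow> nat \<Rightarrow> 'k^3 \<Rightarrow> 'k"
  where "cube_diag z j v = 2 * z * v$2 * v$3 + (if j \<le> 2 then 1 else -1) * (v$3 ^ 2 - z\<^sup>2 * v$2 ^ 2) +
    (if odd j then 1 else -1) * (z\<^sup>2 * v$3 ^ 2 - v$2 ^ 2)"

text \<open>The scalar may depend on j: only the zeros of each quadratic form matter.\<close>

definition cube_acts :: "'k::field \<Rightarrow> 'k^3^3 \<Rightarrow> (nat \<Rightarrow> nat) \<Rightarrow> bool"
  where "cube_acts z A s \<longleftrightarrow> s permutes {1..4} \<and>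
    (\<forall>j\<in>{1..4}. \<exists>c. c \<noteq> 0 \<and> (\<forall>v. cube_diag z (s j) (A *v v) = c * cube_diag z j v))"

lemma cube_acts_mult:
  assumes "cube_acts z A s" "cube_acts z B t"
  shows "cube_acts z (A ** B) (s \<circ> t)"
  unfolding cube_acts_def
proof (intro conjI ballI)
  show "(s \<circ> t) permutes {1..4}" using assms by (simp add: cube_acts_def permutes_compose)
  fix j :: nat assume j: "j \<in> {1..4}"
  hence tj: "t j \<in> {1..4}" using assms(2) by (simp add: cube_acts_def permutes_in_image del: atLeastAtMost_iff)
  obtain c where c: "c \<noteq> 0" "\<forall>v. cube_diag z (t j) (B *v v) = c * cube_diag z j v" using assms(2) j unfolding cube_acts_def by blast
  obtain c' where c': "c' \<noteq> 0" "\<forall>v. cube_diag z (s (t j)) (A *v v) = c' * cube_diag z (t j) v" using assms(1) tj unfolding cube_acts_def by blast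
  have "cube_diag z ((s \<circ> t) j) (A ** B *v v) = (c' * c) * cube_diag z j v" for v
    using c c' by (simp flip: matrix_vector_mul_assoc)
  thus "\<exists>c. c \<noteq> 0 \<and> (\<forall>v. cube_diag z ((s \<circ> t) j) (A ** B *v v) = c * cube_diag z j v)"
    using c c' by (metis no_zero_divisors)
qed

lemma atLeastAtMost_1_4: "{1..4::nat} = {1, 2, 3, 4}"
  by auto

text \<open>The diagonals do not involve X, and a scalar on Y and Z multiplies each of them by
  b^2.\<close>

lemma cube_acts_scalar: "b \<noteq> 0 \<Longrightarrow> cube_acts z (diag3 a b b) id"
  unfolding cube_acts_def
proof (intro conjI ballI)
  assume b: "b \<noteq> 0"
  fix j
  show "\<exists>c. c \<noteq> 0 \<and> (\<forall>v. cube_diag z (id j) (diag3 a b b *v v) = c * cube_diag z j v)"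
    using b by (intro exI[of _ "b\<^sup>2"]) (simp add: diag3_mult_vec cube_diag_def power_mult_distrib algebra_simps power2_eq_square)
qed (rule permutes_id)

definition perm4 :: "nat \<Rightarrow> nat \<Rightarrow> nat \<Rightarrow> nat \<Rightarrow> nat \<Rightarrow> nat"
  where "perm4 a b c d j = (if j = 1 then a else if j = 2 then b else if j = 3 then c else if j = 4 then d else j)"

lemma perm4_permutes:
  assumes e: "{a, b, c, d} = {1, 2, 3, 4}"
  shows "perm4 a b c d permutes {1..4}"
proof (rule bij_imp_permutes)
  have "perm4 a b c d ` {1..4} = {a, b, c, d}"
    unfolding atLeastAtMost_1_4 image_insert image_empty by (simp add: perm4_def)
  hence im: "perm4 a b c d ` {1..4} = {1..4}" unfolding e atLeastAtMost_1_4 .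
  thus "bij_betw (perm4 a b c d) {1..4} {1..4}"
    by (simp add: bij_betw_def finite_surj_inj)
qed (auto simp: perm4_def)

text \<open>On Y and Z a rotation of order 3 of the octahedron, up to scalars, when z^4 = -1: it
  fixes the first diagonal and cycles the other three.\<close>

definition cubeH :: "'k::field \<Rightarrow> 'k^3^3"
  where "cubeH z = vector [vector [1, 0, 0], vector [0, 1, z], vector [0, z, - (z\<^sup>2)]]"

lemma cubeH_mult_vec: "cubeH z *v v = vector [v$1, v$2 + z * v$3, z * v$2 - z\<^sup>2 * v$3]"
  by (simp add: vec_eq_iff forall_3 matrix_vector_mult_def cubeH_def sum3)

text \<open>As z^2 is a primitive fourth root of unity, this is a quarter turn about the axis
  through the zeros of Y Z; it acts as a 4-cycle.\<close>

lemma cube_acts_T: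
  assumes z: "z ^ 4 = (-1 :: 'k::field_char_0)"
  shows "cube_acts z (diag3 a 1 (z\<^sup>2)) (perm4 2 4 1 3)"
  unfolding cube_acts_def
proof (intro conjI ballI)
  have z0: "z \<noteq> 0" using z by auto
  have z4: "z * (z * (z * z)) = -1" using z by (simp add: eval_nat_numeral)
  have zz: "z * (z * (z * (z * w))) = - w" for w using z4 by (simp add: mult.assoc[symmetric])
  fix j :: nat assume "j \<in> {1..4}"
  thus "\<exists>c. c \<noteq> 0 \<and> (\<forall>v. cube_diag z (perm4 2 4 1 3 j) (diag3 a 1 (z\<^sup>2) *v v) = c * cube_diag z j v)"
    unfolding atLeastAtMost_1_4 using z0
    by (intro exI[of _ "z\<^sup>2"])
      (auto simp: diag3_mult_vec cube_diag_def perm4_def algebra_simps power2_eq_square zz z4)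
qed (rule perm4_permutes, auto)

text \<open>A transposition of the first and the fourth diagonal.\<close>

lemma cube_acts_swap3:
  assumes z: "z ^ 4 = (-1 :: 'k::field_char_0)"
  shows "cube_acts z swap3 (perm4 4 2 3 1)"
  unfolding cube_acts_def
proof (intro conjI ballI)
  fix j :: nat assume "j \<in> {1..4}"
  thus "\<exists>c. c \<noteq> 0 \<and> (\<forall>v. cube_diag z (perm4 4 2 3 1 j) (swap3 *v v) = c * cube_diag z j v)"
    unfolding atLeastAtMost_1_4
    by (intro exI[of _ 1])
      (auto simp: swap3_mult_vec cube_diag_def perm4_def algebra_simps power2_eq_square)
qed (rule perm4_permutes, auto)

lemma cube_acts_H:
  assumes z: "z ^ 4 = (-1 :: 'k::field_char_0)"
  shows "cube_acts z (cubeH z) (perm4 1 4 2 3)"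
  unfolding cube_acts_def
proof (intro conjI ballI)
  have z0: "z \<noteq> 0" using z by auto
  have z4: "z * (z * (z * z)) = -1" using z by (simp add: eval_nat_numeral)
  have zz: "z * (z * (z * (z * w))) = - w" for w using z4 by (simp add: mult.assoc[symmetric])
  fix j :: nat assume "j \<in> {1..4}"
  thus "\<exists>c. c \<noteq> 0 \<and> (\<forall>v. cube_diag z (perm4 1 4 2 3 j) (cubeH z *v v) = c * cube_diag z j v)"
    unfolding atLeastAtMost_1_4 using z0
    \<comment> \<open>The scale is the determinant -2 z^2 of the block, up to a sign depending on
      the diagonal.\<close>
    by (intro exI[of _ "(if odd j then 1 else -1) * (- 2 * z\<^sup>2)"])
      (auto simp: cubeH_mult_vec cube_diag_def perm4_def algebra_simps power2_eq_square zz z4)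
qed (rule perm4_permutes, auto)

text \<open>Multiples of the four diagonals could have four different factors, but there is a linear
  relation between the diagonals. It makes the factors equal, so P1, P2 and P3 are all multiplied by
  the same k, and comparing coefficients leaves only scalar blocks.\<close>

lemma cube_diag_scalar:
  fixes z :: "'k::field_char_0"
  assumes z: "z ^ 4 = -1" and A: "cube_acts z A id" "A$2$1 = 0" "A$3$1 = 0"
  shows "A$2$3 = 0 \<and> A$3$2 = 0 \<and> A$2$2 = A$3$3"
proof -
  have z0: "z \<noteq> 0" using z by auto
  define i where "i = z\<^sup>2"
  have ii: "i * i = -1" using z by (simp add: i_def eval_nat_numeral mult.assoc)
  have iiw: "i * (i * w) = - w" for w by (simp add: mult.assoc[symmetric] ii)
  define p q r w where "p = A$2$2" "q = A$3$2" "r = A$2$3" "w = A$3$3"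
  have Av: "(A *v v)$2 = p * v$2 + r * v$3" "(A *v v)$3 = q * v$2 + w * v$3" for v
    using A(2,3) by (simp_all add: matrix_vector_mult_def sum3 p_q_r_w_def)
  have "\<forall>j\<in>{1..4}. \<exists>c. c \<noteq> 0 \<and> (\<forall>v. cube_diag z j (A *v v) = c * cube_diag z j v)"
    using A(1) by (simp add: cube_acts_def)
  then obtain c where c0: "\<And>j. j \<in> {1..4} \<Longrightarrow> c j \<noteq> 0"
    and c: "\<And>j v. j \<in> {1..4} \<Longrightarrow> cube_diag z j (A *v v) = c j * cube_diag z j v" by metis
  define P1 P2 P3 where "P1 v = 2 * z * v$2 * v$3" and "P2 v = v$3 ^ 2 - i * v$2 ^ 2" and "P3 v = i * v$3 ^ 2 - v$2 ^ 2" for v :: "'k^3"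
  have Q: "cube_diag z 1 v = P1 v + P2 v + P3 v" "cube_diag z 2 v = P1 v + P2 v - P3 v"
    "cube_diag z 3 v = P1 v - P2 v + P3 v" "cube_diag z 4 v = P1 v - P2 v - P3 v" for v
    by (simp_all add: cube_diag_def P1_def P2_def P3_def i_def)
  have q1: "P1 (A *v v) + P2 (A *v v) + P3 (A *v v) = c 1 * (P1 v + P2 v + P3 v)"
    and q2: "P1 (A *v v) + P2 (A *v v) - P3 (A *v v) = c 2 * (P1 v + P2 v - P3 v)"
    and q3: "P1 (A *v v) - P2 (A *v v) + P3 (A *v v) = c 3 * (P1 v - P2 v + P3 v)"
    and q4: "P1 (A *v v) - P2 (A *v v) - P3 (A *v v) = c 4 * (P1 v - P2 v - P3 v)" for v
  proof -
    have m: "(1::nat) \<in> {1..4}" "(2::nat) \<in> {1..4}" "(3::nat) \<in> {1..4}" "(4::nat) \<in> {1..4}" by auto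
    show "P1 (A *v v) + P2 (A *v v) + P3 (A *v v) = c 1 * (P1 v + P2 v + P3 v)"
      "P1 (A *v v) + P2 (A *v v) - P3 (A *v v) = c 2 * (P1 v + P2 v - P3 v)"
      "P1 (A *v v) - P2 (A *v v) + P3 (A *v v) = c 3 * (P1 v - P2 v + P3 v)"
      "P1 (A *v v) - P2 (A *v v) - P3 (A *v v) = c 4 * (P1 v - P2 v - P3 v)"
      using c[OF m(1), of v] c[OF m(2), of v] c[OF m(3), of v] c[OF m(4), of v] unfolding Q .
  qed
  \<comment> \<open>The first and fourth diagonal have the same sum 2 P1 as the second and third;
    the relation is applied at \<open>A *v v\<close> and expressed at \<open>v\<close>.\<close>
  have rel: "(c 1 + c 4 - c 2 - c 3) * P1 v + (c 1 - c 4) * (P2 v + P3 v) = (c 2 - c 3) * (P2 v - P3 v)" for v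
  proof -
    have "c 1 * (P1 v + P2 v + P3 v) + c 4 * (P1 v - P2 v - P3 v) = c 2 * (P1 v + P2 v - P3 v) + c 3 * (P1 v - P2 v + P3 v)"
      unfolding q1[symmetric] q2[symmetric] q3[symmetric] q4[symmetric] by simp
    thus ?thesis by (simp add: algebra_simps)
  qed
  define e2 e3 e23 :: "'k^3" where "e2 = vector [0, 1, 0]" "e3 = vector [0, 0, 1]" "e23 = vector [0, 1, 1]"
  have P: "P1 e2 = 0" "P2 e2 = - i" "P3 e2 = -1" "P1 e3 = 0" "P2 e3 = 1" "P3 e3 = i" "P1 e23 = 2 * z" "P2 e23 = 1 - i" "P3 e23 = i - 1"
    by (simp_all add: P1_def P2_def P3_def e2_e3_e23_def)
  define D E where "D = c 1 - c 4" and "E = c 2 - c 3"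
  have DE: "D * (- i - 1) = E * (1 - i)" "D * (1 + i) = E * (1 - i)"
    using rel[of e2] rel[of e3] by (simp_all add: P D_def E_def algebra_simps)
  have "2 * (D * (1 + i)) = 0" using DE by (simp add: algebra_simps)
  hence "D * (1 + i) = 0" "E * (1 - i) = 0" using DE(2) by simp_all
  moreover have "(1 + i) * (1 - i) = 2" by (simp add: algebra_simps ii)
  hence "1 + i \<noteq> 0" "1 - i \<noteq> 0" by auto
  ultimately have D: "c 4 = c 1" "c 3 = c 2" by (auto simp: D_def E_def)
  have "(c 1 + c 4 - c 2 - c 3) * (2 * z) = 0" using rel[of e23] by (simp add: P D)
  hence "2 * (c 1 - c 2) = 0" using z0 D by (simp add: algebra_simps)
  hence c12: "c 2 = c 1" by simp
  define k where "k = c 1"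
  have k0: "k \<noteq> 0" using c0[of 1] by (simp add: k_def)
  note qq = q1[folded k_def] q2[unfolded c12, folded k_def] q3[unfolded D c12, folded k_def] q4[unfolded D c12, folded k_def]
  have "2 * P1 (A *v v) = 2 * (k * P1 v)" "2 * P2 (A *v v) = 2 * (k * P2 v)" "2 * P3 (A *v v) = 2 * (k * P3 v)" for v
  proof -
    have "2 * P1 (A *v v) = (P1 (A *v v) + P2 (A *v v) + P3 (A *v v)) + (P1 (A *v v) - P2 (A *v v) - P3 (A *v v))" by simp
    thus "2 * P1 (A *v v) = 2 * (k * P1 v)" unfolding qq by (simp add: algebra_simps)
    have "2 * P2 (A *v v) = (P1 (A *v v) + P2 (A *v v) + P3 (A *v v)) - (P1 (A *v v) - P2 (A *v v) + P3 (A *v v))" by simp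
    thus "2 * P2 (A *v v) = 2 * (k * P2 v)" unfolding qq by (simp add: algebra_simps)
    have "2 * P3 (A *v v) = (P1 (A *v v) + P2 (A *v v) + P3 (A *v v)) - (P1 (A *v v) + P2 (A *v v) - P3 (A *v v))" by simp
    thus "2 * P3 (A *v v) = 2 * (k * P3 v)" unfolding qq by (simp add: algebra_simps)
  qed
  hence PA: "P1 (A *v v) = k * P1 v" "P2 (A *v v) = k * P2 v" "P3 (A *v v) = k * P3 v" for v by simp_all
  have 1: "w * w - i * (r * r) = k" "i * (w * w) - r * r = i * k"
    using PA(2,3)[of e3] unfolding P by (simp_all add: P2_def P3_def Av e2_e3_e23_def power2_eq_square mult.commute)
  have 2: "q * q - i * (p * p) = - (i * k)" "i * (q * q) - p * p = - k"
    using PA(2,3)[of e2] unfolding P by (simp_all add: P2_def P3_def Av e2_e3_e23_def power2_eq_square mult.commute)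
  \<comment> \<open>The two equations have proportional right sides; since i * i = -1, their
    combination isolates r^2, and the next one q^2.\<close>
  have "i * (w * w - i * (r * r)) = i * (w * w) - r * r" unfolding 1 ..
  hence "2 * (r * r) = 0" by (simp add: algebra_simps iiw eq_neg_iff_add_eq_0)
  hence r: "r = 0" by simp
  have "i * (i * (q * q) - p * p) = q * q - i * (p * p)" unfolding 2 by simp
  hence "2 * (q * q) = 0" by (simp add: algebra_simps iiw eq_neg_iff_add_eq_0)
  hence q: "q = 0" by simp
  have "p * w * (2 * z) = k * (2 * z)" using PA(1)[of e23] q r unfolding P by (simp add: P1_def Av e2_e3_e23_def mult.commute)
  hence "p * w = k" using z0 by simp
  moreover have "w * w = k" using 1 r by simp
  ultimately have "p = w" using k0 by (metis mult_cancel_right mult_zero_left)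
  thus ?thesis using q r by (simp add: p_q_r_w_def)
qed

lemma cube_diag_inj:
  fixes z :: "'k::field_char_0"
  assumes z: "z ^ 4 = -1" and jj: "j \<in> {1..4}" "j' \<in> {1..4}"
    and eq: "\<And>v. cube_diag z j v = c * cube_diag z j' v"
  shows "j = j'"
proof -
  have z0: "z \<noteq> 0" using z by auto
  define i where "i = z\<^sup>2"
  have "i * i = -1" using z by (simp add: i_def eval_nat_numeral mult.assoc)
  hence "(1 + i) * (1 - i) = 2" by (simp add: algebra_simps)
  hence ii: "1 + i \<noteq> 0" "1 - i \<noteq> 0" by auto
  define e where "e j = (if j \<le> 2 then 1 else -1 :: 'k)" for j :: nat
  define f where "f j = (if odd j then 1 else -1 :: 'k)" for j :: nat
  \<comment> \<open>This combination of values is the coefficient of Y Z, which is 2 z for all four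
    forms and thus forces c = 1. The two signs then identify j.\<close>
  have "cube_diag z j (vector [0, 1, 1]) - cube_diag z j (vector [0, 1, 0]) - cube_diag z j (vector [0, 0, 1]) =
    c * (cube_diag z j' (vector [0, 1, 1]) - cube_diag z j' (vector [0, 1, 0]) - cube_diag z j' (vector [0, 0, 1]))"
    by (simp add: eq algebra_simps)
  hence "2 * z = c * (2 * z)" by (simp add: cube_diag_def algebra_simps)
  hence c: "c = 1" using z0 by simp
  have 1: "e j + f j * i = e j' + f j' * i"
    using eq[of "vector [0, 0, 1]"] c by (simp add: cube_diag_def e_def f_def i_def)
  have 2: "e j * i + f j = e j' * i + f j'"
  proof -
    have "- (e j * i + f j) = - (e j' * i + f j')"
      using eq[of "vector [0, 1, 0]"] c unfolding cube_diag_def e_def[symmetric] f_def[symmetric] i_def[symmetric] by simp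
    thus ?thesis by (simp only: neg_equal_iff_equal)
  qed
  have "(e j - f j - (e j' - f j')) * (1 - i) = (e j + f j * i - (e j' + f j' * i)) - (e j * i + f j - (e j' * i + f j'))" by (simp add: algebra_simps)
  hence a: "e j - f j = e j' - f j'" using 1 2 ii by simp
  have "(e j + f j - (e j' + f j')) * (1 + i) = (e j + f j * i - (e j' + f j' * i)) + (e j * i + f j - (e j' * i + f j'))" by (simp add: algebra_simps)
  hence b: "e j + f j = e j' + f j'" using 1 2 ii by simp
  have "2 * e j = (e j - f j) + (e j + f j)" by simp
  also have "\<dots> = (e j' - f j') + (e j' + f j')" by (simp only: a b)
  also have "\<dots> = 2 * e j'" by simp
  finally have ee: "e j = e j'" by simp
  hence ff: "f j = f j'" using a by simp
  have "(j \<le> 2) = (j' \<le> 2)" using ee unfolding e_def by (auto split: if_splits)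
  moreover have "odd j = odd j'" using ff unfolding f_def by (auto split: if_splits)
  ultimately show ?thesis using jj unfolding atLeastAtMost_1_4 by auto
qed

text \<open>As A is onto, two candidates for the image of a diagonal would be proportional forms,
  hence equal.\<close>

lemma cube_acts_unique:
  fixes z :: "'k::field_char_0"
  assumes z: "z ^ 4 = -1" and A: "cube_acts z A s" "cube_acts z A t" "invertible A"
  shows "s = t"
proof
  fix j
  show "s j = t j"
  proof (cases "j \<in> {1..4}")
    case True
    obtain a where a: "a \<noteq> 0" "\<And>v. cube_diag z (s j) (A *v v) = a * cube_diag z j v" using A(1) True unfolding cube_acts_def by blast
    obtain b where b: "b \<noteq> 0" "\<And>v. cube_diag z (t j) (A *v v) = b * cube_diag z j v" using A(2) True unfolding cube_acts_def by blast
    obtain B where B: "A ** B = mat 1" using A(3) unfolding invertible_def by blast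
    have "cube_diag z (s j) v = (a / b) * cube_diag z (t j) v" for v
      using a(2)[of "B *v v"] b(2)[of "B *v v"] b(1) by (simp add: matrix_vector_mul_assoc B)
    moreover have "s j \<in> {1..4}" "t j \<in> {1..4}" using A True by (simp_all add: cube_acts_def permutes_in_image del: atLeastAtMost_iff)
    ultimately show ?thesis using cube_diag_inj[OF z] by blast
  next
    case False
    thus ?thesis using A unfolding cube_acts_def by (metis permutes_not_in)
  qed
qed


lemma cube_acts_pgl:
  fixes A :: "'k::field^3^3"
  assumes "cube_acts z A s" "pgl A = pgl B"
  shows "cube_acts z B s"
proof -
  obtain c where c: "c \<noteq> 0" "B = mat c ** A" using assms(2)[symmetric] by (auto simp: pgl_eq_iff)
  thus ?thesis using cube_acts_mult[OF cube_acts_scalar[OF c(1), of z c] assms(1)] by (simp add: mat_eq_diag3)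
qed

section \<open>Automorphisms of the sextic permute the diagonals\<close>

text \<open>The fourth derivative used for d at least 7, at the degree where Y^(d-5) Z and Y Z^(d-5)
  are both Y Z. The two conditions merge into their sum, which admits solutions that are not
  monomial.\<close>

lemma preserves_nf3_6_quartic:
  fixes A :: "'k::field_char_0^3^3"
  assumes A: "preserves (nf3 6) A"
  shows "A$2$2 * A$2$3 * (A$3$2 * A$2$3 + A$2$2 * A$3$3) = 0" "A$3$2 * A$3$3 * (A$2$2 * A$3$3 + A$3$2 * A$2$3) = 0"
    "A$2$2 * A$2$2 * A$2$3 * A$2$3 + A$3$2 * A$3$2 * A$3$3 * A$3$3 = 0"
proof -
  have d5: "6 \<ge> (5::nat)" by simp
  note blk = preserves_nf3_block[OF d5 A]
  obtain c where c: "c \<noteq> 0" "subst3 (nf3 6) A = const3 c * nf3 6" using A by (auto simp: preserves_def)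
  let ?u = "A *v axis 2 1" and ?v = "A *v axis 3 1"
  have uv: "?u $ 1 = 0" "?u $ 2 = A$2$2" "?u $ 3 = A$3$2" "?v $ 2 = A$2$3" "?v $ 3 = A$3$3" using blk by (simp_all add: mult_axis_nth)
  have z: "dd (axis 2 1) (dd (axis 2 1) (dd (axis 3 1) (dd (axis 3 1) (nf3 6)))) = (0 :: 'k poly3)"
    by (subst dd4_nf3) (simp_all add: axis_def)
  have "dd (axis 2 1) (dd (axis 2 1) (dd (axis 3 1) (dd (axis 3 1) (subst3 (nf3 6) A)))) = 0"
    unfolding c(2) dd_const3_mult z by simp
  hence "dd ?u (dd ?u (dd ?v (dd ?v (nf3 6)))) = 0"
    using subst3_eq_0_iff[OF preserves_invertible[OF A]] unfolding dd_subst3 by blast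
  hence *: "eval3 (dd ?u (dd ?u (dd ?v (dd ?v (nf3 6))))) x = 0" for x by simp
  define p q r w where "p = A$2$2" "q = A$3$2" "r = A$2$3" "w = A$3$3"
  note uv' = uv(2-5)[folded p_q_r_w_def]
  note e4 = dd4_nf3[OF uv(1), of ?v, unfolded uv']
  have "120 * (p * r * (q * r + p * w)) = 0"
    using *[of "vector [0, 1, 0]"] unfolding e4 by (simp add: algebra_simps)
  hence U: "p * r * (q * r + p * w) = 0" by simp
  have "120 * (q * w * (p * w + q * r)) = 0"
    using *[of "vector [0, 0, 1]"] unfolding e4 by (simp add: algebra_simps)
  hence V: "q * w * (p * w + q * r) = 0" by simp
  have "120 * (p * p * r * r + q * q * w * w) + 120 * (p * r * (q * r + p * w)) + 120 * (q * w * (p * w + q * r)) = 0"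
    using *[of "vector [0, 1, 1]"] unfolding e4 by (simp add: algebra_simps)
  hence "120 * (p * p * r * r + q * q * w * w) = 0" unfolding U V by simp
  hence W: "p * p * r * r + q * q * w * w = 0" by (simp del: distrib_left_numeral)
  show "A$2$2 * A$2$3 * (A$3$2 * A$2$3 + A$2$2 * A$3$3) = 0" "A$3$2 * A$3$3 * (A$2$2 * A$3$3 + A$3$2 * A$2$3) = 0"
    "A$2$2 * A$2$2 * A$2$3 * A$2$3 + A$3$2 * A$3$2 * A$3$3 * A$3$3 = 0"
    using U V W unfolding p_q_r_w_def .
qed

text \<open>Such a matrix is a power of the quarter turn times a scalar block.\<close>

lemma cube_acts_diag:
  assumes z: "z ^ 4 = (-1 :: 'k::field_char_0)" and b: "b \<noteq> 0"
  shows "\<exists>s. cube_acts z (diag3 a b (b * (z\<^sup>2) ^ m)) s"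
proof -
  have "\<exists>s. cube_acts z (diag3 a 1 ((z\<^sup>2) ^ m)) s" for a
  proof (induction m arbitrary: a)
    case 0
    show ?case using cube_acts_scalar[of 1 z a] by auto
  next
    case (Suc m)
    obtain s where "cube_acts z (diag3 1 1 ((z\<^sup>2) ^ m)) s" using Suc by blast
    from cube_acts_mult[OF cube_acts_T[OF z, of a] this] show ?case by (auto simp: diag3_mult)
  qed
  then obtain s where "cube_acts z (diag3 1 1 ((z\<^sup>2) ^ m)) s" by blast
  from cube_acts_mult[OF cube_acts_scalar[OF b, of z a] this] show ?thesis by (auto simp: diag3_mult)
qed

lemma primitive_root_4:
  assumes z: "z ^ 4 = (-1 :: 'k::field_char_0)"
  shows "primitive_root 4 (z\<^sup>2)"
proof -
  have z8: "(z\<^sup>2) ^ 2 = -1" using z by (simp flip: power_mult)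
  have "(z\<^sup>2) ^ k \<noteq> 1" if "0 < k" "k < 4" for k
  proof -
    have "k = 1 \<or> k = 2 \<or> k = 3" using that by auto
    thus ?thesis
    proof (elim disjE)
      assume k: "k = 1"
      show ?thesis
      proof
        assume "(z\<^sup>2) ^ k = 1"
        hence "(z\<^sup>2) ^ 2 = 1" unfolding k by (simp only: power_one_right power_one)
        thus False unfolding z8 by simp
      qed
    next
      assume "k = 2"
      thus ?thesis using z8 by simp
    next
      assume k: "k = 3"
      show ?thesis
      proof
        assume "(z\<^sup>2) ^ k = 1"
        hence "z\<^sup>2 * (z\<^sup>2) ^ 2 = 1" unfolding k by (simp add: eval_nat_numeral)
        hence "z\<^sup>2 = -1" unfolding z8 by (simp add: minus_equation_iff)
        thus False using z8 by simp
      qed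
    qed
  qed
  moreover have "(z\<^sup>2) ^ 4 = ((z\<^sup>2) ^ 2) ^ 2" by (simp flip: power_mult)
  hence "(z\<^sup>2) ^ 4 = 1" unfolding z8 by simp
  ultimately show ?thesis by (simp add: primitive_root_def)
qed

lemma fourth_root_of_minus_1:
  assumes "z ^ 4 = (-1 :: 'k::field_char_0)" "x ^ 4 = -1"
  obtains m where "x = z * (z\<^sup>2) ^ m"
proof -
  have z0: "z \<noteq> 0" using assms by auto
  have "(x / z) ^ 4 = 1" using assms by (simp add: power_divide)
  then obtain m where "x / z = (z\<^sup>2) ^ m" using primitive_root_powers[OF primitive_root_4[OF assms(1)]] by blast
  hence "x = z * (z\<^sup>2) ^ m" using z0 by (simp add: field_simps)
  thus thesis by (rule that)
qed

lemma cube_acts_diag_preserves: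
  assumes z: "z ^ 4 = (-1 :: 'k::field_char_0)" and P: "preserves (nf3 6) (diag3 a b c)"
  shows "\<exists>s. cube_acts z (diag3 a b c) s"
proof -
  obtain y where y: "pgl (diag3 a b c) = pgl (diag3 1 y (inverse (y ^ 5)))" "y ^ 24 = 1"
    using preserves_nf3_diag3[OF _ P] by auto
  obtain k where k: "k \<noteq> 0" "diag3 a b c = mat k ** diag3 1 y (inverse (y ^ 5))" using y(1) by (auto simp: pgl_eq_iff)
  have y0: "y \<noteq> 0" using y by auto
  have "(inverse (y ^ 6)) ^ 4 = 1" using y(2) by (simp add: power_inverse flip: power_mult)
  then obtain m where m: "inverse (y ^ 6) = (z\<^sup>2) ^ m" using primitive_root_powers[OF primitive_root_4[OF z]] by blast
  have "k * inverse (y ^ 5) = (k * y) * inverse (y ^ 6)" using y0 by (simp add: eval_nat_numeral)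
  hence eq: "k * inverse (y ^ 5) = (k * y) * (z\<^sup>2) ^ m" unfolding m .
  have "diag3 a b c = diag3 k (k * y) ((k * y) * (z\<^sup>2) ^ m)"
    by (simp only: k(2) mat_eq_diag3 diag3_mult eq mult_1_right)
  thus ?thesis using cube_acts_diag[OF z] k(1) y0 by (metis mult_eq_0_iff)
qed

text \<open>A monomial block is treated by quarter turns and the swap. Any other block factors as a
  diagonal matrix, \<open>cubeH\<close> and a diagonal matrix, with ratios of entries that are
  fourth roots of -1.\<close>

lemma cube_acts_preserves:
  fixes A :: "'k::field_char_0^3^3"
  assumes z: "z ^ 4 = -1" and A: "preserves (nf3 6) A"
  shows "\<exists>s. cube_acts z A s"
proof -
  have d5: "6 \<ge> (5::nat)" by simp
  note blk = preserves_nf3_block[OF d5 A]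
  note quart = preserves_nf3_6_quartic[OF A]
  have z0: "z \<noteq> 0" using z by auto
  show ?thesis
  proof (cases "A$2$2 * A$2$3 = 0")
    case True
    hence "A$3$2 * A$3$3 = 0" using quart(3) by auto
    hence "(A$2$3 = 0 \<and> A$3$2 = 0) \<or> (A$2$2 = 0 \<and> A$3$3 = 0)" using True blk(6) by auto
    thus ?thesis
    proof
      assume "A$2$3 = 0 \<and> A$3$2 = 0"
      hence "A = diag3 (A$1$1) (A$2$2) (A$3$3)" using blk by (simp add: vec_eq_iff forall_3 diag3_def)
      thus ?thesis using cube_acts_diag_preserves[OF z] A by metis
    next
      assume "A$2$2 = 0 \<and> A$3$3 = 0"
      hence eq: "A = swap3 ** diag3 (A$1$1) (A$3$2) (A$2$3)"
        using blk by (simp add: vec_eq_iff forall_3 matrix_matrix_mult_def swap3_def sum3 diag3_def)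
      have "swap3 ** A = diag3 (A$1$1) (A$3$2) (A$2$3)" by (subst eq) (simp add: matrix_mul_assoc swap3_square)
      hence "preserves (nf3 6) (diag3 (A$1$1) (A$3$2) (A$2$3))" using preserves_mult[OF preserves_swap3 A] by metis
      then obtain s where "cube_acts z (diag3 (A$1$1) (A$3$2) (A$2$3)) s" using cube_acts_diag_preserves[OF z] by blast
      from cube_acts_mult[OF cube_acts_swap3[OF z] this] show ?thesis using eq by metis
    qed
  next
    case False
    define p q r w where "p = A$2$2" "q = A$3$2" "r = A$2$3" "w = A$3$3"
    have pr: "p \<noteq> 0" "r \<noteq> 0" using False by (auto simp: p_q_r_w_def)
    have 1: "q * r + p * w = 0" using quart(1) False by (simp add: p_q_r_w_def)
    have 3: "p * p * r * r + q * q * w * w = 0" using quart(3) by (simp add: p_q_r_w_def)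
    define q' r' where "q' = q / p" and "r' = r / p"
    have q: "q = p * q'" and r: "r = p * r'" using pr by (simp_all add: q'_def r'_def)
    have "p * (p * q' * r' + w) = 0" using 1 unfolding q r by (simp add: algebra_simps)
    hence w: "w = - (p * q' * r')" using pr by (simp add: eq_neg_iff_add_eq_0 add.commute)
    have "p * p * r * r * (1 + q' ^ 4) = 0" using 3 unfolding w q r by (simp add: algebra_simps eval_nat_numeral)
    hence q4: "q' ^ 4 = -1" using pr by (simp add: eq_neg_iff_add_eq_0 add.commute)
    have q'0: "q' \<noteq> 0" using q4 by auto
    have r'0: "r' \<noteq> 0" using pr r by auto
    define s where "s = r' * z"
    have s0: "s \<noteq> 0" using r'0 z0 by (simp add: s_def)
    \<comment> \<open>The quartic conditions settle q / p but leave r / p open. The vertex (0, 1, z)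
      of the octahedron is on the curve, and its image must be too, which gives (z r / p)^4 =
      1.\<close>
    have "eval3 (nf3 6) (vector [0, 1, z] :: 'k^3) = z * (1 + z ^ 4)" by (simp add: nf3_def algebra_simps eval_nat_numeral)
    hence "eval3 (nf3 6) (A *v vector [0, 1, z]) = 0" using preserves_eval_dd2(3)[OF A] z by simp
    moreover have "A *v vector [0, 1, z] = vector [0, p * (1 + s), p * (q' * (1 - s))]"
      using blk by (simp add: vec_eq_iff forall_3 matrix_vector_mult_def sum3 p_q_r_w_def[symmetric] q r w s_def algebra_simps)
    ultimately have "(p * (1 + s)) ^ 5 * (p * (q' * (1 - s))) + (p * (1 + s)) * (p * (q' * (1 - s))) ^ 5 = 0"
      by (simp add: nf3_def)
    moreover have "Y ^ 5 * Z + Y * Z ^ 5 = Y * Z * (Y ^ 4 + Z ^ 4)" for Y Z :: 'k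
      by (simp add: algebra_simps eval_nat_numeral)
    ultimately have "(p * (1 + s)) * (p * (q' * (1 - s))) * ((p * (1 + s)) ^ 4 + (p * (q' * (1 - s))) ^ 4) = 0" by simp
    moreover have "(p * (1 + s)) ^ 4 + (p * (q' * (1 - s))) ^ 4 = p ^ 4 * ((1 + s) ^ 4 - (1 - s) ^ 4)"
      by (simp only: power_mult_distrib q4) (simp add: algebra_simps)
    ultimately have "(p * (1 + s)) * (p * (q' * (1 - s))) * (p ^ 4 * ((1 + s) ^ 4 - (1 - s) ^ 4)) = 0" by simp
    hence "(1 + s) * (1 - s) * ((1 + s) ^ 4 - (1 - s) ^ 4) = 0" using pr q'0 by auto
    moreover have "(1 + s) * (1 - s) * ((1 + s) ^ 4 - (1 - s) ^ 4) = 8 * s * (1 - s ^ 4)"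
      by (simp add: algebra_simps eval_nat_numeral)
    ultimately have "s ^ 4 = 1" using s0 by simp
    hence r4: "r' ^ 4 = -1" using z by (simp add: s_def power_mult_distrib minus_equation_iff)
    obtain m where m: "q' = z * (z\<^sup>2) ^ m" using fourth_root_of_minus_1[OF z q4] .
    obtain n where n: "r' = z * (z\<^sup>2) ^ n" using fourth_root_of_minus_1[OF z r4] .
    \<comment> \<open>Both ratios are z times a power of z^2; these powers are split off as the two
      diagonal factors around \<open>cubeH\<close>.\<close>
    have eq: "A = diag3 (A$1$1) p (p * (z\<^sup>2) ^ m) ** (cubeH z ** diag3 1 1 (1 * (z\<^sup>2) ^ n))"
      using blk by (simp add: vec_eq_iff forall_3 matrix_matrix_mult_def cubeH_def sum3 diag3_def p_q_r_w_def[symmetric] q r w m n algebra_simps power2_eq_square)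
    obtain s1 where s1: "cube_acts z (diag3 (A$1$1) p (p * (z\<^sup>2) ^ m)) s1" using cube_acts_diag[OF z pr(1)] by blast
    obtain s2 where s2: "cube_acts z (diag3 1 1 (1 * (z\<^sup>2) ^ n)) s2" using cube_acts_diag[OF z one_neq_zero] by blast
    from cube_acts_mult[OF s1 cube_acts_mult[OF cube_acts_H[OF z] s2]] show ?thesis using eq by metis
  qed
qed


text \<open>The permutation depends only on the class in \<open>PGL3\<close>, as
  \<open>cube_perm_eq\<close> shows, so the choice of a matrix does no harm.\<close>

definition cube_perm :: "'k::field_char_0 \<Rightarrow> ('k^3^3) set \<Rightarrow> nat \<Rightarrow> nat"
  where "cube_perm z x = (SOME s. \<exists>A. x = pgl A \<and> preserves (nf3 6) A \<and> cube_acts z A s)"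

lemma cube_perm_eq:
  fixes A :: "'k::field_char_0^3^3"
  assumes z: "z ^ 4 = -1" and A: "preserves (nf3 6) A" "cube_acts z A s"
  shows "cube_perm z (pgl A) = s"
proof -
  have "\<exists>B. pgl A = pgl B \<and> preserves (nf3 6) B \<and> cube_acts z B (cube_perm z (pgl A))"
    unfolding cube_perm_def by (rule someI[of _ s]) (use A in blast)
  then obtain B where B: "pgl A = pgl B" "cube_acts z B (cube_perm z (pgl A))" by blast
  hence "cube_acts z A (cube_perm z (pgl A))" using cube_acts_pgl[OF B(2)] by metis
  thus ?thesis using cube_acts_unique[OF z _ A(2) preserves_invertible[OF A(1)]] by blast
qed

text \<open>\<open>cubeH\<close> multiplies the binary sextic by 8 z^2; the entry a, a sixth root of
  this factor, makes X^6 scale alike.\<close>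

lemma preserves_scaled_cubeH:
  assumes z: "z ^ 4 = (-1 :: 'k::field_char_0)" and a: "a ^ 6 = 8 * z\<^sup>2"
  shows "preserves (nf3 6) (diag3 a 1 1 ** cubeH z)"
  unfolding preserves_iff
proof (intro conjI exI[of _ "8 * z\<^sup>2"] allI)
  have z0: "z \<noteq> 0" using z by auto
  have a0: "a \<noteq> 0" using a z0 by auto
  show "8 * z\<^sup>2 \<noteq> 0" using z0 by simp
  have "invertible (cubeH z)" using z0 by (simp add: invertible_det3 cubeH_def power2_eq_square)
  thus "invertible (diag3 a 1 1 ** cubeH z)" using a0 by (simp add: invertible_mult invertible_diag3)
  fix v :: "'k^3"
  define y s where "y = v$2" and "s = z * v$3"
  have "Y ^ 5 * Z + Y * Z ^ 5 = Y * Z * (Y ^ 4 + Z ^ 4)" for Y Z :: 'k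
    by (simp add: algebra_simps eval_nat_numeral)
  hence "(y + s) ^ 5 * (z * (y - s)) + (y + s) * (z * (y - s)) ^ 5 = (y + s) * (z * (y - s)) * ((y + s) ^ 4 + (z * (y - s)) ^ 4)" .
  also have "\<dots> = z * ((y + s) * (y - s) * ((y + s) ^ 4 - (y - s) ^ 4))" by (simp add: power_mult_distrib z)
  \<comment> \<open>The fourth power z^4 = -1 has produced the difference of fourth powers, which
    reproduces the sextic in y and s.\<close>
  also have "(y + s) * (y - s) * ((y + s) ^ 4 - (y - s) ^ 4) = 8 * y * s * (y ^ 4 - s ^ 4)"
    by (simp add: algebra_simps eval_nat_numeral)
  also have "s ^ 4 = - (v$3 ^ 4)" by (simp add: s_def power_mult_distrib z)
  also have "z * (8 * y * s * (y ^ 4 - - (v$3 ^ 4))) = 8 * z\<^sup>2 * (v$2 ^ 5 * v$3 + v$2 * v$3 ^ 5)"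
    by (simp add: y_def s_def algebra_simps eval_nat_numeral)
  finally have eq: "(y + s) ^ 5 * (z * (y - s)) + (y + s) * (z * (y - s)) ^ 5 = 8 * z\<^sup>2 * (v$2 ^ 5 * v$3 + v$2 * v$3 ^ 5)" .
  have "diag3 a 1 1 ** cubeH z *v v = vector [a * v$1, y + s, z * (y - s)]"
    by (simp add: cubeH_mult_vec diag3_mult_vec y_def s_def algebra_simps power2_eq_square flip: matrix_vector_mul_assoc)
  hence "eval3 (nf3 6) (diag3 a 1 1 ** cubeH z *v v) = (a * v$1) ^ 6 + ((y + s) ^ 5 * (z * (y - s)) + (y + s) * (z * (y - s)) ^ 5)"
    by (simp add: nf3_def)
  thus "eval3 (nf3 6) (diag3 a 1 1 ** cubeH z *v v) = 8 * z\<^sup>2 * eval3 (nf3 6) v"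
    unfolding eq by (simp add: nf3_def power_mult_distrib a algebra_simps)
qed

text \<open>The 3-cycle conjugates the transposition of 1 and 4 into those of 1 with 2 and with 3.
  Conjugating these by one another gives the remaining transpositions.\<close>

lemma perms4_generated:
  assumes cl: "\<And>p q. p \<in> I \<Longrightarrow> q \<in> I \<Longrightarrow> p \<circ> q \<in> I" and "id \<in> I"
    and w: "perm4 4 2 3 1 \<in> I" and h: "perm4 1 4 2 3 \<in> I" and s: "s permutes {1..4}"
  shows "s \<in> I"
proof -
  let ?w = "perm4 4 2 3 1" and ?h = "perm4 1 4 2 3"
  \<comment> \<open>As \<open>?h\<close> has order 3, its square is its inverse and both products
    are conjugates of \<open>?w\<close>.\<close>
  have "?h \<circ> ?w \<circ> ?h \<circ> ?h \<in> I" "?h \<circ> ?h \<circ> ?w \<circ> ?h \<in> I" using cl w h by blast+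
  moreover have "?h \<circ> ?w \<circ> ?h \<circ> ?h = perm4 3 2 1 4" "?h \<circ> ?h \<circ> ?w \<circ> ?h = perm4 2 1 3 4"
    by (auto simp: fun_eq_iff perm4_def)
  ultimately have 1: "perm4 3 2 1 4 \<in> I" "perm4 2 1 3 4 \<in> I" by simp_all
  have "perm4 2 1 3 4 \<circ> perm4 3 2 1 4 \<circ> perm4 2 1 3 4 \<in> I" "perm4 2 1 3 4 \<circ> ?w \<circ> perm4 2 1 3 4 \<in> I"
    "perm4 3 2 1 4 \<circ> ?w \<circ> perm4 3 2 1 4 \<in> I" using cl 1 w by blast+
  moreover have "perm4 2 1 3 4 \<circ> perm4 3 2 1 4 \<circ> perm4 2 1 3 4 = perm4 1 3 2 4"
    "perm4 2 1 3 4 \<circ> ?w \<circ> perm4 2 1 3 4 = perm4 1 4 3 2"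
    "perm4 3 2 1 4 \<circ> ?w \<circ> perm4 3 2 1 4 = perm4 1 2 4 3"
    by (auto simp: fun_eq_iff perm4_def)
  ultimately have 2: "perm4 1 3 2 4 \<in> I" "perm4 1 4 3 2 \<in> I" "perm4 1 2 4 3 \<in> I" by simp_all
  have t: "Transposition.transpose 1 2 = perm4 2 1 3 4" "Transposition.transpose 1 3 = perm4 3 2 1 4" "Transposition.transpose 1 4 = ?w"
    "Transposition.transpose 2 3 = perm4 1 3 2 4" "Transposition.transpose 2 4 = perm4 1 4 3 2" "Transposition.transpose 3 4 = perm4 1 2 4 3"
    by (auto simp: fun_eq_iff perm4_def Transposition.transpose_def)
  have tr: "Transposition.transpose a b \<in> I" if "a \<in> {1..4}" "b \<in> {1..4}" "a \<noteq> b" for a b :: nat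
  proof -
    have *: "Transposition.transpose a b \<in> I" if "a \<in> {1..4}" "b \<in> {1..4}" "a < b" for a b :: nat
    proof -
      have "(a = 1 \<and> b = 2) \<or> (a = 1 \<and> b = 3) \<or> (a = 1 \<and> b = 4) \<or> (a = 2 \<and> b = 3) \<or> (a = 2 \<and> b = 4) \<or> (a = 3 \<and> b = 4)"
        using that unfolding atLeastAtMost_1_4 by auto
      thus ?thesis using t 1 2 w by (elim disjE) metis+
    qed
    show ?thesis
    proof (cases "a < b")
      case False
      hence "Transposition.transpose b a \<in> I" using * that by simp
      thus ?thesis by (simp add: Transposition.transpose_commute)
    qed (use * that in simp)
  qed
  have "finite {1..4::nat}" by simp
  from s this show ?thesis
  proof (induction s rule: permutes_induct)
    case id
    show ?case by fact
  next
    case (swap a b p)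
    show ?case by (rule cl[OF tr]) (use swap in blast)+
  qed
qed

text \<open>\<open>cube_perm\<close> maps onto S4, and its kernel consists of the classes diag(1, b,
  b) with b^6 = 1. These commute with every block matrix, so the extension is central, and the order
  is 24 * 6.\<close>

lemma nf3_6_group:
  "central_extension (Aut (nf3 6 :: 'k::{alg_closed_field,field_char_0} poly3)) (sym_group 4) (integer_mod_group 6)"
  "order (Aut (nf3 6 :: 'k poly3)) = 144"
proof -
  obtain z :: 'k where z: "z ^ 4 = -1" using nth_root_exists[of 4 "-1"] by auto
  let ?G = "Aut (nf3 6 :: 'k poly3)"
  let ?f = "cube_perm z"
  have d5: "6 \<ge> (5::nat)" by simp
  interpret G: group ?G by (rule group_Aut)
  have f: "\<exists>s. cube_acts z A s \<and> ?f (pgl A) = s" if "preserves (nf3 6) A" for A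
    using cube_acts_preserves[OF z that] cube_perm_eq[OF z that] by blast
  have "?f \<in> hom ?G (sym_group 4)"
  proof (rule homI)
    fix x assume "x \<in> carrier ?G"
    then obtain A where "x = pgl A" "preserves (nf3 6) A" by (auto simp: carrier_Aut)
    thus "?f x \<in> carrier (sym_group 4)" using f by (auto simp: sym_group_carrier cube_acts_def)
  next
    fix x y assume "x \<in> carrier ?G" "y \<in> carrier ?G"
    then obtain A B where AB: "x = pgl A" "preserves (nf3 6) A" "y = pgl B" "preserves (nf3 6) B" by (auto simp: carrier_Aut)
    hence "cube_acts z (A ** B) (?f x \<circ> ?f y)" using f cube_acts_mult by metis
    hence "?f (pgl (A ** B)) = ?f x \<circ> ?f y" using cube_perm_eq[OF z preserves_mult] AB by blast
    thus "?f (x \<otimes>\<^bsub>?G\<^esub> y) = ?f x \<otimes>\<^bsub>sym_group 4\<^esub> ?f y"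
      using AB by (simp add: pgl_mult preserves_invertible sym_group_mult)
  qed
  then interpret F: group_hom ?G "sym_group 4" ?f
    by (intro group_hom.intro group_hom_axioms.intro group_Aut sym_group_is_group)
  have img: "?f ` carrier ?G = carrier (sym_group 4)"
  proof
    show "carrier (sym_group 4) \<subseteq> ?f ` carrier ?G"
    proof
      fix s assume "s \<in> carrier (sym_group 4)"
      hence s: "s permutes {1..4}" by (simp add: sym_group_carrier)
      obtain a :: 'k where a: "a ^ 6 = 8 * z\<^sup>2" using nth_root_exists[of 6] by auto
      have z0: "z \<noteq> 0" using z by auto
      have "cube_acts z (diag3 a 1 1 ** cubeH z) (id \<circ> perm4 1 4 2 3)"
        by (rule cube_acts_mult[OF cube_acts_scalar cube_acts_H[OF z]]) simp
      hence h: "?f (pgl (diag3 a 1 1 ** cubeH z)) = perm4 1 4 2 3"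
        using cube_perm_eq[OF z preserves_scaled_cubeH[OF z a]] by simp
      have w: "?f (pgl swap3) = perm4 4 2 3 1" using cube_perm_eq[OF z preserves_swap3 cube_acts_swap3[OF z]] .
      show "s \<in> ?f ` carrier ?G"
      proof (rule perms4_generated[OF _ _ _ _ s])
        fix p q assume "p \<in> ?f ` carrier ?G" "q \<in> ?f ` carrier ?G"
        then obtain x y where xy: "x \<in> carrier ?G" "y \<in> carrier ?G" "p = ?f x" "q = ?f y" by blast
        have "p \<circ> q = ?f (x \<otimes>\<^bsub>?G\<^esub> y)" unfolding F.hom_mult[OF xy(1,2)] xy sym_group_mult ..
        thus "p \<circ> q \<in> ?f ` carrier ?G" using G.m_closed[OF xy(1,2)] by blast
      next
        show "id \<in> ?f ` carrier ?G" using F.hom_one G.one_closed unfolding sym_group_one by (metis imageI)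
        show "perm4 4 2 3 1 \<in> ?f ` carrier ?G" unfolding w[symmetric] carrier_Aut using preserves_swap3 by blast
        show "perm4 1 4 2 3 \<in> ?f ` carrier ?G" unfolding h[symmetric] carrier_Aut using preserves_scaled_cubeH[OF z a] by blast
      qed
    qed
  qed (use F.hom_closed in blast)
  let ?K = "kernel ?G (sym_group 4) ?f"
  \<comment> \<open>A matrix fixing all diagonals has a scalar block; comparing X^6 with the sextic
    part makes the ratio of the two scalars a sixth root of unity.\<close>
  have K: "?K = {pgl (diag3 1 b b) |b. b ^ 6 = 1}"
  proof (intro equalityI subsetI)
    fix x assume "x \<in> ?K"
    hence x: "x \<in> carrier ?G" "?f x = id" by (auto simp: kernel_def sym_group_one)
    then obtain A where A: "x = pgl A" "preserves (nf3 6) A" by (auto simp: carrier_Aut)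
    note blk = preserves_nf3_block[OF d5 A(2)]
    have "cube_acts z A id" using f[OF A(2)] x(2) A(1) by metis
    from cube_diag_scalar[OF z this blk(1,2)] have e: "A = diag3 (A$1$1) (A$2$2) (A$2$2)"
      using blk by (simp add: vec_eq_iff forall_3 diag3_def)
    obtain l where l: "\<forall>v. eval3 (nf3 6) (A *v v) = l * eval3 (nf3 6) v" using A(2) unfolding preserves_iff by blast
    define a b where "a = A$1$1" and "b = A$2$2"
    have Ad: "A = diag3 a b b" using e by (simp add: a_def b_def)
    have "a ^ 6 = l" "2 * b ^ 6 = l * 2"
      using l[rule_format, of "vector [1, 0, 0]"] l[rule_format, of "vector [0, 1, 1]"]
      by (simp_all add: Ad diag3_mult_vec nf3_def eval_nat_numeral)
    hence "b ^ 6 = a ^ 6" by simp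
    hence "(b / a) ^ 6 = 1" using blk(3) by (simp add: power_divide a_def)
    moreover have "a \<noteq> 0" using blk(3) by (simp add: a_def)
    hence "x = pgl (diag3 1 (b / a) (b / a))" unfolding A(1) Ad by (rule pgl_diag3_normalise)
    ultimately show "x \<in> {pgl (diag3 1 b b) |b. b ^ 6 = 1}" by blast
  next
    fix x assume "x \<in> {pgl (diag3 1 b b) |b :: 'k. b ^ 6 = 1}"
    then obtain b :: 'k where b: "x = pgl (diag3 1 b b)" "b ^ 6 = 1" by blast
    have b0: "b \<noteq> 0" using b(2) by auto
    have b6: "(b * u) ^ 5 * (b * v) = b ^ 6 * (u ^ 5 * v)" "(b * u) * (b * v) ^ 5 = b ^ 6 * (u * v ^ 5)" for u v
      by (simp_all add: power_mult_distrib eval_nat_numeral)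
    have "eval3 (nf3 6) (diag3 1 b b *v x) = 1 * eval3 (nf3 6) x" for x
    proof -
      have "eval3 (nf3 6) (diag3 1 b b *v x) = x$1 ^ 6 + (b * x$2) ^ 5 * (b * x$3) + (b * x$2) * (b * x$3) ^ 5"
        by (simp add: diag3_mult_vec nf3_def)
      thus ?thesis unfolding b6 b(2) by (simp add: nf3_def)
    qed
    hence P: "preserves (nf3 6) (diag3 1 b b)"
      unfolding preserves_iff using b0 by (intro conjI exI[of _ 1]) (simp_all add: invertible_diag3)
    have "?f x = id" unfolding b(1) using cube_perm_eq[OF z P cube_acts_scalar[OF b0]] .
    thus "x \<in> ?K" using P b(1) by (auto simp: kernel_def sym_group_one carrier_Aut)
  qed
  obtain \<xi> :: 'k where \<xi>: "primitive_root 6 \<xi>" using ex_primitive_root[of 6] by auto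
  have \<xi>0: "\<xi> \<noteq> 0" using \<xi> by (auto simp: primitive_root_def)
  let ?g = "pgl (diag3 1 \<xi> \<xi>)"
  have gK: "?g \<in> ?K" unfolding K using \<xi> by (auto simp: primitive_root_def)
  hence g: "?g \<in> carrier ?G" by (simp add: kernel_def)
  have og: "G.ord ?g = 6" using \<xi> by (intro ord_pgl_diag3[OF g \<xi>0 \<xi>0]) (simp add: primitive_root_iff)
  have gen: "generate ?G {?g} = ?K"
  proof
    show "generate ?G {?g} \<subseteq> ?K" using gK F.subgroup_kernel by (intro G.generate_subgroup_incl) auto
    show "?K \<subseteq> generate ?G {?g}"
    proof
      fix x assume "x \<in> ?K"
      then obtain b where b: "x = pgl (diag3 1 b b)" "b ^ 6 = 1" unfolding K by blast
      then obtain k where "b = \<xi> ^ k" using primitive_root_powers[OF \<xi>] by blast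
      hence "x = ?g [^]\<^bsub>?G\<^esub> (int k)" using b \<xi>0 by (simp add: int_pow_int pgl_diag3_pow del: int_pow_int) (simp add: int_pow_int pgl_diag3_pow)
      thus "x \<in> generate ?G {?g}" using G.generate_pow[OF g] by blast
    qed
  qed
  have cardK: "card ?K = 6" using G.generate_pow_card[OF g] og gen by simp
  let ?h = "\<lambda>k::int. ?g [^]\<^bsub>?G\<^esub> k"
  have six: "(6::nat) > 0" by simp
  have "?h \<in> iso (integer_mod_group 6) (?G\<lparr>carrier := ?K\<rparr>)"
    using cyclic_embedding[OF group_Aut g og six] unfolding gen by (auto simp: mon_def iso_def hom_def bij_betw_def)
  hence "integer_mod_group 6 \<cong> ?G\<lparr>carrier := ?K\<rparr>" unfolding is_iso_def by blast
  hence iso6: "?G\<lparr>carrier := ?K\<rparr> \<cong> integer_mod_group 6" by (rule group.iso_sym[OF group_integer_mod_group])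
  have isoS: "?G Mod ?K \<cong> sym_group 4" by (rule F.FactGroup_iso[OF img])
  have cent: "x \<otimes>\<^bsub>?G\<^esub> y = y \<otimes>\<^bsub>?G\<^esub> x" if x: "x \<in> ?K" and y: "y \<in> carrier ?G" for x y
  proof -
    obtain b where b: "x = pgl (diag3 1 b b)" "b ^ 6 = 1" using x unfolding K by blast
    have b0: "b \<noteq> 0" using b(2) by auto
    obtain A where A: "y = pgl A" "preserves (nf3 6) A" using y by (auto simp: carrier_Aut)
    note blk = preserves_nf3_block[OF d5 A(2)]
    have "diag3 1 b b ** A = A ** diag3 1 b b"
      using blk by (simp add: vec_eq_iff forall_3 matrix_matrix_mult_def sum3 diag3_def mult.commute)
    thus ?thesis using A b b0 by (simp add: pgl_mult invertible_diag3 preserves_invertible)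
  qed
  show "central_extension ?G (sym_group 4) (integer_mod_group 6)"
    unfolding central_extension_def using F.normal_kernel cent iso6 isoS by blast
  have "card (rcosets\<^bsub>?G\<^esub> ?K) * card ?K = order ?G" by (rule G.lagrange[OF F.subgroup_kernel])
  moreover have "card (rcosets\<^bsub>?G\<^esub> ?K) = card (carrier (sym_group 4))"
    using iso_same_card[OF isoS] by (simp add: FactGroup_def)
  moreover have "card (carrier (sym_group 4)) = fact 4"
    unfolding sym_group_def by (simp add: card_permutations)
  ultimately show "order ?G = 144" using cardK by (simp add: fact_numeral)
qed

subsection \<open>Curves with a very large automorphism\<close>

lemma iso_integer_mod_group:
  assumes "group G" "x \<in> carrier G" "group.ord G x = N" "N > 0" "card (carrier G) = N"
  shows "G \<cong> integer_mod_group N"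
proof -
  let ?h = "\<lambda>k::int. x [^]\<^bsub>G\<^esub> k" and ?Z = "integer_mod_group N"
  have h: "?h \<in> hom ?Z G" "inj_on ?h (carrier ?Z)"
    using cyclic_embedding(1)[OF assms(1-4)] by (auto simp: mon_def)
  have "finite (carrier G)" using assms(4,5) by (metis card_gt_0_iff)
  moreover have "?h ` carrier ?Z \<subseteq> carrier G" using h(1) by (auto simp: hom_def)
  moreover have "card (carrier ?Z) = N" using assms(4) by (simp add: carrier_integer_mod_group)
  ultimately have "?h ` carrier ?Z = carrier G"
    using card_image[OF h(2)] assms(5) by (intro card_subset_eq) auto
  hence "?h \<in> iso ?Z G" using h by (simp add: iso_def bij_betw_def)
  hence "?Z \<cong> G" unfolding is_iso_def by blast
  thus ?thesis by (rule group.iso_sym[OF group_integer_mod_group])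
qed

text \<open>The property is only proved for the normal form and has to be transported to all
  models.\<close>

lemma central_extension_iso:
  assumes iso: "G \<cong> H" and G: "group G" and H: "group H" and E: "central_extension H Q A"
  shows "central_extension G Q A"
proof -
  obtain h where h: "h \<in> hom G H" "bij_betw h (carrier G) (carrier H)"
    using iso unfolding is_iso_def iso_def by auto
  obtain N where N: "N \<lhd> H" "\<forall>x\<in>N. \<forall>y\<in>carrier H. x \<otimes>\<^bsub>H\<^esub> y = y \<otimes>\<^bsub>H\<^esub> x"
    "H\<lparr>carrier := N\<rparr> \<cong> A" "H Mod N \<cong> Q" using E unfolding central_extension_def by blast
  interpret G: group G by (rule G)
  interpret N: normal N H by (rule N(1))
  have hc: "h x \<in> carrier H" if "x \<in> carrier G" for x using h(1) that by (auto simp: hom_def)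
  have hm: "h (x \<otimes>\<^bsub>G\<^esub> y) = h x \<otimes>\<^bsub>H\<^esub> h y" if "x \<in> carrier G" "y \<in> carrier G" for x y
    using h(1) that by (auto simp: hom_def)
  have hi: "inj_on h (carrier G)" and hs: "h ` carrier G = carrier H" using h(2) by (auto simp: bij_betw_def)
  \<comment> \<open>The central subgroup of \<open>G\<close> is obtained as the kernel of the
    composite with the quotient map, so that its normality and the quotient come from the first
    isomorphism theorem.\<close>
  define p where "p x = N #>\<^bsub>H\<^esub> h x" for x
  have "p \<in> hom G (H Mod N)"
    using hom_compose[OF h(1) N.r_coset_hom_Mod] unfolding p_def comp_def .
  then interpret p: group_hom G "H Mod N" p
    by (intro group_hom.intro group_hom_axioms.intro G N.factorgroup_is_group)
  have surj: "p ` carrier G = carrier (H Mod N)"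
    unfolding p_def FactGroup_def RCOSETS_def hs[symmetric] by auto
  let ?M = "kernel G (H Mod N) p"
  have M: "x \<in> ?M \<longleftrightarrow> x \<in> carrier G \<and> h x \<in> N" for x
  proof -
    have "N #>\<^bsub>H\<^esub> h x = N \<longleftrightarrow> h x \<in> N" if "x \<in> carrier G"
      using hc[OF that] N.coset_join1[OF _ _ N.subgroup_axioms] N.coset_join2[OF _ N.subgroup_axioms] by metis
    thus ?thesis by (auto simp: kernel_def p_def FactGroup_def)
  qed
  have "h ` ?M = N"
  proof (intro equalityI subsetI)
    fix y assume y: "y \<in> N"
    hence "y \<in> h ` carrier G" using hs N.subset by blast
    thus "y \<in> h ` ?M" using y M by blast
  qed (use M in blast)
  moreover have "inj_on h ?M" using hi by (rule inj_on_subset) (use M in blast)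
  ultimately have "h \<in> iso (G\<lparr>carrier := ?M\<rparr>) (H\<lparr>carrier := N\<rparr>)"
    using M hm by (auto simp: iso_def bij_betw_def hom_def)
  hence "G\<lparr>carrier := ?M\<rparr> \<cong> A" using N(3) iso_trans unfolding is_iso_def by blast
  moreover have "G Mod ?M \<cong> Q" using iso_trans[OF p.FactGroup_iso[OF surj] N(4)] .
  moreover have "x \<otimes>\<^bsub>G\<^esub> y = y \<otimes>\<^bsub>G\<^esub> x" if x: "x \<in> ?M" and y: "y \<in> carrier G" for x y
  proof (rule inj_onD[OF hi])
    have x': "x \<in> carrier G" "h x \<in> N" using x M by auto
    show "h (x \<otimes>\<^bsub>G\<^esub> y) = h (y \<otimes>\<^bsub>G\<^esub> x)"
      using N(2) x'(2) hc[OF y] hm[OF x'(1) y] hm[OF y x'(1)] by metis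
    show "x \<otimes>\<^bsub>G\<^esub> y \<in> carrier G" "y \<otimes>\<^bsub>G\<^esub> x \<in> carrier G" using x' y by auto
  qed
  ultimately show ?thesis unfolding central_extension_def using p.normal_kernel by blast
qed

lemma automorphism_order_nf1:
  assumes d: "d \<ge> 5"
  shows "(\<forall>\<delta>\<in>(M_Pl d :: ('k::{alg_closed_field, field_char_0}) poly3 set set). \<forall>C\<in>\<delta>.
       \<forall>\<sigma>\<in>carrier (Aut C). group.ord (Aut C) \<sigma> = d * (d - 1) \<longrightarrow>
         carrier (Aut C) = generate PGL3 {\<sigma>} \<and> K_isomorphic C (nf1 d)) \<and>
      irreducible_point_locus d
        (M_Pl_grp d (integer_mod_group (d * (d - 1))) :: 'k poly3 set set) \<and>
      (M_Pl_full d (integer_mod_group (d * (d - 1))) :: 'k poly3 set set)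
        = M_Pl_grp d (integer_mod_group (d * (d - 1))) \<and>
      (\<forall>\<xi>::'k. primitive_root (d * (d - 1)) \<xi> \<longrightarrow>
        (let E = cyclic_embeddings (d * (d - 1)) (pgl (diag3 1 (\<xi> ^ (d - 1)) (\<xi> ^ d)))
         in E \<noteq> {} \<and> (\<forall>\<rho>\<in>E. M_Pl_grp d (integer_mod_group (d * (d - 1)))
                               = M_Pl_rho d (integer_mod_group (d * (d - 1))) \<rho>)))"
proof -
  have d4: "d \<ge> 4" and N: "d * (d - 1) > 0" using d by auto
  obtain \<xi>0 :: 'k where \<xi>0: "primitive_root (d * (d - 1)) \<xi>0" using ex_primitive_root[OF N] by blast
  note T = Aut_nf1_generator[OF d \<xi>0] and S = smooth_nf1[OF d4]
  note uniq = K_isomorphic_nf1[OF _ d4]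
  have Z: "Aut (nf1 d :: 'k poly3) \<cong> integer_mod_group (d * (d - 1))"
    by (rule iso_integer_mod_group[OF group_Aut T N card_Aut_nf1[OF d]])
  show ?thesis
  proof (rule conjI[OF _ conjI[OF single_locus_irreducible[OF S N T uniq] conjI[OF single_locus_full[OF S N T uniq Z]]]];
      (intro ballI allI impI)?)
    fix \<delta> C \<sigma> assume *: "\<delta> \<in> M_Pl d" "(C :: 'k poly3) \<in> \<delta>" "\<sigma> \<in> carrier (Aut C)" "group.ord (Aut C) \<sigma> = d * (d - 1)"
    have K: "K_isomorphic C (nf1 d)" by (rule uniq[OF M_Pl_mem(1)[OF *(1,2)] *(3,4)])
    have "card (carrier (Aut C)) = d * (d - 1)"
      using iso_same_card[OF K_isomorphic_Aut[OF K]] card_Aut_nf1[OF d] by simp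
    thus "carrier (Aut C) = generate PGL3 {\<sigma>} \<and> K_isomorphic C (nf1 d)"
      using generate_ord_card[OF *(3,4) N] K by blast
  next
    fix \<xi> :: 'k assume "primitive_root (d * (d - 1)) \<xi>"
    from single_locus_rho[OF S N Aut_nf1_generator[OF d this] uniq]
    show "let E = cyclic_embeddings (d * (d - 1)) (pgl (diag3 1 (\<xi> ^ (d - 1)) (\<xi> ^ d)))
         in E \<noteq> {} \<and> (\<forall>\<rho>\<in>E. M_Pl_grp d (integer_mod_group (d * (d - 1)))
                               = M_Pl_rho d (integer_mod_group (d * (d - 1))) \<rho>)" .
  qed
qed

lemma automorphism_order_nf2:
  assumes d: "d \<ge> 4"
  shows "(\<forall>\<delta>\<in>(M_Pl d :: ('k::{alg_closed_field, field_char_0}) poly3 set set). \<forall>C\<in>\<delta>.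
       \<forall>\<sigma>\<in>carrier (Aut C). group.ord (Aut C) \<sigma> = (d - 1)\<^sup>2 \<longrightarrow>
         carrier (Aut C) = generate PGL3 {\<sigma>} \<and> K_isomorphic C (nf2 d)) \<and>
      irreducible_point_locus d
        (M_Pl_grp d (integer_mod_group ((d - 1)\<^sup>2)) :: 'k poly3 set set) \<and>
      (M_Pl_full d (integer_mod_group ((d - 1)\<^sup>2)) :: 'k poly3 set set)
        = M_Pl_grp d (integer_mod_group ((d - 1)\<^sup>2)) \<and>
      (\<forall>\<xi>::'k. primitive_root ((d - 1)\<^sup>2) \<xi> \<longrightarrow>
        (let E = cyclic_embeddings ((d - 1)\<^sup>2) (pgl (diag3 1 \<xi> (\<xi> ^ ((d - 1) * (d - 2)))))
         in E \<noteq> {} \<and> (\<forall>\<rho>\<in>E. M_Pl_grp d (integer_mod_group ((d - 1)\<^sup>2))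
                               = M_Pl_rho d (integer_mod_group ((d - 1)\<^sup>2)) \<rho>)))"
proof -
  have N: "(d - 1)\<^sup>2 > 0" using d by simp
  obtain \<xi>0 :: 'k where \<xi>0: "primitive_root ((d - 1)\<^sup>2) \<xi>0" using ex_primitive_root[OF N] by blast
  note T = Aut_nf2_generator[OF d \<xi>0] and S = smooth_nf2[OF d]
  note uniq = K_isomorphic_nf2[OF _ d]
  have Z: "Aut (nf2 d :: 'k poly3) \<cong> integer_mod_group ((d - 1)\<^sup>2)"
    by (rule iso_integer_mod_group[OF group_Aut T N card_Aut_nf2[OF d]])
  show ?thesis
  proof (rule conjI[OF _ conjI[OF single_locus_irreducible[OF S N T uniq] conjI[OF single_locus_full[OF S N T uniq Z]]]];
      (intro ballI allI impI)?)
    fix \<delta> C \<sigma> assume *: "\<delta> \<in> M_Pl d" "(C :: 'k poly3) \<in> \<delta>" "\<sigma> \<in> carrier (Aut C)" "group.ord (Aut C) \<sigma> = (d - 1)\<^sup>2"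
    have K: "K_isomorphic C (nf2 d)" by (rule uniq[OF M_Pl_mem(1)[OF *(1,2)] *(3,4)])
    have "card (carrier (Aut C)) = (d - 1)\<^sup>2"
      using iso_same_card[OF K_isomorphic_Aut[OF K]] card_Aut_nf2[OF d] by simp
    thus "carrier (Aut C) = generate PGL3 {\<sigma>} \<and> K_isomorphic C (nf2 d)"
      using generate_ord_card[OF *(3,4) N] K by blast
  next
    fix \<xi> :: 'k assume "primitive_root ((d - 1)\<^sup>2) \<xi>"
    from single_locus_rho[OF S N Aut_nf2_generator[OF d this] uniq]
    show "let E = cyclic_embeddings ((d - 1)\<^sup>2) (pgl (diag3 1 \<xi> (\<xi> ^ ((d - 1) * (d - 2)))))
         in E \<noteq> {} \<and> (\<forall>\<rho>\<in>E. M_Pl_grp d (integer_mod_group ((d - 1)\<^sup>2))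
                               = M_Pl_rho d (integer_mod_group ((d - 1)\<^sup>2)) \<rho>)" .
  qed
qed

lemma automorphism_order_nf3:
  assumes d: "d \<ge> 4"
  shows "(\<forall>\<delta>\<in>(M_Pl d :: ('k::{alg_closed_field, field_char_0}) poly3 set set). \<forall>C\<in>\<delta>.
       \<forall>\<sigma>\<in>carrier (Aut C). group.ord (Aut C) \<sigma> = d * (d - 2) \<longrightarrow>
         K_isomorphic C (nf3 d) \<and>
         (d \<noteq> 4 \<and> d \<noteq> 6 \<longrightarrow> Aut C \<cong> H_group d) \<and>
         (d = 6 \<longrightarrow> central_extension (Aut C) (sym_group 4) (integer_mod_group 6) \<and>
                    order (Aut C) = 144) \<and>
         (d = 4 \<longrightarrow> K_isomorphic C fermat4 \<and> Aut C \<cong> Fermat_quartic_group)) \<and>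
      irreducible_point_locus d
        (M_Pl_grp d (integer_mod_group (d * (d - 2))) :: 'k poly3 set set) \<and>
      (d \<noteq> 4 \<and> d \<noteq> 6 \<longrightarrow>
        (M_Pl_full d (H_group d) :: 'k poly3 set set)
          = M_Pl_grp d (integer_mod_group (d * (d - 2))) \<and>
        (\<forall>\<xi>::'k. primitive_root (d * (d - 2)) \<xi> \<longrightarrow>
          (let E = cyclic_embeddings (d * (d - 2)) (pgl (diag3 1 \<xi> (\<xi> powi (- (int d - 1)))))
           in E \<noteq> {} \<and> (\<forall>\<rho>\<in>E. M_Pl_grp d (integer_mod_group (d * (d - 2)))
                                 = M_Pl_rho d (integer_mod_group (d * (d - 2))) \<rho>))))"
proof -
  have N: "d * (d - 2) > 0" using d by simp
  obtain \<xi>0 :: 'k where \<xi>0: "primitive_root (d * (d - 2)) \<xi>0" using ex_primitive_root[OF N] by blast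
  note T = Aut_nf3_generator[OF d \<xi>0] and S = smooth_nf3[OF d]
  note uniq = K_isomorphic_nf3[OF _ d]
  \<comment> \<open>The generators found above are written with inverses of natural powers; this
    matches them with the negative integer exponent of the claim.\<close>
  have pw: "\<xi> powi (- (int d - 1)) = inverse (\<xi> ^ (d - 1))" for \<xi> :: 'k
    using power_int_nat_minus[of 1 d \<xi>] d by simp
  show ?thesis
  proof (rule conjI[OF _ conjI[OF single_locus_irreducible[OF S N T uniq]]];
      (intro ballI allI impI conjI; (elim conjE)?)?)
    fix \<delta> C \<sigma> assume *: "\<delta> \<in> M_Pl d" "(C :: 'k poly3) \<in> \<delta>" "\<sigma> \<in> carrier (Aut C)" "group.ord (Aut C) \<sigma> = d * (d - 2)"
    show K: "K_isomorphic C (nf3 d)" by (rule uniq[OF M_Pl_mem(1)[OF *(1,2)] *(3,4)])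
    note iso = K_isomorphic_Aut[OF K]
    show "Aut C \<cong> H_group d" if "d \<noteq> 4" "d \<noteq> 6"
      by (rule iso_trans[OF iso H_group_iso]) (use d that in auto)
    assume d: "d = 6"
    show "central_extension (Aut C) (sym_group 4) (integer_mod_group 6)"
      by (rule central_extension_iso[OF iso[unfolded d] group_Aut group_Aut nf3_6_group(1)])
    show "order (Aut C) = 144"
      using iso_same_card[OF iso[unfolded d]] nf3_6_group(2)[where 'k = 'k] by (simp add: order_def)
  next
    fix \<delta> C \<sigma> assume *: "\<delta> \<in> M_Pl d" "(C :: 'k poly3) \<in> \<delta>" "\<sigma> \<in> carrier (Aut C)" "group.ord (Aut C) \<sigma> = d * (d - 2)"
    assume d: "d = 4"
    show K: "K_isomorphic C fermat4"
      using K_isomorphic_trans[OF uniq[OF M_Pl_mem(1)[OF *(1,2)] *(3,4), unfolded d] nf3_4_fermat] .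
    show "Aut C \<cong> Fermat_quartic_group" by (rule iso_trans[OF K_isomorphic_Aut[OF K] Aut_fermat4])
  next
    assume d': "d \<noteq> 4" "d \<noteq> 6"
    have "Aut (nf3 d :: 'k poly3) \<cong> H_group d" by (rule H_group_iso) (use d d' in auto)
    from single_locus_full[OF S N T uniq this]
    show "M_Pl_full d (H_group d) = (M_Pl_grp d (integer_mod_group (d * (d - 2))) :: 'k poly3 set set)" .
  next
    fix \<xi> :: 'k assume "primitive_root (d * (d - 2)) \<xi>"
    from single_locus_rho[OF S N Aut_nf3_generator[OF d this] uniq]
    show "let E = cyclic_embeddings (d * (d - 2)) (pgl (diag3 1 \<xi> (\<xi> powi (- (int d - 1)))))
           in E \<noteq> {} \<and> (\<forall>\<rho>\<in>E. M_Pl_grp d (integer_mod_group (d * (d - 2)))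
                                 = M_Pl_rho d (integer_mod_group (d * (d - 2))) \<rho>)" unfolding pw .
  qed
qed

lemma automorphism_order_nf4:
  assumes d: "d \<ge> 4"
  shows "(\<forall>\<delta>\<in>(M_Pl d :: ('k::{alg_closed_field, field_char_0}) poly3 set set). \<forall>C\<in>\<delta>.
       \<forall>\<sigma>\<in>carrier (Aut C). group.ord (Aut C) \<sigma> = d\<^sup>2 - 3 * d + 3 \<longrightarrow>
         K_isomorphic C (nf4 d) \<and> (d \<ge> 5 \<longrightarrow> Aut C \<cong> H_Klein d)) \<and>
      irreducible_point_locus d
        (M_Pl_grp d (integer_mod_group (d\<^sup>2 - 3 * d + 3)) :: 'k poly3 set set) \<and>
      (d \<ge> 5 \<longrightarrow>
        (M_Pl_full d (H_Klein d) :: 'k poly3 set set)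
          = M_Pl_grp d (integer_mod_group (d\<^sup>2 - 3 * d + 3)) \<and>
        (\<forall>\<xi>::'k. primitive_root (d\<^sup>2 - 3 * d + 3) \<xi> \<longrightarrow>
          (let E = cyclic_embeddings (d\<^sup>2 - 3 * d + 3) (pgl (diag3 1 \<xi> (\<xi> powi (- (int d - 2)))))
           in E \<noteq> {} \<and> (\<forall>\<rho>\<in>E. M_Pl_grp d (integer_mod_group (d\<^sup>2 - 3 * d + 3))
                                 = M_Pl_rho d (integer_mod_group (d\<^sup>2 - 3 * d + 3)) \<rho>))))"
proof -
  have N: "d\<^sup>2 - 3 * d + 3 > 0" by simp
  obtain \<xi>0 :: 'k where \<xi>0: "primitive_root (d\<^sup>2 - 3 * d + 3) \<xi>0" using ex_primitive_root[OF N] by blast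
  \<comment> \<open>The order is rewritten as d^2 - 3 d + 3; the calculations used (d-1)(d-2) + 1,
    which avoids subtraction from a square.\<close>
  note gen = Aut_nf4_generator[OF d, folded klein_order[OF d]]
  note T = gen[OF \<xi>0] and S = smooth_nf4[OF d]
  note uniq = K_isomorphic_nf4[OF _ d, folded klein_order[OF d]]
  have pw: "\<xi> powi (- (int d - 2)) = inverse (\<xi> ^ (d - 2))" for \<xi> :: 'k
    using power_int_nat_minus[of 2 d \<xi>] d by simp
  show ?thesis
  proof (rule conjI[OF _ conjI[OF single_locus_irreducible[OF S N T uniq]]];
      (intro ballI allI impI conjI)?)
    fix \<delta> C \<sigma> assume *: "\<delta> \<in> M_Pl d" "(C :: 'k poly3) \<in> \<delta>" "\<sigma> \<in> carrier (Aut C)"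
      "group.ord (Aut C) \<sigma> = d\<^sup>2 - 3 * d + 3"
    show K: "K_isomorphic C (nf4 d)" by (rule uniq[OF M_Pl_mem(1)[OF *(1,2)] *(3,4)])
    show "Aut C \<cong> H_Klein d" if "d \<ge> 5" by (rule iso_trans[OF K_isomorphic_Aut[OF K] H_Klein_iso[OF that]])
  next
    assume "d \<ge> 5"
    from single_locus_full[OF S N T uniq H_Klein_iso[OF this]]
    show "M_Pl_full d (H_Klein d) = (M_Pl_grp d (integer_mod_group (d\<^sup>2 - 3 * d + 3)) :: 'k poly3 set set)" .
  next
    fix \<xi> :: 'k assume "primitive_root (d\<^sup>2 - 3 * d + 3) \<xi>"
    from single_locus_rho[OF S N gen[OF this] uniq]
    show "let E = cyclic_embeddings (d\<^sup>2 - 3 * d + 3) (pgl (diag3 1 \<xi> (\<xi> powi (- (int d - 2)))))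
           in E \<noteq> {} \<and> (\<forall>\<rho>\<in>E. M_Pl_grp d (integer_mod_group (d\<^sup>2 - 3 * d + 3))
                                 = M_Pl_rho d (integer_mod_group (d\<^sup>2 - 3 * d + 3)) \<rho>)" unfolding pw .
  qed
qed

theorem theorem1:
  fixes d :: nat
  assumes "d \<ge> 4"
  shows
   "(d \<ge> 5 \<longrightarrow>
      (\<forall>\<delta>\<in>(M_Pl d :: ('k::{alg_closed_field, field_char_0}) poly3 set set). \<forall>C\<in>\<delta>.
       \<forall>\<sigma>\<in>carrier (Aut C). group.ord (Aut C) \<sigma> = d * (d - 1) \<longrightarrow>
         carrier (Aut C) = generate PGL3 {\<sigma>} \<and>
         K_isomorphic C (varX ^ d + varY ^ d + varX * varZ ^ (d - 1))) \<and>
      irreducible_point_locus d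
        (M_Pl_grp d (integer_mod_group (d * (d - 1))) :: 'k poly3 set set) \<and>
      (M_Pl_full d (integer_mod_group (d * (d - 1))) :: 'k poly3 set set)
        = M_Pl_grp d (integer_mod_group (d * (d - 1))) \<and>
      (\<forall>\<xi>::'k. primitive_root (d * (d - 1)) \<xi> \<longrightarrow>
        (let E = cyclic_embeddings (d * (d - 1)) (pgl (diag3 1 (\<xi> ^ (d - 1)) (\<xi> ^ d)))
         in E \<noteq> {} \<and> (\<forall>\<rho>\<in>E. M_Pl_grp d (integer_mod_group (d * (d - 1)))
                               = M_Pl_rho d (integer_mod_group (d * (d - 1))) \<rho>)))) \<and>
    ((\<forall>\<delta>\<in>(M_Pl d :: 'k poly3 set set). \<forall>C\<in>\<delta>.
       \<forall>\<sigma>\<in>carrier (Aut C). group.ord (Aut C) \<sigma> = (d - 1)\<^sup>2 \<longrightarrow>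
         carrier (Aut C) = generate PGL3 {\<sigma>} \<and>
         K_isomorphic C (varX ^ d + varY ^ (d - 1) * varZ + varX * varZ ^ (d - 1))) \<and>
      irreducible_point_locus d
        (M_Pl_grp d (integer_mod_group ((d - 1)\<^sup>2)) :: 'k poly3 set set) \<and>
      (M_Pl_full d (integer_mod_group ((d - 1)\<^sup>2)) :: 'k poly3 set set)
        = M_Pl_grp d (integer_mod_group ((d - 1)\<^sup>2)) \<and>
      (\<forall>\<xi>::'k. primitive_root ((d - 1)\<^sup>2) \<xi> \<longrightarrow>
        (let E = cyclic_embeddings ((d - 1)\<^sup>2) (pgl (diag3 1 \<xi> (\<xi> ^ ((d - 1) * (d - 2)))))
         in E \<noteq> {} \<and> (\<forall>\<rho>\<in>E. M_Pl_grp d (integer_mod_group ((d - 1)\<^sup>2))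
                               = M_Pl_rho d (integer_mod_group ((d - 1)\<^sup>2)) \<rho>)))) \<and>
    ((\<forall>\<delta>\<in>(M_Pl d :: 'k poly3 set set). \<forall>C\<in>\<delta>.
       \<forall>\<sigma>\<in>carrier (Aut C). group.ord (Aut C) \<sigma> = d * (d - 2) \<longrightarrow>
         K_isomorphic C (varX ^ d + varY ^ (d - 1) * varZ + varY * varZ ^ (d - 1)) \<and>
         (d \<noteq> 4 \<and> d \<noteq> 6 \<longrightarrow> Aut C \<cong> H_group d) \<and>
         (d = 6 \<longrightarrow> central_extension (Aut C) (sym_group 4) (integer_mod_group 6) \<and>
                    order (Aut C) = 144) \<and>
         (d = 4 \<longrightarrow> K_isomorphic C (varX ^ 4 + varY ^ 4 + varZ ^ 4) \<and>
                    Aut C \<cong> Fermat_quartic_group)) \<and>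
      irreducible_point_locus d
        (M_Pl_grp d (integer_mod_group (d * (d - 2))) :: 'k poly3 set set) \<and>
      (d \<noteq> 4 \<and> d \<noteq> 6 \<longrightarrow>
        (M_Pl_full d (H_group d) :: 'k poly3 set set)
          = M_Pl_grp d (integer_mod_group (d * (d - 2))) \<and>
        (\<forall>\<xi>::'k. primitive_root (d * (d - 2)) \<xi> \<longrightarrow>
          (let E = cyclic_embeddings (d * (d - 2)) (pgl (diag3 1 \<xi> (\<xi> powi (- (int d - 1)))))
           in E \<noteq> {} \<and> (\<forall>\<rho>\<in>E. M_Pl_grp d (integer_mod_group (d * (d - 2)))
                                 = M_Pl_rho d (integer_mod_group (d * (d - 2))) \<rho>))))) \<and>
    ((\<forall>\<delta>\<in>(M_Pl d :: 'k poly3 set set). \<forall>C\<in>\<delta>.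
       \<forall>\<sigma>\<in>carrier (Aut C). group.ord (Aut C) \<sigma> = d\<^sup>2 - 3 * d + 3 \<longrightarrow>
         K_isomorphic C (varX ^ (d - 1) * varY + varY ^ (d - 1) * varZ + varZ ^ (d - 1) * varX) \<and>
         (d \<ge> 5 \<longrightarrow> Aut C \<cong> H_Klein d)) \<and>
      irreducible_point_locus d
        (M_Pl_grp d (integer_mod_group (d\<^sup>2 - 3 * d + 3)) :: 'k poly3 set set) \<and>
      (d \<ge> 5 \<longrightarrow>
        (M_Pl_full d (H_Klein d) :: 'k poly3 set set)
          = M_Pl_grp d (integer_mod_group (d\<^sup>2 - 3 * d + 3)) \<and>
        (\<forall>\<xi>::'k. primitive_root (d\<^sup>2 - 3 * d + 3) \<xi> \<longrightarrow>
          (let E = cyclic_embeddings (d\<^sup>2 - 3 * d + 3) (pgl (diag3 1 \<xi> (\<xi> powi (- (int d - 2)))))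
           in E \<noteq> {} \<and> (\<forall>\<rho>\<in>E. M_Pl_grp d (integer_mod_group (d\<^sup>2 - 3 * d + 3))
                                 = M_Pl_rho d (integer_mod_group (d\<^sup>2 - 3 * d + 3)) \<rho>)))))"
  by (rule conjI[OF impI conjI[OF automorphism_order_nf2[OF assms, unfolded nf2_def]
    conjI[OF automorphism_order_nf3[OF assms, unfolded nf3_def fermat4_def]
      automorphism_order_nf4[OF assms, unfolded nf4_def]]]]) (erule automorphism_order_nf1[unfolded nf1_def])

end
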